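(* Let $m\le n$ be positive integers, let $U$ be an open subset of $\mathbb R^n$, let $V$ be an $m$-dimensional rectifiable varifold in $U$ such that $\|\delta V\|$ is a Radon measure, let $f\in\mathbf T(V)$, let $T\in\mathscr D'(U\times\mathbb R,\mathbb R^n)$ satisfy $$T(\psi)=\int\langle\psi(z,f(z)),V\mathbf Df(z)\rangle\,d\|V\|z\quad\text{for }\psi\in C_c^\infty(U\times\mathbb R,\mathbb R^n),$$ and let $E(t)=\{z: f(z)>t\}$ for $t\in\mathbb R$. Then $T$ is representable by integration and $$T(\psi)=\int V\,\partial E(t)\,(\psi(\cdot,t))\,d\mathscr L^1t,\qquad \int g\,d\|T\|=\int\!\!\int g(z,t)\,d\|V\,\partial E(t)\|z\,d\mathscr L^1t$$ whenever $\psi\in\mathbf L_1(\|T\|,\mathbb R^n)$ and $g$ is an extended real valued $\|T\|$ integrable function.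
   Context: $\mathbf G(n,m)$ is the set of $m$-dimensional linear subspaces of $\mathbb R^n$; $S_\natural$ is the orthogonal projection onto $S$; $\sigma\bullet\tau=\operatorname{trace}(\sigma^*\circ\tau)$; $\langle v,\lambda\rangle=\lambda(v)$ for a linear map $\lambda$. $\mathscr L^1$ is Lebesgue measure. Measurable functions may be defined only almost everywhere. An $m$-dimensional varifold $V$ in $U$ is a Radon measure over $U\times\mathbf G(n,m)$, with weight $\|V\|(A)=V(A\times\mathbf G(n,m))$. It is rectifiable if $V(k)=\sum_{i=1}^\infty c_i\int_{E_i}k(z,\operatorname{Tan}(M_i,z))\,d\mathscr H^m z$ for continuous compactly supported $k$, with $0<c_i<\infty$ and $E_i$ Borel subsets of $m$-dimensional $C^1$ submanifolds $M_i$. First variation: $\delta V(g)=\int Dg(z)\bullet S_\natural\,dV(z,S)$ for $g\in C_c^\infty(U,\mathbb R^n)$. For a distribution $S\in\mathscr D'(W,\mathbb R^n)$ on an open set $W$ of a Euclidean space, $\|S\|$ is the largest Borel regular measure with $\|S\|(C)=\sup\{S(\theta):\theta\in C_c^\infty(W,\mathbb R^n),\operatorname{spt}\theta\subset C,|\theta|\le1\}$ for open $C\subset W$. $S$ is representable by integration if $\|S\|$ is a Radon measure; in this case $S(\theta)$ for $\theta\in\mathbf L_1(\|S\|,\mathbb R^n)$ denotes the value of the unique $\mathbf L_1(\|S\|)$-continuous extension of $S$. For $\|\delta V\|$ Radon and $E$ $\|V\|+\|\delta V\|$ measurable, $((\delta V)\llcorner E)(\theta)=\delta V(\chi_E\theta)$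 (extension) and the distributional $V$ boundary of $E$ is $V\,\partial E=(\delta V)\llcorner E-\delta(V\llcorner(E\times\mathbf G(n,m)))\in\mathscr D'(U,\mathbb R^n)$. Generalised $V$ weakly differentiable functions: for a positive integer $l$, $\mathbf T(V,\mathbb R^l)$ is the set of $\mathbb R^l$ valued $\|V\|+\|\delta V\|$ measurable functions $f$ with domain contained in $U$ for which there is a $\|V\|$ measurable $\operatorname{Hom}(\mathbb R^n,\mathbb R^l)$ valued function $F$ such that (i) $\int_{K\cap\{z:|f(z)|\le s\}}|F|\,d\|V\|<\infty$ for all compact $K\subset U$ and $0\le s<\infty$; (ii) for $\theta\in C_c^\infty(U,\mathbb R^n)$ and $\eta\in C^\infty(\mathbb R^l,\mathbb R)$ with $\operatorname{spt}D\eta$ compact, $$\delta V((\eta\circ f)\theta)=\int\eta(f(z))\,S_\natural\bullet D\theta(z)\,dV(z,S)+\int\langle\theta(z),D\eta(f(z))\circ F(z)\rangle\,d\|V\|z .$$ $F$ is $\|V\|$ almost unique and $V\mathbf Df$ denotes its representative given by approximate limits of $F$ with respect to $\|V\|$ (so $V\mathbf Df=F$ $\|V\|$ almost everywhere). $\mathbf T(V)=\mathbf T(V,\mathbb R)$. *)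

theory Defs
  imports "HOL-Analysis.Analysis"
begin

text \<open>
  Functions which are only defined almost everywhere, or only on an open set, are represented by
  arbitrary total extensions.  Borel regular (outer) measures on a space are represented by their
  restrictions to the Borel sets, and measurability with respect to such a measure is
  measurability with respect to its completion.
\<close>

section \<open>Radon measures\<close>

definition borel_of :: "'a topology \<Rightarrow> 'a measure" where
  "borel_of X = sigma (topspace X) {C. openin X C}"

definition radon_measure :: "'a topology \<Rightarrow> 'a measure \<Rightarrow> bool" where
  "radon_measure X M \<longleftrightarrow>
     sets M = sets (borel_of X) \<and>
     (\<forall>K. compactin X K \<longrightarrow> emeasure M K < \<infinity>) \<and>
     (\<forall>C. openin X C \<longrightarrow> emeasure M C = (SUP K\<in>{K. compactin X K \<and> K \<subseteq> C}. emeasure M K)) \<and>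
     (\<forall>A\<in>sets M. emeasure M A = (INF C\<in>{C. openin X C \<and> A \<subseteq> C}. emeasure M C))"

definition add_measure :: "'a measure \<Rightarrow> 'a measure \<Rightarrow> 'a measure" where
  "add_measure M N = measure_of (space M) (sets M) (\<lambda>A. emeasure M A + emeasure N A)"

text \<open>The restriction of \<open>M\<close> to a set \<open>A\<close> measurable for the completion of \<open>M\<close>.\<close>

definition restr_measure :: "'a measure \<Rightarrow> 'a set \<Rightarrow> 'a measure" where
  "restr_measure M A = measure_of (space M) (sets M) (\<lambda>B. emeasure (completion M) (A \<inter> B))"

definition L1_space :: "'a measure \<Rightarrow> ('a \<Rightarrow> 'b::{banach, second_countable_topology}) set" where
  "L1_space M = {f. integrable (completion M) f}"

text \<open>
  Integration of extended real valued functions follows Federer: a measurable function is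
  integrable if its integral exists as an element of the extended real line; thus, the integral
  may be infinite.  The function \<open>e2ennreal\<close> maps negative numbers to zero.
\<close>

definition ereal_integrable :: "'a measure \<Rightarrow> ('a \<Rightarrow> ereal) \<Rightarrow> bool" where
  "ereal_integrable M g \<longleftrightarrow>
     g \<in> borel_measurable M \<and>
     ((\<integral>\<^sup>+x. e2ennreal (g x) \<partial>M) < \<infinity> \<or> (\<integral>\<^sup>+x. e2ennreal (- g x) \<partial>M) < \<infinity>)"

definition ereal_integral :: "'a measure \<Rightarrow> ('a \<Rightarrow> ereal) \<Rightarrow> ereal" where
  "ereal_integral M g =
     enn2ereal (\<integral>\<^sup>+x. e2ennreal (g x) \<partial>M) - enn2ereal (\<integral>\<^sup>+x. e2ennreal (- g x) \<partial>M)"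


section \<open>Test functions and distributions\<close>

primrec iter_deriv ::
  "'a list \<Rightarrow> ('a::real_normed_vector \<Rightarrow> 'b::real_normed_vector) \<Rightarrow> 'a \<Rightarrow> 'b" where
  "iter_deriv [] f = f"
| "iter_deriv (v # vs) f = (\<lambda>x. frechet_derivative (iter_deriv vs f) (at x) v)"

definition smooth :: "('a::real_normed_vector \<Rightarrow> 'b::real_normed_vector) \<Rightarrow> bool" where
  "smooth f \<longleftrightarrow> (\<forall>vs x. iter_deriv vs f differentiable (at x))"

definition spt :: "('a::topological_space \<Rightarrow> 'b::zero) \<Rightarrow> 'a set" where
  "spt f = closure {x. f x \<noteq> 0}"

text \<open>Members of \<open>C\<^sub>c\<^sup>\<infinity>(W)\<close> are extended to the whole space by zero.\<close>

definition test_fun :: "'a::euclidean_space set \<Rightarrow> ('a \<Rightarrow> 'b::euclidean_space) \<Rightarrow> bool" where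
  "test_fun W \<theta> \<longleftrightarrow> smooth \<theta> \<and> compact (spt \<theta>) \<and> spt \<theta> \<subseteq> W"

text \<open>
  Only the values of a distribution on test functions are meaningful.  Continuity with respect to
  the inductive limit topology is expressed by the usual seminorm estimates: \<open>B\<close> ranges over the
  upper bounds for the supremum norm of the partial derivatives of order at most \<open>N\<close>.
\<close>

definition is_distribution ::
  "'a::euclidean_space set \<Rightarrow> (('a \<Rightarrow> 'b::euclidean_space) \<Rightarrow> real) \<Rightarrow> bool" where
  "is_distribution W S \<longleftrightarrow>
     (\<forall>\<theta> \<zeta>. test_fun W \<theta> \<longrightarrow> test_fun W \<zeta> \<longrightarrow> S (\<lambda>x. \<theta> x + \<zeta> x) = S \<theta> + S \<zeta>) \<and>
     (\<forall>c \<theta>. test_fun W \<theta> \<longrightarrow> S (\<lambda>x. c *\<^sub>R \<theta> x) = c * S \<theta>) \<and>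
     (\<forall>K. compact K \<longrightarrow> K \<subseteq> W \<longrightarrow>
        (\<exists>N C. \<forall>\<theta> B. test_fun W \<theta> \<longrightarrow> spt \<theta> \<subseteq> K \<longrightarrow>
           (\<forall>vs x. set vs \<subseteq> Basis \<longrightarrow> length vs \<le> N \<longrightarrow> norm (iter_deriv vs \<theta> x) \<le> B) \<longrightarrow>
           \<bar>S \<theta>\<bar> \<le> C * B))"

text \<open>
  The measure \<open>\<parallel>S\<parallel>\<close>.  On measures with the same \<open>\<sigma>\<close>-algebra, the order of the type of measures is
  the setwise one.
\<close>

definition variation ::
  "'a::euclidean_space set \<Rightarrow> (('a \<Rightarrow> 'b::euclidean_space) \<Rightarrow> real) \<Rightarrow> 'a measure" where
  "variation W S = (GREATEST \<mu>.
     sets \<mu> = sets (borel_of (top_of_set W)) \<and>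
     (\<forall>C. open C \<longrightarrow> C \<subseteq> W \<longrightarrow>
        emeasure \<mu> C =
          (SUP \<theta>\<in>{\<theta>. test_fun W \<theta> \<and> spt \<theta> \<subseteq> C \<and> (\<forall>x. norm (\<theta> x) \<le> 1)}. ennreal (S \<theta>))))"

definition representable_by_integration ::
  "'a::euclidean_space set \<Rightarrow> (('a \<Rightarrow> 'b::euclidean_space) \<Rightarrow> real) \<Rightarrow> bool" where
  "representable_by_integration W S \<longleftrightarrow> radon_measure (top_of_set W) (variation W S)"

text \<open>The unique \<open>\<parallel>S\<parallel>\<close>-continuous extension of \<open>S\<close> from test functions to the \<open>L\<^sub>1\<close> space of \<open>\<parallel>S\<parallel>\<close>.\<close>

definition dist_ext ::
  "'a::euclidean_space set \<Rightarrow> (('a \<Rightarrow> 'b::euclidean_space) \<Rightarrow> real) \<Rightarrow> ('a \<Rightarrow> 'b) \<Rightarrow> real" where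
  "dist_ext W S = (THE L.
     L \<in> extensional (L1_space (variation W S)) \<and>
     (\<forall>\<theta>. test_fun W \<theta> \<longrightarrow> L \<theta> = S \<theta>) \<and>
     (\<forall>\<theta>\<in>L1_space (variation W S). \<forall>\<epsilon>>0. \<exists>\<delta>>0. \<forall>\<zeta>\<in>L1_space (variation W S).
        (\<integral>x. norm (\<zeta> x - \<theta> x) \<partial>completion (variation W S)) < \<delta> \<longrightarrow> \<bar>L \<zeta> - L \<theta>\<bar> < \<epsilon>))"

definition dist_restrict ::
  "'a::euclidean_space set \<Rightarrow> (('a \<Rightarrow> 'b::euclidean_space) \<Rightarrow> real) \<Rightarrow> 'a set \<Rightarrow> ('a \<Rightarrow> 'b) \<Rightarrow> real"
  where "dist_restrict W S E \<theta> = dist_ext W S (\<lambda>z. indicator E z *\<^sub>R \<theta> z)"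


section \<open>Hausdorff measure and submanifolds\<close>

definition hausdorff_pre :: "real \<Rightarrow> nat \<Rightarrow> 'a::metric_space set \<Rightarrow> ennreal" where
  "hausdorff_pre \<delta> m A =
     (INF S\<in>{S :: nat \<Rightarrow> 'a set. A \<subseteq> (\<Union>j. S j) \<and> (\<forall>j. bounded (S j) \<and> diameter (S j) \<le> \<delta>)}.
        \<Sum>j. if S j = {} then 0 else ennreal (unit_ball_vol (real m) * (diameter (S j) / 2) ^ m))"

definition hausdorff_measure :: "nat \<Rightarrow> 'a::metric_space measure" where
  "hausdorff_measure m = measure_of UNIV (sets borel) (\<lambda>A. SUP \<delta>\<in>{0<..}. hausdorff_pre \<delta> m A)"

definition C1_on :: "'a::euclidean_space set \<Rightarrow> ('a \<Rightarrow> 'b::euclidean_space) \<Rightarrow> bool" where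
  "C1_on S f \<longleftrightarrow> (\<exists>f' :: 'a \<Rightarrow> 'a \<Rightarrow>\<^sub>L 'b.
     (\<forall>x\<in>S. (f has_derivative blinfun_apply (f' x)) (at x)) \<and> continuous_on S f')"

definition C1_submanifold :: "nat \<Rightarrow> 'a::euclidean_space set \<Rightarrow> bool" where
  "C1_submanifold m M \<longleftrightarrow> (\<forall>a\<in>M. \<exists>(T :: 'a set) (T' :: 'a set) \<sigma> \<tau> Z.
     open T \<and> a \<in> T \<and> open T' \<and> homeomorphism T T' \<sigma> \<tau> \<and> C1_on T \<sigma> \<and> C1_on T' \<tau> \<and>
     subspace Z \<and> dim Z = m \<and> \<sigma> ` (M \<inter> T) = Z \<inter> T')"

text \<open>
  Federer's tangent cone; at the points of a \<open>C\<^sup>1\<close> submanifold it is the usual tangent space.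
\<close>

definition Tan :: "'a::real_normed_vector set \<Rightarrow> 'a \<Rightarrow> 'a set" where
  "Tan S a = {v. \<forall>\<epsilon>>0. \<exists>x\<in>S. \<exists>r>0. norm (x - a) < \<epsilon> \<and> norm (r *\<^sub>R (x - a) - v) < \<epsilon>}"


section \<open>Varifolds\<close>

definition orth_proj :: "'a::euclidean_space set \<Rightarrow> 'a \<Rightarrow>\<^sub>L 'a" where
  "orth_proj S = Blinfun (\<lambda>x. THE y. y \<in> S \<and> (\<forall>w\<in>S. orthogonal (x - y) w))"

text \<open>The topology of the Grassmannian is the one induced by \<open>S \<mapsto> S\<^sub>\<natural>\<close>.\<close>

definition grassmannian :: "nat \<Rightarrow> 'a::euclidean_space set topology" where
  "grassmannian m = pullback_topology {S. subspace S \<and> dim S = m} orth_proj euclidean"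

definition hom_inner ::
  "('a::euclidean_space \<Rightarrow> 'b::euclidean_space) \<Rightarrow> ('a \<Rightarrow> 'b) \<Rightarrow> real" where
  "hom_inner \<sigma> \<tau> = (\<Sum>b\<in>Basis. (adjoint \<sigma> \<circ> \<tau>) b \<bullet> b)"

definition varifold_space ::
  "'a::euclidean_space set \<Rightarrow> nat \<Rightarrow> ('a \<times> 'a set) topology" where
  "varifold_space U m = prod_topology (top_of_set U) (grassmannian m)"

definition varifold ::
  "'a::euclidean_space set \<Rightarrow> nat \<Rightarrow> ('a \<times> 'a set) measure \<Rightarrow> bool" where
  "varifold U m V \<longleftrightarrow> radon_measure (varifold_space U m) V"

definition weight ::
  "'a::euclidean_space set \<Rightarrow> ('a \<times> 'a set) measure \<Rightarrow> 'a measure" where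
  "weight U V = distr V (borel_of (top_of_set U)) fst"

definition rectifiable_varifold ::
  "'a::euclidean_space set \<Rightarrow> nat \<Rightarrow> ('a \<times> 'a set) measure \<Rightarrow> bool" where
  "rectifiable_varifold U m V \<longleftrightarrow> varifold U m V \<and>
     (\<exists>(c :: nat \<Rightarrow> real) (M :: nat \<Rightarrow> 'a set) (E :: nat \<Rightarrow> 'a set).
        (\<forall>i. 0 < c i) \<and>
        (\<forall>i. C1_submanifold m (M i) \<and> M i \<subseteq> U) \<and>
        (\<forall>i. E i \<in> sets borel \<and> E i \<subseteq> M i) \<and>
        (\<forall>k. continuous_map (varifold_space U m) euclideanreal k \<longrightarrow>
             (\<exists>K. compactin (varifold_space U m) K \<and>
                  (\<forall>p\<in>topspace (varifold_space U m) - K. k p = 0)) \<longrightarrow>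
             (\<forall>i. set_integrable (hausdorff_measure m) (E i) (\<lambda>z. k (z, Tan (M i) z))) \<and>
             (\<lambda>i. c i * (LINT z:E i|hausdorff_measure m. k (z, Tan (M i) z)))
               sums (\<integral>p. k p \<partial>V)))"

definition first_variation ::
  "('a::euclidean_space \<times> 'a set) measure \<Rightarrow> ('a \<Rightarrow> 'a) \<Rightarrow> real" where
  "first_variation V g =
     (\<integral>(z, S). hom_inner (frechet_derivative g (at z)) (orth_proj S) \<partial>V)"

text \<open>The distributional boundary \<open>V \<partial> E\<close>, for \<open>E\<close> measurable for \<open>\<parallel>V\<parallel> + \<parallel>\<delta>V\<parallel>\<close>.\<close>

definition varifold_boundary ::
  "'a::euclidean_space set \<Rightarrow> nat \<Rightarrow> ('a \<times> 'a set) measure \<Rightarrow> 'a set \<Rightarrow> ('a \<Rightarrow> 'a) \<Rightarrow> real" where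
  "varifold_boundary U m V E \<theta> =
     dist_restrict U (first_variation V) E \<theta> -
     first_variation (restr_measure V (E \<times> topspace (grassmannian m))) \<theta>"


section \<open>Generalised weakly differentiable functions\<close>

definition is_weak_deriv ::
  "'a::euclidean_space set \<Rightarrow> ('a \<times> 'a set) measure \<Rightarrow> ('a \<Rightarrow> 'b::euclidean_space) \<Rightarrow>
     ('a \<Rightarrow> 'a \<Rightarrow>\<^sub>L 'b) \<Rightarrow> bool" where
  "is_weak_deriv U V f F \<longleftrightarrow>
     F \<in> borel_measurable (completion (weight U V)) \<and>
     (\<forall>K s. compact K \<longrightarrow> K \<subseteq> U \<longrightarrow> 0 \<le> s \<longrightarrow>
        (\<integral>\<^sup>+z\<in>K \<inter> {z. norm (f z) \<le> s}. ennreal (norm (F z)) \<partial>completion (weight U V)) < \<infinity>) \<and>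
     (\<forall>\<theta> (\<eta> :: 'b \<Rightarrow> real).
        test_fun U \<theta> \<longrightarrow> smooth \<eta> \<longrightarrow>
        compact (closure {y. frechet_derivative \<eta> (at y) \<noteq> (\<lambda>_. 0)}) \<longrightarrow>
        dist_ext U (first_variation V) (\<lambda>z. \<eta> (f z) *\<^sub>R \<theta> z) =
          (\<integral>(z, S). \<eta> (f z) * hom_inner (orth_proj S) (frechet_derivative \<theta> (at z)) \<partial>completion V) +
          (\<integral>z. (frechet_derivative \<eta> (at (f z)) \<circ> F z) (\<theta> z) \<partial>completion (weight U V)))"

text \<open>The class \<open>T(V)\<close>; it is only meaningful if \<open>\<parallel>\<delta>V\<parallel>\<close> is a Radon measure.\<close>

definition weakly_diff ::
  "'a::euclidean_space set \<Rightarrow> ('a \<times> 'a set) measure \<Rightarrow> ('a \<Rightarrow> 'b::euclidean_space) set" where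
  "weakly_diff U V = {f.
     f \<in> borel_measurable
           (completion (add_measure (weight U V) (variation U (first_variation V)))) \<and>
     (\<exists>F. is_weak_deriv U V f F)}"

definition approx_limit ::
  "'a::metric_space measure \<Rightarrow> ('a \<Rightarrow> 'b::metric_space) \<Rightarrow> 'a \<Rightarrow> 'b \<Rightarrow> bool" where
  "approx_limit M F a y \<longleftrightarrow>
     (\<forall>r>0. 0 < emeasure M (cball a r \<inter> space M)) \<and>
     (\<forall>\<epsilon>>0. ((\<lambda>r. emeasure M {z \<in> cball a r \<inter> space M. \<epsilon> \<le> dist (F z) y} /
                  emeasure M (cball a r \<inter> space M)) \<longlongrightarrow> 0) (at_right 0))"

text \<open>
  The generalised weak derivative \<open>V D f\<close>.  As \<open>F\<close> is unique up to null sets, its approximate limits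
  do not depend on the choice of \<open>F\<close>.  At points without approximate limit, which form a null set,
  the value is arbitrary.
\<close>

definition weak_deriv ::
  "'a::euclidean_space set \<Rightarrow> ('a \<times> 'a set) measure \<Rightarrow> ('a \<Rightarrow> 'b::euclidean_space) \<Rightarrow> 'a \<Rightarrow> 'a \<Rightarrow>\<^sub>L 'b"
  where "weak_deriv U V f a =
    (THE y. \<exists>F. is_weak_deriv U V f F \<and> approx_limit (completion (weight U V)) F a y)"

end

theory Submission
  imports Defs "HOL-Real_Asymp.Real_Asymp"
begin

text \<open>
  Testing the definition of \<open>V D f\<close> with smooth approximations of the primitive of the indicator of
  \<open>{a<..b}\<close> and applying Fubini's theorem to superlevel sets gives, for all test functions \<open>\<theta>\<close>,
  \<open>\<integral>\<^bsub>a\<^esub>\<^bsup>b\<^esup> V \<partial>E(t)(\<theta>) dt = \<integral>\<^bsub>{a < f \<le> b}\<^esub> \<langle>\<theta>, V D f\<rangle> d\<parallel>V\<parallel>\<close>.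
  The variation of \<open>T\<close> is the image of the measure \<open>|V D f| \<parallel>V\<parallel>\<close> under \<open>z \<mapsto> (z, f z)\<close>, and its
  values \<open>\<parallel>T\<parallel>(D \<times> {a<..b})\<close> agree with \<open>\<integral>\<^bsub>a\<^esub>\<^bsup>b\<^esup> \<parallel>V \<partial>E(t)\<parallel>(D) dt\<close> for \<open>D\<close> open: since
  \<open>t \<mapsto> V \<partial>E(t)(\<theta>)\<close> is right continuous, \<open>\<parallel>V \<partial>E(t)\<parallel>(D)\<close> is at most the lower right derivative of
  \<open>\<parallel>T\<parallel>(D \<times> {..t})\<close>, so that Fatou's lemma yields one inequality, and integrating
  \<open>V \<partial>E(t)(\<theta>) \<le> \<parallel>V \<partial>E(t)\<parallel>(D)\<close> for \<open>|\<theta>| \<le> 1\<close> supported in \<open>D\<close> yields the other.  Thus \<open>\<parallel>T\<parallel>\<close> is disintegrated by the measures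
  \<open>\<parallel>V \<partial>E(t)\<parallel>\<close>; the same holds for the positive measures \<open>(1 + n \<bullet> e) \<parallel>T\<parallel>\<close>, where \<open>n\<close> is the polar
  density of \<open>T\<close> and \<open>e\<close> a basis vector, and this gives the formula for \<open>T\<close> itself.

  That \<open>V D f\<close>, defined by approximate limits, agrees almost everywhere with any generalised weak
  derivative rests on the almost everywhere approximate continuity of functions measurable with
  respect to a Radon measure, obtained from the weak type inequality for the centred maximal function.
\<close>

section \<open>Smooth functions\<close>

text \<open>\<open>variation\<close> selects a greatest measure, so nothing is known about it before
  a measure with the prescribed values on open sets has been built. This is done for every linear
  functional, because the variation of V \<partial>E(t) is seen to be finite only for almost every
  t; at the other t the kernel is replaced by the null measure, which keeps it finite for all t. The
  polar density of V \<partial>E(t) is chosen for each t separately, so nothing is known about its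
  joint measurability in (z, t). Only its integrals over open sets, being limits of values V
  \<partial>E(t)(\<theta>), are measurable in t, and the passage to positive measures lets a
  uniqueness argument on boxes do the rest. Measurability of the variation itself, a supremum over
  uncountably many \<theta>, comes from right continuity: the superlevel sets are open to the right,
  hence Borel. The polar decomposition starts from the crude bound |S(\<theta>)| \<le> 16
  \<integral> |\<theta>| d||S||, proved by cutting \<theta> into dyadic layers of |\<theta>|; the
  unit length of the density is recovered afterwards from the uniqueness of Radon-Nikodym
  densities.\<close>

lemma smooth_differentiable: "smooth f \<Longrightarrow> f differentiable (at x)"
  unfolding smooth_def by (metis iter_deriv.simps(1))

lemma smooth_has_derivative:
  "smooth f \<Longrightarrow> (f has_derivative frechet_derivative f (at x)) (at x)"
  using frechet_derivative_works smooth_differentiable by blast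

lemma iter_deriv_append: "iter_deriv (vs @ ws) f = iter_deriv vs (iter_deriv ws f)"
  by (induction vs) auto

lemma smooth_frechet_derivative:
  assumes "smooth f" shows "smooth (\<lambda>x. frechet_derivative f (at x) v)"
proof -
  have "iter_deriv vs (\<lambda>x. frechet_derivative f (at x) v) = iter_deriv (vs @ [v]) f" for vs
    by (simp add: iter_deriv_append)
  then show ?thesis using assms unfolding smooth_def by metis
qed

lemma frechet_derivative_eqI:
  "(f has_derivative f') (at x) \<Longrightarrow> frechet_derivative f (at x) v = f' v"
  by (simp add: frechet_derivative_at[symmetric])

text \<open>Smoothness is the largest predicate stable under directional derivatives. The induction
  over the list of directions is done here once and for all; later proofs only exhibit a stable
  class containing the given function.\<close>

lemma smooth_coinduct [consumes 1, case_names deriv]: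
  assumes "P f"
    and deriv: "\<And>g. P g \<Longrightarrow>
      \<exists>g'. (\<forall>x. (g has_derivative g' x) (at x)) \<and> (\<forall>v. P (\<lambda>x. g' x v))"
  shows "smooth f"
proof -
  have P: "P (\<lambda>x. frechet_derivative g (at x) v)" if Pg: "P g" for g v
  proof -
    obtain g' where "\<forall>x. (g has_derivative g' x) (at x)" "P (\<lambda>x. g' x v)"
      using deriv[OF Pg] by blast
    moreover from this have "frechet_derivative g (at x) v = g' x v" for x
      by (intro frechet_derivative_eqI) blast
    ultimately show ?thesis by presburger
  qed
  have "P (iter_deriv vs f)" for vs
    by (induction vs) (auto simp: \<open>P f\<close> P)
  then show ?thesis unfolding smooth_def using deriv differentiableI by blast
qed

lemma smooth_continuous_on: "smooth f \<Longrightarrow> continuous_on S f"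
  by (simp add: continuous_at_imp_continuous_on differentiable_imp_continuous_within
      smooth_differentiable)

lemma smooth_const [simp]: "smooth (\<lambda>x. c)"
proof (rule smooth_coinduct[where P="\<lambda>f. \<exists>c. f = (\<lambda>x. c)"])
  fix g :: "'a \<Rightarrow> 'b"
  assume "\<exists>c. g = (\<lambda>x. c)"
  then obtain c where "g = (\<lambda>x. c)" by blast
  then have "(g has_derivative (\<lambda>v. 0)) (at x)" for x by simp
  then show "\<exists>g'. (\<forall>x. (g has_derivative g' x) (at x)) \<and> (\<forall>v. \<exists>c. (\<lambda>x. g' x v) = (\<lambda>x. c))"
    by (intro exI[of _ "\<lambda>x v. 0"] conjI allI) blast+
qed blast

lemma smooth_linear: "bounded_linear f \<Longrightarrow> smooth f"
proof -
  assume "bounded_linear f"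
  then have "bounded_linear f \<or> (\<exists>c. f = (\<lambda>x. c))" by blast
  then show ?thesis
  proof (induction rule: smooth_coinduct)
    case (deriv g)
    then show ?case
    proof
      assume "bounded_linear g"
      from bounded_linear_imp_has_derivative[OF this] show ?thesis
        by (intro exI[of _ "\<lambda>x v. g v"] conjI allI disjI2) blast+
    next
      assume "\<exists>c. g = (\<lambda>x. c)"
      then obtain c where "g = (\<lambda>x. c)" by blast
      then have "(g has_derivative (\<lambda>v. 0)) (at x)" for x by simp
      then show ?thesis by (intro exI[of _ "\<lambda>x v. 0"] conjI allI disjI2) blast+
    qed
  qed
qed

text \<open>Closing the products under sums makes the class stable under differentiation.\<close>

inductive smooth_products ::
  "('a::real_normed_vector \<Rightarrow> 'b::real_normed_vector) \<Rightarrow> bool" where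
  scaleR: "smooth a \<Longrightarrow> smooth b \<Longrightarrow> smooth_products (\<lambda>x. a x *\<^sub>R b x)"
| add: "smooth_products f \<Longrightarrow> smooth_products g \<Longrightarrow> smooth_products (\<lambda>x. f x + g x)"

lemma smooth_products_smooth:
  assumes "smooth_products f" shows "smooth f"
  using assms
proof (induction rule: smooth_coinduct)
  case (deriv f)
  then show ?case
  proof induction
    case (scaleR a b)
    let ?a = "\<lambda>x. frechet_derivative a (at x)" and ?b = "\<lambda>x. frechet_derivative b (at x)"
    have "smooth_products (\<lambda>x. a x *\<^sub>R ?b x v + ?a x v *\<^sub>R b x)" for v
      by (intro smooth_products.intros scaleR smooth_frechet_derivative)
    moreover have "((\<lambda>x. a x *\<^sub>R b x) has_derivative (\<lambda>v. a x *\<^sub>R ?b x v + ?a x v *\<^sub>R b x)) (at x)" for x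
      by (intro has_derivative_scaleR scaleR smooth_has_derivative)
    ultimately show ?case
      by (intro exI[of _ "\<lambda>x v. a x *\<^sub>R ?b x v + ?a x v *\<^sub>R b x"] conjI allI) blast+
  next
    case (add f g)
    then obtain f' g' where
      fg: "\<forall>x. (f has_derivative f' x) (at x)" "\<forall>v. smooth_products (\<lambda>x. f' x v)"
        "\<forall>x. (g has_derivative g' x) (at x)" "\<forall>v. smooth_products (\<lambda>x. g' x v)"
      by blast
    then have "((\<lambda>x. f x + g x) has_derivative (\<lambda>v. f' x v + g' x v)) (at x)" for x
      by (intro has_derivative_add) auto
    with fg show ?case
      by (intro exI[of _ "\<lambda>x v. f' x v + g' x v"] conjI allI smooth_products.add) blast+
  qed
qed

lemma smooth_scaleR: "smooth a \<Longrightarrow> smooth b \<Longrightarrow> smooth (\<lambda>x. a x *\<^sub>R b x)"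
  by (rule smooth_products_smooth) (rule smooth_products.scaleR)

lemma smooth_mult: "smooth a \<Longrightarrow> smooth b \<Longrightarrow> smooth (\<lambda>x. a x * b x :: real)"
  using smooth_scaleR[of a b] by simp

lemma smooth_add:
  assumes "smooth f" "smooth g" shows "smooth (\<lambda>x. f x + g x)"
proof -
  have "smooth_products (\<lambda>x. 1 *\<^sub>R f x + 1 *\<^sub>R g x)"
    by (intro smooth_products.add smooth_products.scaleR smooth_const assms)
  then show ?thesis using smooth_products_smooth by force
qed

lemma smooth_diff: "smooth f \<Longrightarrow> smooth g \<Longrightarrow> smooth (\<lambda>x. f x - g x)"
  using smooth_add[of f "\<lambda>x. (-1) *\<^sub>R g x"] smooth_scaleR[of "\<lambda>_. -1" g] by simp

lemma smooth_sum:
  assumes "finite I" "\<And>i. i \<in> I \<Longrightarrow> smooth (f i)" shows "smooth (\<lambda>x. \<Sum>i\<in>I. f i x)"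
  using assms by (induction I rule: finite_induct) (auto intro: smooth_add)

lemma smooth_bounded_linear_comp:
  assumes L: "bounded_linear L" and "smooth f" shows "smooth (\<lambda>x. L (f x))"
proof (rule smooth_coinduct[where P="\<lambda>h. \<exists>f. smooth f \<and> h = (\<lambda>x. L (f x))"])
  fix h :: "'c \<Rightarrow> 'b"
  assume "\<exists>f. smooth f \<and> h = (\<lambda>x. L (f x))"
  then obtain f where f: "smooth f" "h = (\<lambda>x. L (f x))" by blast
  have "(h has_derivative (\<lambda>v. L (frechet_derivative f (at x) v))) (at x)" for x
    unfolding f(2) by (rule bounded_linear.has_derivative[OF L smooth_has_derivative[OF f(1)]])
  then show "\<exists>h'. (\<forall>x. (h has_derivative h' x) (at x)) \<and>
      (\<forall>v. \<exists>f. smooth f \<and> (\<lambda>x. h' x v) = (\<lambda>x. L (f x)))"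
    using smooth_frechet_derivative[OF f(1)]
    by (intro exI[of _ "\<lambda>x v. L (frechet_derivative f (at x) v)"] conjI allI) (blast, metis)
qed (use assms in blast)

lemma smooth_inner:
  fixes a b :: "'a::real_normed_vector \<Rightarrow> 'b::euclidean_space"
  assumes "smooth a" "smooth b" shows "smooth (\<lambda>x. a x \<bullet> b x)"
proof -
  have "(\<lambda>x. a x \<bullet> b x) = (\<lambda>x. \<Sum>e\<in>Basis. (a x \<bullet> e) * (b x \<bullet> e))"
    by (rule ext) (rule euclidean_inner)
  moreover have "smooth (\<lambda>x. \<Sum>e\<in>Basis. (a x \<bullet> e) * (b x \<bullet> e))"
    by (intro smooth_sum[OF finite_Basis] smooth_mult)
      (rule smooth_bounded_linear_comp[OF bounded_linear_inner_left], rule assms)+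
  ultimately show ?thesis by presburger
qed

text \<open>The chain rule turns \<phi>(g) b into \<phi>(g) b' + \<phi>'(g) g' b. The free factor
  \<open>b\<close> absorbs g', and closure under sums makes the class stable. The outer function has
  a real argument, so its derivative is again a single function.\<close>

inductive smooth_compositions ::
  "('a::real_normed_vector \<Rightarrow> real) \<Rightarrow> ('a \<Rightarrow> real) \<Rightarrow> bool" for g where
  comp: "smooth \<phi> \<Longrightarrow> smooth b \<Longrightarrow> smooth_compositions g (\<lambda>x. \<phi> (g x) * b x)"
| add: "smooth_compositions g f \<Longrightarrow> smooth_compositions g h \<Longrightarrow> smooth_compositions g (\<lambda>x. f x + h x)"

lemma smooth_real_deriv:
  fixes \<phi> :: "real \<Rightarrow> real"
  assumes "smooth \<phi>" shows "(\<phi> has_real_derivative frechet_derivative \<phi> (at y) 1) (at y)"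
proof -
  have "linear (frechet_derivative \<phi> (at y))"
    using smooth_has_derivative[OF assms, of y] has_derivative_linear by blast
  then have "frechet_derivative \<phi> (at y) v = frechet_derivative \<phi> (at y) 1 * v" for v
    using linear_cmul[of "frechet_derivative \<phi> (at y)" v 1] by simp
  then have "(*) (frechet_derivative \<phi> (at y) 1) = frechet_derivative \<phi> (at y)"
    by (intro ext) (rule sym)
  then show ?thesis unfolding has_field_derivative_def
    using smooth_has_derivative[OF assms, of y] by (simp only:)
qed

lemma smooth_compositions_smooth:
  assumes g: "smooth g" and "smooth_compositions g f" shows "smooth f"
  using assms(2)
proof (induction rule: smooth_coinduct)
  case (deriv f)
  then show ?case
  proof induction
    case (comp \<phi> b)
    let ?\<phi> = "\<lambda>y. frechet_derivative \<phi> (at y) 1" and ?g = "\<lambda>x. frechet_derivative g (at x)"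
      and ?b = "\<lambda>x. frechet_derivative b (at x)"
    have "smooth_compositions g (\<lambda>x. \<phi> (g x) * ?b x v + ?\<phi> (g x) * (?g x v * b x))" for v
      by (intro smooth_compositions.intros comp smooth_frechet_derivative smooth_mult g)
    moreover have "((\<lambda>x. \<phi> (g x) * b x) has_derivative
        (\<lambda>v. \<phi> (g x) * ?b x v + ?\<phi> (g x) * (?g x v * b x))) (at x)" for x
    proof -
      have "((\<lambda>x. \<phi> (g x)) has_derivative (\<lambda>v. ?\<phi> (g x) * ?g x v)) (at x)"
        using has_derivative_compose[OF smooth_has_derivative[OF g]
            smooth_real_deriv[OF comp(1), unfolded has_field_derivative_def]] .
      from has_derivative_mult[OF this smooth_has_derivative[OF comp(2)]]
      show ?thesis by (simp add: mult.assoc)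
    qed
    ultimately show ?case
      by (intro exI[of _ "\<lambda>x v. \<phi> (g x) * ?b x v + ?\<phi> (g x) * (?g x v * b x)"] conjI allI) blast+
  next
    case (add f h)
    then obtain f' h' where
      fh: "\<forall>x. (f has_derivative f' x) (at x)" "\<forall>v. smooth_compositions g (\<lambda>x. f' x v)"
        "\<forall>x. (h has_derivative h' x) (at x)" "\<forall>v. smooth_compositions g (\<lambda>x. h' x v)"
      by blast
    then have "((\<lambda>x. f x + h x) has_derivative (\<lambda>v. f' x v + h' x v)) (at x)" for x
      by (intro has_derivative_add) auto
    with fh show ?case
      by (intro exI[of _ "\<lambda>x v. f' x v + h' x v"] conjI allI smooth_compositions.add) blast+
  qed
qed

lemma smooth_compose:
  fixes \<phi> :: "real \<Rightarrow> real"
  assumes "smooth g" "smooth \<phi>" shows "smooth (\<lambda>x. \<phi> (g x))"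
  using smooth_compositions_smooth[OF assms(1) smooth_compositions.comp[OF assms(2) smooth_const[of 1]]]
  by simp

lemma smooth_antiderivative:
  fixes \<eta> \<omega> :: "real \<Rightarrow> real"
  assumes \<eta>: "\<And>x. (\<eta> has_real_derivative \<omega> x) (at x)" and \<omega>: "smooth \<omega>" shows "smooth \<eta>"
proof (rule smooth_coinduct[where P="\<lambda>g. g = \<eta> \<or> smooth g"])
  fix g assume "g = \<eta> \<or> smooth g"
  then show "\<exists>g'. (\<forall>x. (g has_derivative g' x) (at x)) \<and> (\<forall>v. (\<lambda>x. g' x v) = \<eta> \<or> smooth (\<lambda>x. g' x v))"
  proof
    assume "smooth g"
    then show ?thesis
      by (intro exI[of _ "\<lambda>x. frechet_derivative g (at x)"] conjI allI smooth_has_derivative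
          disjI2 smooth_frechet_derivative)
  next
    assume "g = \<eta>"
    then have "(g has_derivative (\<lambda>v. \<omega> x * v)) (at x)" for x
      using \<eta> by (simp add: has_field_derivative_def)
    moreover have "smooth (\<lambda>x. \<omega> x * v)" for v by (intro smooth_mult \<omega> smooth_const)
    ultimately show ?thesis
      by (intro exI[of _ "\<lambda>x v. \<omega> x * v"] conjI allI disjI2) blast+
  qed
qed simp

section \<open>Bump functions\<close>

text \<open>The functions \<open>p (1/x) exp (-1/x)\<close>, extended by \<open>0\<close> to \<open>x \<le> 0\<close>, with \<open>p\<close> a polynomial form
  a class closed under differentiation.\<close>

definition flat_exp :: "real poly \<Rightarrow> real \<Rightarrow> real" where
  "flat_exp p x = (if 0 < x then poly p (1 / x) * exp (- (1 / x)) else 0)"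

lemma poly_times_exp_neg_tendsto_0:
  fixes p :: "real poly"
  shows "((\<lambda>y. poly p y * exp (- y)) \<longlongrightarrow> 0) at_top"
proof -
  have "((\<lambda>y. \<Sum>i\<le>degree p. coeff p i * (y ^ i / exp y)) \<longlongrightarrow> (\<Sum>i\<le>degree p. coeff p i * 0)) at_top"
    by (intro tendsto_intros tendsto_power_div_exp_0)
  moreover have "(\<lambda>y. \<Sum>i\<le>degree p. coeff p i * (y ^ i / exp y)) = (\<lambda>y. poly p y * exp (- y))"
    by (simp add: poly_altdef sum_distrib_right exp_minus divide_inverse mult.assoc)
  ultimately show ?thesis by simp
qed

text \<open>With y = 1/x one has dy/dx = -y^2, so p(y) exp(-y) has the derivative y^2 (p - p')(y)
  exp(-y); the factor \<open>[:0, 0, 1:]\<close> is y^2. At 0 the right difference quotient is y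
  p(y) exp(-y), which tends to 0 as y tends to infinity.\<close>

lemma flat_exp_has_derivative:
  "(flat_exp p has_real_derivative flat_exp ([:0, 0, 1:] * (p - pderiv p)) x) (at x)"
proof -
  consider "x < 0" | "x > 0" | "x = 0" by linarith
  then show ?thesis
  proof cases
    case 1
    have "((\<lambda>_. 0) has_real_derivative 0) (at x)" by simp
    then have "(flat_exp p has_real_derivative 0) (at x)"
      by (rule has_field_derivative_transform_within[where d="-x"]) (use 1 in \<open>auto simp: flat_exp_def dist_real_def\<close>)
    with 1 show ?thesis by (simp add: flat_exp_def)
  next
    case 2
    have d: "((\<lambda>x. 1 / x) has_real_derivative - (1 / x * (1 / x))) (at x)"
      using 2 DERIV_inverse[of x] by (simp add: inverse_eq_divide power2_eq_square)
    have "flat_exp ([:0, 0, 1:] * (p - pderiv p)) x =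
        poly (pderiv p) (1 / x) * - (1 / x * (1 / x)) * exp (- (1 / x)) +
        exp (- (1 / x)) * - (- (1 / x * (1 / x))) * poly p (1 / x)"
      using 2 by (simp add: flat_exp_def) (simp add: algebra_simps add_divide_distrib diff_divide_distrib)
    with DERIV_mult[OF DERIV_chain2[OF poly_DERIV d] DERIV_chain2[OF DERIV_exp DERIV_minus[OF d]], of p]
    have "((\<lambda>x. poly p (1 / x) * exp (- (1 / x))) has_real_derivative
        flat_exp ([:0, 0, 1:] * (p - pderiv p)) x) (at x)" by presburger
    then show ?thesis
      by (rule has_field_derivative_transform_within[where d="x"]) (use 2 in \<open>auto simp: flat_exp_def dist_real_def\<close>)
  next
    case 3
    have "((\<lambda>h. (flat_exp p (0 + h) - flat_exp p 0) / h) \<longlongrightarrow> 0) (at 0)"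
    proof (rule filterlim_split_at)
      show "((\<lambda>h. (flat_exp p (0 + h) - flat_exp p 0) / h) \<longlongrightarrow> 0) (at_left 0)"
        by (rule tendsto_eventually) (auto simp: flat_exp_def eventually_at_filter)
      have "((\<lambda>h. poly ([:0, 1:] * p) (inverse h) * exp (- inverse h)) \<longlongrightarrow> 0) (at_right (0::real))"
        by (rule filterlim_compose[OF poly_times_exp_neg_tendsto_0 filterlim_inverse_at_top_right])
      then show "((\<lambda>h. (flat_exp p (0 + h) - flat_exp p 0) / h) \<longlongrightarrow> 0) (at_right 0)"
        by (rule Lim_transform_eventually)
          (simp add: flat_exp_def eventually_at_filter inverse_eq_divide)
    qed
    then show ?thesis using 3 by (simp add: DERIV_def flat_exp_def)
  qed
qed

lemma smooth_flat_exp: "smooth (flat_exp p)"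
proof (rule smooth_coinduct[where P="\<lambda>g. \<exists>c p. g = (\<lambda>x. c * flat_exp p x)"])
  show "\<exists>c p'. flat_exp p = (\<lambda>x. c * flat_exp p' x)" by (intro exI[of _ 1] exI[of _ p]) simp
  fix g assume "\<exists>c p. g = (\<lambda>x. c * flat_exp p x)"
  then obtain c p where g: "g = (\<lambda>x. c * flat_exp p x)" by blast
  let ?q = "[:0, 0, 1:] * (p - pderiv p)"
  have "(g has_derivative (\<lambda>v. c * v * flat_exp ?q x)) (at x)" for x
  proof -
    have "(\<lambda>v. c * v * flat_exp ?q x) = (*) (c * flat_exp ?q x)" by (simp add: fun_eq_iff)
    then show ?thesis
      using DERIV_cmult[OF flat_exp_has_derivative[of p x], of c]
      unfolding g has_field_derivative_def by presburger
  qed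
  then show "\<exists>g'. (\<forall>x. (g has_derivative g' x) (at x)) \<and>
      (\<forall>v. \<exists>c p. (\<lambda>x. g' x v) = (\<lambda>x. c * flat_exp p x))"
    by (intro exI[of _ "\<lambda>x v. c * v * flat_exp ?q x"] conjI allI) blast+
qed

lemma flat_exp_1_pos: "0 < flat_exp 1 x \<longleftrightarrow> 0 < x" "0 \<le> flat_exp 1 x" "x \<le> 0 \<Longrightarrow> flat_exp 1 x = 0"
  by (auto simp: flat_exp_def)

text \<open>The lower limit -1 makes every x >= 0 an interior point of the interval of integration,
  while for x < 0 the integral vanishes identically; so the derivative at x is two-sided in both
  cases.\<close>

lemma antiderivative_exists:
  fixes w :: "real \<Rightarrow> real"
  assumes w: "continuous_on UNIV w" "\<And>x. x \<le> 0 \<Longrightarrow> w x = 0"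
  shows "\<exists>I. (\<forall>x. (I has_real_derivative w x) (at x)) \<and> (\<forall>x\<le>0. I x = 0)"
proof -
  have int: "w integrable_on {a..b}" for a b
    using integrable_continuous_real continuous_on_subset[OF w(1)] by blast
  have zero: "integral {-1..x} w = 0" if "x \<le> 0" for x
  proof -
    have "integral {-1..x} w = integral {-1..x} (\<lambda>x. 0::real)"
      by (rule Henstock_Kurzweil_Integration.integral_cong) (use that w(2) in auto)
    then show ?thesis by simp
  qed
  have "((\<lambda>x. integral {-1..x} w) has_real_derivative w x) (at x)" for x
  proof (cases "x < 0")
    case True
    have "((\<lambda>_. 0) has_real_derivative 0) (at x)" by simp
    then have "((\<lambda>x. integral {-1..x} w) has_real_derivative 0) (at x)"
      by (rule has_field_derivative_transform_within[where d="-x"]) (use True zero in \<open>auto simp: dist_real_def\<close>)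
    with True show ?thesis by (simp add: w(2))
  next
    case False
    have "((\<lambda>x. integral {-1..x} w) has_real_derivative w x) (at x within {-1..x+1})"
      by (rule integral_has_real_derivative) (use False continuous_on_subset[OF w(1)] in auto)
    then show ?thesis using False by (simp add: at_within_Icc_at)
  qed
  then show ?thesis using zero by blast
qed

text \<open>The step is the normalised primitive of a smooth bump that is positive exactly on the
  open unit interval.\<close>

lemma smooth_step_exists:
  "\<exists>\<sigma>::real \<Rightarrow> real. smooth \<sigma> \<and> (\<forall>x. 0 \<le> \<sigma> x \<and> \<sigma> x \<le> 1) \<and> (\<forall>x\<le>0. \<sigma> x = 0) \<and> (\<forall>x\<ge>1. \<sigma> x = 1)"
proof -
  define w where "w x = flat_exp 1 x * flat_exp 1 (1 - x)" for x
  have "smooth (\<lambda>x. flat_exp 1 (1 - x))"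
    by (rule smooth_compose[OF smooth_diff[OF smooth_const smooth_linear[OF bounded_linear_ident]]
          smooth_flat_exp])
  then have w: "smooth w" unfolding w_def by (intro smooth_mult smooth_flat_exp)
  have w0: "0 \<le> w x" for x by (simp add: w_def flat_exp_1_pos)
  obtain I where I_deriv: "\<And>x. (I has_real_derivative w x) (at x)" and I_0: "\<And>x. x \<le> 0 \<Longrightarrow> I x = 0"
    using antiderivative_exists[OF smooth_continuous_on[OF w]] by (auto simp: w_def flat_exp_1_pos)
  have I: "smooth I" using smooth_antiderivative I_deriv w by blast
  have mono: "I x \<le> I y" if "x \<le> y" for x y
    by (rule DERIV_nonneg_imp_nondecreasing[OF that]) (use I_deriv w0 in blast)
  have const: "I x = I 1" if "1 \<le> x" for x
  proof (rule antisym[OF DERIV_nonpos_imp_nonincreasing[OF that] mono[OF that]])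
    fix y :: real assume "1 \<le> y"
    then have "w y = 0" by (simp add: w_def flat_exp_1_pos)
    then show "\<exists>d. (I has_real_derivative d) (at y) \<and> d \<le> 0" using I_deriv[of y] by auto
  qed
  \<comment> \<open>Otherwise the monotone function \<open>I\<close> would be constant on the unit
    interval, and its derivative \<open>w\<close> would vanish at 1/2.\<close>
  have pos: "0 < I 1"
  proof (rule ccontr)
    assume "\<not> 0 < I 1"
    then have "I y = 0" if "0 \<le> y" "y \<le> 1" for y
      using mono[of y 1] mono[of 0 y] that by (auto simp: I_0)
    then have "((\<lambda>_. 0) has_real_derivative w (1/2)) (at (1/2))"
      by (intro has_field_derivative_transform_within[OF I_deriv, where d="1/2"]) (auto simp: dist_real_def abs_if split: if_splits)
    then have "w (1/2) = 0" using DERIV_const DERIV_unique by blast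
    then show False by (simp add: w_def flat_exp_def)
  qed
  have "smooth (\<lambda>x. I x * inverse (I 1))" by (intro smooth_mult I smooth_const)
  moreover have "0 \<le> I x" "I x \<le> I 1" for x
    using mono[of 0 x] mono[of x 0] mono[of x 1] const[of x] by (cases "x \<le> 0"; cases "x \<le> 1"; auto simp: I_0)+
  moreover have "I x = 0" if "x \<le> 0" for x using that by (simp add: I_0)
  moreover have "0 \<le> I x * inverse (I 1)" "I x * inverse (I 1) \<le> 1" for x
    using \<open>0 \<le> I x\<close> \<open>I x \<le> I 1\<close> pos by (simp_all add: field_simps)
  moreover have "I x * inverse (I 1) = 1" if "1 \<le> x" for x using const[OF that] pos by simp
  ultimately show ?thesis
    by (intro exI[of _ "\<lambda>x. I x * inverse (I 1)"] conjI allI impI) simp_all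
qed

definition smooth_step :: "real \<Rightarrow> real" where
  "smooth_step = (SOME \<sigma>. smooth \<sigma> \<and> (\<forall>x. 0 \<le> \<sigma> x \<and> \<sigma> x \<le> 1) \<and> (\<forall>x\<le>0. \<sigma> x = 0) \<and> (\<forall>x\<ge>1. \<sigma> x = 1))"

lemma smooth_step:
  "smooth smooth_step" "0 \<le> smooth_step x" "smooth_step x \<le> 1"
  "x \<le> 0 \<Longrightarrow> smooth_step x = 0" "1 \<le> x \<Longrightarrow> smooth_step x = 1"
  using someI_ex[OF smooth_step_exists] unfolding smooth_step_def[symmetric] by auto

lemma smooth_linear_comp: "smooth (\<lambda>x. c * x + d :: real)"
  by (rule smooth_add smooth_mult smooth_const smooth_linear bounded_linear_ident)+

lemma test_fun_smooth: "test_fun W \<theta> \<Longrightarrow> smooth \<theta>" by (simp add: test_fun_def)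

lemma spt_outside: "x \<notin> spt f \<Longrightarrow> f x = 0"
  using closure_subset[of "{x. f x \<noteq> 0}"] by (auto simp: spt_def)

lemma spt_subsetI: "(\<And>x. f x \<noteq> 0 \<Longrightarrow> x \<in> A) \<Longrightarrow> closed A \<Longrightarrow> spt f \<subseteq> A"
  unfolding spt_def by (rule closure_minimal) auto

lemma closed_spt [simp]: "closed (spt f)" by (simp add: spt_def)

lemma spt_mono: "(\<And>x. g x = 0 \<Longrightarrow> f x = 0) \<Longrightarrow> spt f \<subseteq> spt g"
  unfolding spt_def by (rule closure_mono) auto

lemma test_funI:
  assumes "smooth \<theta>" "compact K" "K \<subseteq> W" "\<And>x. x \<notin> K \<Longrightarrow> \<theta> x = 0"
  shows "test_fun W \<theta>" "spt \<theta> \<subseteq> K"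
proof -
  show *: "spt \<theta> \<subseteq> K"
    by (rule spt_subsetI) (use assms(4) compact_imp_closed[OF assms(2)] in auto)
  then have "compact (spt \<theta>)"
    using compact_Int_closed[OF assms(2) closed_spt, of \<theta>] by (simp add: Int_absorb1)
  then show "test_fun W \<theta>" using * assms by (auto simp: test_fun_def)
qed

lemma test_fun_add:
  assumes "test_fun W \<theta>" "test_fun W \<zeta>"
  shows "test_fun W (\<lambda>x. \<theta> x + \<zeta> x)" "spt (\<lambda>x. \<theta> x + \<zeta> x) \<subseteq> spt \<theta> \<union> spt \<zeta>"
  using assms test_funI[of "\<lambda>x. \<theta> x + \<zeta> x" "spt \<theta> \<union> spt \<zeta>" W]
  by (auto simp: test_fun_def spt_outside smooth_add)

lemma test_fun_scaleR:
  assumes "smooth \<phi>" "test_fun W \<theta>"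
  shows "test_fun W (\<lambda>x. \<phi> x *\<^sub>R \<theta> x)" "spt (\<lambda>x. \<phi> x *\<^sub>R \<theta> x) \<subseteq> spt \<theta>"
  using assms test_funI[of "\<lambda>x. \<phi> x *\<^sub>R \<theta> x" "spt \<theta>" W]
  by (auto simp: test_fun_def spt_outside smooth_scaleR)

lemma test_fun_scaleR_const:
  assumes "test_fun W \<phi>"
  shows "test_fun W (\<lambda>x. \<phi> x *\<^sub>R c)" "spt (\<lambda>x. \<phi> x *\<^sub>R c) \<subseteq> spt \<phi>"
  using assms test_funI[of "\<lambda>x. \<phi> x *\<^sub>R c" "spt \<phi>" W]
  by (auto simp: test_fun_def spt_outside smooth_scaleR)

lemma test_fun_0: "test_fun W (\<lambda>x. 0)"
  using test_funI[of "\<lambda>x. 0" "{}" W] by simp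

lemma test_fun_sum:
  assumes "finite I" "\<And>i. i \<in> I \<Longrightarrow> test_fun W (f i)" shows "test_fun W (\<lambda>x. \<Sum>i\<in>I. f i x)"
  using assms by (induction I rule: finite_induct) (auto intro: test_fun_add test_fun_0)

text \<open>A finite sum of radial bumps is positive on \<open>K\<close>; a smooth step turns it into a function which
  is \<open>1\<close> near \<open>K\<close>.\<close>

lemma bump_function:
  fixes K :: "'a::euclidean_space set"
  assumes "compact K" "open C" "K \<subseteq> C"
  obtains \<phi> :: "'a \<Rightarrow> real" and G where "test_fun C \<phi>" "\<And>x. 0 \<le> \<phi> x" "\<And>x. \<phi> x \<le> 1"
    "open G" "K \<subseteq> G" "\<And>x. x \<in> G \<Longrightarrow> \<phi> x = 1"
proof -
  have "\<forall>x\<in>K. \<exists>r. 0 < r \<and> cball x r \<subseteq> C"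
  proof
    fix x assume "x \<in> K"
    then have "x \<in> C" using assms(3) by (rule rev_subsetD)
    from assms(2)[unfolded open_contains_cball, rule_format, OF this]
    show "\<exists>r. 0 < r \<and> cball x r \<subseteq> C" by simp
  qed
  from bchoice[OF this] obtain r where r: "\<And>x. x \<in> K \<Longrightarrow> 0 < r x \<and> cball x (r x) \<subseteq> C" by auto
  have "K \<subseteq> (\<Union>x\<in>K. ball x (r x))"
  proof
    fix x assume "x \<in> K"
    then show "x \<in> (\<Union>x\<in>K. ball x (r x))" using r[of x] by (intro UN_I[of x]) simp_all
  qed
  then obtain F where F: "F \<subseteq> K" "finite F" "K \<subseteq> (\<Union>x\<in>F. ball x (r x))"
    using compactE_image[OF assms(1), of K "\<lambda>x. ball x (r x)"] by blast
  \<comment> \<open>The squared distance keeps each summand smooth at the centre, where the norm is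
    not differentiable.\<close>
  define B where "B z = (\<Sum>x\<in>F. flat_exp 1 ((r x)\<^sup>2 - (z - x) \<bullet> (z - x)))" for z
  have smB: "smooth B" unfolding B_def
    by (rule smooth_sum[OF F(2)], rule smooth_compose[OF _ smooth_flat_exp])
      (rule smooth_diff smooth_const smooth_inner smooth_linear bounded_linear_ident)+
  have arg: "0 < (r x)\<^sup>2 - (z - x) \<bullet> (z - x) \<longleftrightarrow> z \<in> ball x (r x)" if "x \<in> F" for x z
  proof -
    have "0 < r x" using r F that by blast
    then have "z \<in> ball x (r x) \<longleftrightarrow> (norm (z - x))\<^sup>2 < (r x)\<^sup>2"
      using power_mono_iff[of "r x" "norm (z - x)" 2]
      by (simp add: dist_norm norm_minus_commute not_le[symmetric])
    then show ?thesis by (simp add: power2_norm_eq_inner)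
  qed
  have Bpos: "0 < B z" if zK: "z \<in> K" for z
  proof -
    obtain x where x: "x \<in> F" "z \<in> ball x (r x)" using F(3) zK by blast
    then have "0 < flat_exp 1 ((r x)\<^sup>2 - (z - x) \<bullet> (z - x))" using arg flat_exp_1_pos by blast
    then show ?thesis unfolding B_def using x F flat_exp_1_pos(2)
      by (intro sum_pos2[of F x]) auto
  qed
  have B0: "B z = 0" if "z \<notin> (\<Union>x\<in>F. cball x (r x))" for z
    unfolding B_def
  proof (intro sum.neutral ballI flat_exp_1_pos(3))
    fix x assume "x \<in> F"
    then have "z \<notin> ball x (r x)" using that by auto
    then show "(r x)\<^sup>2 - (z - x) \<bullet> (z - x) \<le> 0" using arg[OF \<open>x \<in> F\<close>] by force
  qed
  \<comment> \<open>Half of the minimum of \<open>B\<close> on K. The strict inequality makes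
    \<open>{z. c < B z}\<close> an open neighbourhood of K on which the step, applied to B/c, has
    reached 1.\<close>
  obtain c where c: "c > 0" "\<And>z. z \<in> K \<Longrightarrow> c < B z"
  proof (cases "K = {}")
    case False
    obtain x where x: "x \<in> K" "\<And>y. y \<in> K \<Longrightarrow> B x \<le> B y"
      using continuous_attains_inf[OF assms(1) False smooth_continuous_on[OF smB]] by blast
    show ?thesis
    proof (rule that[of "B x / 2"])
      show "0 < B x / 2" using Bpos[OF x(1)] by simp
      fix z assume "z \<in> K"
      then show "B x / 2 < B z" using x(2)[of z] Bpos[OF x(1)] by linarith
    qed
  qed (use that[of 1] in auto)
  define \<phi> where "\<phi> z = smooth_step (inverse c * B z + 0)" for z
  have sm: "smooth \<phi>" unfolding \<phi>_def
    using smooth_compose[OF smB smooth_compose[OF smooth_linear_comp smooth_step(1)]] .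
  show ?thesis
  proof (rule that[of \<phi> "{z. c < B z}"])
    have sub: "(\<Union>x\<in>F. cball x (r x)) \<subseteq> C" "compact (\<Union>x\<in>F. cball x (r x))"
      using F(1) r by blast (intro compact_UN F(2) compact_cball)
    show "test_fun C \<phi>"
      by (rule test_funI[OF sm sub(2,1)]) (simp add: \<phi>_def B0 smooth_step)
    show "open {z. c < B z}"
      by (intro open_Collect_less smooth_continuous_on smB continuous_on_const)
    show "K \<subseteq> {z. c < B z}" using c(2) by blast
    show "0 \<le> \<phi> z" "\<phi> z \<le> 1" for z by (simp_all add: \<phi>_def smooth_step)
    fix z assume "z \<in> {z. c < B z}"
    then have "1 \<le> inverse c * B z + 0" using c(1) by (simp add: field_simps)
    then show "\<phi> z = 1" unfolding \<phi>_def by (rule smooth_step(5))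
  qed
qed

section \<open>Locally finite measures on open sets\<close>

lemma space_borel_of: "space (borel_of X) = topspace X"
  by (simp add: borel_of_def space_measure_of_conv)

lemma sets_borel_of: "sets (borel_of X) = sigma_sets (topspace X) {C. openin X C}"
  unfolding borel_of_def by (rule sets_measure_of) (auto dest: openin_subset)

lemma sets_borel_of_top_of_set:
  assumes "open W" shows "sets (borel_of (top_of_set W)) = sets (restrict_space borel W)"
proof -
  have borel: "sets (borel :: 'a measure) = sigma_sets UNIV {C. open C}"
    by (simp add: borel_def)
  have "{C. openin (top_of_set W) C} = (\<inter>) W ` {C. open C}"
    by (auto simp: openin_open)
  moreover have "sigma_sets W ((\<inter>) W ` {C. open C}) = (\<inter>) W ` sigma_sets UNIV {C. open C}"
    by (rule sigma_sets_Int[symmetric]) (use assms in auto)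
  ultimately show ?thesis
    by (simp add: sets_borel_of sets_restrict_space borel)
qed

text \<open>Open subsets of a Euclidean space are countable unions of compact sets, so finiteness on
  compact sets already forces both regularity conditions of \<open>radon_measure\<close>; this is
  lemma \<open>radon\<close>.\<close>

locale locally_finite =
  fixes W :: "'a::euclidean_space set" and M :: "'a measure"
  assumes open_W: "open W"
    and sets_M: "sets M = sets (borel_of (top_of_set W))"
    and finite_on_compact: "\<And>K. compact K \<Longrightarrow> K \<subseteq> W \<Longrightarrow> emeasure M K < \<infinity>"
begin

lemma sets_M': "sets M = sets (restrict_space borel W)"
  by (simp add: sets_M sets_borel_of_top_of_set open_W)

lemma space_M: "space M = W"
  using sets_eq_imp_space_eq[OF sets_M'] by (simp add: space_restrict_space)

lemma sets_iff: "A \<in> sets M \<longleftrightarrow> A \<in> sets borel \<and> A \<subseteq> W"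
  using open_W by (subst sets_M', subst sets_restrict_space_iff) auto

lemma measurable_M: "f \<in> measurable borel N \<Longrightarrow> f \<in> measurable M N"
  by (subst measurable_cong_sets[OF sets_M' refl]) (rule measurable_restrict_space1)

lemma open_in_sets: "open C \<Longrightarrow> C \<subseteq> W \<Longrightarrow> C \<in> sets M"
  by (simp add: sets_iff)

lemma compact_in_sets: "compact C \<Longrightarrow> C \<subseteq> W \<Longrightarrow> C \<in> sets M"
  by (simp add: sets_iff compact_imp_closed)

lemma exhaustion:
  obtains C where "\<And>n::nat. compact (C n)" "\<And>n. C n \<subseteq> W" "incseq C" "(\<Union>n. interior (C n)) = W"
    "\<And>K. compact K \<Longrightarrow> K \<subseteq> W \<Longrightarrow> \<exists>n. K \<subseteq> interior (C n)"
proof -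
  obtain C where C: "\<And>n::nat. compact (C n)" "\<And>n. C n \<subseteq> W" "\<And>n. C n \<subseteq> interior(C(Suc n))"
    "\<Union>(range C) = W" "\<And>K. \<lbrakk>compact K; K \<subseteq> W\<rbrakk> \<Longrightarrow> \<exists>N. \<forall>n\<ge>N. K \<subseteq> (C n)"
    using open_Union_compact_subsets[OF open_W] by metis
  show ?thesis
  proof (rule that[OF C(1,2)])
    show "incseq C" by (rule incseq_SucI) (use C(3) interior_subset in blast)
    show "(\<Union>n. interior (C n)) = W"
    proof
      show "(\<Union>n. interior (C n)) \<subseteq> W" using C(2) interior_subset by blast
      show "W \<subseteq> (\<Union>n. interior (C n))" using C(3,4) by blast
    qed
    fix K assume "compact K" "K \<subseteq> W"
    from C(5)[OF this] obtain N where "K \<subseteq> C N" by blast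
    then show "\<exists>n. K \<subseteq> interior (C n)" using C(3)[of N] by blast
  qed
qed

lemma sigma_finite: "sigma_finite_measure M"
proof -
  obtain C where C: "\<And>n::nat. compact (C n)" "\<And>n. C n \<subseteq> W" "incseq C" "(\<Union>n. interior (C n)) = W"
    using exhaustion by metis
  have "(\<Union>n. C n) = W" using C(2,4) interior_subset by blast
  then show ?thesis
    using C finite_on_compact compact_in_sets
    by (intro sigma_finite_measure.intro exI[of _ "range C"]) (auto simp: space_M less_top[symmetric])
qed

text \<open>Cut down to the interior of one compact set of the exhaustion, M becomes a finite Borel
  measure on the whole space and is outer regular. The errors e/2^(n+1) of the pieces add up to
  e.\<close>

lemma outer_approx:
  assumes A: "A \<in> sets M" and e: "0 < (e::real)"
  obtains C where "open C" "A \<subseteq> C" "C \<subseteq> W" "emeasure M (C - A) \<le> e"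
proof -
  obtain K where K: "\<And>n::nat. compact (K n)" "\<And>n. K n \<subseteq> W" "incseq K" "(\<Union>n. interior (K n)) = W"
    using exhaustion by metis
  let ?e = "\<lambda>n. e*((1/2)^Suc n)"
  have B: "interior (K n) \<in> sets M" for n
    using K(2)[of n] interior_subset by (intro open_in_sets) blast+
  have "\<exists>U. open U \<and> interior (K n) \<inter> A \<subseteq> U \<and> U \<subseteq> W \<and> emeasure M (U - A) < ?e n" for n
  proof -
    let ?B = "interior (K n)" and ?A = "distr (density M (indicator (interior (K n)))) borel (\<lambda>x. x)"
    have meas: "(\<lambda>x. x) \<in> measurable M borel" by (rule measurable_M) simp
    have BX: "X \<in> sets borel \<Longrightarrow> ?B \<inter> X \<in> sets M" for X
      using B[of n] by (auto simp: sets_iff)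
    have emeasure_A: "emeasure ?A X = emeasure M (?B \<inter> X)" if X: "X \<in> sets borel" for X
    proof -
      have "emeasure ?A X = emeasure (density M (indicator ?B)) (X \<inter> space M)"
        using X meas by (subst emeasure_distr) (auto simp: vimage_def Int_def)
      also have "\<dots> = (\<integral>\<^sup>+x. indicator ?B x * indicator (X \<inter> space M) x \<partial>M)"
        using X by (intro emeasure_density borel_measurable_indicator B) (auto simp: sets_iff space_M open_W)
      also have "\<dots> = (\<integral>\<^sup>+x. indicator (?B \<inter> X) x \<partial>M)"
        by (intro nn_integral_cong) (auto simp: indicator_def)
      finally show ?thesis using BX[OF X] by simp
    qed
    have "emeasure M ?B \<le> emeasure M (K n)"
      by (intro emeasure_mono interior_subset compact_in_sets K)
    then have finB: "emeasure M ?B < \<infinity>" using finite_on_compact[OF K(1,2)] le_less_trans by blast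
    have finite_A: "emeasure ?A (space ?A) \<noteq> \<infinity>" using emeasure_A[of UNIV] finB by simp
    have Ab: "A \<in> sets borel" using A sets_iff by blast
    have fin: "emeasure M (?B \<inter> A) \<noteq> \<infinity>"
      using finB emeasure_mono[of "?B \<inter> A" ?B M] B[of n] by (auto simp: less_top[symmetric] top_unique)
    have "emeasure ?A A + ?e n > (INF U\<in>{U. A \<subseteq> U \<and> open U}. emeasure ?A U)"
      using \<open>0<e\<close> fin emeasure_A[OF Ab] by (subst outer_regular[OF _ finite_A Ab, symmetric]) auto
    then obtain U where U: "A \<subseteq> U" "open U" and "emeasure ?A A + ?e n > emeasure ?A U"
      unfolding INF_less_iff by blast
    then have muU: "emeasure M (?B \<inter> A) + ?e n > emeasure M (?B \<inter> U)"
      using emeasure_A Ab by simp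
    have "emeasure M (?B \<inter> U - A) = emeasure M ((?B \<inter> U) - (?B \<inter> A))"
      by (intro arg_cong[where f="emeasure M"]) auto
    also have "\<dots> = emeasure M (?B \<inter> U) - emeasure M (?B \<inter> A)"
      using U BX[of U] BX[OF Ab] fin by (intro emeasure_Diff) auto
    also have "\<dots> < ?e n"
      using U muU fin BX[of U]
      by (subst minus_less_iff_ennreal) (auto simp: less_top ac_simps intro!: emeasure_mono)
    finally have "emeasure M (?B \<inter> U - A) < ?e n" .
    then show ?thesis
      using U K(2)[of n] interior_subset by (intro exI[of _ "?B \<inter> U"]) blast
  qed
  then obtain U where U: "\<And>n. open (U n)" "\<And>n. interior (K n) \<inter> A \<subseteq> U n" "\<And>n. U n \<subseteq> W"
    "\<And>n. emeasure M (U n - A) < ?e n"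
    by metis
  show ?thesis
  proof
    show "open (\<Union>n. U n)" using U(1) by blast
    show "A \<subseteq> (\<Union>n. U n)" using U(2) K(4) A sets_iff by blast
    show "(\<Union>n. U n) \<subseteq> W" using U(3) by blast
    have sets: "U n - A \<in> sets M" for n by (intro sets.Diff open_in_sets U A)
    have "emeasure M ((\<Union>n. U n) - A) = emeasure M (\<Union>n. U n - A)"
      by (intro arg_cong[where f="emeasure M"]) auto
    also have "\<dots> \<le> (\<Sum>n. emeasure M (U n - A))"
      using sets by (intro emeasure_subadditive_countably) auto
    also have "\<dots> \<le> (\<Sum>n. ennreal (?e n))"
      using U(4) by (intro suminf_le) (auto intro: less_imp_le)
    also have "\<dots> = ennreal (e * 1)"
      using \<open>0<e\<close> by (intro suminf_ennreal_eq sums_mult power_half_series) auto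
    finally show "emeasure M ((\<Union>n. U n) - A) \<le> ennreal e" by simp
  qed
qed

text \<open>A compact subset arises by removing from a large compact set of the exhaustion an open
  set D that covers the complement of A and overlaps A only slightly.\<close>

lemma inner_approx:
  assumes A: "A \<in> sets M" and fin: "emeasure M A < \<infinity>" and e: "0 < (e::real)"
  obtains K where "compact K" "K \<subseteq> A" "emeasure M (A - K) \<le> e"
proof -
  obtain C where C: "\<And>n::nat. compact (C n)" "\<And>n. C n \<subseteq> W" "incseq C" "(\<Union>n. interior (C n)) = W"
    using exhaustion by metis
  have CW: "(\<Union>n. C n) = W" using C(2,4) interior_subset by blast
  have WA: "W - A \<in> sets M" using A sets.compl_sets[OF A] by (simp add: space_M)
  obtain D where D: "open D" "W - A \<subseteq> D" "D \<subseteq> W" "emeasure M (D - (W - A)) \<le> ennreal (e / 2)"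
    using outer_approx[OF WA, of "e / 2"] e by auto
  have "(\<lambda>n. emeasure M (A - C n)) \<longlonglongrightarrow> emeasure M (\<Inter>n. A - C n)"
  proof (rule Lim_emeasure_decseq)
    show "range (\<lambda>n. A - C n) \<subseteq> sets M" using A(1) compact_in_sets[OF C(1,2)] by blast
    show "decseq (\<lambda>n. A - C n)" using C(3) by (auto simp: decseq_def incseq_def)
    show "emeasure M (A - C n) \<noteq> \<infinity>" for n
      using fin emeasure_mono[OF Diff_subset A, of "C n"] by (auto simp: less_top[symmetric] top_unique)
  qed
  moreover have "(\<Inter>n. A - C n) = {}" using CW A sets_iff by blast
  ultimately have "(\<lambda>n. emeasure M (A - C n)) \<longlonglongrightarrow> 0" by (metis emeasure_empty)
  then have "\<forall>\<^sub>F n in sequentially. emeasure M (A - C n) < ennreal (e / 2)"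
    using e by (intro order_tendstoD) auto
  then obtain n where n: "emeasure M (A - C n) < ennreal (e / 2)"
    by (auto simp: eventually_sequentially)
  show ?thesis
  proof
    have sets: "A \<in> sets M" "D \<in> sets M" "C n \<in> sets M"
      using A open_in_sets[OF D(1,3)] compact_in_sets[OF C(1,2)] by auto
    show "compact (C n - D)" using C(1) D(1) by (rule compact_diff)
    show "C n - D \<subseteq> A" using C(2) D(2) by blast
    have "emeasure M (A - (C n - D)) \<le> emeasure M ((D - (W - A)) \<union> (A - C n))"
      by (intro emeasure_mono sets.Un sets.Diff open_in_sets[OF open_W] sets) blast+
    also have "\<dots> \<le> emeasure M (D - (W - A)) + emeasure M (A - C n)"
      by (intro emeasure_subadditive sets.Diff sets WA)
    also have "\<dots> \<le> ennreal (e / 2) + ennreal (e / 2)"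
      using D n by (intro add_mono) auto
    also have "\<dots> = ennreal e" using e by (simp flip: ennreal_plus)
    finally show "emeasure M (A - (C n - D)) \<le> e" .
  qed
qed

lemma emeasure_eq_INF:
  assumes A: "A \<in> sets M"
  shows "emeasure M A = (INF C\<in>{C. openin (top_of_set W) C \<and> A \<subseteq> C}. emeasure M C)"
proof (rule antisym)
  show "emeasure M A \<le> (INF C\<in>{C. openin (top_of_set W) C \<and> A \<subseteq> C}. emeasure M C)"
    using open_W by (intro INF_greatest emeasure_mono) (auto simp: openin_open_eq intro: open_in_sets)
  show "(INF C\<in>{C. openin (top_of_set W) C \<and> A \<subseteq> C}. emeasure M C) \<le> emeasure M A"
  proof (rule ennreal_le_epsilon)
    fix e :: real assume "0 < e"
    then obtain C where C: "open C" "A \<subseteq> C" "C \<subseteq> W" "emeasure M (C - A) \<le> e"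
      using outer_approx[OF A] by blast
    have "(INF C\<in>{C. openin (top_of_set W) C \<and> A \<subseteq> C}. emeasure M C) \<le> emeasure M C"
      using C open_W by (intro INF_lower) (auto simp: openin_open_eq)
    also have "emeasure M C = emeasure M A + emeasure M (C - A)"
      using plus_emeasure[of A M "C - A"] open_in_sets[OF C(1,3)] A C(2) by (simp add: Un_absorb1)
    also have "\<dots> \<le> emeasure M A + e" using C(4) by (rule add_left_mono)
    finally show "(INF C\<in>{C. openin (top_of_set W) C \<and> A \<subseteq> C}. emeasure M C) \<le> emeasure M A + e" .
  qed
qed

lemma open_eq_SUP:
  assumes "openin (top_of_set W) C"
  shows "emeasure M C = (SUP K\<in>{K. compactin (top_of_set W) K \<and> K \<subseteq> C}. emeasure M K)"
proof (rule antisym)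
  have C: "open C" "C \<subseteq> W" "C \<in> sets M"
    using assms open_W by (auto simp: openin_open_eq intro: open_in_sets)
  show "(SUP K\<in>{K. compactin (top_of_set W) K \<and> K \<subseteq> C}. emeasure M K) \<le> emeasure M C"
    by (intro SUP_least emeasure_mono C) auto
  obtain K where K: "\<And>n::nat. compact (K n)" "\<And>n. K n \<subseteq> C" "\<And>n. K n \<subseteq> interior(K(Suc n))"
    "\<Union>(range K) = C"
    using open_Union_compact_subsets[OF C(1)] by metis
  have "(SUP n. emeasure M (K n)) = emeasure M (\<Union>n. K n)"
  proof (rule SUP_emeasure_incseq)
    show "range K \<subseteq> sets M" using compact_in_sets[OF K(1) subset_trans[OF K(2) C(2)]] by blast
    show "incseq K" by (rule incseq_SucI) (rule subset_trans[OF K(3) interior_subset])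
  qed
  also have "\<dots> = emeasure M C" using K(4) by simp
  finally have "emeasure M C = (SUP n. emeasure M (K n))" ..
  also have "\<dots> \<le> (SUP K\<in>{K. compactin (top_of_set W) K \<and> K \<subseteq> C}. emeasure M K)"
    using K(1,2) subset_trans[OF K(2) C(2)]
    by (intro SUP_least SUP_upper) (simp add: compactin_subtopology)
  finally show "emeasure M C \<le> (SUP K\<in>{K. compactin (top_of_set W) K \<and> K \<subseteq> C}. emeasure M K)" .
qed

lemma radon: "radon_measure (top_of_set W) M"
  unfolding radon_measure_def
  using sets_M finite_on_compact emeasure_eq_INF open_eq_SUP
  by (auto simp: compactin_subtopology)

lemma test_fun_measurable:
  fixes \<theta> :: "'a \<Rightarrow> 'b::euclidean_space"
  assumes "test_fun W \<theta>" shows "\<theta> \<in> borel_measurable M"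
  by (intro measurable_M borel_measurable_continuous_onI smooth_continuous_on test_fun_smooth[OF assms])

lemma test_fun_bounded:
  fixes \<theta> :: "'a \<Rightarrow> 'b::euclidean_space"
  assumes "test_fun V \<theta>" obtains B where "0 \<le> B" "\<And>x. norm (\<theta> x) \<le> B"
proof -
  have "compact (\<theta> ` spt \<theta>)"
    using assms by (intro compact_continuous_image smooth_continuous_on) (auto simp: test_fun_def)
  then obtain B where B: "0 < B" "\<And>x. x \<in> \<theta> ` spt \<theta> \<Longrightarrow> norm x \<le> B"
    using compact_imp_bounded bounded_pos by metis
  have "norm (\<theta> x) \<le> B" for x
    using B spt_outside[of x \<theta>] by (cases "x \<in> spt \<theta>") auto
  then show ?thesis using B that[of B] by auto
qed

lemma integrable_compact_spt:
  fixes f :: "'a \<Rightarrow> 'b::euclidean_space"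
  assumes "compact K" "K \<subseteq> W" "f \<in> borel_measurable M" "\<And>x. x \<in> W \<Longrightarrow> norm (f x) \<le> B"
    "\<And>x. x \<in> W \<Longrightarrow> x \<notin> K \<Longrightarrow> f x = 0"
  shows "integrable M f"
  by (rule integrableI_bounded_set[of K M f B])
    (use assms finite_on_compact in \<open>auto intro!: compact_in_sets AE_I2 simp: space_M\<close>)

lemma test_fun_integrable:
  fixes \<theta> :: "'a \<Rightarrow> 'b::euclidean_space"
  assumes "test_fun W \<theta>" shows "integrable M \<theta>"
proof -
  obtain B where "\<And>x. norm (\<theta> x) \<le> B" using test_fun_bounded[OF assms] by blast
  then show ?thesis
    using assms spt_outside by (intro integrable_compact_spt[of "spt \<theta>" _ B] test_fun_measurable)
      (auto simp: test_fun_def)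
qed

text \<open>A bump that is 1 on a compact K inside A and lives in an open D around A differs from
  the indicator only on D - A and A - K. Each has measure at most e/3, which leaves room for the
  strict inequality. Intersecting D with \<open>C\<close> controls the support.\<close>

lemma test_fun_approx_indicator:
  assumes A: "A \<in> sets M" "emeasure M A < \<infinity>" and C: "open C" "A \<subseteq> C" "C \<subseteq> W" and e: "0 < (e::real)"
  obtains \<phi> :: "'a \<Rightarrow> real" where "test_fun C \<phi>" "\<And>x. 0 \<le> \<phi> x" "\<And>x. \<phi> x \<le> 1"
    "(\<integral>x. \<bar>\<phi> x - indicator A x\<bar> \<partial>M) < e"
proof -
  obtain D where D: "open D" "A \<subseteq> D" "D \<subseteq> W" "emeasure M (D - A) \<le> ennreal (e / 3)"
    using outer_approx[OF A(1), of "e/3"] e by auto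
  obtain K where K: "compact K" "K \<subseteq> A" "emeasure M (A - K) \<le> ennreal (e / 3)"
    using inner_approx[OF A, of "e/3"] e by auto
  have KDC: "K \<subseteq> D \<inter> C" using K D C by blast
  obtain \<phi> :: "'a \<Rightarrow> real" and G where \<phi>: "test_fun (D \<inter> C) \<phi>" "\<And>x. 0 \<le> \<phi> x" "\<And>x. \<phi> x \<le> 1"
    "open G" "K \<subseteq> G" "\<And>x. x \<in> G \<Longrightarrow> \<phi> x = 1"
    using bump_function[OF K(1) open_Int[OF D(1) C(1)] KDC] by metis
  have sets: "A \<in> sets M" "D \<in> sets M" "K \<in> sets M"
    using A(1) open_in_sets[OF D(1,3)] compact_in_sets[OF K(1)] K(2) D(2,3) by auto
  have tW: "test_fun W \<phi>" using \<phi>(1) D C by (auto simp: test_fun_def)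
  have out: "\<phi> x = 0" if "x \<notin> D" for x
    using \<phi>(1) that spt_outside[of x \<phi>] by (auto simp: test_fun_def)
  have "(\<integral>\<^sup>+x. ennreal \<bar>\<phi> x - indicator A x\<bar> \<partial>M) \<le> (\<integral>\<^sup>+x. indicator (D - A) x + indicator (A - K) x \<partial>M)"
  proof (intro nn_integral_mono)
    fix x
    consider "x \<notin> D" | "x \<in> D - A" | "x \<in> A - K" | "x \<in> K" by blast
    then show "ennreal \<bar>\<phi> x - indicator A x\<bar> \<le> indicator (D - A) x + indicator (A - K) x"
    proof cases
      case 1 then show ?thesis using out D(2) by (auto simp: indicator_def)
    next
      case 4 then show ?thesis using \<phi>(5,6) K(2) by (auto simp: indicator_def)
    next
      case 2 then show ?thesis using \<phi>(2,3)[of x] by (auto simp: indicator_def abs_if)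
    next
      case 3 then show ?thesis using \<phi>(2,3)[of x] by (auto simp: indicator_def abs_if)
    qed
  qed
  also have "\<dots> = emeasure M (D - A) + emeasure M (A - K)"
    using sets by (subst nn_integral_add) auto
  also have "\<dots> \<le> ennreal (e/3) + ennreal (e/3)" using D K by (intro add_mono) auto
  also have "\<dots> = ennreal (e/3+e/3)" using e by (simp flip: ennreal_plus)
  finally have "(\<integral>\<^sup>+x. ennreal \<bar>\<phi> x - indicator A x\<bar> \<partial>M) \<le> ennreal (e/3+e/3)" .
  then have "enn2real (\<integral>\<^sup>+x. ennreal \<bar>\<phi> x - indicator A x\<bar> \<partial>M) \<le> e/3 + e/3"
    using e by (intro enn2real_leI) auto
  then have "(\<integral>x. \<bar>\<phi> x - indicator A x\<bar> \<partial>M) \<le> e/3 + e/3"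
    using sets(1) test_fun_measurable[OF tW] by (subst integral_eq_nn_integral) auto
  then have "(\<integral>x. \<bar>\<phi> x - indicator A x\<bar> \<partial>M) < e" using e by linarith
  then show ?thesis using that[of \<phi>] \<phi> by (auto simp: test_fun_def)
qed

lemma test_fun_dense:
  fixes f :: "'a \<Rightarrow> 'b::euclidean_space"
  assumes "integrable M f" and "0 < e"
  shows "\<exists>\<theta>. test_fun W \<theta> \<and> (\<integral>x. norm (\<theta> x - f x) \<partial>M) < e"
  using assms
proof (induction arbitrary: e)
  case (base A c)
  \<comment> \<open>The summand 1 covers the case c = 0.\<close>
  let ?e = "e / (norm c + 1)"
  have e: "0 < ?e" using base by (simp add: add_nonneg_pos)
  obtain \<phi> :: "'a \<Rightarrow> real" where \<phi>: "test_fun W \<phi>" "(\<integral>x. \<bar>\<phi> x - indicator A x\<bar> \<partial>M) < ?e"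
    using test_fun_approx_indicator[OF base(1,2) open_W _ order_refl e] base(1) sets_iff[of A]
    by metis
  have "(\<integral>x. norm (\<phi> x *\<^sub>R c - indicator A x *\<^sub>R c) \<partial>M) = (\<integral>x. \<bar>\<phi> x - indicator A x\<bar> * norm c \<partial>M)"
    by (simp flip: scaleR_left_diff_distrib)
  also have "\<dots> = (\<integral>x. \<bar>\<phi> x - indicator A x\<bar> \<partial>M) * norm c" by simp
  also have "\<dots> \<le> ?e * norm c" using \<phi>(2) by (intro mult_right_mono) auto
  also have "\<dots> < e"
    using base(3) norm_ge_zero[of c] by (simp add: divide_less_eq distrib_left add_nonneg_pos del: norm_ge_zero)
  finally show ?case using test_fun_scaleR_const[OF \<phi>(1)] by blast
next
  case (add f g)
  obtain \<theta> where \<theta>: "test_fun W \<theta>" "(\<integral>x. norm (\<theta> x - f x) \<partial>M) < e / 2" using add(3)[of "e/2"] add.prems by auto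
  obtain \<zeta> where \<zeta>: "test_fun W \<zeta>" "(\<integral>x. norm (\<zeta> x - g x) \<partial>M) < e / 2" using add(4)[of "e/2"] add.prems by auto
  note [simp] = test_fun_integrable[OF \<theta>(1)] test_fun_integrable[OF \<zeta>(1)] add(1,2)
  have "(\<integral>x. norm (\<theta> x + \<zeta> x - (f x + g x)) \<partial>M) \<le> (\<integral>x. norm (\<theta> x - f x) + norm (\<zeta> x - g x) \<partial>M)"
    by (intro integral_mono Bochner_Integration.integrable_add Bochner_Integration.integrable_diff
        integrable_norm) (simp_all add: add_diff_add norm_triangle_ineq)
  also have "\<dots> = (\<integral>x. norm (\<theta> x - f x) \<partial>M) + (\<integral>x. norm (\<zeta> x - g x) \<partial>M)"
    by (intro Bochner_Integration.integral_add Bochner_Integration.integrable_diff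
        integrable_norm) simp_all
  also have "\<dots> < e" using \<theta> \<zeta> by linarith
  finally show ?case using test_fun_add(1)[OF \<theta>(1) \<zeta>(1)] by blast
next
  case (lim f s)
  \<comment> \<open>The approximating simple functions are bounded by 2 |f|, so their distance to f
    is dominated by 3 |f|.\<close>
  have "(\<lambda>i. \<integral>x. norm (s i x - f x) \<partial>M) \<longlonglongrightarrow> (\<integral>x. 0 \<partial>M)"
  proof (rule integral_dominated_convergence[where w="\<lambda>x. 3 * norm (f x)"])
    show "AE x in M. (\<lambda>i. norm (s i x - f x)) \<longlonglongrightarrow> 0"
      using lim(2) by (intro AE_I2) (auto simp: tendsto_norm_zero_iff LIM_zero_iff)
    show "AE x in M. norm (norm (s i x - f x)) \<le> 3 * norm (f x)" for i
    proof (rule AE_I2)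
      fix x assume "x \<in> space M"
      from lim(3)[OF this, of i] norm_triangle_ineq4[of "s i x" "f x"]
      show "norm (norm (s i x - f x)) \<le> 3 * norm (f x)" by simp
    qed
  qed (use lim(1,4) in auto)
  then have "\<forall>\<^sub>F i in sequentially. (\<integral>x. norm (s i x - f x) \<partial>M) < e / 2"
    using lim.prems by (intro order_tendstoD) auto
  then obtain i where i: "(\<integral>x. norm (s i x - f x) \<partial>M) < e / 2" by (auto simp: eventually_sequentially)
  obtain \<theta> where \<theta>: "test_fun W \<theta>" "(\<integral>x. norm (\<theta> x - s i x) \<partial>M) < e / 2"
    using lim(5)[of "e/2" i] lim.prems by auto
  note [simp] = test_fun_integrable[OF \<theta>(1)] lim(1,4)
  have "(\<integral>x. norm (\<theta> x - f x) \<partial>M) \<le> (\<integral>x. norm (\<theta> x - s i x) + norm (s i x - f x) \<partial>M)"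
    using norm_triangle_ineq[of "\<theta> x - s i x" "s i x - f x" for x]
    by (intro integral_mono Bochner_Integration.integrable_add Bochner_Integration.integrable_diff
        integrable_norm) simp_all
  also have "\<dots> = (\<integral>x. norm (\<theta> x - s i x) \<partial>M) + (\<integral>x. norm (s i x - f x) \<partial>M)"
    by (intro Bochner_Integration.integral_add Bochner_Integration.integrable_diff
        integrable_norm) simp_all
  also have "\<dots> < e" using \<theta> i by linarith
  finally show ?case using \<theta>(1) by blast
qed

end

section \<open>The variation of a distribution\<close>

text \<open>The algebraic part of \<open>is_distribution\<close>. Linearity alone makes the
  variation on open sets subadditive, and the estimates used later come from finiteness of the
  variation instead of seminorm bounds.\<close>

definition dist_linear ::
  "'a::euclidean_space set \<Rightarrow> (('a \<Rightarrow> 'b::euclidean_space) \<Rightarrow> real) \<Rightarrow> bool" where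
  "dist_linear W S \<longleftrightarrow>
     (\<forall>\<theta> \<zeta>. test_fun W \<theta> \<longrightarrow> test_fun W \<zeta> \<longrightarrow> S (\<lambda>x. \<theta> x + \<zeta> x) = S \<theta> + S \<zeta>) \<and>
     (\<forall>c \<theta>. test_fun W \<theta> \<longrightarrow> S (\<lambda>x. c *\<^sub>R \<theta> x) = c * S \<theta>)"

lemma dist_linear_add:
  "dist_linear W S \<Longrightarrow> test_fun W \<theta> \<Longrightarrow> test_fun W \<zeta> \<Longrightarrow> S (\<lambda>x. \<theta> x + \<zeta> x) = S \<theta> + S \<zeta>"
  by (simp add: dist_linear_def)

lemma dist_linear_scaleR:
  "dist_linear W S \<Longrightarrow> test_fun W \<theta> \<Longrightarrow> S (\<lambda>x. c *\<^sub>R \<theta> x) = c * S \<theta>"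
  by (simp add: dist_linear_def)

lemma dist_linear_0: "dist_linear W S \<Longrightarrow> S (\<lambda>x. 0) = 0"
  using dist_linear_scaleR[of W S "\<lambda>x. 0" 0] by (simp add: test_fun_0)

lemma dist_linear_diff:
  assumes "dist_linear W S" "test_fun W \<theta>" "test_fun W \<zeta>"
  shows "S (\<lambda>x. \<theta> x - \<zeta> x) = S \<theta> - S \<zeta>"
  using dist_linear_add[OF assms(1,2), of "\<lambda>x. (-1) *\<^sub>R \<zeta> x"]
    dist_linear_scaleR[OF assms(1,3), of "-1"] test_fun_scaleR(1)[OF smooth_const assms(3), of "-1"]
  by simp

lemma dist_linear_sum:
  assumes "dist_linear W S" "finite I" "\<And>i. i \<in> I \<Longrightarrow> test_fun W (f i)"
  shows "S (\<lambda>x. \<Sum>i\<in>I. f i x) = (\<Sum>i\<in>I. S (f i))"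
  using assms(2,3)
proof (induction I rule: finite_induct)
  case empty
  then show ?case using dist_linear_0[OF assms(1)] by simp
next
  case (insert i I)
  have "test_fun W (\<lambda>x. \<Sum>i\<in>I. f i x)" by (intro test_fun_sum insert) simp
  with insert dist_linear_add[OF assms(1), of "f i" "\<lambda>x. \<Sum>i\<in>I. f i x"] show ?case by simp
qed

definition open_variation ::
  "'a::euclidean_space set \<Rightarrow> (('a \<Rightarrow> 'b::euclidean_space) \<Rightarrow> real) \<Rightarrow> 'a set \<Rightarrow> ennreal" where
  "open_variation W S C =
    (SUP \<theta>\<in>{\<theta>. test_fun W \<theta> \<and> spt \<theta> \<subseteq> C \<and> (\<forall>x. norm (\<theta> x) \<le> 1)}. ennreal (S \<theta>))"

lemma open_variation_upper:
  "test_fun W \<theta> \<Longrightarrow> spt \<theta> \<subseteq> C \<Longrightarrow> (\<And>x. norm (\<theta> x) \<le> 1) \<Longrightarrow> ennreal (S \<theta>) \<le> open_variation W S C"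
  unfolding open_variation_def by (rule SUP_upper) simp

lemma open_variation_least:
  "(\<And>\<theta>. test_fun W \<theta> \<Longrightarrow> spt \<theta> \<subseteq> C \<Longrightarrow> (\<And>x. norm (\<theta> x) \<le> 1) \<Longrightarrow> ennreal (S \<theta>) \<le> u) \<Longrightarrow>
    open_variation W S C \<le> u"
  unfolding open_variation_def by (rule SUP_least) simp

lemma open_variation_mono: "C \<subseteq> D \<Longrightarrow> open_variation W S C \<le> open_variation W S D"
  by (rule open_variation_least, rule open_variation_upper) auto

text \<open>An outer regular candidate dominates every competitor: a Borel set has competitor
  measure at most that of any open set around it, where both measures agree. So it is the greatest
  one.\<close>

lemma variation_eqI:
  assumes W: "open W" and sets: "sets \<mu> = sets (borel_of (top_of_set W))"
    and C: "\<And>C. open C \<Longrightarrow> C \<subseteq> W \<Longrightarrow> emeasure \<mu> C = open_variation W S C"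
    and outer: "\<And>A. A \<in> sets \<mu> \<Longrightarrow>
      emeasure \<mu> A = (INF C\<in>{C. openin (top_of_set W) C \<and> A \<subseteq> C}. emeasure \<mu> C)"
  shows "variation W S = \<mu>"
  unfolding variation_def open_variation_def[symmetric]
proof (rule Greatest_equality)
  show "sets \<mu> = sets (borel_of (top_of_set W)) \<and>
    (\<forall>C. open C \<longrightarrow> C \<subseteq> W \<longrightarrow> emeasure \<mu> C = open_variation W S C)"
    using sets C by blast
  fix \<nu> assume \<nu>: "sets \<nu> = sets (borel_of (top_of_set W)) \<and>
    (\<forall>C. open C \<longrightarrow> C \<subseteq> W \<longrightarrow> emeasure \<nu> C = open_variation W S C)"
  then have sets_\<nu>: "sets \<nu> = sets \<mu>" using sets by simp
  have "emeasure \<nu> A \<le> emeasure \<mu> A" if "A \<in> sets \<mu>" for A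
    unfolding outer[OF that]
  proof (rule INF_greatest)
    fix D assume "D \<in> {C. openin (top_of_set W) C \<and> A \<subseteq> C}"
    then have D: "open D" "D \<subseteq> W" "A \<subseteq> D" using W by (auto simp: openin_open_eq)
    have "D \<in> sets \<nu>" using D W \<nu> by (simp add: sets_borel_of_top_of_set sets_restrict_space_iff)
    then have "emeasure \<nu> A \<le> emeasure \<nu> D" using D(3) by (intro emeasure_mono)
    also have "\<dots> = emeasure \<mu> D" using C \<nu> D by simp
    finally show "emeasure \<nu> A \<le> emeasure \<mu> D" .
  qed
  then show "\<nu> \<le> \<mu>"
    using sets_\<nu> sets_eq_imp_space_eq[OF sets_\<nu>]
    by (auto simp: le_measure_iff le_fun_def emeasure_notin_sets)
      (metis emeasure_notin_sets order_refl)
qed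

lemma ennreal_add_le: "ennreal (a + b) \<le> ennreal a + ennreal b"
proof (cases "0 \<le> a \<and> 0 \<le> b")
  case False
  then have "ennreal (a + b) \<le> ennreal a \<or> ennreal (a + b) \<le> ennreal b"
    by (metis add_le_cancel_left add_le_cancel_right add.right_neutral add_0 ennreal_leI linear)
  then show ?thesis by (meson add_increasing add_increasing2 order_trans zero_le order_refl)
qed simp

text \<open>A cut-off \<phi> supported in C splits \<theta> into \<phi> \<theta> and (1 - \<phi>)
  \<theta>. Since \<phi> is 1 on a whole neighbourhood G of spt \<theta> - D, the support of the
  second part, and not only its nonzero set, stays inside D.\<close>

lemma open_variation_Un:
  fixes S :: "('a::euclidean_space \<Rightarrow> 'b::euclidean_space) \<Rightarrow> real"
  assumes S: "dist_linear W S" and "open C" "open D"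
  shows "open_variation W S (C \<union> D) \<le> open_variation W S C + open_variation W S D"
proof (rule open_variation_least)
  fix \<theta> :: "'a \<Rightarrow> 'b"
  assume \<theta>: "test_fun W \<theta>" "spt \<theta> \<subseteq> C \<union> D" "\<And>x. norm (\<theta> x) \<le> 1"
  have K: "compact (spt \<theta> - D)" "spt \<theta> - D \<subseteq> C"
    using \<theta> assms(3) by (auto simp: test_fun_def intro: compact_diff)
  obtain \<phi> :: "'a \<Rightarrow> real" and G where \<phi>: "test_fun C \<phi>" "\<And>x. 0 \<le> \<phi> x" "\<And>x. \<phi> x \<le> 1"
    "open G" "spt \<theta> - D \<subseteq> G" "\<And>x. x \<in> G \<Longrightarrow> \<phi> x = 1"
    using bump_function[OF K(1) assms(2) K(2)] by metis
  have sm: "smooth \<phi>" "smooth (\<lambda>x. 1 - \<phi> x)"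
    using test_fun_smooth[OF \<phi>(1)] by (auto intro: smooth_diff)
  let ?a = "\<lambda>x. \<phi> x *\<^sub>R \<theta> x" and ?b = "\<lambda>x. (1 - \<phi> x) *\<^sub>R \<theta> x"
  have ab: "test_fun W ?a" "test_fun W ?b" by (intro test_fun_scaleR sm \<theta>)+
  have "spt ?a \<subseteq> spt \<phi>" by (rule spt_mono) simp
  then have a: "spt ?a \<subseteq> C" using \<phi>(1) by (auto simp: test_fun_def)
  have "spt ?b \<subseteq> spt \<theta> \<inter> - G"
  proof (rule spt_subsetI)
    show "closed (spt \<theta> \<inter> - G)" using \<phi>(4) by (intro closed_Int closed_spt) (simp add: closed_def)
    fix x assume x: "?b x \<noteq> 0"
    then have "\<theta> x \<noteq> 0" "\<phi> x \<noteq> 1" by auto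
    then show "x \<in> spt \<theta> \<inter> - G" using \<phi>(6) spt_outside[of x \<theta>] by blast
  qed
  then have b: "spt ?b \<subseteq> D" using \<phi>(5) by blast
  have norms: "norm (?a x) \<le> 1" "norm (?b x) \<le> 1" for x
    using \<phi>(2,3)[of x] \<theta>(3)[of x] by (auto intro!: mult_le_one)
  have "\<theta> = (\<lambda>x. ?a x + ?b x)" by (simp flip: scaleR_left_distrib)
  then have "S \<theta> = S ?a + S ?b" using dist_linear_add[OF S ab] by simp
  then have "ennreal (S \<theta>) \<le> ennreal (S ?a) + ennreal (S ?b)" using ennreal_add_le by simp
  also have "\<dots> \<le> open_variation W S C + open_variation W S D"
    by (intro add_mono open_variation_upper ab a b norms)
  finally show "ennreal (S \<theta>) \<le> open_variation W S C + open_variation W S D" .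
qed

lemma open_variation_empty:
  fixes S :: "('a::euclidean_space \<Rightarrow> 'b::euclidean_space) \<Rightarrow> real"
  shows "dist_linear W S \<Longrightarrow> open_variation W S {} = 0"
proof -
  assume S: "dist_linear W S"
  have "open_variation W S {} \<le> 0"
  proof (rule open_variation_least)
    fix \<theta> :: "'a \<Rightarrow> 'b" assume "spt \<theta> \<subseteq> {}"
    then have "\<theta> = (\<lambda>x. 0)" using spt_outside[of _ \<theta>] by blast
    then show "ennreal (S \<theta>) \<le> 0" using dist_linear_0[OF S] by simp
  qed
  then show ?thesis by simp
qed

text \<open>The compact support of each competing test function meets the union in finitely many of
  its members, which reduces the claim to finite unions.\<close>

lemma open_variation_UN:
  fixes S :: "('a::euclidean_space \<Rightarrow> 'b::euclidean_space) \<Rightarrow> real"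
  assumes S: "dist_linear W S" and C: "\<And>i::nat. open (C i)"
  shows "open_variation W S (\<Union>i. C i) \<le> (\<Sum>i. open_variation W S (C i))"
proof (rule open_variation_least)
  fix \<theta> :: "'a \<Rightarrow> 'b"
  assume \<theta>: "test_fun W \<theta>" "spt \<theta> \<subseteq> (\<Union>i. C i)" "\<And>x. norm (\<theta> x) \<le> 1"
  have fin: "open_variation W S (\<Union>i\<in>I. C i) \<le> (\<Sum>i\<in>I. open_variation W S (C i))" if "finite I" for I
    using that
  proof induction
    case (insert i I)
    have "open_variation W S (\<Union>i\<in>insert i I. C i) \<le> open_variation W S (C i) + open_variation W S (\<Union>i\<in>I. C i)"
      using open_variation_Un[OF S C, of "\<Union>i\<in>I. C i" i] C by auto
    also have "\<dots> \<le> open_variation W S (C i) + (\<Sum>i\<in>I. open_variation W S (C i))"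
      using insert by (intro add_left_mono)
    finally show ?case using insert by simp
  qed (simp add: open_variation_empty S)
  have "compact (spt \<theta>)" using \<theta> by (simp add: test_fun_def)
  then obtain I where I: "finite I" "spt \<theta> \<subseteq> (\<Union>i\<in>I. C i)"
    using compactE_image[of "spt \<theta>" UNIV C] \<theta>(2) C by metis
  have "ennreal (S \<theta>) \<le> open_variation W S (\<Union>i\<in>I. C i)"
    by (rule open_variation_upper[OF \<theta>(1) I(2) \<theta>(3)])
  also have "\<dots> \<le> (\<Sum>i\<in>I. open_variation W S (C i))" by (rule fin[OF I(1)])
  also have "\<dots> \<le> (\<Sum>i. open_variation W S (C i))"
    by (rule sum_le_suminf) (use I in auto)
  finally show "ennreal (S \<theta>) \<le> (\<Sum>i. open_variation W S (C i))" .
qed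

text \<open>The De Giorgi-Letta construction: the outer measure induced by the variation on open sets.\<close>

context
  fixes W :: "'a::euclidean_space set" and S :: "('a \<Rightarrow> 'b::euclidean_space) \<Rightarrow> real"
  assumes W: "open W" and S: "dist_linear W S"
begin

definition outer_var :: "'a set \<Rightarrow> ennreal" where
  "outer_var A = (INF C\<in>{C. open C \<and> C \<subseteq> W \<and> A \<subseteq> C}. open_variation W S C)"

lemma outer_var_open: "open C \<Longrightarrow> C \<subseteq> W \<Longrightarrow> outer_var C = open_variation W S C"
  unfolding outer_var_def
  by (intro antisym INF_lower INF_greatest) (auto intro: open_variation_mono)

lemma outer_var_le: "open C \<Longrightarrow> C \<subseteq> W \<Longrightarrow> A \<subseteq> C \<Longrightarrow> outer_var A \<le> open_variation W S C"
  unfolding outer_var_def by (rule INF_lower) simp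

lemma outer_var_mono: "A \<subseteq> B \<Longrightarrow> outer_var A \<le> outer_var B"
  unfolding outer_var_def by (rule INF_superset_mono) auto

lemma outer_var_close:
  assumes "A \<subseteq> W" "outer_var A < top" "0 < (e::real)"
  obtains C where "open C" "C \<subseteq> W" "A \<subseteq> C" "open_variation W S C \<le> outer_var A + e"
proof -
  have "outer_var A < outer_var A + e" using assms by (simp add: less_top)
  then obtain C where "open C" "C \<subseteq> W" "A \<subseteq> C" "open_variation W S C < outer_var A + e"
    unfolding outer_var_def[of A] INF_less_iff by auto
  then show ?thesis using that less_imp_le by blast
qed

lemma outer_var_UN:
  assumes A: "\<And>i::nat. A i \<subseteq> W"
  shows "outer_var (\<Union>i. A i) \<le> (\<Sum>i. outer_var (A i))"
proof (rule ennreal_le_epsilon)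
  fix e :: real assume e: "0 < e" and fin: "(\<Sum>i. outer_var (A i)) < top"
  let ?e = "\<lambda>n. e*((1/2)^Suc n)"
  have "\<exists>C. open C \<and> C \<subseteq> W \<and> A i \<subseteq> C \<and> open_variation W S C \<le> outer_var (A i) + ?e i" for i
  proof -
    have "outer_var (A i) < top" using fin by (rule ennreal_suminf_lessD)
    moreover have "0 < ?e i" using e by simp
    ultimately show ?thesis by (rule outer_var_close[OF A]) blast
  qed
  then obtain C where C: "\<And>i. open (C i)" "\<And>i. C i \<subseteq> W" "\<And>i. A i \<subseteq> C i"
    "\<And>i. open_variation W S (C i) \<le> outer_var (A i) + ?e i" by metis
  have "outer_var (\<Union>i. A i) \<le> open_variation W S (\<Union>i. C i)"
  proof (rule outer_var_le)
    show "open (\<Union>i. C i)" using C(1) by (rule open_UN[OF ballI])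
    show "(\<Union>i. C i) \<subseteq> W" using C(2) by (rule UN_least)
    show "(\<Union>i. A i) \<subseteq> (\<Union>i. C i)" using C(3) by (intro UN_mono) auto
  qed
  also have "\<dots> \<le> (\<Sum>i. open_variation W S (C i))" by (rule open_variation_UN[OF S C(1)])
  also have "\<dots> \<le> (\<Sum>i. outer_var (A i) + ?e i)" by (intro suminf_le C(4)) auto
  also have "\<dots> = (\<Sum>i. outer_var (A i)) + (\<Sum>i. ennreal (?e i))"
    by (rule suminf_add[symmetric]) auto
  also have "(\<Sum>i. ennreal (?e i)) = ennreal (e * 1)"
    using \<open>0<e\<close> by (intro suminf_ennreal_eq sums_mult power_half_series) auto
  finally show "outer_var (\<Union>i. A i) \<le> (\<Sum>i. outer_var (A i)) + e" by simp
qed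

lemma outer_var_empty: "outer_var {} = 0"
  using outer_var_open[of "{}"] open_variation_empty[OF S] by simp

lemma outer_var_Un:
  assumes "A \<subseteq> W" "B \<subseteq> W" shows "outer_var (A \<union> B) \<le> outer_var A + outer_var B"
proof -
  let ?C = "\<lambda>i::nat. if i = 0 then A else if i = 1 then B else {}"
  have eq: "(\<Union>i. ?C i) = A \<union> B"
    by (auto split: if_splits)
  have "outer_var (A \<union> B) \<le> (\<Sum>i. outer_var (?C i))"
    using outer_var_UN[of ?C] assms eq by auto
  also have "\<dots> = (\<Sum>i\<in>{0,1}. outer_var (?C i))"
    by (rule suminf_finite) (auto simp: outer_var_empty)
  finally show ?thesis by simp
qed

text \<open>Caratheodory's criterion for open G. If \<theta> lives in C \<inter> G, then C - spt
  \<theta> is an open set containing A - G; a test function \<zeta> living there has support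
  disjoint from that of \<theta>, so \<theta> + \<zeta> still has norm at most 1 and competes on C.
  Suprema over \<zeta> and then over \<theta> give the claim.\<close>

lemma outer_var_split:
  assumes G: "open G" "G \<subseteq> W" and A: "A \<subseteq> W"
  shows "outer_var (A \<inter> G) + outer_var (A - G) \<le> outer_var A"
  unfolding outer_var_def[of A]
proof (rule INF_greatest)
  fix C assume "C \<in> {C. open C \<and> C \<subseteq> W \<and> A \<subseteq> C}"
  then have C: "open C" "C \<subseteq> W" "A \<subseteq> C" by auto
  let ?I = "\<lambda>C. {\<theta>::'a \<Rightarrow> 'b. test_fun W \<theta> \<and> spt \<theta> \<subseteq> C \<and> (\<forall>x. norm (\<theta> x) \<le> 1)}"
  have ne: "?I D \<noteq> {}" for D
  proof -
    have "spt (\<lambda>x::'a. 0::'b) \<subseteq> D" by (simp add: spt_def)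
    then have "(\<lambda>x. 0) \<in> ?I D" by (simp add: test_fun_0)
    then show ?thesis by blast
  qed
  have pair: "ennreal (S \<theta>) + ennreal (S \<zeta>) \<le> open_variation W S C"
    if \<theta>: "\<theta> \<in> ?I (C \<inter> G)" and \<zeta>: "\<zeta> \<in> ?I (C - spt \<theta>)" for \<theta> \<zeta>
  proof -
    have \<theta>\<zeta>: "test_fun W \<theta>" "test_fun W \<zeta>" "spt \<theta> \<subseteq> C" "spt \<zeta> \<subseteq> C"
      "\<And>x. norm (\<theta> x) \<le> 1" "\<And>x. norm (\<zeta> x) \<le> 1" using \<theta> \<zeta> by auto
    have "norm (\<theta> x + \<zeta> x) \<le> 1" for x
    proof (cases "x \<in> spt \<theta>")
      case True
      then have "\<zeta> x = 0" using \<zeta> by (intro spt_outside) auto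
      then show ?thesis using \<theta>\<zeta>(5) by simp
    qed (use spt_outside[of x \<theta>] \<theta>\<zeta>(6) in simp)
    then have "ennreal (S \<theta> + S \<zeta>) \<le> open_variation W S C"
      using open_variation_upper[of W "\<lambda>x. \<theta> x + \<zeta> x" C S] test_fun_add[OF \<theta>\<zeta>(1,2)] \<theta>\<zeta>(3,4)
        dist_linear_add[OF S \<theta>\<zeta>(1,2)] by auto
    moreover have "ennreal (S \<theta>) \<le> open_variation W S C" "ennreal (S \<zeta>) \<le> open_variation W S C"
      by (intro open_variation_upper \<theta>\<zeta>)+
    \<comment> \<open>Negative values are truncated to 0 by \<open>ennreal\<close>; according to the
      signs, the sum is the value at \<theta> + \<zeta>, at \<theta> or at \<zeta>.\<close>
    moreover have "ennreal (S \<theta>) + ennreal (S \<zeta>) \<in> {ennreal (S \<theta> + S \<zeta>), ennreal (S \<theta>), ennreal (S \<zeta>)}"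
      by (cases "0 \<le> S \<theta>"; cases "0 \<le> S \<zeta>") (auto simp: ennreal_neg)
    ultimately show ?thesis by auto
  qed
  have one: "ennreal (S \<theta>) + outer_var (A - G) \<le> open_variation W S C" if \<theta>: "\<theta> \<in> ?I (C \<inter> G)" for \<theta>
  proof -
    have "outer_var (A - G) \<le> open_variation W S (C - spt \<theta>)"
      using C \<theta> by (intro outer_var_le open_Diff) auto
    then have "ennreal (S \<theta>) + outer_var (A - G) \<le> ennreal (S \<theta>) + open_variation W S (C - spt \<theta>)"
      by (rule add_left_mono)
    also have "\<dots> = (SUP \<zeta>\<in>?I (C - spt \<theta>). ennreal (S \<theta>) + ennreal (S \<zeta>))"
      unfolding open_variation_def by (rule ennreal_SUP_add_right[OF ne])
    also have "\<dots> \<le> open_variation W S C" by (rule SUP_least) (rule pair[OF \<theta>])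
    finally show ?thesis .
  qed
  have "outer_var (A \<inter> G) \<le> open_variation W S (C \<inter> G)"
    using C G by (intro outer_var_le) auto
  then have "outer_var (A \<inter> G) + outer_var (A - G) \<le> open_variation W S (C \<inter> G) + outer_var (A - G)"
    by (rule add_right_mono)
  also have "\<dots> = (SUP \<theta>\<in>?I (C \<inter> G). ennreal (S \<theta>) + outer_var (A - G))"
    unfolding open_variation_def by (rule ennreal_SUP_add_left[OF ne, symmetric])
  also have "\<dots> \<le> open_variation W S C" by (rule SUP_least) (rule one)
  finally show "outer_var (A \<inter> G) + outer_var (A - G) \<le> open_variation W S C" .
qed

text \<open>Shows that the greatest measure required by \<open>variation\<close> exists, for any
  linear functional and without any finiteness of the variation.\<close>

lemma variation_spec:
  "sets (variation W S) = sets (borel_of (top_of_set W)) \<and>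
   (\<forall>C. open C \<longrightarrow> C \<subseteq> W \<longrightarrow> emeasure (variation W S) C = open_variation W S C)"
proof -
  interpret P: sigma_algebra W "Pow W" by (rule sigma_algebra_Pow)
  let ?L = "lambda_system W (Pow W) outer_var"
  have "outer_measure_space (Pow W) outer_var"
    unfolding outer_measure_space_def positive_def increasing_def countably_subadditive_def
    by (auto simp: outer_var_empty intro: outer_var_mono outer_var_UN)
  then have ms: "measure_space W ?L outer_var" by (rule P.caratheodory_lemma)
  then have sa: "sigma_algebra W ?L" by (simp add: measure_space_def)
  have "C \<in> ?L" if "openin (top_of_set W) C" for C
  proof -
    have C: "open C" "C \<subseteq> W" using that W by (auto simp: openin_open_eq)
    have "outer_var (x \<inter> C) + outer_var (x - C) = outer_var x" if "x \<subseteq> W" for x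
    proof (rule antisym)
      show "outer_var (x \<inter> C) + outer_var (x - C) \<le> outer_var x"
        by (rule outer_var_split[OF C that])
      have "outer_var ((x \<inter> C) \<union> (x - C)) \<le> outer_var (x \<inter> C) + outer_var (x - C)"
        using that by (intro outer_var_Un) auto
      moreover have "(x \<inter> C) \<union> (x - C) = x" by auto
      ultimately show "outer_var x \<le> outer_var (x \<inter> C) + outer_var (x - C)" by simp
    qed
    then show ?thesis using C by (simp add: P.lambda_system_eq)
  qed
  then have sub: "sets (borel_of (top_of_set W)) \<subseteq> ?L"
    using sigma_algebra.sigma_sets_subset[OF sa, of "{C. openin (top_of_set W) C}"]
    by (auto simp: sets_borel_of)
  define \<mu> where "\<mu> = measure_of W (sets (borel_of (top_of_set W))) outer_var"
  have saB: "sigma_algebra W (sets (borel_of (top_of_set W)))"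
    using sets.sigma_algebra_axioms[of "borel_of (top_of_set W)"] by (simp add: space_borel_of)
  have ms': "measure_space W (sets (borel_of (top_of_set W))) outer_var"
    by (rule measure_down[OF ms saB sub])
  have sets_\<mu>: "sets \<mu> = sets (borel_of (top_of_set W))"
    unfolding \<mu>_def by (simp add: sigma_algebra.sets_measure_of_eq[OF saB])
  have em: "emeasure \<mu> A = outer_var A" if "A \<in> sets \<mu>" for A
    unfolding \<mu>_def using ms' that sets_\<mu>
    by (intro emeasure_measure_of_sigma) (auto simp: measure_space_def)
  have open_sets: "C \<in> sets \<mu>" if "open C" "C \<subseteq> W" for C
    unfolding sets_\<mu> using that W by (simp add: sets_borel_of_top_of_set sets_restrict_space_iff)
  have em_open: "emeasure \<mu> C = open_variation W S C" if "open C" "C \<subseteq> W" for C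
    using em[OF open_sets[OF that]] outer_var_open[OF that] by simp
  have "variation W S = \<mu>"
  proof (rule variation_eqI[OF W sets_\<mu> em_open])
    fix A assume A: "A \<in> sets \<mu>"
    have "emeasure \<mu> A = (INF C\<in>{C. open C \<and> C \<subseteq> W \<and> A \<subseteq> C}. open_variation W S C)"
      using em[OF A] by (simp add: outer_var_def)
    also have "\<dots> = (INF C\<in>{C. openin (top_of_set W) C \<and> A \<subseteq> C}. emeasure \<mu> C)"
      using W by (intro INF_cong) (auto simp: openin_open_eq em_open)
    finally show "emeasure \<mu> A = (INF C\<in>{C. openin (top_of_set W) C \<and> A \<subseteq> C}. emeasure \<mu> C)" .
  qed
  then show ?thesis using sets_\<mu> em_open by simp
qed

lemma locally_finite_variation:
  assumes "radon_measure (top_of_set W) (variation W S)"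
  shows "locally_finite W (variation W S)"
  using assms W by unfold_locales (auto simp: radon_measure_def compactin_subtopology)

end

lemma (in locally_finite) variation_eqI:
  assumes "\<And>C. open C \<Longrightarrow> C \<subseteq> W \<Longrightarrow> emeasure M C = open_variation W S C"
  shows "variation W S = M"
  by (rule variation_eqI[OF open_W sets_M assms emeasure_eq_INF])

section \<open>Distributions represented by a density\<close>

lemma spt_subset_outside: "spt f \<subseteq> C \<Longrightarrow> x \<notin> C \<Longrightarrow> f x = 0"
  using spt_outside[of x f] by blast

text \<open>Density of test functions, applied to the restricted measure, yields approximations that
  are supported in the smaller open set D.\<close>

lemma (in locally_finite) locally_finite_restrict:
  assumes "open D" "D \<subseteq> W" shows "locally_finite D (restrict_space M D)"
proof
  have D: "D \<inter> space M \<in> sets M" using open_in_sets[OF assms] by simp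
  show "sets (restrict_space M D) = sets (borel_of (top_of_set D))"
    using assms sets_restrict_restrict_space[of borel W D] sets_restrict_space_cong[OF sets_M', of D]
    by (simp add: sets_borel_of_top_of_set Int_absorb1)
  fix K assume "compact K" "K \<subseteq> D"
  then show "emeasure (restrict_space M D) K < \<infinity>"
    using D assms finite_on_compact[of K] by (subst emeasure_restrict_space) auto
qed fact

lemma (in locally_finite) relatively_compact_nbhd:
  assumes "compact K" "K \<subseteq> C" "open C" "C \<subseteq> W"
  obtains D where "open D" "K \<subseteq> D" "D \<subseteq> C" "emeasure M D < \<infinity>"
proof -
  obtain D where D: "open D" "K \<subseteq> D" "compact (closure D)" "closure D \<subseteq> C"
  proof -
    obtain \<phi> :: "'a \<Rightarrow> real" and G where \<phi>: "test_fun C \<phi>" "open G" "K \<subseteq> G" "\<And>x. x \<in> G \<Longrightarrow> \<phi> x = 1"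
      using bump_function[OF assms(1,3,2)] by metis
    have "G \<subseteq> spt \<phi>" using \<phi>(4) spt_outside[of _ \<phi>] by force
    then have "closure G \<subseteq> spt \<phi>" by (simp add: closure_minimal)
    moreover from this have "compact (closure G)"
      using \<phi>(1) compact_Int_closed[of "spt \<phi>" "closure G"] by (simp add: test_fun_def Int_absorb1)
    ultimately show ?thesis using that[of G] \<phi> by (auto simp: test_fun_def)
  qed
  have "emeasure M D \<le> emeasure M (closure D)"
    using D assms by (intro emeasure_mono closure_subset compact_in_sets) auto
  also have "\<dots> < \<infinity>" using D assms by (intro finite_on_compact) auto
  finally show ?thesis using that[OF D(1,2)] D(4) closure_subset by blast
qed

text \<open>The cut-off \<open>v \<mapsto> h (|v|\<^sup>2) v\<close> fixes unit vectors and has norm at most \<open>1\<close>, since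
  \<open>r (3 - r\<^sup>2) / 2 \<le> 1\<close> for \<open>r \<ge> 0\<close> with equality at \<open>r = 1\<close>.\<close>

definition unit_cutoff :: "'b::euclidean_space \<Rightarrow> 'b" where
  "unit_cutoff v = ((3 - v \<bullet> v) / 2 * smooth_step (3 - v \<bullet> v)) *\<^sub>R v"

lemma unit_cutoff_unit: "norm v = 1 \<Longrightarrow> unit_cutoff v = v"
  by (simp add: unit_cutoff_def dot_square_norm smooth_step)

lemma unit_cutoff_0 [simp]: "unit_cutoff 0 = 0"
  by (simp add: unit_cutoff_def)

lemma norm_unit_cutoff_le: "norm (unit_cutoff v) \<le> 1"
proof (cases "3 \<le> (norm v)\<^sup>2")
  case True
  then show ?thesis by (simp add: unit_cutoff_def smooth_step dot_square_norm)
next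
  case False
  let ?r = "norm v"
  have "(?r - 1)\<^sup>2 * (?r + 2) \<ge> 0" by simp
  then have r: "(3 - ?r\<^sup>2) / 2 * ?r \<le> 1" by (simp add: power2_eq_square algebra_simps)
  have "norm (unit_cutoff v) = (3 - ?r\<^sup>2) / 2 * ?r * smooth_step (3 - ?r\<^sup>2)"
    using False smooth_step(2)[of "3 - ?r\<^sup>2"]
    by (simp add: unit_cutoff_def dot_square_norm abs_mult)
  also have "\<dots> \<le> (3 - ?r\<^sup>2) / 2 * ?r * 1"
    using False smooth_step(3) by (intro mult_left_mono) auto
  finally show ?thesis using r by simp
qed

lemma smooth_unit_cutoff:
  assumes "smooth \<theta>" shows "smooth (\<lambda>x. unit_cutoff (\<theta> x))"
proof -
  have q: "smooth (\<lambda>x. 3 - \<theta> x \<bullet> \<theta> x)"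
    by (rule smooth_diff[OF smooth_const smooth_inner[OF assms assms]])
  have h: "smooth (\<lambda>x. (3 - \<theta> x \<bullet> \<theta> x) * inverse 2)" by (rule smooth_mult[OF q smooth_const])
  have s: "smooth (\<lambda>x. smooth_step (3 - \<theta> x \<bullet> \<theta> x))" by (rule smooth_compose[OF q smooth_step(1)])
  show ?thesis
    unfolding unit_cutoff_def divide_inverse by (rule smooth_scaleR[OF smooth_mult[OF h s] assms])
qed

lemma test_fun_unit_cutoff:
  assumes "test_fun W \<theta>"
  shows "test_fun W (\<lambda>x. unit_cutoff (\<theta> x))" "spt (\<lambda>x. unit_cutoff (\<theta> x)) \<subseteq> spt \<theta>"
  using assms test_funI[of "\<lambda>x. unit_cutoff (\<theta> x)" "spt \<theta>" W]
  by (auto simp: test_fun_def spt_outside smooth_unit_cutoff)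

lemma continuous_unit_cutoff: "continuous_on UNIV unit_cutoff"
  using smooth_continuous_on[OF smooth_unit_cutoff[OF smooth_linear[OF bounded_linear_ident]]] .

lemma unit_cutoff_tendsto: "(f \<longlongrightarrow> v) F \<Longrightarrow> ((\<lambda>x. unit_cutoff (f x)) \<longlongrightarrow> unit_cutoff v) F"
  by (rule continuous_on_tendsto_compose[OF continuous_unit_cutoff]) auto

context locally_finite
begin

lemma bounded_mult_integrable:
  fixes f n :: "'a \<Rightarrow> 'b::euclidean_space"
  assumes "integrable M f" "n \<in> borel_measurable M" "\<And>x. norm (n x) \<le> B"
  shows "integrable M (\<lambda>x. f x \<bullet> n x)"
proof (rule Bochner_Integration.integrable_bound[of M "\<lambda>x. B *\<^sub>R norm (f x)"])
  show "integrable M (\<lambda>x. B *\<^sub>R norm (f x))" using assms(1) by auto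
  show "(\<lambda>x. f x \<bullet> n x) \<in> borel_measurable M"
    using assms borel_measurable_integrable by (intro borel_measurable_inner) auto
  have "norm (f x \<bullet> n x) \<le> norm (f x) * norm (n x)" for x by (simp add: Cauchy_Schwarz_ineq2)
  also have "norm (f x) * norm (n x) \<le> norm (B *\<^sub>R norm (f x))" for x
    using mult_left_mono[OF assms(3)[of x] norm_ge_zero[of "f x"]] order_trans[OF norm_ge_zero assms(3)[of x]]
    by (simp add: abs_mult mult.commute)
  finally show "AE x in M. norm (f x \<bullet> n x) \<le> norm (B *\<^sub>R norm (f x))" by simp
qed

lemma unit_density_open_variation_le:
  fixes n :: "'a \<Rightarrow> 'b::euclidean_space"
  assumes n: "n \<in> borel_measurable M" "\<And>x. norm (n x) \<le> 1"
    and S: "\<And>\<theta>. test_fun W \<theta> \<Longrightarrow> S \<theta> = (\<integral>x. \<theta> x \<bullet> n x \<partial>M)"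
    and C: "open C" "C \<subseteq> W"
  shows "open_variation W S C \<le> emeasure M C"
proof (rule open_variation_least)
  fix \<theta> :: "'a \<Rightarrow> 'b" assume \<theta>: "test_fun W \<theta>" "spt \<theta> \<subseteq> C" "\<And>x. norm (\<theta> x) \<le> 1"
  have int: "integrable M (\<lambda>x. \<theta> x \<bullet> n x)"
    by (rule bounded_mult_integrable[OF test_fun_integrable[OF \<theta>(1)] n])
  have "ennreal (S \<theta>) \<le> ennreal (norm (\<integral>x. \<theta> x \<bullet> n x \<partial>M))"
    unfolding S[OF \<theta>(1)] by (intro ennreal_leI) simp
  also have "\<dots> \<le> (\<integral>\<^sup>+x. norm (\<theta> x \<bullet> n x) \<partial>M)" by (rule integral_norm_bound_ennreal[OF int])
  also have "\<dots> \<le> (\<integral>\<^sup>+x. indicator C x \<partial>M)"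
  proof (rule nn_integral_mono)
    fix x
    have "\<bar>\<theta> x \<bullet> n x\<bar> \<le> 1"
      using Cauchy_Schwarz_ineq2[of "\<theta> x" "n x"] mult_le_one[OF \<theta>(3)[of x] _ n(2)[of x]] by simp
    then show "ennreal (norm (\<theta> x \<bullet> n x)) \<le> indicator C x"
      using spt_subset_outside[OF \<theta>(2), of x] by (cases "x \<in> C") (auto simp: indicator_def)
  qed
  also have "\<dots> = emeasure M C" using open_in_sets[OF C] by simp
  finally show "ennreal (S \<theta>) \<le> emeasure M C" .
qed

text \<open>Test functions approximating n on K in the mean converge almost everywhere along a
  subsequence. Applying \<open>unit_cutoff\<close> brings their norms below 1 and leaves the limit
  unchanged, because n is a unit vector almost everywhere; so their values under S tend to the
  measure of K. The set D of finite measure between K and C contains all supports and supplies the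
  dominating function.\<close>

lemma unit_density_open_variation_ge:
  fixes n :: "'a \<Rightarrow> 'b::euclidean_space"
  assumes n: "n \<in> borel_measurable M" "\<And>x. norm (n x) \<le> 1" "AE x in M. norm (n x) = 1"
    and S: "\<And>\<theta>. test_fun W \<theta> \<Longrightarrow> S \<theta> = (\<integral>x. \<theta> x \<bullet> n x \<partial>M)"
    and K: "compact K" "K \<subseteq> C" and C: "open C" "C \<subseteq> W"
  shows "emeasure M K \<le> open_variation W S C"
proof -
  obtain D where D: "open D" "K \<subseteq> D" "D \<subseteq> C" "emeasure M D < \<infinity>"
    using relatively_compact_nbhd[OF K C] by metis
  have DW: "D \<subseteq> W" using D C by blast
  have sets: "D \<in> sets M" "K \<in> sets M"
    using open_in_sets[OF D(1) DW] compact_in_sets[OF K(1)] K(2) C(2) by auto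
  have DM: "D \<inter> space M \<in> sets M" using sets by simp
  interpret D: locally_finite D "restrict_space M D"
    by (rule locally_finite_restrict[OF D(1) DW])
  let ?f = "\<lambda>x. indicator K x *\<^sub>R n x"
  have fK: "emeasure M K < \<infinity>" using finite_on_compact[OF K(1)] K(2) C(2) by auto
  have f: "integrable M ?f"
    using n sets fK by (intro integrableI_bounded_set[of K M _ 1]) auto
  have indD: "indicator D x *\<^sub>R ?f x = ?f x" for x using D(2) by (auto simp: indicator_def)
  have "integrable (restrict_space M D) ?f"
    using f by (subst integrable_restrict_space[OF DM]) (simp only: indD)
  then have "\<exists>\<theta>. test_fun D \<theta> \<and> (\<integral>x. norm (\<theta> x - ?f x) \<partial>restrict_space M D) < inverse (Suc k)" for k
    by (rule D.test_fun_dense) simp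
  then obtain \<zeta> where \<zeta>: "\<And>k. test_fun D (\<zeta> k)"
    "\<And>k. (\<integral>x. norm (\<zeta> k x - ?f x) \<partial>restrict_space M D) < inverse (Suc k)" by metis
  have \<zeta>W: "test_fun W (\<zeta> k)" for k using \<zeta>(1)[of k] DW by (auto simp: test_fun_def)
  have eq: "indicator D x *\<^sub>R norm (\<zeta> k x - ?f x) = norm (\<zeta> k x - ?f x)" for k x
    using \<zeta>(1)[of k] D(2) spt_outside[of x "\<zeta> k"] by (auto simp: indicator_def test_fun_def)
  have "(\<integral>x. norm (\<zeta> k x - ?f x) \<partial>M) < inverse (Suc k)" for k
    using \<zeta>(2)[of k] unfolding integral_restrict_space[OF DM] eq .
  then have lim: "(\<lambda>k. \<integral>x. norm (\<zeta> k x - ?f x) \<partial>M) \<longlonglongrightarrow> 0"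
    by (intro tendsto_sandwich[OF _ _ tendsto_const LIMSEQ_inverse_real_of_nat])
      (auto intro!: always_eventually less_imp_le)
  have int: "integrable M (\<lambda>x. \<zeta> k x - ?f x)" for k
    using test_fun_integrable[OF \<zeta>W] f by (rule Bochner_Integration.integrable_diff)
  obtain r where r: "strict_mono r" "AE x in M. (\<lambda>k. \<zeta> (r k) x - ?f x) \<longlonglongrightarrow> 0"
    using tendsto_L1_AE_subseq[OF int lim] by blast
  define \<theta> where "\<theta> k x = unit_cutoff (\<zeta> (r k) x)" for k x
  have \<theta>: "test_fun W (\<theta> k)" "spt (\<theta> k) \<subseteq> C" "\<And>x. norm (\<theta> k x) \<le> 1" for k
    using test_fun_unit_cutoff[OF \<zeta>W, of "r k"] \<zeta>(1)[of "r k"] D(3)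
    unfolding \<theta>_def by (auto simp: test_fun_def norm_unit_cutoff_le)
  have out: "\<theta> k x = 0" if "x \<notin> D" for k x
    using \<zeta>(1)[of "r k"] spt_subset_outside[of "\<zeta> (r k)" D x] that by (simp add: \<theta>_def test_fun_def)
  have "(\<lambda>k. \<integral>x. \<theta> k x \<bullet> n x \<partial>M) \<longlonglongrightarrow> (\<integral>x. ?f x \<bullet> n x \<partial>M)"
  proof (rule integral_dominated_convergence[where w="indicator D"])
    show "integrable M (indicator D :: 'a \<Rightarrow> real)" using sets D(4) by simp
    show "AE x in M. norm (\<theta> k x \<bullet> n x) \<le> indicator D x" for k
    proof (rule AE_I2)
      fix x
      have "\<bar>\<theta> k x \<bullet> n x\<bar> \<le> 1"
        using Cauchy_Schwarz_ineq2[of "\<theta> k x" "n x"] mult_le_one[OF \<theta>(3)[of k x] _ n(2)[of x]] by simp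
      then show "norm (\<theta> k x \<bullet> n x) \<le> indicator D x"
        using out[of x k] by (cases "x \<in> D") auto
    qed
    show "AE x in M. (\<lambda>k. \<theta> k x \<bullet> n x) \<longlonglongrightarrow> ?f x \<bullet> n x"
      using r(2) n(3)
    proof eventually_elim
      case (elim x)
      have "unit_cutoff (?f x) = ?f x" using elim(2) unit_cutoff_unit by (auto simp: indicator_def)
      moreover have "(\<lambda>k. \<theta> k x) \<longlonglongrightarrow> unit_cutoff (?f x)"
        unfolding \<theta>_def using elim(1) by (intro unit_cutoff_tendsto) (simp add: LIM_zero_iff)
      ultimately show ?case by (intro tendsto_inner tendsto_const) simp
    qed
    show "(\<lambda>x. ?f x \<bullet> n x) \<in> borel_measurable M"
      using n(1) sets by measurable
    show "(\<lambda>x. \<theta> k x \<bullet> n x) \<in> borel_measurable M" for k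
      using n(1) test_fun_measurable[OF \<theta>(1)] by (intro borel_measurable_inner)
  qed
  moreover have "(\<integral>x. ?f x \<bullet> n x \<partial>M) = measure M K"
  proof -
    have "(\<integral>x. ?f x \<bullet> n x \<partial>M) = (\<integral>x. indicator K x \<partial>M)"
    proof (rule integral_cong_AE)
      show "AE x in M. ?f x \<bullet> n x = indicator K x"
        using n(3) by eventually_elim (simp add: dot_square_norm)
    qed (use n(1) sets in measurable)
    then show ?thesis using sets fK by simp
  qed
  ultimately have "(\<lambda>k. S (\<theta> k)) \<longlonglongrightarrow> measure M K" using S[OF \<theta>(1)] by simp
  then have "(\<lambda>k. ennreal (S (\<theta> k))) \<longlonglongrightarrow> ennreal (measure M K)" by (rule tendsto_ennrealI)
  moreover have "ennreal (measure M K) = emeasure M K"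
    using fK by (simp add: emeasure_eq_ennreal_measure)
  ultimately have "(\<lambda>k. ennreal (S (\<theta> k))) \<longlonglongrightarrow> emeasure M K" by simp
  then show ?thesis
    by (rule LIMSEQ_le_const2) (intro exI allI impI open_variation_upper \<theta>)
qed

lemma unit_density_open_variation:
  fixes n :: "'a \<Rightarrow> 'b::euclidean_space"
  assumes "n \<in> borel_measurable M" "\<And>x. norm (n x) \<le> 1" "AE x in M. norm (n x) = 1"
    and "\<And>\<theta>. test_fun W \<theta> \<Longrightarrow> S \<theta> = (\<integral>x. \<theta> x \<bullet> n x \<partial>M)"
    and C: "open C" "C \<subseteq> W"
  shows "emeasure M C = open_variation W S C"
proof (rule antisym)
  have "openin (top_of_set W) C" using C open_W by (simp add: openin_open_eq)
  from open_eq_SUP[OF this] show "emeasure M C \<le> open_variation W S C"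
    by (simp only:) (auto intro!: SUP_least unit_density_open_variation_ge[OF assms(1-4) _ _ C]
        simp: compactin_subtopology)
  show "open_variation W S C \<le> emeasure M C"
    by (rule unit_density_open_variation_le[OF assms(1,2,4) C])
qed

lemma unit_density_variation:
  fixes n :: "'a \<Rightarrow> 'b::euclidean_space"
  assumes "n \<in> borel_measurable M" "\<And>x. norm (n x) \<le> 1" "AE x in M. norm (n x) = 1"
    and "\<And>\<theta>. test_fun W \<theta> \<Longrightarrow> S \<theta> = (\<integral>x. \<theta> x \<bullet> n x \<partial>M)"
  shows "variation W S = M"
  by (rule variation_eqI) (rule unit_density_open_variation[OF assms])

lemma locally_finite_density:
  fixes g :: "'a \<Rightarrow> ennreal"
  assumes g: "g \<in> borel_measurable M"
    and "\<And>K. compact K \<Longrightarrow> K \<subseteq> W \<Longrightarrow> (\<integral>\<^sup>+x\<in>K. g x \<partial>M) < \<infinity>"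
  shows "locally_finite W (density M g)"
proof
  show "open W" by (rule open_W)
  show "sets (density M g) = sets (borel_of (top_of_set W))" by (simp add: sets_M)
  fix K assume "compact K" "K \<subseteq> W"
  then show "emeasure (density M g) K < \<infinity>"
    using assms compact_in_sets by (subst emeasure_density) auto
qed

lemma integral_density_sgn:
  fixes \<eta> f :: "'a \<Rightarrow> 'b::euclidean_space"
  assumes "\<eta> \<in> borel_measurable M" "f \<in> borel_measurable M"
  shows "(\<integral>x. f x \<bullet> sgn (\<eta> x) \<partial>density M (\<lambda>x. ennreal (norm (\<eta> x)))) = (\<integral>x. f x \<bullet> \<eta> x \<partial>M)"
proof -
  have [measurable]: "(\<lambda>x. sgn (\<eta> x)) \<in> borel_measurable M"
    unfolding sgn_div_norm using assms by measurable
  have "(\<integral>x. f x \<bullet> sgn (\<eta> x) \<partial>density M (\<lambda>x. ennreal (norm (\<eta> x)))) = (\<integral>x. norm (\<eta> x) *\<^sub>R (f x \<bullet> sgn (\<eta> x)) \<partial>M)"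
    using assms by (intro integral_density) auto
  also have "\<dots> = (\<integral>x. f x \<bullet> \<eta> x \<partial>M)"
  proof (intro Bochner_Integration.integral_cong refl)
    fix x show "norm (\<eta> x) *\<^sub>R (f x \<bullet> sgn (\<eta> x)) = f x \<bullet> \<eta> x"
      by (cases "\<eta> x = 0") (simp_all add: sgn_div_norm)
  qed
  finally show ?thesis .
qed

lemma AE_density_norm_sgn:
  fixes \<eta> :: "'a \<Rightarrow> 'b::euclidean_space"
  assumes "\<eta> \<in> borel_measurable M"
  shows "AE x in density M (\<lambda>x. ennreal (norm (\<eta> x))). norm (sgn (\<eta> x)) = 1"
  using assms by (subst AE_density) (auto simp: norm_sgn)

lemma sgn_measurable:
  fixes \<eta> :: "'a \<Rightarrow> 'b::euclidean_space"
  assumes "\<eta> \<in> borel_measurable N" shows "(\<lambda>x. sgn (\<eta> x)) \<in> borel_measurable N"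
  unfolding sgn_div_norm using assms by measurable

lemma norm_sgn_le_1: "norm (sgn (v :: 'b::euclidean_space)) \<le> 1" by (simp add: norm_sgn)

text \<open>Reduction to a unit density: \<eta> M is \<open>sgn\<close> \<eta> times the measure
  |\<eta>| M, and the unit case applies to the latter.\<close>

lemma density_open_variation:
  fixes \<eta> :: "'a \<Rightarrow> 'b::euclidean_space"
  assumes \<eta>: "\<eta> \<in> borel_measurable M"
    and fin: "\<And>K. compact K \<Longrightarrow> K \<subseteq> W \<Longrightarrow> (\<integral>\<^sup>+x\<in>K. norm (\<eta> x) \<partial>M) < \<infinity>"
    and S: "\<And>\<theta>. test_fun W \<theta> \<Longrightarrow> S \<theta> = (\<integral>x. \<theta> x \<bullet> \<eta> x \<partial>M)"
    and C: "open C" "C \<subseteq> W"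
  shows "open_variation W S C = (\<integral>\<^sup>+x\<in>C. norm (\<eta> x) \<partial>M)"
proof -
  interpret N: locally_finite W "density M (\<lambda>x. ennreal (norm (\<eta> x)))"
    using \<eta> fin by (intro locally_finite_density) auto
  have "emeasure (density M (\<lambda>x. ennreal (norm (\<eta> x)))) C = open_variation W S C"
  proof (rule N.unit_density_open_variation[OF _ norm_sgn_le_1 AE_density_norm_sgn[OF \<eta>] _ C])
    show "(\<lambda>x. sgn (\<eta> x)) \<in> borel_measurable (density M (\<lambda>x. ennreal (norm (\<eta> x))))"
      using sgn_measurable[OF \<eta>] by simp
    show "S \<theta> = (\<integral>x. \<theta> x \<bullet> sgn (\<eta> x) \<partial>density M (\<lambda>x. ennreal (norm (\<eta> x))))" if "test_fun W \<theta>" for \<theta>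
      using S[OF that] integral_density_sgn[OF \<eta> test_fun_measurable[OF that]] by simp
  qed
  moreover have "emeasure (density M (\<lambda>x. ennreal (norm (\<eta> x)))) C = (\<integral>\<^sup>+x\<in>C. norm (\<eta> x) \<partial>M)"
    using \<eta> open_in_sets[OF C] by (intro emeasure_density) auto
  ultimately show ?thesis by simp
qed

end

section \<open>The extension to integrable functions\<close>

lemma completion_ex_borel_measurable_euclidean:
  fixes f :: "'a \<Rightarrow> 'b::euclidean_space"
  assumes f: "f \<in> borel_measurable (completion M)"
  shows "\<exists>f'\<in>borel_measurable M. AE x in M. f x = f' x"
proof -
  have "\<exists>g\<in>borel_measurable M. AE x in M. f x \<bullet> b = g x" for b
    by (rule completion_ex_borel_measurable_real[OF borel_measurable_inner[OF f borel_measurable_const]])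
  then obtain g where g: "\<And>b. g b \<in> borel_measurable M" "\<And>b. AE x in M. f x \<bullet> b = g b x" by metis
  have "AE x in M. \<forall>b\<in>Basis. f x \<bullet> b = g b x"
    using g(2) by (intro AE_finite_allI) auto
  then have "AE x in M. f x = (\<Sum>b\<in>Basis. g b x *\<^sub>R b)"
  proof eventually_elim
    case (elim x)
    then have "(\<Sum>b\<in>Basis. g b x *\<^sub>R b) = (\<Sum>b\<in>Basis. (f x \<bullet> b) *\<^sub>R b)" by (intro sum.cong) auto
    then show ?case by (simp add: euclidean_representation)
  qed
  moreover have "(\<lambda>x. \<Sum>b\<in>Basis. g b x *\<^sub>R b) \<in> borel_measurable M"
    by (intro borel_measurable_sum borel_measurable_scaleR g borel_measurable_const)
  ultimately show ?thesis by (rule bexI)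
qed

lemma L1_space_borel:
  fixes f :: "'a \<Rightarrow> 'b::euclidean_space"
  assumes "f \<in> L1_space M"
  obtains f' where "integrable M f'" "AE x in M. f x = f' x"
proof -
  have f: "integrable (completion M) f" using assms by (simp add: L1_space_def)
  obtain f' where f': "f' \<in> borel_measurable M" "AE x in M. f x = f' x"
    using completion_ex_borel_measurable_euclidean borel_measurable_integrable[OF f] by blast
  have "integrable (completion M) f'"
    using f f' AE_completion[OF f'(2)] measurable_completion[OF f'(1)] borel_measurable_integrable[OF f]
    by (subst integrable_cong_AE[of f' _ f]) auto
  then show ?thesis using that f' by (simp add: integrable_completion)
qed

context locally_finite
begin

lemma test_fun_L1:
  fixes \<theta> :: "'a \<Rightarrow> 'b::euclidean_space"
  shows "test_fun W \<theta> \<Longrightarrow> \<theta> \<in> L1_space M"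
  using test_fun_integrable[of \<theta>] test_fun_measurable[of \<theta>]
  by (simp add: L1_space_def integrable_completion)

lemma test_fun_dense_L1:
  fixes f :: "'a \<Rightarrow> 'b::euclidean_space"
  assumes f: "f \<in> L1_space M" and e: "0 < e"
  shows "\<exists>\<theta>. test_fun W \<theta> \<and> (\<integral>x. norm (\<theta> x - f x) \<partial>completion M) < e"
proof -
  obtain f' where f': "integrable M f'" "AE x in M. f x = f' x" using L1_space_borel[OF f] by blast
  obtain \<theta> where \<theta>: "test_fun W \<theta>" "(\<integral>x. norm (\<theta> x - f' x) \<partial>M) < e"
    using test_fun_dense[OF f'(1) e] by blast
  have m [measurable]: "\<theta> \<in> borel_measurable M" "f' \<in> borel_measurable M"
    using test_fun_measurable[OF \<theta>(1)] f'(1) by auto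
  have [measurable]: "f \<in> borel_measurable (completion M)"
    using f by (simp add: L1_space_def)
  note [measurable] = m[THEN measurable_completion]
  have "(\<integral>x. norm (\<theta> x - f x) \<partial>completion M) = (\<integral>x. norm (\<theta> x - f' x) \<partial>completion M)"
    using AE_completion[OF f'(2)] by (intro integral_cong_AE) (measurable, auto)
  also have "\<dots> = (\<integral>x. norm (\<theta> x - f' x) \<partial>M)" by (intro integral_completion) measurable
  finally show ?thesis using \<theta> by auto
qed

lemma integral_unit_bound:
  fixes f g n :: "'a \<Rightarrow> 'b::euclidean_space"
  assumes n: "n \<in> borel_measurable M" "\<And>x. norm (n x) \<le> 1" and f: "f \<in> L1_space M" "g \<in> L1_space M"
  shows "integrable (completion M) (\<lambda>x. f x \<bullet> n x)"
    "\<bar>(\<integral>x. g x \<bullet> n x \<partial>completion M) - (\<integral>x. f x \<bullet> n x \<partial>completion M)\<bar> \<le> (\<integral>x. norm (g x - f x) \<partial>completion M)"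
proof -
  have [measurable]: "n \<in> borel_measurable (completion M)" by (rule measurable_completion[OF n(1)])
  have le: "\<bar>v \<bullet> n x\<bar> \<le> norm v" for v :: 'b and x
    using Cauchy_Schwarz_ineq2[of v "n x"] mult_left_mono[OF n(2)[of x] norm_ge_zero[of v]] by simp
  have int: "integrable (completion M) (\<lambda>x. h x \<bullet> n x)" if "h \<in> L1_space M" for h :: "'a \<Rightarrow> 'b"
  proof (rule Bochner_Integration.integrable_bound)
    show "integrable (completion M) h" using that by (simp add: L1_space_def)
    then have [measurable]: "h \<in> borel_measurable (completion M)" by simp
    show "(\<lambda>x. h x \<bullet> n x) \<in> borel_measurable (completion M)" by measurable
  qed (use le in auto)
  show "integrable (completion M) (\<lambda>x. f x \<bullet> n x)" by (rule int[OF f(1)])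
  have fg: "integrable (completion M) (\<lambda>x. g x - f x)" using f by (simp add: L1_space_def)
  have "\<bar>(\<integral>x. g x \<bullet> n x \<partial>completion M) - (\<integral>x. f x \<bullet> n x \<partial>completion M)\<bar>
      = norm (\<integral>x. (g x - f x) \<bullet> n x \<partial>completion M)"
    using int[OF f(1)] int[OF f(2)] by (simp add: inner_diff_left)
  also have "\<dots> \<le> (\<integral>x. norm (g x - f x) \<partial>completion M)"
  proof (rule Bochner_Integration.integral_norm_bound_integral[OF _ integrable_norm[OF fg]])
    show "integrable (completion M) (\<lambda>x. (g x - f x) \<bullet> n x)"
      using int[OF f(1)] int[OF f(2)] by (simp add: inner_diff_left)
  qed (simp add: le)
  finally show "\<bar>(\<integral>x. g x \<bullet> n x \<partial>completion M) - (\<integral>x. f x \<bullet> n x \<partial>completion M)\<bar> \<le> (\<integral>x. norm (g x - f x) \<partial>completion M)" .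
qed

text \<open>Since |n| \<le> 1, integration against n is 1-Lipschitz in the mean and is a continuous
  extension. Test functions are dense, so any other one agrees with it on integrable functions;
  being \<open>extensional\<close> settles the values elsewhere, as the definite description in
  \<open>dist_ext\<close> requires.\<close>

lemma dist_ext_eq:
  fixes n :: "'a \<Rightarrow> 'b::euclidean_space"
  assumes V: "variation W S = M" and n: "n \<in> borel_measurable M" "\<And>x. norm (n x) \<le> 1"
    and S: "\<And>\<theta>. test_fun W \<theta> \<Longrightarrow> S \<theta> = (\<integral>x. \<theta> x \<bullet> n x \<partial>M)"
    and f: "f \<in> L1_space M"
  shows "dist_ext W S f = (\<integral>x. f x \<bullet> n x \<partial>completion M)"
proof -
  define L0 where "L0 = restrict (\<lambda>f. \<integral>x. f x \<bullet> n x \<partial>completion M) (L1_space M)"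
  let ?P = "\<lambda>L. L \<in> extensional (L1_space M) \<and> (\<forall>\<theta>. test_fun W \<theta> \<longrightarrow> L \<theta> = S \<theta>) \<and>
     (\<forall>\<theta>\<in>L1_space M. \<forall>\<epsilon>>0. \<exists>\<delta>>0. \<forall>\<zeta>\<in>L1_space M.
        (\<integral>x. norm (\<zeta> x - \<theta> x) \<partial>completion M) < \<delta> \<longrightarrow> \<bar>L \<zeta> - L \<theta>\<bar> < \<epsilon>)"
  have cont0: "\<bar>L0 \<zeta> - L0 \<theta>\<bar> < \<epsilon>" if "\<theta> \<in> L1_space M" "\<zeta> \<in> L1_space M"
    "(\<integral>x. norm (\<zeta> x - \<theta> x) \<partial>completion M) < \<epsilon>" for \<zeta> \<theta> \<epsilon>
    using integral_unit_bound(2)[OF n that(1,2)] that by (simp add: L0_def)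
  have test0: "L0 \<theta> = S \<theta>" if "test_fun W \<theta>" for \<theta>
  proof -
    have "(\<lambda>x. \<theta> x \<bullet> n x) \<in> borel_measurable M"
      by (intro borel_measurable_inner test_fun_measurable that n)
    then show ?thesis using S[OF that] test_fun_L1[OF that] by (simp add: L0_def integral_completion)
  qed
  have "dist_ext W S = L0"
    unfolding dist_ext_def V
  proof (rule the_equality)
    show "?P L0" using cont0 test0 by (auto simp: L0_def)
    fix L assume L: "?P L"
    show "L = L0"
    proof (rule extensionalityI)
      show "L \<in> extensional (L1_space M)" "L0 \<in> extensional (L1_space M)" using L by (auto simp: L0_def)
      fix g :: "'a \<Rightarrow> 'b" assume g: "g \<in> L1_space M"
      have "\<bar>L g - L0 g\<bar> \<le> 0 + \<epsilon>" if \<epsilon>: "0 < \<epsilon>" for \<epsilon>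
      proof -
        obtain \<delta> where \<delta>: "0 < \<delta>" "\<And>\<zeta>. \<zeta> \<in> L1_space M \<Longrightarrow>
            (\<integral>x. norm (\<zeta> x - g x) \<partial>completion M) < \<delta> \<Longrightarrow> \<bar>L \<zeta> - L g\<bar> < \<epsilon> / 2"
          using L g \<epsilon> by (meson half_gt_zero)
        obtain \<theta> where \<theta>: "test_fun W \<theta>" "(\<integral>x. norm (\<theta> x - g x) \<partial>completion M) < min \<delta> (\<epsilon> / 2)"
          using test_fun_dense_L1[OF g, of "min \<delta> (\<epsilon> / 2)"] \<delta>(1) \<epsilon> by auto
        have "\<bar>L \<theta> - L g\<bar> < \<epsilon> / 2" using \<theta> \<delta>(2)[OF test_fun_L1[OF \<theta>(1)]] by simp
        moreover have "\<bar>L0 \<theta> - L0 g\<bar> < \<epsilon> / 2" using \<theta> cont0[OF g test_fun_L1[OF \<theta>(1)], of "\<epsilon>/2"] by simp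
        moreover have "L \<theta> = L0 \<theta>" using L \<theta>(1) test0 by simp
        ultimately show ?thesis by linarith
      qed
      then have "\<bar>L g - L0 g\<bar> \<le> 0" by (rule field_le_epsilon)
      then show "L g = L0 g" by simp
    qed
  qed
  then show ?thesis using f by (simp add: L0_def)
qed

end

section \<open>Polar decomposition\<close>

text \<open>The active terms form a geometric sum, which is less than twice its last term, and that
  term is below s.\<close>

lemma dyadic_sum_le:
  fixes s d :: real
  assumes "0 \<le> s" "0 < d"
  shows "(\<Sum>j<N. 2 ^ j * d * (if 2 ^ j * d < s then 1 else 0)) \<le> 2 * s"
proof (induction N)
  case (Suc N)
  show ?case
  proof (cases "2 ^ N * d < s")
    case True
    have "(\<Sum>j<Suc N. 2 ^ j * d * (if 2 ^ j * d < s then 1 else 0)) \<le> (\<Sum>j<Suc N. 2 ^ j * d)"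
      using assms by (intro sum_mono) auto
    also have "\<dots> = (\<Sum>j<Suc N. 2 ^ j) * d" by (rule sum_distrib_right[symmetric])
    also have "(\<Sum>j<Suc N. 2 ^ j) = (2 ^ Suc N - 1 :: real)" by (subst sum_gp_strict) simp
    also have "(2 ^ Suc N - 1) * d \<le> 2 * (2 ^ N * d)" using assms by (simp add: algebra_simps)
    also have "\<dots> \<le> 2 * s" using True by simp
    finally show ?thesis .
  qed (use Suc in simp)
qed (use assms in simp)

locale distribution_with_variation = locally_finite W M
  for W :: "'a::euclidean_space set" and M +
  fixes S :: "('a \<Rightarrow> 'b::euclidean_space) \<Rightarrow> real"
  assumes S: "dist_linear W S" and var: "variation W S = M"
begin

lemma open_variation_eq: "open C \<Longrightarrow> C \<subseteq> W \<Longrightarrow> open_variation W S C = emeasure M C"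
  using variation_spec[OF open_W S] var by simp

section \<open>Dyadic layers and the bound of a functional by the integral of the norm\<close>

lemma S_le_measure:
  assumes \<theta>: "test_fun W \<theta>" "spt \<theta> \<subseteq> C" "\<And>x. norm (\<theta> x) \<le> b" and b: "0 < b"
    and C: "open C" "C \<subseteq> W" "emeasure M C < \<infinity>"
  shows "S \<theta> \<le> b * measure M C"
proof -
  let ?\<theta> = "\<lambda>x. inverse b *\<^sub>R \<theta> x"
  have "test_fun W ?\<theta>" "spt ?\<theta> \<subseteq> C" using test_fun_scaleR[OF smooth_const \<theta>(1), of "inverse b"] \<theta>(2) by auto
  moreover have "norm (?\<theta> x) \<le> 1" for x using \<theta>(3)[of x] b by (simp add: field_simps)
  ultimately have "ennreal (S ?\<theta>) \<le> emeasure M C"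
    using open_variation_upper[of W ?\<theta> C S] open_variation_eq[OF C(1,2)] by simp
  also have "emeasure M C = ennreal (measure M C)"
    using C(3) by (simp add: emeasure_eq_ennreal_measure)
  finally have "S ?\<theta> \<le> measure M C" by simp
  moreover have "S \<theta> = b * S ?\<theta>" using dist_linear_scaleR[OF S \<theta>(1), of "inverse b"] b by simp
  ultimately show ?thesis using b by (simp add: mult_left_mono)
qed

text \<open>The argument of the step is (|\<theta>|^2 - c^2) / (3 c^2), which is 0 where |\<theta>|
  = c and 1 where |\<theta>| = 2c. Squaring keeps the cut-off smooth at the zeros of
  \<theta>.\<close>

definition layer :: "real \<Rightarrow> ('a \<Rightarrow> 'b) \<Rightarrow> 'a \<Rightarrow> real" where
  "layer c \<theta> x = smooth_step (inverse (3 * c\<^sup>2) * (\<theta> x \<bullet> \<theta> x) + (- 1 / 3))"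

lemma layer:
  assumes "0 < c" "smooth \<theta>"
  shows "smooth (layer c \<theta>)" "0 \<le> layer c \<theta> x" "layer c \<theta> x \<le> 1"
    "norm (\<theta> x) \<le> c \<Longrightarrow> layer c \<theta> x = 0" "2 * c \<le> norm (\<theta> x) \<Longrightarrow> layer c \<theta> x = 1"
proof -
  show "smooth (layer c \<theta>)" unfolding layer_def
    by (rule smooth_compose[OF smooth_inner[OF assms(2,2)] smooth_compose[OF smooth_linear_comp smooth_step(1)]])
  show "0 \<le> layer c \<theta> x" "layer c \<theta> x \<le> 1" by (simp_all add: layer_def smooth_step)
  show "layer c \<theta> x = 0" if "norm (\<theta> x) \<le> c"
  proof -
    have "(norm (\<theta> x))\<^sup>2 \<le> c\<^sup>2" using that by (intro power_mono) auto
    then show ?thesis unfolding layer_def using assms(1)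
      by (intro smooth_step(4)) (simp add: dot_square_norm field_simps)
  qed
  show "layer c \<theta> x = 1" if "2 * c \<le> norm (\<theta> x)"
  proof -
    have "(2 * c)\<^sup>2 \<le> (norm (\<theta> x))\<^sup>2" using that assms(1) by (intro power_mono) auto
    then show ?thesis unfolding layer_def using assms(1)
      by (intro smooth_step(5)) (simp add: dot_square_norm field_simps)
  qed
qed

lemma spt_layer_subset:
  assumes "0 < c" "smooth \<theta>" "\<And>x. norm (\<theta> x) < c \<Longrightarrow> f x = 0"
  shows "spt f \<subseteq> {x. c / 2 < norm (\<theta> x)}"
proof -
  have "spt f \<subseteq> {x. c \<le> norm (\<theta> x)}"
  proof (rule spt_subsetI)
    show "closed {x. c \<le> norm (\<theta> x)}"
      by (intro closed_Collect_le continuous_on_norm smooth_continuous_on[OF assms(2)] continuous_on_const)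
  qed (use assms(3) not_le in blast)
  then show ?thesis using assms(1) by auto
qed

lemma layer_superlevel:
  assumes "0 < c" "test_fun W \<theta>"
  shows "open {x. c / 2 < norm (\<theta> x)}" "{x. c / 2 < norm (\<theta> x)} \<subseteq> spt \<theta>" "{x. c / 2 < norm (\<theta> x)} \<subseteq> W"
    "emeasure M {x. c / 2 < norm (\<theta> x)} < \<infinity>"
proof -
  show o: "open {x. c / 2 < norm (\<theta> x)}"
    by (intro open_Collect_less continuous_on_norm smooth_continuous_on test_fun_smooth[OF assms(2)]
        continuous_on_const)
  show sub: "{x. c / 2 < norm (\<theta> x)} \<subseteq> spt \<theta>" using assms(1) spt_outside[of _ \<theta>] by force
  have \<theta>: "compact (spt \<theta>)" "spt \<theta> \<subseteq> W" using assms(2) by (auto simp: test_fun_def)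
  show "{x. c / 2 < norm (\<theta> x)} \<subseteq> W" using sub \<theta>(2) by blast
  have "emeasure M {x. c / 2 < norm (\<theta> x)} \<le> emeasure M (spt \<theta>)"
    by (intro emeasure_mono sub compact_in_sets \<theta>)
  also have "\<dots> < \<infinity>" by (rule finite_on_compact[OF \<theta>])
  finally show "emeasure M {x. c / 2 < norm (\<theta> x)} < \<infinity>" .
qed

text \<open>The two cut-offs agree where |\<theta>| < c (both are 0) and where |\<theta>| > 4c (both
  are 1). So the difference has norm at most 4c and support in the closed set |\<theta>| \<ge> c;
  the level c/2 provides an open set around that support.\<close>

lemma S_layer_le:
  assumes c: "0 < c" and \<theta>: "test_fun W \<theta>"
  shows "S (\<lambda>x. layer c \<theta> x *\<^sub>R \<theta> x) - S (\<lambda>x. layer (2 * c) \<theta> x *\<^sub>R \<theta> x)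
    \<le> 4 * c * measure M {x. c / 2 < norm (\<theta> x)}"
proof -
  note sm = test_fun_smooth[OF \<theta>]
  have c2: "0 < 2 * c" using c by simp
  let ?a = "\<lambda>x. layer c \<theta> x *\<^sub>R \<theta> x" and ?b = "\<lambda>x. layer (2 * c) \<theta> x *\<^sub>R \<theta> x"
  have t: "test_fun W ?a" "test_fun W ?b"
    by (rule test_fun_scaleR(1)[OF layer(1)[OF c sm] \<theta>], rule test_fun_scaleR(1)[OF layer(1)[OF c2 sm] \<theta>])
  have eq: "?a x - ?b x = (layer c \<theta> x - layer (2 * c) \<theta> x) *\<^sub>R \<theta> x" for x
    by (simp add: scaleR_left_diff_distrib)
  have t': "test_fun W (\<lambda>x. ?a x - ?b x)" unfolding eq
    by (rule test_fun_scaleR(1)[OF smooth_diff[OF layer(1)[OF c sm] layer(1)[OF c2 sm]] \<theta>])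
  have small: "?a x - ?b x = 0" if "norm (\<theta> x) < c" for x
    using layer(4)[OF c sm, of x] layer(4)[OF c2 sm, of x] that c by simp
  have bound: "norm (?a x - ?b x) \<le> 4 * c" for x
  proof (cases "norm (\<theta> x) \<le> 4 * c")
    case True
    have "\<bar>layer c \<theta> x - layer (2 * c) \<theta> x\<bar> \<le> 1"
      using layer(2,3)[OF c sm, of x] layer(2,3)[OF c2 sm, of x] by linarith
    then have "norm (?a x - ?b x) \<le> 1 * norm (\<theta> x)"
      unfolding eq norm_scaleR by (intro mult_right_mono) auto
    with True show ?thesis by simp
  next
    case False
    then have "?a x - ?b x = 0" using layer(5)[OF c sm, of x] layer(5)[OF c2 sm, of x] c by simp
    then show ?thesis using c by (simp only: norm_zero)
  qed
  have "S (\<lambda>x. ?a x - ?b x) \<le> 4 * c * measure M {x. c / 2 < norm (\<theta> x)}"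
    using c by (intro S_le_measure[OF t' spt_layer_subset[OF c sm small] bound] layer_superlevel[OF c \<theta>]) simp_all
  then show ?thesis using dist_linear_diff[OF S t] by simp
qed

text \<open>Telescoping over c, 2c, 4c, ... leaves the sum of 4 (2^j c) times the measure of
  |\<theta>| > 2^j c / 2. The constant 16 is 4 from the layer bound, 2 from rewriting c as 2 (c/2),
  and 2 from the dyadic sum.\<close>

lemma S_tail_le:
  assumes c: "0 < c" and \<theta>: "test_fun W \<theta>"
  shows "S (\<lambda>x. layer c \<theta> x *\<^sub>R \<theta> x) \<le> 16 * (\<integral>x. norm (\<theta> x) \<partial>M)"
proof -
  note sm = test_fun_smooth[OF \<theta>]
  let ?O = "\<lambda>c. {x. c / 2 < norm (\<theta> x)}" and ?a = "\<lambda>c. S (\<lambda>x. layer c \<theta> x *\<^sub>R \<theta> x)"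
  have cj: "0 < 2 ^ j * c" for j :: nat using c by simp
  obtain B where B: "\<And>x. norm (\<theta> x) \<le> B" using test_fun_bounded[OF \<theta>] by blast
  \<comment> \<open>Since |\<theta>| \<le> 2^N c everywhere, the cut-off at that level vanishes and
    the telescoping ends.\<close>
  obtain N :: nat where N: "B / c < 2 ^ N" using real_arch_pow[of 2 "B / c"] by auto
  have "norm (\<theta> x) \<le> 2 ^ N * c" for x using B[of x] N c by (simp add: field_simps)
  then have "(\<lambda>x. layer (2 ^ N * c) \<theta> x *\<^sub>R \<theta> x) = (\<lambda>x. 0)"
    using layer(4)[OF cj sm] by auto
  then have zero: "?a (2 ^ N * c) = 0" using dist_linear_0[OF S] by simp
  have tele: "?a c \<le> (\<Sum>j<n. 4 * (2 ^ j * c) * measure M (?O (2 ^ j * c))) + ?a (2 ^ n * c)" for n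
  proof (induction n)
    case (Suc n)
    have "?a (2 ^ n * c) - ?a (2 * (2 ^ n * c)) \<le> 4 * (2 ^ n * c) * measure M (?O (2 ^ n * c))"
      by (rule S_layer_le[OF cj \<theta>])
    with Suc show ?case by (simp add: mult.assoc)
  qed simp
  have O: "?O (2 ^ j * c) \<in> sets M" "emeasure M (?O (2 ^ j * c)) < \<infinity>" for j :: nat
    using layer_superlevel[OF cj[of j] \<theta>] open_in_sets by auto
  have int: "integrable M (\<lambda>x. indicator (?O (2 ^ j * c)) x :: real)" for j :: nat
    using O by (intro integrable_real_indicator) auto
  have "?a c \<le> (\<Sum>j<N. 4 * (2 ^ j * c) * measure M (?O (2 ^ j * c)))" using tele[of N] zero by simp
  also have "\<dots> = (\<Sum>j<N. \<integral>x. 4 * (2 ^ j * c) * indicator (?O (2 ^ j * c)) x \<partial>M)"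
    using O by (intro sum.cong refl) (simp add: mult.assoc)
  also have "\<dots> = (\<integral>x. (\<Sum>j<N. 4 * (2 ^ j * c) * indicator (?O (2 ^ j * c)) x) \<partial>M)"
    using int by (intro Bochner_Integration.integral_sum[symmetric] integrable_mult_right)
  also have "\<dots> \<le> (\<integral>x. 16 * norm (\<theta> x) \<partial>M)"
  proof (rule integral_mono)
    show "integrable M (\<lambda>x. \<Sum>j<N. 4 * (2 ^ j * c) * indicator (?O (2 ^ j * c)) x)"
      using int by (intro Bochner_Integration.integrable_sum integrable_mult_right)
    show "integrable M (\<lambda>x. 16 * norm (\<theta> x))" using test_fun_integrable[OF \<theta>] by simp
    fix x
    have "(\<Sum>j<N. 4 * (2 ^ j * c) * indicator (?O (2 ^ j * c)) x) =
        8 * (\<Sum>j<N. 2 ^ j * (c / 2) * (if 2 ^ j * (c / 2) < norm (\<theta> x) then 1 else 0))"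
      unfolding sum_distrib_left by (intro sum.cong refl) (auto simp: indicator_def)
    also have "\<dots> \<le> 8 * (2 * norm (\<theta> x))"
      using dyadic_sum_le[of "norm (\<theta> x)" "c / 2" N] c by (intro mult_left_mono) auto
    finally show "(\<Sum>j<N. 4 * (2 ^ j * c) * indicator (?O (2 ^ j * c)) x) \<le> 16 * norm (\<theta> x)" by simp
  qed
  finally show ?thesis by simp
qed

text \<open>What the tail estimate misses is the part where |\<theta>| is small. It is uniformly
  small and supported in a set of finite measure, so it vanishes as c tends to 0. The best constant
  is 1, but any constant gives the continuity needed for the extension.\<close>

lemma S_le_integral:
  assumes \<theta>: "test_fun W \<theta>"
  shows "S \<theta> \<le> 16 * (\<integral>x. norm (\<theta> x) \<partial>M)"
proof (rule field_le_epsilon)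
  fix e :: real assume e: "0 < e"
  have K: "compact (spt \<theta>)" "spt \<theta> \<subseteq> W" using \<theta> by (auto simp: test_fun_def)
  note sm = test_fun_smooth[OF \<theta>]
  obtain C where C: "open C" "spt \<theta> \<subseteq> C" "C \<subseteq> W" "emeasure M C < \<infinity>"
    using relatively_compact_nbhd[OF K open_W order_refl] by metis
  \<comment> \<open>Chosen such that 2c times the measure of C is at most e; the summand 1 covers a
    null set C.\<close>
  define c where "c = e / (2 * (measure M C + 1))"
  have c: "0 < c" using e by (simp add: c_def add_nonneg_pos)
  let ?a = "\<lambda>x. layer c \<theta> x *\<^sub>R \<theta> x"
  have t: "test_fun W ?a" by (rule test_fun_scaleR(1)[OF layer(1)[OF c sm] \<theta>])
  have eq: "\<theta> x - ?a x = (1 - layer c \<theta> x) *\<^sub>R \<theta> x" for x by (simp add: scaleR_left_diff_distrib)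
  have t': "test_fun W (\<lambda>x. \<theta> x - ?a x)" "spt (\<lambda>x. \<theta> x - ?a x) \<subseteq> spt \<theta>"
    unfolding eq using test_fun_scaleR[OF smooth_diff[OF smooth_const layer(1)[OF c sm]] \<theta>] by auto
  have bound: "norm (\<theta> x - ?a x) \<le> 2 * c" for x
  proof (cases "norm (\<theta> x) \<le> 2 * c")
    case True
    have "\<bar>1 - layer c \<theta> x\<bar> \<le> 1" using layer(2,3)[OF c sm, of x] by linarith
    then have "norm (\<theta> x - ?a x) \<le> 1 * norm (\<theta> x)"
      unfolding eq norm_scaleR by (intro mult_right_mono) auto
    with True show ?thesis by simp
  next
    case False
    then have "\<theta> x - ?a x = 0" using layer(5)[OF c sm, of x] by simp
    then show ?thesis using c by simp
  qed
  have "S (\<lambda>x. \<theta> x - ?a x) \<le> 2 * c * measure M C"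
    using c t'(2) C by (intro S_le_measure[OF t'(1) _ bound]) auto
  also have "\<dots> \<le> e"
  proof -
    have "2 * c * measure M C \<le> 2 * c * (measure M C + 1)" using c by (intro mult_left_mono) auto
    also have "\<dots> = e" unfolding c_def using measure_nonneg[of M C] by (simp add: field_simps del: measure_nonneg)
    finally show ?thesis .
  qed
  finally have "S \<theta> - S ?a \<le> e" using dist_linear_diff[OF S \<theta> t] by simp
  then show "S \<theta> \<le> 16 * (\<integral>x. norm (\<theta> x) \<partial>M) + e" using S_tail_le[OF c \<theta>] by linarith
qed

lemma S_abs_le:
  assumes \<theta>: "test_fun W \<theta>"
  shows "\<bar>S \<theta>\<bar> \<le> 16 * (\<integral>x. norm (\<theta> x) \<partial>M)"
  using S_le_integral[OF \<theta>] S_le_integral[OF test_fun_scaleR(1)[OF smooth_const \<theta>, of "-1"]]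
    dist_linear_scaleR[OF S \<theta>, of "-1"] by simp

text \<open>The continuous extension of \<open>S\<close> in direction \<open>e\<close>, characterised by its distance to \<open>S\<close>.\<close>

definition ext :: "'b \<Rightarrow> ('a \<Rightarrow> real) \<Rightarrow> real" where
  "ext e f = (SOME l. \<forall>\<phi>. test_fun W \<phi> \<longrightarrow> \<bar>S (\<lambda>x. \<phi> x *\<^sub>R e) - l\<bar> \<le> 16 * (\<integral>x. \<bar>\<phi> x - f x\<bar> \<partial>M))"

lemma S_diff_le:
  assumes e: "norm e = 1" and t: "test_fun W \<phi>" "test_fun W \<psi>"
  shows "\<bar>S (\<lambda>x. \<phi> x *\<^sub>R e) - S (\<lambda>x. \<psi> x *\<^sub>R e)\<bar> \<le> 16 * (\<integral>x. \<bar>\<phi> x - \<psi> x\<bar> \<partial>M)"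
proof -
  note t' = test_fun_scaleR_const(1)[OF t(1), of e] test_fun_scaleR_const(1)[OF t(2), of e]
  have "test_fun W (\<lambda>x. \<phi> x - \<psi> x)"
    using test_fun_add(1)[OF t(1) test_fun_scaleR(1)[OF smooth_const t(2), of "-1"]] by simp
  moreover have "norm ((\<phi> x - \<psi> x) *\<^sub>R e) = \<bar>\<phi> x - \<psi> x\<bar>" for x using e by simp
  ultimately have "\<bar>S (\<lambda>x. (\<phi> x - \<psi> x) *\<^sub>R e)\<bar> \<le> 16 * (\<integral>x. \<bar>\<phi> x - \<psi> x\<bar> \<partial>M)"
    using S_abs_le[OF test_fun_scaleR_const(1), of "\<lambda>x. \<phi> x - \<psi> x" e] by (simp only:)
  then show ?thesis
    using dist_linear_diff[OF S t'] by (simp add: scaleR_left_diff_distrib)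
qed

lemma ext:
  assumes e: "norm e = 1" and f: "integrable M f" and t: "test_fun W \<phi>"
  shows "\<bar>S (\<lambda>x. \<phi> x *\<^sub>R e) - ext e f\<bar> \<le> 16 * (\<integral>x. \<bar>\<phi> x - f x\<bar> \<partial>M)"
proof -
  have "\<exists>\<phi>::'a \<Rightarrow> real. test_fun W \<phi> \<and> (\<integral>x. norm (\<phi> x - f x) \<partial>M) < inverse (Suc k)" for k
    by (rule test_fun_dense[OF f]) simp
  then obtain \<phi> :: "nat \<Rightarrow> 'a \<Rightarrow> real" where \<phi>: "\<And>k. test_fun W (\<phi> k)"
    "\<And>k. (\<integral>x. norm (\<phi> k x - f x) \<partial>M) < inverse (Suc k)" by metis
  let ?s = "\<lambda>k. S (\<lambda>x. \<phi> k x *\<^sub>R e)"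
  have tri: "(\<integral>x. \<bar>\<psi> x - \<phi> k x\<bar> \<partial>M) \<le> (\<integral>x. \<bar>\<psi> x - f x\<bar> \<partial>M) + inverse (Suc k)"
    if "test_fun W \<psi>" for \<psi> k
  proof -
    have i: "integrable M \<psi>" "integrable M (\<phi> k)"
      using that \<phi>(1)[of k] by (auto intro: test_fun_integrable)
    have "(\<integral>x. \<bar>\<psi> x - \<phi> k x\<bar> \<partial>M) \<le> (\<integral>x. \<bar>\<psi> x - f x\<bar> + \<bar>\<phi> k x - f x\<bar> \<partial>M)"
      using i f by (intro integral_mono) auto
    also have "\<dots> = (\<integral>x. \<bar>\<psi> x - f x\<bar> \<partial>M) + (\<integral>x. \<bar>\<phi> k x - f x\<bar> \<partial>M)"
      using i f by (intro Bochner_Integration.integral_add) auto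
    finally show ?thesis using \<phi>(2)[of k] by simp
  qed
  have "Cauchy ?s"
  proof (rule metric_CauchyI)
    fix r :: real assume r: "0 < r"
    \<comment> \<open>The two approximations are within 2 (r/32) of each other in the mean, and the
      factor 16 turns this into r.\<close>
    obtain N where N: "inverse (real (Suc N)) < r / 32" using reals_Archimedean[of "r / 32"] r by auto
    have "dist (?s i) (?s j) < r" if "N \<le> i" "N \<le> j" for i j
    proof -
      have "inverse (real (Suc i)) \<le> inverse (real (Suc N))" "inverse (real (Suc j)) \<le> inverse (real (Suc N))"
        using that by (simp_all add: le_imp_inverse_le)
      then have "(\<integral>x. \<bar>\<phi> i x - \<phi> j x\<bar> \<partial>M) < 2 * (r / 32)"
        using tri[OF \<phi>(1)[of i], of j] \<phi>(2)[of i] N unfolding real_norm_def by linarith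
      then show ?thesis using S_diff_le[OF e \<phi>(1)[of i] \<phi>(1)[of j]] by (simp add: dist_real_def)
    qed
    then show "\<exists>N. \<forall>i\<ge>N. \<forall>j\<ge>N. dist (?s i) (?s j) < r" by blast
  qed
  then obtain l where l: "?s \<longlonglongrightarrow> l" using Cauchy_convergent convergent_def by blast
  have "\<bar>S (\<lambda>x. \<psi> x *\<^sub>R e) - l\<bar> \<le> 16 * (\<integral>x. \<bar>\<psi> x - f x\<bar> \<partial>M)" if \<psi>: "test_fun W \<psi>" for \<psi>
  proof (rule LIMSEQ_le)
    show "(\<lambda>k. \<bar>S (\<lambda>x. \<psi> x *\<^sub>R e) - ?s k\<bar>) \<longlonglongrightarrow> \<bar>S (\<lambda>x. \<psi> x *\<^sub>R e) - l\<bar>"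
      by (intro tendsto_intros l)
    have "(\<lambda>k. 16 * ((\<integral>x. \<bar>\<psi> x - f x\<bar> \<partial>M) + inverse (real (Suc k)))) \<longlonglongrightarrow> 16 * ((\<integral>x. \<bar>\<psi> x - f x\<bar> \<partial>M) + 0)"
      by (intro tendsto_intros LIMSEQ_inverse_real_of_nat)
    then show "(\<lambda>k. 16 * ((\<integral>x. \<bar>\<psi> x - f x\<bar> \<partial>M) + inverse (real (Suc k)))) \<longlonglongrightarrow> 16 * (\<integral>x. \<bar>\<psi> x - f x\<bar> \<partial>M)" by simp
    show "\<exists>N. \<forall>k\<ge>N. \<bar>S (\<lambda>x. \<psi> x *\<^sub>R e) - ?s k\<bar> \<le> 16 * ((\<integral>x. \<bar>\<psi> x - f x\<bar> \<partial>M) + inverse (real (Suc k)))"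
    proof (intro exI allI impI)
      fix k
      show "\<bar>S (\<lambda>x. \<psi> x *\<^sub>R e) - ?s k\<bar> \<le> 16 * ((\<integral>x. \<bar>\<psi> x - f x\<bar> \<partial>M) + inverse (real (Suc k)))"
        using S_diff_le[OF e \<psi> \<phi>(1)[of k]] tri[OF \<psi>, of k] by simp
    qed
  qed
  then have "\<exists>l. \<forall>\<phi>. test_fun W \<phi> \<longrightarrow> \<bar>S (\<lambda>x. \<phi> x *\<^sub>R e) - l\<bar> \<le> 16 * (\<integral>x. \<bar>\<phi> x - f x\<bar> \<partial>M)" by blast
  from someI_ex[OF this] t show ?thesis unfolding ext_def by blast
qed

lemma ext_test_fun:
  assumes "norm e = 1" "test_fun W \<phi>" shows "ext e \<phi> = S (\<lambda>x. \<phi> x *\<^sub>R e)"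
  using ext[OF assms(1) test_fun_integrable[OF assms(2)] assms(2)] by simp

lemma ext_add:
  assumes e: "norm e = 1" and f: "integrable M f" "integrable M g"
  shows "ext e (\<lambda>x. f x + g x) = ext e f + ext e g"
proof -
  have "\<bar>ext e (\<lambda>x. f x + g x) - (ext e f + ext e g)\<bar> \<le> 0 + \<epsilon>" if \<epsilon>: "0 < \<epsilon>" for \<epsilon>
  proof -
    \<comment> \<open>Three distances enter, with errors 16/64, 16/64 and 16/32 of \<epsilon>, which
      add up to \<epsilon>.\<close>
    have e64: "0 < \<epsilon> / 64" using \<epsilon> by simp
    obtain \<phi> \<psi> :: "'a \<Rightarrow> real" where t: "test_fun W \<phi>" "(\<integral>x. norm (\<phi> x - f x) \<partial>M) < \<epsilon> / 64"
      "test_fun W \<psi>" "(\<integral>x. norm (\<psi> x - g x) \<partial>M) < \<epsilon> / 64"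
      using test_fun_dense[OF f(1) e64] test_fun_dense[OF f(2) e64] by blast
    have i: "integrable M \<phi>" "integrable M \<psi>" using t by (auto intro: test_fun_integrable)
    have "(\<integral>x. \<bar>\<phi> x + \<psi> x - (f x + g x)\<bar> \<partial>M) \<le> (\<integral>x. \<bar>\<phi> x - f x\<bar> + \<bar>\<psi> x - g x\<bar> \<partial>M)"
      using i f by (intro integral_mono) auto
    also have "\<dots> = (\<integral>x. \<bar>\<phi> x - f x\<bar> \<partial>M) + (\<integral>x. \<bar>\<psi> x - g x\<bar> \<partial>M)"
      using i f by (intro Bochner_Integration.integral_add) auto
    finally have le: "(\<integral>x. \<bar>\<phi> x + \<psi> x - (f x + g x)\<bar> \<partial>M) \<le> \<epsilon> / 32" using t by simp
    have "S (\<lambda>x. (\<phi> x + \<psi> x) *\<^sub>R e) = S (\<lambda>x. \<phi> x *\<^sub>R e) + S (\<lambda>x. \<psi> x *\<^sub>R e)"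
      using dist_linear_add[OF S test_fun_scaleR_const(1)[OF t(1)] test_fun_scaleR_const(1)[OF t(3)]]
      by (simp add: scaleR_left_distrib)
    with ext[OF e f(1) t(1)] ext[OF e f(2) t(3)] t le
      ext[OF e Bochner_Integration.integrable_add[OF f] test_fun_add(1)[OF t(1,3)]]
    show ?thesis by simp
  qed
  then have "\<bar>ext e (\<lambda>x. f x + g x) - (ext e f + ext e g)\<bar> \<le> 0" by (rule field_le_epsilon)
  then show ?thesis by simp
qed

lemma ext_abs_le:
  assumes e: "norm e = 1" and f: "integrable M f"
  shows "\<bar>ext e f\<bar> \<le> 16 * (\<integral>x. \<bar>f x\<bar> \<partial>M)"
  using ext[OF e f test_fun_0] dist_linear_0[OF S] by simp

lemma ext_diff:
  assumes e: "norm e = 1" and f: "integrable M f" "integrable M g"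
  shows "ext e f - ext e g = ext e (\<lambda>x. f x - g x)"
  using ext_add[OF e Bochner_Integration.integrable_diff[OF f] f(2)] by simp

lemma ext_scale:
  assumes e: "norm e = 1" and f: "integrable M f"
  shows "ext e (\<lambda>x. c * f x) = c * ext e f"
proof -
  have "\<bar>ext e (\<lambda>x. c * f x) - c * ext e f\<bar> \<le> 0 + \<epsilon>" if \<epsilon>: "0 < \<epsilon>" for \<epsilon>
  proof -
    \<comment> \<open>After multiplication by |c| at most \<epsilon>/32 is left; it is used twice
      with the factor 16.\<close>
    have "0 < \<epsilon> / (32 * (\<bar>c\<bar> + 1))" using \<epsilon> by (simp add: add_nonneg_pos)
    then obtain \<phi> :: "'a \<Rightarrow> real" where t: "test_fun W \<phi>" "(\<integral>x. norm (\<phi> x - f x) \<partial>M) < \<epsilon> / (32 * (\<bar>c\<bar> + 1))"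
      using test_fun_dense[OF f] by blast
    have "\<bar>c\<bar> * (\<integral>x. \<bar>\<phi> x - f x\<bar> \<partial>M) \<le> (\<bar>c\<bar> + 1) * (\<epsilon> / (32 * (\<bar>c\<bar> + 1)))"
      using t by (intro mult_mono) auto
    also have "\<dots> = \<epsilon> / 32" by (simp add: field_simps add_nonneg_pos)
    finally have small: "\<bar>c\<bar> * (\<integral>x. \<bar>\<phi> x - f x\<bar> \<partial>M) \<le> \<epsilon> / 32" .
    have "(\<integral>x. \<bar>c * \<phi> x - c * f x\<bar> \<partial>M) = (\<integral>x. \<bar>c\<bar> * \<bar>\<phi> x - f x\<bar> \<partial>M)"
      by (simp flip: abs_mult right_diff_distrib)
    then have le: "(\<integral>x. \<bar>c * \<phi> x - c * f x\<bar> \<partial>M) \<le> \<epsilon> / 32" using small by simp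
    have "S (\<lambda>x. (c * \<phi> x) *\<^sub>R e) = c * S (\<lambda>x. \<phi> x *\<^sub>R e)"
      using dist_linear_scaleR[OF S test_fun_scaleR_const(1)[OF t(1)], of c] by simp
    moreover have "\<bar>c * S (\<lambda>x. \<phi> x *\<^sub>R e) - c * ext e f\<bar> \<le> 16 * (\<epsilon> / 32)"
      using mult_left_mono[OF ext[OF e f t(1)], of "\<bar>c\<bar>"] small
      by (simp flip: right_diff_distrib add: abs_mult)
    moreover have "test_fun W (\<lambda>x. c * \<phi> x)" using test_fun_scaleR(1)[OF smooth_const t(1), of c] by simp
    moreover have "\<bar>S (\<lambda>x. (c * \<phi> x) *\<^sub>R e) - ext e (\<lambda>x. c * f x)\<bar> \<le> 16 * (\<integral>x. \<bar>c * \<phi> x - c * f x\<bar> \<partial>M)"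
      using test_fun_scaleR(1)[OF smooth_const t(1), of c] by (intro ext[OF e integrable_mult_right[OF f]]) simp
    ultimately show ?thesis using le by linarith
  qed
  then have "\<bar>ext e (\<lambda>x. c * f x) - c * ext e f\<bar> \<le> 0" by (rule field_le_epsilon)
  then show ?thesis by simp
qed

lemma ext_cong_tendsto:
  assumes e: "norm e = 1" and f: "\<And>k. integrable M (s k)" "integrable M f"
    and lim: "(\<lambda>k. \<integral>x. \<bar>s k x - f x\<bar> \<partial>M) \<longlonglongrightarrow> 0"
  shows "(\<lambda>k. ext e (s k)) \<longlonglongrightarrow> ext e f"
proof (rule LIM_zero_cancel, rule Lim_null_comparison)
  show "\<forall>\<^sub>F k in sequentially. norm (ext e (s k) - ext e f) \<le> 16 * (\<integral>x. \<bar>s k x - f x\<bar> \<partial>M)"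
    using ext_diff[OF e f] ext_abs_le[OF e Bochner_Integration.integrable_diff[OF f]] by auto
  show "(\<lambda>k. 16 * (\<integral>x. \<bar>s k x - f x\<bar> \<partial>M)) \<longlonglongrightarrow> 0"
    using tendsto_mult_right_zero[OF lim, of 16] by (simp add: mult.commute)
qed

text \<open>Multiplying by a positive integrable weight makes the set function of the extension finite;
  adding the bound makes it a positive measure, to which the Radon-Nikodym theorem applies.\<close>

lemma direction_density:
  assumes e: "norm e = 1"
  obtains n where "n \<in> borel_measurable M" "\<And>x. \<bar>n x\<bar> \<le> 16"
    "\<And>\<phi>. test_fun W \<phi> \<Longrightarrow> S (\<lambda>x. \<phi> x *\<^sub>R e) = (\<integral>x. \<phi> x * n x \<partial>M)"
proof -
  interpret sigma_finite_measure M by (rule sigma_finite)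
  obtain h where h: "h \<in> borel_measurable M" "integral\<^sup>N M h \<noteq> \<infinity>"
    "\<And>x. x \<in> space M \<Longrightarrow> 0 < h x \<and> h x < \<infinity>"
    using Ex_finite_integrable_function by blast
  define w where "w x = enn2real (h x)" for x
  have [measurable]: "w \<in> borel_measurable M" using h(1) unfolding w_def by measurable
  have w0: "0 \<le> w x" for x by (simp add: w_def)
  have wpos: "0 < w x" if "x \<in> space M" for x
    using h(3)[OF that] by (simp add: w_def enn2real_positive_iff)
  have hw: "ennreal (w x) = h x" if "x \<in> space M" for x
    using h(3)[OF that] by (simp add: w_def)
  have w: "integrable M w"
  proof (rule integrableI_nonneg)
    have "(\<integral>\<^sup>+x. ennreal (w x) \<partial>M) = integral\<^sup>N M h" by (intro nn_integral_cong hw)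
    then show "(\<integral>\<^sup>+x. ennreal (w x) \<partial>M) < \<infinity>" using h(2) by (simp add: less_top)
  qed (use w0 in auto)
  have wA: "integrable M (\<lambda>x. w x * indicator A x)" if "A \<in> sets M" for A
    using integrable_mult_indicator[OF that w] by (simp add: mult.commute)
  define \<Lambda> where "\<Lambda> A = ext e (\<lambda>x. w x * indicator A x)" for A
  define \<mu> where "\<mu> A = (\<integral>x. w x * indicator A x \<partial>M)" for A
  have \<Lambda>_le: "\<bar>\<Lambda> A\<bar> \<le> 16 * \<mu> A" if "A \<in> sets M" for A
    using ext_abs_le[OF e wA[OF that]] w0 unfolding \<Lambda>_def \<mu>_def by (simp add: abs_mult)
  have Un: "\<Lambda> (A \<union> B) + 16 * \<mu> (A \<union> B) = (\<Lambda> A + 16 * \<mu> A) + (\<Lambda> B + 16 * \<mu> B)"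
    if AB: "A \<in> sets M" "B \<in> sets M" "A \<inter> B = {}" for A B
  proof -
    have "w x * indicator (A \<union> B) x = w x * indicator A x + w x * indicator B x" for x
      using AB(3) by (auto simp: indicator_def)
    then show ?thesis
      unfolding \<Lambda>_def \<mu>_def using wA AB ext_add[OF e wA[OF AB(1)] wA[OF AB(2)]] by simp
  qed
  define \<nu> where "\<nu> A = ennreal (\<Lambda> A + 16 * \<mu> A)" for A
  have nonneg: "0 \<le> \<Lambda> A + 16 * \<mu> A" if "A \<in> sets M" for A using \<Lambda>_le[OF that] by linarith
  have \<mu>0: "\<mu> {} = 0" by (simp add: \<mu>_def)
  have \<nu>0: "\<nu> {} = 0" using \<Lambda>_le[of "{}"] by (simp add: \<nu>_def \<mu>0)
  \<comment> \<open>The set function lies between 0 and 32 \<mu>, and \<mu> is continuous at the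
    empty set by dominated convergence; for a finite additive function this gives countable
    additivity.\<close>
  have ca: "countably_additive (sets M) \<nu>"
  proof (rule sets.empty_continuous_imp_countably_additive)
    show "positive (sets M) \<nu>" by (simp add: positive_def \<nu>0)
    show "additive (sets M) \<nu>"
      unfolding additive_def \<nu>_def using Un nonneg by (simp flip: ennreal_plus)
    show "\<forall>A\<in>sets M. \<nu> A \<noteq> \<infinity>" by (simp add: \<nu>_def)
    fix A :: "nat \<Rightarrow> 'a set" assume A: "range A \<subseteq> sets M" "decseq A" "(\<Inter>i. A i) = {}"
    have As: "A i \<in> sets M" for i using A(1) by blast
    have "(\<lambda>i. \<mu> (A i)) \<longlonglongrightarrow> (\<integral>x. 0 \<partial>M)"
      unfolding \<mu>_def
    proof (rule integral_dominated_convergence[where w=w])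
      show "AE x in M. (\<lambda>i. w x * indicator (A i) x) \<longlonglongrightarrow> 0"
      proof (rule AE_I2)
        fix x
        obtain k where k: "x \<notin> A k" using A(3) by blast
        have "x \<notin> A i" if "k \<le> i" for i using decseqD[OF A(2) that] k by blast
        then have "\<forall>\<^sub>F i in sequentially. w x * indicator (A i) x = 0"
          by (auto simp: eventually_sequentially intro!: exI[of _ k])
        then show "(\<lambda>i. w x * indicator (A i) x) \<longlonglongrightarrow> 0" by (rule tendsto_eventually)
      qed
      show "AE x in M. norm (w x * indicator (A i) x) \<le> w x" for i
        using w0 by (auto simp: indicator_def)
      show "(\<lambda>x. w x * indicator (A i) x) \<in> borel_measurable M" for i using As by measurable
    qed (use w in auto)
    then have lim: "(\<lambda>i. 32 * \<mu> (A i)) \<longlonglongrightarrow> 0" using tendsto_mult_right_zero[of _ _ 32] by (simp add: mult.commute)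
    have "(\<lambda>i. \<Lambda> (A i) + 16 * \<mu> (A i)) \<longlonglongrightarrow> 0"
    proof (rule tendsto_sandwich[OF _ _ tendsto_const lim])
      show "\<forall>\<^sub>F i in sequentially. 0 \<le> \<Lambda> (A i) + 16 * \<mu> (A i)" using nonneg[OF As] by simp
      have "\<Lambda> (A i) + 16 * \<mu> (A i) \<le> 32 * \<mu> (A i)" for i using \<Lambda>_le[OF As[of i]] by linarith
      then show "\<forall>\<^sub>F i in sequentially. \<Lambda> (A i) + 16 * \<mu> (A i) \<le> 32 * \<mu> (A i)" by simp
    qed
    then show "(\<lambda>i. \<nu> (A i)) \<longlonglongrightarrow> 0" unfolding \<nu>_def using tendsto_ennrealI by fastforce
  qed
  define N where "N = measure_of (space M) (sets M) \<nu>"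
  have sets_N: "sets N = sets M" unfolding N_def by simp
  have N: "emeasure N A = \<nu> A" if "A \<in> sets M" for A
    unfolding N_def using that ca \<nu>0
    by (intro emeasure_measure_of_sigma sets.sigma_algebra_axioms) (auto simp: positive_def)
  have "absolutely_continuous M N"
    unfolding absolutely_continuous_def
  proof
    fix A assume A: "A \<in> null_sets M"
    then have As: "A \<in> sets M" by blast
    have "AE x in M. w x * indicator A x = 0" using AE_not_in[OF A] by eventually_elim simp
    then have "\<mu> A = 0" unfolding \<mu>_def by (rule integral_eq_zero_AE)
    then have "\<nu> A = 0" using \<Lambda>_le[OF As] by (simp add: \<nu>_def)
    then show "A \<in> null_sets N" using As N sets_N by (intro null_setsI) auto
  qed
  then obtain g where g: "g \<in> borel_measurable M" "density M g = N"
    using Radon_Nikodym sets_N by blast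
  have gA: "(\<integral>\<^sup>+x\<in>A. g x \<partial>M) = \<nu> A" if "A \<in> sets M" for A
    using N[OF that] emeasure_density[OF g(1) that] g(2) by simp
  have wA': "(\<integral>\<^sup>+x\<in>A. ennreal (32 * w x) \<partial>M) = ennreal (32 * \<mu> A)" if "A \<in> sets M" for A
  proof -
    have "(\<integral>\<^sup>+x\<in>A. ennreal (32 * w x) \<partial>M) = (\<integral>\<^sup>+x. ennreal (32 * (w x * indicator A x)) \<partial>M)"
      by (intro nn_integral_cong) (auto simp: indicator_def)
    also have "\<dots> = ennreal (\<integral>x. 32 * (w x * indicator A x) \<partial>M)"
      using wA[OF that] w0 by (intro nn_integral_eq_integral) auto
    finally show ?thesis by (simp add: \<mu>_def)
  qed
  \<comment> \<open>The density inherits the bound \<nu> \<le> 32 \<mu>: on the set where it fails,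
    the integrals would be strictly ordered the wrong way.\<close>
  have g_le: "AE x in M. g x \<le> ennreal (32 * w x)"
  proof -
    let ?A = "{x \<in> space M. ennreal (32 * w x) < g x}"
    have A: "?A \<in> sets M" using g(1) by measurable
    have "AE x in M. g x * indicator ?A x \<le> ennreal (32 * w x) * indicator ?A x"
    proof (rule ccontr)
      assume n: "\<not> (AE x in M. g x * indicator ?A x \<le> ennreal (32 * w x) * indicator ?A x)"
      have "(\<integral>\<^sup>+x\<in>?A. ennreal (32 * w x) \<partial>M) < (\<integral>\<^sup>+x\<in>?A. g x \<partial>M)"
      proof (rule nn_integral_less[OF _ _ _ _ n])
        show "(\<integral>\<^sup>+x\<in>?A. ennreal (32 * w x) \<partial>M) \<noteq> \<infinity>" unfolding wA'[OF A] by simp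
        show "AE x in M. ennreal (32 * w x) * indicator ?A x \<le> g x * indicator ?A x"
          by (auto simp: indicator_def)
      qed (use A g(1) in measurable)
      also have "(\<integral>\<^sup>+x\<in>?A. g x \<partial>M) \<le> ennreal (32 * \<mu> ?A)"
        unfolding gA[OF A] \<nu>_def using \<Lambda>_le[OF A] by (intro ennreal_leI) linarith
      also have "\<dots> = (\<integral>\<^sup>+x\<in>?A. ennreal (32 * w x) \<partial>M)" by (rule wA'[OF A, symmetric])
      finally show False by simp
    qed
    then show ?thesis
      using AE_space
    proof eventually_elim
      case (elim x)
      then show ?case by (cases "ennreal (32 * w x) < g x") (simp_all add: not_less)
    qed
  qed
  \<comment> \<open>Undoes the shift by 16 and the weight, so that g = w (n + 16) almost everywhere.
    The clamping changes only a null set and makes the bound hold at every point.\<close>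
  define n where "n x = max (- 16) (min 16 (enn2real (g x) / w x - 16))" for x
  have "n \<in> borel_measurable M" unfolding n_def using g(1) by measurable
  moreover have "\<bar>n x\<bar> \<le> 16" for x by (simp add: n_def abs_le_iff)
  ultimately have n: "n \<in> borel_measurable M" "\<And>x. \<bar>n x\<bar> \<le> 16" by auto
  have gn: "AE x in M. g x = ennreal (w x * (n x + 16)) \<and> - 16 \<le> n x"
    using g_le AE_space
  proof eventually_elim
    case (elim x)
    then obtain r where r: "g x = ennreal r" "0 \<le> r" "r \<le> 32 * w x"
      using w0[of x] by (cases "g x" rule: ennreal_cases) (auto simp: top_unique)
    then have "r / w x \<le> 32" "0 \<le> r / w x" using wpos[OF elim(2)] by (simp_all add: field_simps)
    then have "n x = r / w x - 16" using r by (simp add: n_def)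
    then show ?case using r wpos[OF elim(2)] n(2)[of x] by (simp add: abs_le_iff)
  qed
  have \<Lambda>_n: "\<Lambda> A = (\<integral>x. w x * n x * indicator A x \<partial>M)" if A: "A \<in> sets M" for A
  proof -
    have wn: "integrable M (\<lambda>x. w x * n x * indicator A x)"
    proof (rule Bochner_Integration.integrable_bound[OF integrable_mult_right[OF w, of 16]])
      show "AE x in M. norm (w x * n x * indicator A x) \<le> norm (16 * w x)"
        using n(2) w0 by (auto simp: indicator_def abs_mult mult.commute intro!: mult_mono)
    qed (use A n in measurable)
    have "ennreal (\<Lambda> A + 16 * \<mu> A) = (\<integral>\<^sup>+x\<in>A. g x \<partial>M)" using gA[OF A] by (simp add: \<nu>_def)
    also have "\<dots> = (\<integral>\<^sup>+x. ennreal (w x * n x * indicator A x + 16 * (w x * indicator A x)) \<partial>M)"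
      using gn by (intro nn_integral_cong_AE) (auto simp: indicator_def algebra_simps)
    also have "\<dots> = ennreal (\<integral>x. w x * n x * indicator A x + 16 * (w x * indicator A x) \<partial>M)"
    proof (rule nn_integral_eq_integral)
      show "AE x in M. 0 \<le> w x * n x * indicator A x + 16 * (w x * indicator A x)"
        using gn
      proof eventually_elim
        case (elim x)
        then have "0 \<le> w x * (n x + 16) * indicator A x" using w0[of x] by (intro mult_nonneg_nonneg) auto
        then show ?case by (simp add: algebra_simps)
      qed
    qed (use wn wA[OF A] in auto)
    also have "(\<integral>x. w x * n x * indicator A x + 16 * (w x * indicator A x) \<partial>M) =
        (\<integral>x. w x * n x * indicator A x \<partial>M) + 16 * \<mu> A"
      using wn wA[OF A] by (simp add: \<mu>_def)
    finally have eq: "ennreal (\<Lambda> A + 16 * \<mu> A) = ennreal ((\<integral>x. w x * n x * indicator A x \<partial>M) + 16 * \<mu> A)" .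
    moreover have "0 \<le> (\<integral>x. w x * n x * indicator A x \<partial>M) + 16 * \<mu> A"
    proof -
      have "- 16 * \<mu> A = (\<integral>x. - 16 * (w x * indicator A x) \<partial>M)" by (simp add: \<mu>_def)
      also have "\<dots> \<le> (\<integral>x. w x * n x * indicator A x \<partial>M)"
      proof (rule integral_mono)
        fix x
        have "w x * - 16 \<le> w x * n x" using n(2)[of x] w0[of x] by (intro mult_left_mono) (auto simp: abs_le_iff)
        then show "- 16 * (w x * indicator A x) \<le> w x * n x * indicator A x" by (auto simp: indicator_def)
      qed (use wn wA[OF A] in auto)
      finally show ?thesis by simp
    qed
    ultimately show ?thesis using nonneg[OF A] by simp
  qed
  \<comment> \<open>Passing from indicators to all functions integrable for w M reaches every test
    function \<phi> as w (\<phi> / w); the weight is positive on W and \<phi> vanishes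
    outside.\<close>
  have rep: "ext e (\<lambda>x. w x * h x) = (\<integral>x. w x * h x * n x \<partial>M)"
    if "integrable (density M (\<lambda>x. ennreal (w x))) h" for h :: "'a \<Rightarrow> real"
  proof -
    have int: "integrable M (\<lambda>x. w x * h x)" if "integrable (density M (\<lambda>x. ennreal (w x))) h" for h :: "'a \<Rightarrow> real"
      using that integrable_density[of h M w] borel_measurable_integrable[OF that] w0 by simp
    have intn: "integrable M (\<lambda>x. w x * h x * n x)" if "integrable (density M (\<lambda>x. ennreal (w x))) h" for h :: "'a \<Rightarrow> real"
    proof (rule Bochner_Integration.integrable_bound[OF integrable_mult_right[OF integrable_abs[OF int[OF that]], of 16]])
      show "AE x in M. norm (w x * h x * n x) \<le> norm (16 * \<bar>w x * h x\<bar>)"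
        using n(2) by (auto simp: abs_mult mult.commute intro!: mult_right_mono)
      show "(\<lambda>x. w x * h x * n x) \<in> borel_measurable M"
        using int[OF that] n by measurable
    qed
    show ?thesis using that
    proof induction
      case (base A c)
      then have A: "A \<in> sets M" by simp
      have "ext e (\<lambda>x. w x * (indicator A x *\<^sub>R c)) = c * \<Lambda> A"
        using ext_scale[OF e wA[OF A], of c] by (simp add: \<Lambda>_def mult_ac)
      also have "\<dots> = (\<integral>x. w x * (indicator A x *\<^sub>R c) * n x \<partial>M)"
        unfolding \<Lambda>_n[OF A] by (simp flip: integral_mult_right_zero add: mult_ac)
      finally show ?case .
    next
      case (add f g)
      then show ?case
        using ext_add[OF e int[OF add(1)] int[OF add(2)]] intn[OF add(1)] intn[OF add(2)]
        by (simp add: distrib_left distrib_right)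
    next
      case (lim f s)
      have conv: "(\<lambda>i. s i x) \<longlonglongrightarrow> f x" if "x \<in> space M" for x using lim(2)[of x] that by simp
      have dom: "\<bar>s i x - f x\<bar> \<le> 3 * \<bar>f x\<bar>" if "x \<in> space M" for x i
        using lim(3)[of x i] that by simp
      have "(\<lambda>i. \<integral>x. \<bar>w x * s i x - w x * f x\<bar> \<partial>M) \<longlonglongrightarrow> (\<integral>x. 0 \<partial>M)"
      proof (rule integral_dominated_convergence[where w="\<lambda>x. 3 * \<bar>w x * f x\<bar>"])
        show "AE x in M. (\<lambda>i. \<bar>w x * s i x - w x * f x\<bar>) \<longlonglongrightarrow> 0"
        proof (rule AE_I2)
          fix x assume "x \<in> space M"
          then have "(\<lambda>i. \<bar>w x * s i x - w x * f x\<bar>) \<longlonglongrightarrow> \<bar>w x * f x - w x * f x\<bar>"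
            by (intro tendsto_intros conv)
          then show "(\<lambda>i. \<bar>w x * s i x - w x * f x\<bar>) \<longlonglongrightarrow> 0" by simp
        qed
        show "AE x in M. norm \<bar>w x * s i x - w x * f x\<bar> \<le> 3 * \<bar>w x * f x\<bar>" for i
        proof (rule AE_I2)
          fix x assume x: "x \<in> space M"
          show "norm \<bar>w x * s i x - w x * f x\<bar> \<le> 3 * \<bar>w x * f x\<bar>"
            using mult_left_mono[OF dom[OF x, of i] w0[of x]] w0[of x]
            by (simp add: abs_mult flip: right_diff_distrib)
        qed
      qed (use int[OF lim(1)] int[OF lim(4)] in auto)
      then have L1: "(\<lambda>i. \<integral>x. \<bar>w x * s i x - w x * f x\<bar> \<partial>M) \<longlonglongrightarrow> 0" by simp
      have "(\<lambda>i. ext e (\<lambda>x. w x * s i x)) \<longlonglongrightarrow> ext e (\<lambda>x. w x * f x)"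
        by (rule ext_cong_tendsto[OF e int[OF lim(1)] int[OF lim(4)] L1])
      moreover have "(\<lambda>i. \<integral>x. w x * s i x * n x \<partial>M) \<longlonglongrightarrow> (\<integral>x. w x * f x * n x \<partial>M)"
      proof (rule LIM_zero_cancel, rule Lim_null_comparison)
        have "norm ((\<integral>x. w x * s i x * n x \<partial>M) - (\<integral>x. w x * f x * n x \<partial>M)) \<le> 16 * (\<integral>x. \<bar>w x * s i x - w x * f x\<bar> \<partial>M)" for i
        proof -
          have "norm ((\<integral>x. w x * s i x * n x \<partial>M) - (\<integral>x. w x * f x * n x \<partial>M)) = norm (\<integral>x. w x * s i x * n x - w x * f x * n x \<partial>M)"
            using intn[OF lim(1)[of i]] intn[OF lim(4)] by simp
          also have "\<dots> \<le> (\<integral>x. 16 * \<bar>w x * s i x - w x * f x\<bar> \<partial>M)"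
          proof (rule Bochner_Integration.integral_norm_bound_integral)
            fix x
            have "norm (w x * s i x * n x - w x * f x * n x) = \<bar>w x * s i x - w x * f x\<bar> * \<bar>n x\<bar>"
              by (simp flip: left_diff_distrib abs_mult)
            also have "\<dots> \<le> \<bar>w x * s i x - w x * f x\<bar> * 16" by (intro mult_left_mono n) simp
            finally show "norm (w x * s i x * n x - w x * f x * n x) \<le> 16 * \<bar>w x * s i x - w x * f x\<bar>" by simp
          qed (use intn[OF lim(1)[of i]] intn[OF lim(4)] int[OF lim(1)[of i]] int[OF lim(4)] in auto)
          finally show ?thesis by simp
        qed
        then show "\<forall>\<^sub>F i in sequentially. norm ((\<integral>x. w x * s i x * n x \<partial>M) - (\<integral>x. w x * f x * n x \<partial>M)) \<le> 16 * (\<integral>x. \<bar>w x * s i x - w x * f x\<bar> \<partial>M)"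
          by simp
        show "(\<lambda>i. 16 * (\<integral>x. \<bar>w x * s i x - w x * f x\<bar> \<partial>M)) \<longlonglongrightarrow> 0"
          using tendsto_mult_right_zero[OF L1, of 16] by (simp add: mult.commute)
      qed
      ultimately show ?case using lim(5) LIMSEQ_unique by simp
    qed
  qed
  show ?thesis
  proof (rule that[OF n])
    fix \<phi> :: "'a \<Rightarrow> real" assume \<phi>: "test_fun W \<phi>"
    have out: "\<phi> x = 0" if "w x = 0" for x
      using that wpos[of x] \<phi> spt_subset_outside[of \<phi> W x] by (force simp: test_fun_def space_M)
    have eq: "w x * (\<phi> x / w x) = \<phi> x" for x using out[of x] by (cases "w x = 0") auto
    have m: "(\<lambda>x. \<phi> x / w x) \<in> borel_measurable M" using test_fun_measurable[OF \<phi>] by measurable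
    have "integrable M (\<lambda>x. w x *\<^sub>R (\<phi> x / w x))"
      unfolding real_scaleR_def eq by (rule test_fun_integrable[OF \<phi>])
    moreover have "integrable (density M (\<lambda>x. ennreal (w x))) (\<lambda>x. \<phi> x / w x) \<longleftrightarrow>
        integrable M (\<lambda>x. w x *\<^sub>R (\<phi> x / w x))"
      by (rule integrable_density[OF m]) (use w0 in auto)
    ultimately have "integrable (density M (\<lambda>x. ennreal (w x))) (\<lambda>x. \<phi> x / w x)" by (simp only:)
    from rep[OF this] show "S (\<lambda>x. \<phi> x *\<^sub>R e) = (\<integral>x. \<phi> x * n x \<partial>M)"
      unfolding eq ext_test_fun[OF e \<phi>] .
  qed
qed

text \<open>The densities in the coordinate directions combine to a bounded field \<eta> that
  represents S. The variation of S is then |\<eta>| M, but it is also M, so uniqueness of densities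
  gives |\<eta>| = 1 almost everywhere. Setting the field to 0 where its norm exceeds 1 makes the
  bound pointwise.\<close>

theorem polar_decomposition:
  obtains n where "n \<in> borel_measurable M" "\<And>x. norm (n x) \<le> 1" "AE x in M. norm (n x) = 1"
    "\<And>\<theta>. test_fun W \<theta> \<Longrightarrow> S \<theta> = (\<integral>x. \<theta> x \<bullet> n x \<partial>M)"
proof -
  have "\<exists>n. n \<in> borel_measurable M \<and> (\<forall>x. \<bar>n x\<bar> \<le> 16) \<and>
    (\<forall>\<phi>. test_fun W \<phi> \<longrightarrow> S (\<lambda>x. \<phi> x *\<^sub>R b) = (\<integral>x. \<phi> x * n x \<partial>M))" if "b \<in> Basis" for b
    using direction_density[of b] norm_Basis[OF that] by metis
  then obtain c where c: "\<And>b. b \<in> Basis \<Longrightarrow> c b \<in> borel_measurable M" "\<And>b x. b \<in> Basis \<Longrightarrow> \<bar>c b x\<bar> \<le> 16"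
    "\<And>b \<phi>. b \<in> Basis \<Longrightarrow> test_fun W \<phi> \<Longrightarrow> S (\<lambda>x. \<phi> x *\<^sub>R b) = (\<integral>x. \<phi> x * c b x \<partial>M)"
    by metis
  define \<eta> where "\<eta> x = (\<Sum>b\<in>Basis. c b x *\<^sub>R b)" for x
  have \<eta>: "\<eta> \<in> borel_measurable M" unfolding \<eta>_def
    by (intro borel_measurable_sum borel_measurable_scaleR c borel_measurable_const)
  define B where "B = (\<Sum>b\<in>(Basis::'b set). 16::real)"
  have B: "norm (\<eta> x) \<le> B" for x
    unfolding \<eta>_def B_def by (rule order_trans[OF norm_sum], intro sum_mono) (use c(2) in auto)
  have rep: "S \<theta> = (\<integral>x. \<theta> x \<bullet> \<eta> x \<partial>M)" if \<theta>: "test_fun W \<theta>" for \<theta>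
  proof -
    have comp: "test_fun W (\<lambda>x. \<theta> x \<bullet> b)" for b
      by (rule test_funI[of _ "spt \<theta>"])
        (use \<theta> smooth_inner[OF test_fun_smooth[OF \<theta>] smooth_const] in \<open>auto simp: test_fun_def spt_outside\<close>)
    have i: "integrable M (\<lambda>x. (\<theta> x \<bullet> b) * c b x)" if b: "b \<in> Basis" for b
      using bounded_mult_integrable[OF test_fun_integrable[OF comp[of b]] c(1)[OF b], of 16] c(2)[OF b] by simp
    have "S \<theta> = S (\<lambda>x. \<Sum>b\<in>Basis. (\<theta> x \<bullet> b) *\<^sub>R b)" by (simp add: euclidean_representation)
    also have "\<dots> = (\<Sum>b\<in>Basis. S (\<lambda>x. (\<theta> x \<bullet> b) *\<^sub>R b))"
      by (rule dist_linear_sum[OF S finite_Basis test_fun_scaleR_const(1)[OF comp]])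
    also have "\<dots> = (\<Sum>b\<in>Basis. \<integral>x. (\<theta> x \<bullet> b) * c b x \<partial>M)" using c(3) comp by simp
    also have "\<dots> = (\<integral>x. (\<Sum>b\<in>Basis. (\<theta> x \<bullet> b) * c b x) \<partial>M)"
      by (rule Bochner_Integration.integral_sum[symmetric]) (rule i)
    also have "\<dots> = (\<integral>x. \<theta> x \<bullet> \<eta> x \<partial>M)"
      by (intro Bochner_Integration.integral_cong refl) (simp add: \<eta>_def inner_sum_right mult.commute)
    finally show ?thesis .
  qed
  have fin: "(\<integral>\<^sup>+x\<in>K. norm (\<eta> x) \<partial>M) < \<infinity>" if K: "compact K" "K \<subseteq> W" for K
  proof -
    have "(\<integral>\<^sup>+x\<in>K. norm (\<eta> x) \<partial>M) \<le> (\<integral>\<^sup>+x. ennreal B * indicator K x \<partial>M)"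
      by (intro nn_integral_mono mult_right_mono ennreal_leI B) simp
    also have "\<dots> = ennreal B * emeasure M K" using compact_in_sets[OF K] by (simp add: nn_integral_cmult_indicator)
    also have "\<dots> < \<infinity>" using finite_on_compact[OF K] by (simp add: ennreal_mult_less_top)
    finally show ?thesis .
  qed
  interpret N: locally_finite W "density M (\<lambda>x. ennreal (norm (\<eta> x)))"
    using \<eta> fin by (intro locally_finite_density) auto
  have "variation W S = density M (\<lambda>x. ennreal (norm (\<eta> x)))"
  proof (rule N.variation_eqI)
    fix C assume C: "open C" "C \<subseteq> W"
    show "emeasure (density M (\<lambda>x. ennreal (norm (\<eta> x)))) C = open_variation W S C"
      using \<eta> open_in_sets[OF C]
      by (subst density_open_variation[OF \<eta> fin rep C]) (auto intro!: emeasure_density)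
  qed
  then have "density M (\<lambda>x. 1) = density M (\<lambda>x. ennreal (norm (\<eta> x)))" using var by (simp add: density_1)
  then have "AE x in M. 1 = ennreal (norm (\<eta> x))"
    using sigma_finite_measure.density_unique_iff[OF sigma_finite, of "\<lambda>x. 1" "\<lambda>x. ennreal (norm (\<eta> x))"] \<eta> by simp
  then have one: "AE x in M. norm (\<eta> x) = 1" by eventually_elim (metis ennreal_eq_1)
  define n where "n x = (if norm (\<eta> x) \<le> 1 then \<eta> x else 0)" for x
  have n\<eta>: "AE x in M. n x = \<eta> x" using one by eventually_elim (simp add: n_def)
  have n: "n \<in> borel_measurable M" unfolding n_def using \<eta> by measurable
  show ?thesis
  proof (rule that[OF n])
    show "norm (n x) \<le> 1" for x by (simp add: n_def)
    show "AE x in M. norm (n x) = 1" using one n\<eta> by eventually_elim simp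
    fix \<theta> :: "'a \<Rightarrow> 'b" assume \<theta>: "test_fun W \<theta>"
    show "S \<theta> = (\<integral>x. \<theta> x \<bullet> n x \<partial>M)"
      unfolding rep[OF \<theta>] using n\<eta> test_fun_measurable[OF \<theta>] \<eta> n
      by (intro integral_cong_AE borel_measurable_inner) auto
  qed
qed

end

section \<open>Disintegration over the real line\<close>

text \<open>If t in A is not interior, it cannot lie in the interval attached to another point of A.
  The intervals attached to the non-interior points are therefore disjoint, and there are only
  countably many of them; so A is open up to a countable set.\<close>

lemma right_open_borel:
  fixes A :: "real set"
  assumes "\<And>t. t \<in> A \<Longrightarrow> \<exists>d>0. {t..<t + d} \<subseteq> A"
  shows "A \<in> sets borel"
proof -
  obtain d where d: "\<And>t. t \<in> A \<Longrightarrow> 0 < d t \<and> {t..<t + d t} \<subseteq> A" using assms by metis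
  let ?I = "\<lambda>t. {t<..<t + d t}"
  have int: "?I t \<subseteq> interior A" if "t \<in> A" for t
  proof (rule interior_maximal)
    show "?I t \<subseteq> A" using d[OF that] by force
  qed simp
  have disj: "?I s \<inter> ?I t = {}" if "s \<in> A - interior A" "t \<in> A - interior A" "s \<noteq> t" for s t
  proof (rule ccontr)
    assume "?I s \<inter> ?I t \<noteq> {}"
    then have "t \<in> ?I s \<or> s \<in> ?I t" using that(3) by auto
    then show False using int that by blast
  qed
  have inj: "inj_on ?I (A - interior A)"
  proof (rule inj_onI, rule ccontr)
    fix s t assume st: "s \<in> A - interior A" "t \<in> A - interior A" "?I s = ?I t" "s \<noteq> t"
    have "?I s \<noteq> {}" using d[of s] st(1) by auto
    then show False using disj[OF st(1,2,4)] st(3) by auto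
  qed
  have "countable (?I ` (A - interior A))"
    by (rule countable_disjoint_open_subsets) (use disj in \<open>auto simp: pairwise_def disjnt_def\<close>)
  then have "countable (A - interior A)" using countable_image_inj_on inj by blast
  then have "A - interior A \<in> sets borel" by (intro sets.countable[OF borel_singleton[OF sets.empty_sets]])
  then have "interior A \<union> (A - interior A) \<in> sets borel"
    by (rule sets.Un[OF borel_open[OF open_interior]])
  moreover have "interior A \<union> (A - interior A) = A" using interior_subset by blast
  ultimately show ?thesis by simp
qed

text \<open>A strict lower bound at t persists a little to the right of t, so superlevel sets of the
  supremum are open to the right. The index set may be uncountable; it will be a set of test
  functions.\<close>

lemma Sup_right_continuous_borel:
  fixes g :: "'i \<Rightarrow> real \<Rightarrow> real"
  assumes "\<And>i t. i \<in> I \<Longrightarrow> continuous (at_right t) (g i)"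
  shows "(\<lambda>t. SUP i\<in>I. ennreal (g i t)) \<in> borel_measurable borel"
proof (rule borel_measurableI_greater)
  fix y :: ennreal
  have "{t. y < (SUP i\<in>I. ennreal (g i t))} \<in> sets borel"
  proof (rule right_open_borel)
    fix t assume "t \<in> {t. y < (SUP i\<in>I. ennreal (g i t))}"
    then obtain i where i: "i \<in> I" "y < ennreal (g i t)" by (auto simp: less_SUP_iff)
    have "((\<lambda>s. ennreal (g i s)) \<longlongrightarrow> ennreal (g i t)) (at_right t)"
      using assms[OF i(1), of t] by (intro tendsto_ennrealI) (simp add: continuous_within)
    then have "\<forall>\<^sub>F s in at_right t. y < ennreal (g i s)" by (rule order_tendstoD(1)[OF _ i(2)])
    then obtain b where b: "t < b" "\<And>s. t < s \<Longrightarrow> s < b \<Longrightarrow> y < ennreal (g i s)"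
      by (auto simp: eventually_at_right_field)
    have "y < (SUP i\<in>I. ennreal (g i s))" if "s \<in> {t..<t + (b - t)}" for s
    proof -
      have "y < ennreal (g i s)" using that b i(2) by (cases "s = t") auto
      also have "\<dots> \<le> (SUP i\<in>I. ennreal (g i s))" by (rule SUP_upper[OF i(1)])
      finally show ?thesis .
    qed
    then show "\<exists>d>0. {t..<t + d} \<subseteq> {t. y < (SUP i\<in>I. ennreal (g i t))}"
      using b(1) by (intro exI[of _ "b - t"]) auto
  qed
  then show "{t \<in> space borel. y < (SUP i\<in>I. ennreal (g i t))} \<in> sets borel" by simp
qed

lemma right_continuous_borel:
  fixes g :: "real \<Rightarrow> real"
  assumes "\<And>t. continuous (at_right t) g"
  shows "g \<in> borel_measurable borel"
proof -
  have 1: "(\<lambda>t. ennreal (g t)) \<in> borel_measurable borel"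
    using Sup_right_continuous_borel[of "{()}" "\<lambda>_. g"] assms by simp
  have 2: "(\<lambda>t. ennreal (- g t)) \<in> borel_measurable borel"
    using Sup_right_continuous_borel[of "{()}" "\<lambda>_ t. - g t"] continuous_minus[OF assms] by simp
  have "g = (\<lambda>t. enn2real (ennreal (g t)) - enn2real (ennreal (- g t)))"
  proof
    show "g t = enn2real (ennreal (g t)) - enn2real (ennreal (- g t))" for t
      by (cases "0 \<le> g t") (auto simp: ennreal_neg)
  qed
  also have "\<dots> \<in> borel_measurable borel" using 1 2 by measurable
  finally show ?thesis .
qed

locale open_exhaustion =
  fixes U :: "'a::euclidean_space set" and C :: "nat \<Rightarrow> 'a set"
  assumes open_U: "open U" and open_C: "\<And>n. open (C n)" and incseq_C: "incseq C"
    and UN_C: "(\<Union>n. C n) = U" and rel_compact: "\<And>n. \<exists>K. compact K \<and> C n \<subseteq> K \<and> K \<subseteq> U"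
    and absorb: "\<And>K. compact K \<Longrightarrow> K \<subseteq> U \<Longrightarrow> \<exists>n. K \<subseteq> C n"

lemma ex_open_exhaustion:
  assumes "open (U :: 'a::euclidean_space set)" shows "\<exists>C. open_exhaustion U C"
proof -
  obtain K where K: "\<And>n::nat. compact(K n)" "\<And>n. K n \<subseteq> U" "\<And>n. K n \<subseteq> interior(K(Suc n))"
    "\<Union>(range K) = U" "\<And>A. \<lbrakk>compact A; A \<subseteq> U\<rbrakk> \<Longrightarrow> \<exists>N. \<forall>n\<ge>N. A \<subseteq> (K n)"
    using open_Union_compact_subsets[OF assms] by metis
  have "open_exhaustion U (\<lambda>n. interior (K n))"
  proof
    show "incseq (\<lambda>n. interior (K n))"
      by (rule incseq_SucI) (rule subset_trans[OF interior_subset K(3)])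
    show "(\<Union>n. interior (K n)) = U"
    proof
      show "(\<Union>n. interior (K n)) \<subseteq> U" by (intro UN_least subset_trans[OF interior_subset K(2)])
      show "U \<subseteq> (\<Union>n. interior (K n))" using K(3,4) by blast
    qed
    show "\<exists>A. compact A \<and> interior (K n) \<subseteq> A \<and> A \<subseteq> U" for n
      by (intro exI[of _ "K n"] conjI K(1,2) interior_subset)
    fix A assume "compact A" "A \<subseteq> U"
    from K(5)[OF this] obtain N where "A \<subseteq> K N" by blast
    then show "\<exists>n. A \<subseteq> interior (K n)" using K(3)[of N] by blast
  qed (use assms in auto)
  then show ?thesis by blast
qed

context open_exhaustion
begin

lemma C_subset: "C n \<subseteq> U" using UN_C by blast

text \<open>A generator stable under intersections on which measures can be compared: D inside some
  \<open>C n\<close> keeps boxes of finite measure, and the half-open intervals are those over which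
  the slices are integrated.\<close>

definition boxes :: "('a \<times> real) set set" where
  "boxes = {D \<times> {a<..b} | D a b. open D \<and> (\<exists>n. D \<subseteq> C n)}"

lemma open_Times: "open (U \<times> (UNIV :: real set))"
  by (intro open_Times open_U open_UNIV)

lemma sets_prod: "sets (borel_of (top_of_set (U \<times> (UNIV :: real set)))) = sets (restrict_space borel (U \<times> UNIV))"
  by (rule sets_borel_of_top_of_set[OF open_Times])

lemma sets_prod_iff: "A \<in> sets (borel_of (top_of_set (U \<times> (UNIV :: real set)))) \<longleftrightarrow> A \<in> sets borel \<and> A \<subseteq> U \<times> UNIV"
  unfolding sets_prod by (subst sets_restrict_space_iff) (use open_Times in auto)

lemma sets_U_iff: "A \<in> sets (borel_of (top_of_set U)) \<longleftrightarrow> A \<in> sets borel \<and> A \<subseteq> U"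
  unfolding sets_borel_of_top_of_set[OF open_U] by (subst sets_restrict_space_iff) (use open_U in auto)

lemma sigma_boxes: "sets (borel_of (top_of_set (U \<times> (UNIV :: real set)))) = sigma_sets (U \<times> UNIV) boxes"
proof
  have "boxes \<subseteq> sets (borel_of (top_of_set (U \<times> (UNIV :: real set))))"
  proof
    fix X assume "X \<in> boxes"
    then obtain D a b n where X: "X = D \<times> {a<..b}" "open D" "D \<subseteq> C n" by (auto simp: boxes_def)
    have "D \<times> {a<..b} \<in> sets (borel \<Otimes>\<^sub>M borel)" using X(2) by (intro pair_measureI) auto
    then have "X \<in> sets borel" unfolding X(1) by (simp only: borel_prod)
    moreover have "X \<subseteq> U \<times> UNIV" using X C_subset[of n] by auto
    ultimately show "X \<in> sets (borel_of (top_of_set (U \<times> (UNIV :: real set))))"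
      by (simp only: sets_prod_iff)
  qed
  then show "sigma_sets (U \<times> UNIV) boxes \<subseteq> sets (borel_of (top_of_set (U \<times> (UNIV :: real set))))"
    using sets.sigma_sets_subset[of boxes "borel_of (top_of_set (U \<times> (UNIV :: real set)))"]
    by (simp add: space_borel_of)
  have "X \<in> sigma_sets (U \<times> UNIV) boxes" if X: "openin (top_of_set (U \<times> (UNIV :: real set))) X" for X
  proof -
    have oX: "open X" "X \<subseteq> U \<times> UNIV" using X open_Times by (auto simp: openin_open_eq)
    obtain B :: "'a set set" where B: "countable B" "topological_basis B" using ex_countable_basis by blast
    define \<F> where "\<F> = {(D, a, b). D \<in> B \<and> (\<exists>n. D \<subseteq> C n) \<and> a \<in> \<rat> \<and> b \<in> \<rat> \<and> D \<times> {a<..b} \<subseteq> X}"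
    have "\<F> \<subseteq> B \<times> \<rat> \<times> \<rat>" by (auto simp: \<F>_def)
    then have cF: "countable \<F>" using B(1) countable_rat by (meson countable_SIGMA countable_subset)
    have "X = (\<Union>(D, a, b)\<in>\<F>. D \<times> {a<..b})"
    proof
      show "(\<Union>(D, a, b)\<in>\<F>. D \<times> {a<..b}) \<subseteq> X" by (auto simp: \<F>_def)
      show "X \<subseteq> (\<Union>(D, a, b)\<in>\<F>. D \<times> {a<..b})"
      proof
        fix p assume p: "p \<in> X"
        obtain z t where zt: "p = (z, t)" by force
        obtain A I where AI: "open A" "open I" "p \<in> A \<times> I" "A \<times> I \<subseteq> X"
          using open_prod_elim[OF oX(1) p] by metis
        have "z \<in> U" using p zt oX(2) by auto
        then obtain n where n: "z \<in> C n" using UN_C by blast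
        have "open (A \<inter> C n)" "z \<in> A \<inter> C n" using AI zt n open_C by auto
        then obtain D where D: "D \<in> B" "z \<in> D" "D \<subseteq> A \<inter> C n"
          using topological_basisE[OF B(2)] by metis
        obtain e where e: "0 < e" "\<And>s. dist s t < e \<Longrightarrow> s \<in> I"
          using AI(2,3) zt unfolding open_dist by auto
        obtain a where a: "a \<in> \<rat>" "t - e < a" "a < t" using Rats_dense_in_real[of "t - e" t] e by auto
        obtain b where b: "b \<in> \<rat>" "t < b" "b < t + e" using Rats_dense_in_real[of t "t + e"] e by auto
        have "{a<..b} \<subseteq> I" using a b e(2) by (auto simp: dist_real_def)
        then have "D \<times> {a<..b} \<subseteq> X" using D(3) AI(4) by blast
        then have "(D, a, b) \<in> \<F>" using D a b by (auto simp: \<F>_def)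
        moreover have "p \<in> D \<times> {a<..b}" using zt D a b by auto
        ultimately show "p \<in> (\<Union>(D, a, b)\<in>\<F>. D \<times> {a<..b})" by blast
      qed
    qed
    moreover have "D \<times> {a<..b} \<in> sigma_sets (U \<times> UNIV) boxes" if "(D, a, b) \<in> \<F>" for D a b
      using that topological_basis_open[OF B(2)] by (intro sigma_sets.Basic) (auto simp: boxes_def \<F>_def)
    ultimately show ?thesis
      using sigma_sets_UNION[OF countable_image[OF cF], of "\<lambda>(D, a, b). D \<times> {a<..b}" "U \<times> UNIV" boxes]
      by fastforce
  qed
  then show "sets (borel_of (top_of_set (U \<times> (UNIV :: real set)))) \<subseteq> sigma_sets (U \<times> UNIV) boxes"
    unfolding sets_borel_of topspace_euclidean_subtopology by (intro sigma_sets_mono) auto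
qed

lemma Int_stable_boxes: "Int_stable boxes"
proof (rule Int_stableI)
  fix X Y assume "X \<in> boxes" "Y \<in> boxes"
  then obtain D a b n D' a' b' where "X = D \<times> {a<..b}" "open D" "D \<subseteq> C n" "Y = D' \<times> {a'<..b'}" "open D'"
    by (auto simp: boxes_def)
  then show "X \<inter> Y \<in> boxes"
    unfolding boxes_def
    by (intro CollectI exI[of _ "D \<inter> D'"] exI[of _ "max a a'"] exI[of _ "min b b'"]) auto
qed

lemma section_sets:
  assumes "A \<in> sets (borel_of (top_of_set (U \<times> (UNIV :: real set))))"
  shows "{z. (z, t) \<in> A} \<in> sets (borel_of (top_of_set U))"
proof -
  have A: "A \<in> sets borel" "A \<subseteq> U \<times> UNIV" using assms sets_prod_iff by auto
  have "(\<lambda>z. (z, t)) \<in> borel_measurable borel"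
    by (intro borel_measurable_continuous_onI continuous_intros)
  from measurable_sets[OF this A(1)] A(2) show ?thesis by (auto simp: sets_U_iff vimage_def)
qed

end

text \<open>The kernel is to be finite on each \<open>C n\<close> for every t, not merely for almost
  every t, so that measures of sections can be subtracted. The identity is assumed only on boxes
  with open base, where variations are computable.\<close>

locale disintegration = open_exhaustion U C + Mu: locally_finite "U \<times> (UNIV :: real set)" \<mu>
  for U :: "'a::euclidean_space set" and C \<mu> +
  fixes \<kappa> :: "real \<Rightarrow> 'a measure"
  assumes sets_\<kappa>: "\<And>t. sets (\<kappa> t) = sets (borel_of (top_of_set U))"
    and finite_\<kappa>: "\<And>t n. emeasure (\<kappa> t) (C n) < \<infinity>"
    and measurable_\<kappa>: "\<And>D n. open D \<Longrightarrow> D \<subseteq> C n \<Longrightarrow> (\<lambda>t. emeasure (\<kappa> t) D) \<in> borel_measurable borel"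
    and box_\<kappa>: "\<And>D n a b. open D \<Longrightarrow> D \<subseteq> C n \<Longrightarrow> a < b \<Longrightarrow>
      (\<integral>\<^sup>+t\<in>{a<..b}. emeasure (\<kappa> t) D \<partial>lborel) = emeasure \<mu> (D \<times> {a<..b})"
begin

lemma C_sets: "C n \<in> sets (\<kappa> t)" using open_C C_subset by (simp add: sets_\<kappa> sets_U_iff)

lemma slice_sets: "A \<in> sets \<mu> \<Longrightarrow> {z. (z, t) \<in> A} \<in> sets (\<kappa> t)"
  using section_sets by (simp add: sets_\<kappa> Mu.sets_M)

text \<open>Cutting with \<open>C n\<close> keeps the measures finite, which the step for
  complements needs; the full section is recovered as an increasing limit.\<close>

lemma emeasure_section_C_measurable:
  assumes "A \<in> sets \<mu>"
  shows "(\<lambda>t. emeasure (\<kappa> t) ({z. (z, t) \<in> A} \<inter> C n)) \<in> borel_measurable borel"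
proof -
  have A: "A \<in> sigma_sets (U \<times> UNIV) boxes" using assms Mu.sets_M sigma_boxes by simp
  have sub: "boxes \<subseteq> Pow (U \<times> UNIV)" using C_subset by (fastforce simp: boxes_def)
  have conv: "X \<in> sets \<mu>" if "X \<in> sigma_sets (U \<times> UNIV) boxes" for X
    using that Mu.sets_M sigma_boxes by simp
  show ?thesis using Int_stable_boxes sub A
  proof (induction rule: sigma_sets_induct_disjoint)
    case (basic X)
    then obtain D a b k where X: "X = D \<times> {a<..b}" "open D" "D \<subseteq> C k" by (auto simp: boxes_def)
    have "emeasure (\<kappa> t) ({z. (z, t) \<in> X} \<inter> C n) = emeasure (\<kappa> t) (D \<inter> C n) * indicator {a<..b} t" for t
      using X by (auto simp: indicator_def)
    moreover have "(\<lambda>t. emeasure (\<kappa> t) (D \<inter> C n)) \<in> borel_measurable borel"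
      using X open_C by (intro measurable_\<kappa>[of _ n]) auto
    ultimately show ?case by simp
  next
    case empty
    show ?case by simp
  next
    case (compl X)
    have "emeasure (\<kappa> t) ({z. (z, t) \<in> U \<times> UNIV - X} \<inter> C n) =
        emeasure (\<kappa> t) (C n) - emeasure (\<kappa> t) ({z. (z, t) \<in> X} \<inter> C n)" for t
    proof -
      have "{z. (z, t) \<in> U \<times> UNIV - X} \<inter> C n = C n - ({z. (z, t) \<in> X} \<inter> C n)" using C_subset by blast
      moreover have "{z. (z, t) \<in> X} \<inter> C n \<in> sets (\<kappa> t)"
        by (intro sets.Int slice_sets conv compl(1) C_sets)
      moreover have "emeasure (\<kappa> t) ({z. (z, t) \<in> X} \<inter> C n) \<noteq> \<infinity>"
      proof -
        have "emeasure (\<kappa> t) ({z. (z, t) \<in> X} \<inter> C n) \<le> emeasure (\<kappa> t) (C n)"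
          by (rule emeasure_mono[OF Int_lower2 C_sets])
        then show ?thesis using finite_\<kappa>[of t n] by (auto simp: top_unique)
      qed
      ultimately show ?thesis using C_sets by (simp add: emeasure_Diff)
    qed
    moreover have "(\<lambda>t. emeasure (\<kappa> t) (C n)) \<in> borel_measurable borel"
      by (rule measurable_\<kappa>[OF open_C order_refl])
    ultimately show ?case using compl(2) by simp
  next
    case (union X)
    have "emeasure (\<kappa> t) ({z. (z, t) \<in> (\<Union>i. X i)} \<inter> C n) = (\<Sum>i. emeasure (\<kappa> t) ({z. (z, t) \<in> X i} \<inter> C n))" for t
    proof -
      have "{z. (z, t) \<in> (\<Union>i. X i)} \<inter> C n = (\<Union>i. {z. (z, t) \<in> X i} \<inter> C n)" by blast
      moreover have "range (\<lambda>i. {z. (z, t) \<in> X i} \<inter> C n) \<subseteq> sets (\<kappa> t)"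
        using union(2) by (auto intro!: sets.Int slice_sets conv C_sets)
      moreover have "disjoint_family (\<lambda>i. {z. (z, t) \<in> X i} \<inter> C n)"
        using union(1) by (fastforce simp: disjoint_family_on_def)
      ultimately show ?thesis by (simp add: suminf_emeasure)
    qed
    then show ?case using union(3) by simp
  qed
qed

lemma emeasure_section_measurable:
  assumes A: "A \<in> sets \<mu>"
  shows "(\<lambda>t. emeasure (\<kappa> t) {z. (z, t) \<in> A}) \<in> borel_measurable borel"
proof -
  have "emeasure (\<kappa> t) {z. (z, t) \<in> A} = (SUP n. emeasure (\<kappa> t) ({z. (z, t) \<in> A} \<inter> C n))" for t
  proof -
    have "{z. (z, t) \<in> A} \<subseteq> U" using A Mu.sets_M sets_prod_iff by auto
    then have "{z. (z, t) \<in> A} = (\<Union>n. {z. (z, t) \<in> A} \<inter> C n)" using UN_C by blast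
    moreover have "(SUP n. emeasure (\<kappa> t) ({z. (z, t) \<in> A} \<inter> C n)) = emeasure (\<kappa> t) (\<Union>n. {z. (z, t) \<in> A} \<inter> C n)"
    proof (rule SUP_emeasure_incseq)
      show "range (\<lambda>n. {z. (z, t) \<in> A} \<inter> C n) \<subseteq> sets (\<kappa> t)"
        by (auto intro!: sets.Int slice_sets A C_sets)
      show "incseq (\<lambda>n. {z. (z, t) \<in> A} \<inter> C n)" using incseq_C by (auto simp: incseq_def)
    qed
    ultimately show ?thesis by simp
  qed
  then show ?thesis using emeasure_section_C_measurable[OF A] by simp
qed

text \<open>The right side is itself a measure in A. The two measures agree on boxes and are finite
  on an exhausting sequence of boxes, hence are equal.\<close>

lemma emeasure_eq_nn_integral:
  assumes A: "A \<in> sets \<mu>"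
  shows "emeasure \<mu> A = (\<integral>\<^sup>+t. emeasure (\<kappa> t) {z. (z, t) \<in> A} \<partial>lborel)"
proof -
  define \<mu>' where "\<mu>' = measure_of (space \<mu>) (sets \<mu>) (\<lambda>A. \<integral>\<^sup>+t. emeasure (\<kappa> t) {z. (z, t) \<in> A} \<partial>lborel)"
  have ca: "countably_additive (sets \<mu>) (\<lambda>A. \<integral>\<^sup>+t. emeasure (\<kappa> t) {z. (z, t) \<in> A} \<partial>lborel)"
  proof (rule countably_additiveI)
    fix X :: "nat \<Rightarrow> _" assume X: "range X \<subseteq> sets \<mu>" "disjoint_family X" "(\<Union>i. X i) \<in> sets \<mu>"
    have Xi: "X i \<in> sets \<mu>" for i using X(1) by blast
    have "(\<Sum>i. \<integral>\<^sup>+t. emeasure (\<kappa> t) {z. (z, t) \<in> X i} \<partial>lborel) = (\<integral>\<^sup>+t. (\<Sum>i. emeasure (\<kappa> t) {z. (z, t) \<in> X i}) \<partial>lborel)"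
      using emeasure_section_measurable[OF Xi] by (intro nn_integral_suminf[symmetric]) simp
    also have "\<dots> = (\<integral>\<^sup>+t. emeasure (\<kappa> t) {z. (z, t) \<in> (\<Union>i. X i)} \<partial>lborel)"
    proof (rule nn_integral_cong)
      fix t
      have "{z. (z, t) \<in> (\<Union>i. X i)} = (\<Union>i. {z. (z, t) \<in> X i})" by blast
      moreover have "range (\<lambda>i. {z. (z, t) \<in> X i}) \<subseteq> sets (\<kappa> t)" using slice_sets[OF Xi] by blast
      moreover have "disjoint_family (\<lambda>i. {z. (z, t) \<in> X i})"
        using X(2) by (fastforce simp: disjoint_family_on_def)
      ultimately show "(\<Sum>i. emeasure (\<kappa> t) {z. (z, t) \<in> X i}) = emeasure (\<kappa> t) {z. (z, t) \<in> (\<Union>i. X i)}"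
        by (simp add: suminf_emeasure)
    qed
    finally show "(\<Sum>i. \<integral>\<^sup>+t. emeasure (\<kappa> t) {z. (z, t) \<in> X i} \<partial>lborel) =
        (\<integral>\<^sup>+t. emeasure (\<kappa> t) {z. (z, t) \<in> (\<Union>i. X i)} \<partial>lborel)" .
  qed
  have sets': "sets \<mu>' = sets \<mu>" unfolding \<mu>'_def by simp
  have em: "emeasure \<mu>' X = (\<integral>\<^sup>+t. emeasure (\<kappa> t) {z. (z, t) \<in> X} \<partial>lborel)" if "X \<in> sets \<mu>" for X
    unfolding \<mu>'_def using that ca
    by (intro emeasure_measure_of_sigma sets.sigma_algebra_axioms) (auto simp: positive_def)
  have box: "emeasure \<mu> X = emeasure \<mu>' X" if "X \<in> boxes" for X
  proof -
    obtain D a b n where X: "X = D \<times> {a<..b}" "open D" "D \<subseteq> C n" using \<open>X \<in> boxes\<close> by (auto simp: boxes_def)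
    have "X \<in> sets \<mu>" using that Mu.sets_M sigma_boxes by (simp add: sigma_sets.Basic)
    then have "emeasure \<mu>' X = (\<integral>\<^sup>+t. emeasure (\<kappa> t) {z. (z, t) \<in> X} \<partial>lborel)" by (rule em)
    also have "\<dots> = (\<integral>\<^sup>+t\<in>{a<..b}. emeasure (\<kappa> t) D \<partial>lborel)"
      using X by (intro nn_integral_cong) (auto simp: indicator_def)
    also have "\<dots> = emeasure \<mu> X"
    proof (cases "a < b")
      case True
      then show ?thesis using box_\<kappa>[OF X(2,3)] X(1) by simp
    qed (use X(1) in simp)
    finally show ?thesis ..
  qed
  have "\<mu> = \<mu>'"
  proof (rule measure_eqI_generator_eq[OF Int_stable_boxes, of "U \<times> UNIV"])
    show "boxes \<subseteq> Pow (U \<times> UNIV)" using C_subset by (fastforce simp: boxes_def)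
    show "sets \<mu> = sigma_sets (U \<times> UNIV) boxes" using Mu.sets_M sigma_boxes by simp
    then show "sets \<mu>' = sigma_sets (U \<times> UNIV) boxes" using sets' by simp
    let ?B = "\<lambda>i::nat. C i \<times> {- real i<..real i}"
    show "range ?B \<subseteq> boxes" using open_C by (auto simp: boxes_def)
    show "(\<Union>i. ?B i) = U \<times> UNIV"
    proof
      show "(\<Union>i. ?B i) \<subseteq> U \<times> UNIV" using C_subset by blast
      show "U \<times> UNIV \<subseteq> (\<Union>i. ?B i)"
      proof
        fix p assume "p \<in> U \<times> (UNIV :: real set)"
        then obtain z t where p: "p = (z, t)" "z \<in> U" by auto
        obtain n where n: "z \<in> C n" using p UN_C by blast
        obtain k where k: "\<bar>t\<bar> < real k" using reals_Archimedean2 by blast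
        have "z \<in> C (max n k)" using n incseqD[OF incseq_C, of n "max n k"] by auto
        moreover have "t \<in> {- real (max n k)<..real (max n k)}" using k by auto
        ultimately show "p \<in> (\<Union>i. ?B i)" using p by blast
      qed
    qed
    show "emeasure \<mu> (?B i) \<noteq> \<infinity>" for i
    proof -
      obtain K where K: "compact K" "C i \<subseteq> K" "K \<subseteq> U" using rel_compact by blast
      have K': "compact (K \<times> {- real i..real i})" "K \<times> {- real i..real i} \<subseteq> U \<times> UNIV"
        using K by (auto intro: compact_Times)
      have "emeasure \<mu> (?B i) \<le> emeasure \<mu> (K \<times> {- real i..real i})"
        using K by (intro emeasure_mono Mu.compact_in_sets K') auto
      also have "\<dots> < \<infinity>" by (rule Mu.finite_on_compact[OF K'])
      finally show ?thesis by simp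
    qed
  qed (rule box)
  then show ?thesis using em[OF A] by simp
qed

lemma nn_integral_disintegration:
  assumes g: "g \<in> borel_measurable \<mu>"
  shows "(\<lambda>t. \<integral>\<^sup>+z. g (z, t) \<partial>\<kappa> t) \<in> borel_measurable borel \<and>
    (\<integral>\<^sup>+p. g p \<partial>\<mu>) = (\<integral>\<^sup>+t. (\<integral>\<^sup>+z. g (z, t) \<partial>\<kappa> t) \<partial>lborel)"
proof -
  have slice: "(\<lambda>z. h (z, t)) \<in> borel_measurable (\<kappa> t)" if "h \<in> borel_measurable \<mu>" for h :: "_ \<Rightarrow> ennreal" and t
  proof -
    have sp: "space (\<kappa> t) = U" using sets_eq_imp_space_eq[OF sets_\<kappa>] by (simp add: space_borel_of)
    have "(\<lambda>z. (z, t)) \<in> measurable (\<kappa> t) \<mu>"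
    proof (rule measurableI)
      show "(z, t) \<in> space \<mu>" if "z \<in> space (\<kappa> t)" for z using that sp Mu.space_M by simp
      fix A assume A: "A \<in> sets \<mu>"
      have "(\<lambda>z. (z, t)) -` A \<inter> space (\<kappa> t) = {z. (z, t) \<in> A}"
        using A sp Mu.sets_iff[of A] by auto
      then show "(\<lambda>z. (z, t)) -` A \<inter> space (\<kappa> t) \<in> sets (\<kappa> t)" using slice_sets[OF A] by simp
    qed
    then show ?thesis using that by simp
  qed
  have spU: "space (\<kappa> t) = U" for t using sets_eq_imp_space_eq[OF sets_\<kappa>] by (simp add: space_borel_of)
  have plus: "(\<lambda>t. p t + q t) \<in> borel_measurable borel"
    if "p \<in> borel_measurable borel" "q \<in> borel_measurable borel" for p q :: "real \<Rightarrow> ennreal"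
    using that by measurable
  have times: "(\<lambda>t. c * p t) \<in> borel_measurable borel"
    if "p \<in> borel_measurable borel" for p :: "real \<Rightarrow> ennreal" and c
    using that by measurable
  show ?thesis using g
  proof (induction rule: borel_measurable_induct)
    case (cong f g)
    have "(\<integral>\<^sup>+z. f (z, t) \<partial>\<kappa> t) = (\<integral>\<^sup>+z. g (z, t) \<partial>\<kappa> t)" for t
      using cong(3) by (intro nn_integral_cong) (auto simp: spU Mu.space_M)
    moreover have "(\<integral>\<^sup>+p. f p \<partial>\<mu>) = (\<integral>\<^sup>+p. g p \<partial>\<mu>)" using cong(3) by (rule nn_integral_cong)
    ultimately show ?case using cong(4) by simp
  next
    case (set A)
    have "(\<integral>\<^sup>+z. indicator A (z, t) \<partial>\<kappa> t) = emeasure (\<kappa> t) {z. (z, t) \<in> A}" for t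
    proof -
      have "(\<integral>\<^sup>+z. indicator A (z, t) \<partial>\<kappa> t) = (\<integral>\<^sup>+z. indicator {z. (z, t) \<in> A} z \<partial>\<kappa> t)"
        by (intro nn_integral_cong) (simp add: indicator_def)
      then show ?thesis using slice_sets[OF set] by simp
    qed
    then show ?case using emeasure_section_measurable[OF set] emeasure_eq_nn_integral[OF set] set by simp
  next
    case (mult u c)
    then have "(\<lambda>t. \<integral>\<^sup>+z. u (z, t) \<partial>\<kappa> t) \<in> borel_measurable borel" by blast
    then have "(\<lambda>t. c * (\<integral>\<^sup>+z. u (z, t) \<partial>\<kappa> t)) \<in> borel_measurable borel" by (rule times)
    then show ?case using mult slice[OF mult(2)] by (simp add: nn_integral_cmult)
  next
    case (add u v)
    have 1: "(\<lambda>t. \<integral>\<^sup>+z. u (z, t) \<partial>\<kappa> t) \<in> borel_measurable borel"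
      and 2: "(\<lambda>t. \<integral>\<^sup>+z. v (z, t) \<partial>\<kappa> t) \<in> borel_measurable borel" using add by blast+
    have "(\<lambda>t. (\<integral>\<^sup>+z. v (z, t) \<partial>\<kappa> t) + (\<integral>\<^sup>+z. u (z, t) \<partial>\<kappa> t)) \<in> borel_measurable borel"
      by (rule plus[OF 2 1])
    with add slice[OF add(1)] slice[OF add(3)] show ?case by (simp add: nn_integral_add)
  next
    case (seq F)
    have inc: "incseq (\<lambda>i z. F i (z, t))" for t using seq(3) by (auto simp: incseq_def le_fun_def)
    have eq: "(\<integral>\<^sup>+z. (SUP i. F i) (z, t) \<partial>\<kappa> t) = (SUP i. \<integral>\<^sup>+z. F i (z, t) \<partial>\<kappa> t)" for t
      using nn_integral_monotone_convergence_SUP[OF inc slice[OF seq(1)], of t] by (simp add: image_comp)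
    have inc2: "incseq (\<lambda>i t. \<integral>\<^sup>+z. F i (z, t) \<partial>\<kappa> t)"
      using inc by (auto simp: incseq_def le_fun_def intro!: nn_integral_mono)
    have "(\<integral>\<^sup>+p. (SUP i. F i) p \<partial>\<mu>) = (SUP i. \<integral>\<^sup>+p. F i p \<partial>\<mu>)"
      using nn_integral_monotone_convergence_SUP[OF seq(3,1)] by (simp add: image_comp)
    also have "\<dots> = (SUP i. \<integral>\<^sup>+t. (\<integral>\<^sup>+z. F i (z, t) \<partial>\<kappa> t) \<partial>lborel)" using seq(5) by simp
    also have "\<dots> = (\<integral>\<^sup>+t. (SUP i. \<integral>\<^sup>+z. F i (z, t) \<partial>\<kappa> t) \<partial>lborel)"
      using seq(5) by (intro nn_integral_monotone_convergence_SUP[OF inc2, symmetric]) auto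
    finally have "(\<integral>\<^sup>+p. (SUP i. F i) p \<partial>\<mu>) = (\<integral>\<^sup>+t. (SUP i. \<integral>\<^sup>+z. F i (z, t) \<partial>\<kappa> t) \<partial>lborel)" .
    moreover have "(\<lambda>t. SUP i. \<integral>\<^sup>+z. F i (z, t) \<partial>\<kappa> t) \<in> borel_measurable borel"
      using seq(5) by (intro borel_measurable_SUP) auto
    ultimately show ?case unfolding eq by blast
  qed
qed

end

section \<open>Slicing a vector valued measure by a real function\<close>

lemma ennreal_integral_le: "ennreal (\<integral>x. f x \<partial>M) \<le> (\<integral>\<^sup>+x. ennreal (f x) \<partial>M)"
proof (cases "integrable M f")
  case True
  have "(\<integral>x. f x \<partial>M) \<le> enn2real (\<integral>\<^sup>+x. ennreal (f x) \<partial>M)"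
    unfolding real_lebesgue_integral_def[OF True] by simp
  then have "ennreal (\<integral>x. f x \<partial>M) \<le> ennreal (enn2real (\<integral>\<^sup>+x. ennreal (f x) \<partial>M))" by (rule ennreal_leI)
  also have "\<dots> = (\<integral>\<^sup>+x. ennreal (f x) \<partial>M)"
  proof (rule ennreal_enn2real)
    have "(\<integral>\<^sup>+x. ennreal (f x) \<partial>M) \<le> (\<integral>\<^sup>+x. ennreal (norm (f x)) \<partial>M)"
      by (intro nn_integral_mono ennreal_leI) simp
    also have "\<dots> < top" using True by (simp add: integrable_iff_bounded)
    finally show "(\<integral>\<^sup>+x. ennreal (f x) \<partial>M) < top" .
  qed
  finally show ?thesis .
qed (simp add: not_integrable_integral_eq)

lemma (in open_exhaustion) box_borel:
  fixes D :: "'a set"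
  assumes "open D" shows "D \<times> {a<..b::real} \<in> sets borel"
proof -
  have "D \<times> {a<..b} \<in> sets (borel \<Otimes>\<^sub>M borel)" using assms by (intro pair_measureI) auto
  then show ?thesis by (simp only: borel_prod)
qed

text \<open>All that the slicing argument uses about the varifold: M stands for the weight, F for
  the gradient, \<open>S t\<close> for V \<partial>E(t), and \<open>S_integral\<close> is the
  identity that ties the slices to the gradient.\<close>

locale coarea_slices = open_exhaustion U C + M: locally_finite U M
  for U :: "'a::euclidean_space set" and C M +
  fixes f :: "'a \<Rightarrow> real" and F :: "'a \<Rightarrow> 'b::euclidean_space"
    and S :: "real \<Rightarrow> ('a \<Rightarrow> 'b) \<Rightarrow> real" and T :: "('a \<times> real \<Rightarrow> 'b) \<Rightarrow> real"
  assumes f [measurable]: "f \<in> borel_measurable M" and F [measurable]: "F \<in> borel_measurable M"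
    and fin: "\<And>K s. compact K \<Longrightarrow> K \<subseteq> U \<Longrightarrow>
      (\<integral>\<^sup>+z\<in>K \<inter> {z. \<bar>f z\<bar> \<le> s}. norm (F z) \<partial>M) < \<infinity>"
    and S_linear: "\<And>t. dist_linear U (S t)"
    and S_right: "\<And>\<theta> t. test_fun U \<theta> \<Longrightarrow> continuous (at_right t) (\<lambda>t. S t \<theta>)"
    and S_integrable: "\<And>\<theta> a b. test_fun U \<theta> \<Longrightarrow> a < b \<Longrightarrow> set_integrable lborel {a<..b} (\<lambda>t. S t \<theta>)"
    and S_integral: "\<And>\<theta> a b. test_fun U \<theta> \<Longrightarrow> a < b \<Longrightarrow>
      (LINT t:{a<..b}|lborel. S t \<theta>) = (\<integral>z. indicator {a<..b} (f z) * (\<theta> z \<bullet> F z) \<partial>M)"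
    and T_eq: "\<And>\<psi>. test_fun (U \<times> UNIV) \<psi> \<Longrightarrow> T \<psi> = (\<integral>z. \<psi> (z, f z) \<bullet> F z \<partial>M)"
begin

abbreviation N :: "'a measure" where "N \<equiv> density M (\<lambda>z. ennreal (norm (F z)))"

definition \<mu> :: "('a \<times> real) measure" where
  "\<mu> = distr N (borel_of (top_of_set (U \<times> UNIV))) (\<lambda>z. (z, f z))"

lemma graph_measurable: "(\<lambda>z. (z, f z)) \<in> measurable N (borel_of (top_of_set (U \<times> UNIV)))"
proof -
  have "(\<lambda>z. (z, f z)) \<in> measurable M (borel \<Otimes>\<^sub>M borel)"
    using M.measurable_M[OF measurable_ident] f by (intro measurable_Pair) (auto simp: id_def)
  then have "(\<lambda>z. (z, f z)) \<in> measurable M (restrict_space borel (U \<times> UNIV))"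
    by (intro measurable_restrict_space2) (auto simp: M.space_M borel_prod)
  then show ?thesis using measurable_cong_sets[OF _ sets_prod, of N M] by simp
qed

lemma graph_measurable_M: "(\<lambda>z. (z, f z)) \<in> measurable M (borel_of (top_of_set (U \<times> UNIV)))"
  using graph_measurable by simp

lemma emeasure_\<mu>:
  assumes "A \<in> sets (borel_of (top_of_set (U \<times> UNIV)))"
  shows "emeasure \<mu> A = (\<integral>\<^sup>+z. ennreal (norm (F z)) * indicator A (z, f z) \<partial>M)"
proof -
  have m: "(\<lambda>z. (z, f z)) -` A \<inter> space N \<in> sets N" by (rule measurable_sets[OF graph_measurable assms])
  have "emeasure \<mu> A = emeasure N ((\<lambda>z. (z, f z)) -` A \<inter> space N)"
    unfolding \<mu>_def by (rule emeasure_distr[OF graph_measurable assms])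
  also have "\<dots> = (\<integral>\<^sup>+z. ennreal (norm (F z)) * indicator ((\<lambda>z. (z, f z)) -` A \<inter> space N) z \<partial>M)"
    using m by (intro emeasure_density) auto
  also have "\<dots> = (\<integral>\<^sup>+z. ennreal (norm (F z)) * indicator A (z, f z) \<partial>M)"
    by (intro nn_integral_cong) (auto simp: indicator_def)
  finally show ?thesis .
qed

lemma sets_\<mu>: "sets \<mu> = sets (borel_of (top_of_set (U \<times> UNIV)))" by (simp add: \<mu>_def)

definition n where "n p = sgn (F (fst p))" for p :: "'a \<times> real"

lemma fst_measurable: "fst \<in> measurable \<mu> M"
proof -
  have "fst \<in> measurable (restrict_space borel (U \<times> (UNIV :: real set))) (restrict_space borel U)"
  proof (rule measurable_restrict_space2)
    show "fst \<in> space (restrict_space borel (U \<times> (UNIV :: real set))) \<rightarrow> U" by (auto simp: space_restrict_space)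
    have "(fst :: 'a \<times> real \<Rightarrow> 'a) \<in> borel_measurable borel"
      by (intro borel_measurable_continuous_onI continuous_intros)
    then show "fst \<in> borel_measurable (restrict_space borel (U \<times> (UNIV :: real set)))"
      by (rule measurable_restrict_space1)
  qed
  then show ?thesis
    using measurable_cong_sets[OF sets_\<mu>[unfolded sets_prod] M.sets_M'] by simp
qed

lemma n_measurable: "n \<in> borel_measurable \<mu>"
proof -
  have [measurable]: "(\<lambda>p. F (fst p)) \<in> borel_measurable \<mu>" by (rule measurable_compose[OF fst_measurable F])
  show ?thesis unfolding n_def sgn_div_norm by measurable
qed

lemma norm_n: "norm (n p) \<le> 1" by (simp add: n_def M.norm_sgn_le_1)

lemma AE_norm_n: "AE p in \<mu>. norm (n p) = 1"
proof -
  have "AE z in N. norm (n (z, f z)) = 1" using M.AE_density_norm_sgn[OF F] by (simp add: n_def)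
  moreover have "{p \<in> space (borel_of (top_of_set (U \<times> UNIV))). norm (n p) = 1} \<in> sets (borel_of (top_of_set (U \<times> (UNIV :: real set))))"
  proof -
    have "n \<in> borel_measurable (borel_of (top_of_set (U \<times> (UNIV :: real set))))"
      using n_measurable unfolding measurable_cong_sets[OF sets_\<mu> refl] .
    then show ?thesis by measurable
  qed
  ultimately show ?thesis unfolding \<mu>_def using AE_distr_iff[OF graph_measurable] by simp
qed

sublocale Mu: locally_finite "U \<times> (UNIV :: real set)" \<mu>
proof
  show "open (U \<times> (UNIV :: real set))" by (rule open_Times)
  show "sets \<mu> = sets (borel_of (top_of_set (U \<times> UNIV)))" by (rule sets_\<mu>)
  fix K assume K: "compact K" "K \<subseteq> U \<times> (UNIV :: real set)"
  have KU: "compact (fst ` K)" "fst ` K \<subseteq> U"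
    using K by (auto intro!: compact_continuous_image continuous_intros)
  have "compact (snd ` K)" using K by (auto intro!: compact_continuous_image continuous_intros)
  then obtain s where s: "\<And>t. t \<in> snd ` K \<Longrightarrow> \<bar>t\<bar> \<le> s"
    using compact_imp_bounded bounded_iff real_norm_def by metis
  have "K \<in> sets (borel_of (top_of_set (U \<times> UNIV)))" using K by (simp add: sets_prod_iff compact_imp_closed)
  then have "emeasure \<mu> K = (\<integral>\<^sup>+z. ennreal (norm (F z)) * indicator K (z, f z) \<partial>M)" by (rule emeasure_\<mu>)
  also have "\<dots> \<le> (\<integral>\<^sup>+z\<in>fst ` K \<inter> {z. \<bar>f z\<bar> \<le> s}. norm (F z) \<partial>M)"
    using s by (intro nn_integral_mono) (force simp: indicator_def)
  also have "\<dots> < \<infinity>" by (rule fin[OF KU])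
  finally show "emeasure \<mu> K < \<infinity>" .
qed

lemma integral_\<mu>:
  fixes \<psi> :: "'a \<times> real \<Rightarrow> 'b"
  assumes "\<psi> \<in> borel_measurable \<mu>"
  shows "(\<integral>p. \<psi> p \<bullet> n p \<partial>\<mu>) = (\<integral>z. \<psi> (z, f z) \<bullet> F z \<partial>M)"
proof -
  have m: "\<psi> \<in> borel_measurable (borel_of (top_of_set (U \<times> UNIV)))" "n \<in> borel_measurable (borel_of (top_of_set (U \<times> UNIV)))"
    using assms n_measurable unfolding measurable_cong_sets[OF sets_\<mu> refl] by auto
  have m2: "(\<lambda>z. \<psi> (z, f z)) \<in> borel_measurable M" by (rule measurable_compose[OF graph_measurable_M m(1)])
  have "(\<integral>p. \<psi> p \<bullet> n p \<partial>\<mu>) = (\<integral>z. \<psi> (z, f z) \<bullet> n (z, f z) \<partial>N)"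
    unfolding \<mu>_def by (rule integral_distr[OF graph_measurable borel_measurable_inner[OF m]])
  also have "\<dots> = (\<integral>z. \<psi> (z, f z) \<bullet> F z \<partial>M)"
    unfolding n_def fst_conv by (rule M.integral_density_sgn[OF F m2])
  finally show ?thesis .
qed

lemma T_eq_\<mu>: "test_fun (U \<times> UNIV) \<psi> \<Longrightarrow> T \<psi> = (\<integral>p. \<psi> p \<bullet> n p \<partial>\<mu>)"
  using T_eq integral_\<mu>[OF Mu.test_fun_measurable] by simp

lemma variation_T: "variation (U \<times> UNIV) T = \<mu>"
  by (rule Mu.unit_density_variation[OF n_measurable norm_n AE_norm_n T_eq_\<mu>])

lemma dist_ext_T: "\<psi> \<in> L1_space \<mu> \<Longrightarrow> dist_ext (U \<times> UNIV) T \<psi> = (\<integral>p. \<psi> p \<bullet> n p \<partial>completion \<mu>)"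
  by (rule Mu.dist_ext_eq[OF variation_T n_measurable norm_n T_eq_\<mu>])

text \<open>Stated with \<open>open_variation\<close>, so that it makes sense for every t, and is
  measurable in t, before the slices are known to have locally finite variation.\<close>

definition \<beta> :: "real \<Rightarrow> 'a set \<Rightarrow> ennreal" where "\<beta> t D = open_variation U (S t) D"

lemma \<beta>_measurable: "(\<lambda>t. \<beta> t D) \<in> borel_measurable borel"
  unfolding \<beta>_def open_variation_def by (rule Sup_right_continuous_borel) (use S_right in blast)

lemma S_measurable: "test_fun U \<theta> \<Longrightarrow> (\<lambda>t. S t \<theta>) \<in> borel_measurable borel"
  by (rule right_continuous_borel[OF S_right])

definition G :: "'a set \<Rightarrow> real \<Rightarrow> real \<Rightarrow> ennreal" where
  "G D a b = (\<integral>\<^sup>+z. ennreal (norm (F z)) * (indicator D z * indicator {a<..b} (f z)) \<partial>M)"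

lemma G_eq_\<mu>:
  assumes "open D" "D \<subseteq> U" shows "G D a b = emeasure \<mu> (D \<times> {a<..b})"
proof -
  have "D \<times> {a<..b} \<in> sets (borel_of (top_of_set (U \<times> UNIV)))"
    using assms box_borel[OF assms(1)] by (auto simp: sets_prod_iff)
  from emeasure_\<mu>[OF this] show ?thesis
    unfolding G_def by (auto intro!: nn_integral_cong simp: indicator_def)
qed

lemma G_finite: "G (C k) a b < \<infinity>"
proof -
  obtain K where K: "compact K" "C k \<subseteq> K" "K \<subseteq> U" using rel_compact by blast
  have "G (C k) a b \<le> (\<integral>\<^sup>+z\<in>K \<inter> {z. \<bar>f z\<bar> \<le> \<bar>a\<bar> + \<bar>b\<bar>}. norm (F z) \<partial>M)"
    unfolding G_def using K by (intro nn_integral_mono) (auto simp: indicator_def)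
  also have "\<dots> < \<infinity>" by (rule fin[OF K(1,3)])
  finally show ?thesis .
qed

lemma G_mono: "D \<subseteq> D' \<Longrightarrow> G D a b \<le> G D' a b"
  unfolding G_def by (intro nn_integral_mono) (auto simp: indicator_def)

lemma S_scaled_integral_le:
  assumes \<theta>: "test_fun U \<theta>" "spt \<theta> \<subseteq> D" "\<And>x. norm (\<theta> x) \<le> 1" and "a < b"
  shows "ennreal (LINT t:{a<..b}|lborel. S t \<theta>) \<le> G D a b"
proof -
  have "ennreal (LINT t:{a<..b}|lborel. S t \<theta>) \<le> (\<integral>\<^sup>+z. ennreal (indicator {a<..b} (f z) * (\<theta> z \<bullet> F z)) \<partial>M)"
    unfolding S_integral[OF \<theta>(1) assms(4)] by (rule ennreal_integral_le)
  also have "\<dots> \<le> G D a b"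
    unfolding G_def
  proof (rule nn_integral_mono)
    fix z
    have "\<theta> z \<bullet> F z \<le> norm (\<theta> z) * norm (F z)" by (rule norm_cauchy_schwarz)
    also have "\<dots> \<le> norm (F z)" using \<theta>(3)[of z] mult_right_mono[OF \<theta>(3)[of z] norm_ge_zero[of "F z"]] by simp
    finally have "\<theta> z \<bullet> F z \<le> norm (F z)" .
    then show "ennreal (indicator {a<..b} (f z) * (\<theta> z \<bullet> F z)) \<le>
        ennreal (norm (F z)) * (indicator D z * indicator {a<..b} (f z))"
      using spt_subset_outside[OF \<theta>(2), of z] by (auto simp: indicator_def intro: ennreal_leI)
  qed
  finally show ?thesis .
qed

lemma \<beta>_le_liminf: "\<beta> t D \<le> liminf (\<lambda>k. ennreal (Suc k) * G D t (t + 1 / Suc k))"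
  unfolding \<beta>_def
proof (rule open_variation_least, rule ennreal_le_epsilon)
  fix \<theta> :: "'a \<Rightarrow> 'b" and e :: real
  assume \<theta>: "test_fun U \<theta>" "spt \<theta> \<subseteq> D" "\<And>x. norm (\<theta> x) \<le> 1" and e: "0 < e"
  have "((\<lambda>s. S s \<theta>) \<longlongrightarrow> S t \<theta>) (at_right t)" using S_right[OF \<theta>(1), of t] by (simp add: continuous_within)
  then have "\<forall>\<^sub>F s in at_right t. S t \<theta> - e < S s \<theta>" by (rule order_tendstoD(1)) (use e in simp)
  then obtain b where b: "t < b" "\<And>s. t < s \<Longrightarrow> s < b \<Longrightarrow> S t \<theta> - e < S s \<theta>"
    by (auto simp: eventually_at_right_field)
  obtain k0 :: nat where k0: "inverse (real (Suc k0)) < b - t" using reals_Archimedean[of "b - t"] b by auto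
  have "ennreal (S t \<theta> - e) \<le> ennreal (Suc k) * G D t (t + 1 / Suc k)" if "k0 \<le> k" for k
  proof -
    let ?d = "1 / real (Suc k)"
    have "?d \<le> inverse (real (Suc k0))" using that by (simp add: field_simps)
    then have d: "t + ?d < b" "0 < ?d" using k0 by auto
    have fin: "emeasure lborel {t<..t + ?d} < \<infinity>" by simp
    have "(S t \<theta> - e) * ?d = (LINT s:{t<..t + ?d}|lborel. S t \<theta> - e)"
      using d by (simp add: set_lebesgue_integral_def)
    also have "\<dots> \<le> (LINT s:{t<..t + ?d}|lborel. S s \<theta>)"
    proof (rule set_integral_mono)
      show "set_integrable lborel {t<..t + ?d} (\<lambda>s. S t \<theta> - e)"
        unfolding set_integrable_def by (intro integrable_scaleR_left integrable_real_indicator) auto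
      show "set_integrable lborel {t<..t + ?d} (\<lambda>s. S s \<theta>)" using d by (intro S_integrable \<theta>) simp
      show "S t \<theta> - e \<le> S s \<theta>" if "s \<in> {t<..t + ?d}" for s using b(2)[of s] that d by auto
    qed
    finally have "S t \<theta> - e \<le> real (Suc k) * (LINT s:{t<..t + ?d}|lborel. S s \<theta>)"
      by (simp add: field_simps)
    then have "ennreal (S t \<theta> - e) \<le> ennreal (real (Suc k) * (LINT s:{t<..t + ?d}|lborel. S s \<theta>))" by (rule ennreal_leI)
    also have "\<dots> = ennreal (Suc k) * ennreal (LINT s:{t<..t + ?d}|lborel. S s \<theta>)"
      by (rule ennreal_mult') simp
    also have "\<dots> \<le> ennreal (Suc k) * G D t (t + ?d)"
      using d by (intro mult_left_mono S_scaled_integral_le \<theta>) auto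
    finally show ?thesis .
  qed
  then have "\<forall>\<^sub>F k in sequentially. ennreal (S t \<theta> - e) \<le> ennreal (Suc k) * G D t (t + 1 / Suc k)"
    by (auto simp: eventually_sequentially)
  then have le: "ennreal (S t \<theta> - e) \<le> liminf (\<lambda>k. ennreal (Suc k) * G D t (t + 1 / Suc k))" by (rule Liminf_bounded)
  have "ennreal (S t \<theta>) \<le> ennreal (S t \<theta> - e) + ennreal e" using ennreal_add_le[of "S t \<theta> - e" e] by simp
  also have "\<dots> \<le> liminf (\<lambda>k. ennreal (Suc k) * G D t (t + 1 / Suc k)) + ennreal e" by (rule add_right_mono[OF le])
  finally show "ennreal (S t \<theta>) \<le> liminf (\<lambda>k. ennreal (Suc k) * G D t (t + 1 / Suc k)) + ennreal e" .
qed

text \<open>By Tonelli: a point z contributes only for t in an interval of length d ending at f z,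
  which the factor 1/d normalises, and then f z lies in the interval from a to b + d.\<close>

lemma averaged_G:
  assumes D: "open D" "D \<subseteq> U" and d: "0 < d"
  shows "(\<lambda>t. G D t (t + d)) \<in> borel_measurable borel"
    "(\<integral>\<^sup>+t\<in>{a<..b}. ennreal (1 / d) * G D t (t + d) \<partial>lborel) \<le> G D a (b + d)"
proof -
  interpret P: pair_sigma_finite M lborel
    by (intro pair_sigma_finite.intro M.sigma_finite sigma_finite_lborel)
  have [measurable]: "D \<in> sets M" by (rule M.open_in_sets[OF D])
  let ?g = "\<lambda>z t. ennreal (norm (F z)) * (indicator D z * (if t < f z \<and> f z \<le> t + d then 1 else 0))"
  have G_eq: "G D t (t + d) = (\<integral>\<^sup>+z. ?g z t \<partial>M)" for t
    unfolding G_def by (intro nn_integral_cong) (auto simp: indicator_def)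
  have gt [measurable]: "?g z \<in> borel_measurable lborel" "(\<lambda>z. ?g z t) \<in> borel_measurable M" for z t by measurable
  have meas: "case_prod (\<lambda>t z. ?g z t) \<in> borel_measurable (lborel \<Otimes>\<^sub>M M)" by measurable
  have meas': "(\<lambda>(z, t). ennreal (1 / d) * indicator {a<..b} t * ?g z t) \<in> borel_measurable (M \<Otimes>\<^sub>M lborel)"
    by measurable
  show 1: "(\<lambda>t. G D t (t + d)) \<in> borel_measurable borel"
    using P.M1.borel_measurable_nn_integral[OF meas] by (simp add: G_eq)
  have "(\<integral>\<^sup>+t\<in>{a<..b}. ennreal (1 / d) * G D t (t + d) \<partial>lborel) =
      (\<integral>\<^sup>+t. (\<integral>\<^sup>+z. ennreal (1 / d) * indicator {a<..b} t * ?g z t \<partial>M) \<partial>lborel)"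
    unfolding G_eq by (intro nn_integral_cong) (subst nn_integral_cmult, rule gt, simp add: mult_ac)
  also have "\<dots> = (\<integral>\<^sup>+z. (\<integral>\<^sup>+t. ennreal (1 / d) * indicator {a<..b} t * ?g z t \<partial>lborel) \<partial>M)"
    by (rule P.Fubini'[OF meas'])
  also have "\<dots> \<le> (\<integral>\<^sup>+z. ennreal (norm (F z)) * (indicator D z * indicator {a<..b + d} (f z)) \<partial>M)"
  proof (rule nn_integral_mono)
    fix z
    have "(\<integral>\<^sup>+t. ennreal (1 / d) * indicator {a<..b} t * ?g z t \<partial>lborel) \<le>
        (\<integral>\<^sup>+t. ennreal (norm (F z)) * (indicator D z * indicator {a<..b + d} (f z)) * (ennreal (1 / d) * indicator {f z - d..f z} t) \<partial>lborel)"
      by (intro nn_integral_mono) (auto simp: indicator_def mult_ac)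
    also have "\<dots> = ennreal (norm (F z)) * (indicator D z * indicator {a<..b + d} (f z)) * (ennreal (1 / d) * ennreal d)"
      using d by (subst nn_integral_cmult, simp, subst nn_integral_cmult_indicator) auto
    also have "ennreal (1 / d) * ennreal d = 1" using d by (simp flip: ennreal_mult)
    finally show "(\<integral>\<^sup>+t. ennreal (1 / d) * indicator {a<..b} t * ?g z t \<partial>lborel) \<le>
      ennreal (norm (F z)) * (indicator D z * indicator {a<..b + d} (f z))" by simp
  qed
  finally show "(\<integral>\<^sup>+t\<in>{a<..b}. ennreal (1 / d) * G D t (t + d) \<partial>lborel) \<le> G D a (b + d)" by (simp add: G_def)
qed

text \<open>Continuity from above; the inclusion in \<open>C k\<close> provides the finiteness.
  Intervals closed on the right shrink exactly to \<open>{a<..b}\<close>.\<close>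

lemma G_tendsto:
  assumes D: "open D" "D \<subseteq> C k"
  shows "(\<lambda>i. G D a (b + 1 / Suc i)) \<longlonglongrightarrow> G D a b"
proof -
  have DU: "D \<subseteq> U" using D C_subset by blast
  have box: "D \<times> {a<..c} \<in> sets \<mu>" for c
    using DU box_borel[OF D(1)] by (auto simp: sets_\<mu> sets_prod_iff)
  have "(\<lambda>i. emeasure \<mu> (D \<times> {a<..b + 1 / Suc i})) \<longlonglongrightarrow> emeasure \<mu> (\<Inter>i. D \<times> {a<..b + 1 / Suc i})"
  proof (rule Lim_emeasure_decseq)
    show "range (\<lambda>i. D \<times> {a<..b + 1 / real (Suc i)}) \<subseteq> sets \<mu>" using box by blast
    show "decseq (\<lambda>i. D \<times> {a<..b + 1 / real (Suc i)})"
    proof (rule decseq_SucI)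
      fix i
      have "1 / real (Suc (Suc i)) \<le> 1 / real (Suc i)" by (simp add: field_simps)
      then show "D \<times> {a<..b + 1 / real (Suc (Suc i))} \<subseteq> D \<times> {a<..b + 1 / real (Suc i)}" by auto
    qed
    show "emeasure \<mu> (D \<times> {a<..b + 1 / real (Suc i)}) \<noteq> \<infinity>" for i
    proof -
      have "G D a (b + 1 / real (Suc i)) < \<infinity>" using G_mono[OF D(2)] G_finite by (rule le_less_trans)
      then show ?thesis using G_eq_\<mu>[OF D(1) DU] by (auto simp: less_top)
    qed
  qed
  moreover have "(\<Inter>i. D \<times> {a<..b + 1 / real (Suc i)}) = D \<times> {a<..b}"
  proof
    show "D \<times> {a<..b} \<subseteq> (\<Inter>i. D \<times> {a<..b + 1 / real (Suc i)})"
    proof (rule INT_greatest)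
      fix i
      have "b \<le> b + 1 / real (Suc i)" by simp
      then have "{..b} \<subseteq> {..b + 1 / real (Suc i)}" by (simp only: atMost_subset_iff)
      then have "{a<..b} \<subseteq> {a<..b + 1 / real (Suc i)}"         unfolding greaterThanAtMost_def by (rule Int_mono[OF order_refl])
      then show "D \<times> {a<..b} \<subseteq> D \<times> {a<..b + 1 / real (Suc i)}" by (rule Sigma_mono[OF order_refl])
    qed
    show "(\<Inter>i. D \<times> {a<..b + 1 / real (Suc i)}) \<subseteq> D \<times> {a<..b}"
    proof
      fix p assume p: "p \<in> (\<Inter>i. D \<times> {a<..b + 1 / real (Suc i)})"
      obtain z t where zt: "p = (z, t)" by force
      have le: "t \<le> b + 1 / real (Suc i)" for i using p zt by auto
      have "t \<le> b + 0"
      proof (rule LIMSEQ_le_const)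
        show "(\<lambda>i. b + 1 / real (Suc i)) \<longlonglongrightarrow> b + 0"
          using LIMSEQ_inverse_real_of_nat by (intro tendsto_intros) (simp add: inverse_eq_divide)
      qed (use le in blast)
      then show "p \<in> D \<times> {a<..b}" using p zt by auto
    qed
  qed
  ultimately show ?thesis using G_eq_\<mu>[OF D(1) DU] by simp
qed

lemma integral_\<beta>_le:
  assumes D: "open D" "D \<subseteq> C k"
  shows "(\<integral>\<^sup>+t\<in>{a<..b}. \<beta> t D \<partial>lborel) \<le> G D a b"
proof -
  have DU: "D \<subseteq> U" using D C_subset by blast
  let ?g = "\<lambda>i t. ennreal (Suc i) * G D t (t + 1 / Suc i)"
  have pos: "0 < 1 / real (Suc i)" for i by simp
  have m: "(\<lambda>t. ?g i t * indicator {a<..b} t) \<in> borel_measurable lborel" for i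
    using averaged_G(1)[OF D(1) DU pos[of i]] by measurable
  have "(\<integral>\<^sup>+t\<in>{a<..b}. \<beta> t D \<partial>lborel) \<le> (\<integral>\<^sup>+t. liminf (\<lambda>i. ?g i t * indicator {a<..b} t) \<partial>lborel)"
  proof (rule nn_integral_mono)
    fix t show "\<beta> t D * indicator {a<..b} t \<le> liminf (\<lambda>i. ?g i t * indicator {a<..b} t)"
      using \<beta>_le_liminf[of t D] by (cases "t \<in> {a<..b}") auto
  qed
  also have "\<dots> \<le> liminf (\<lambda>i. \<integral>\<^sup>+t. ?g i t * indicator {a<..b} t \<partial>lborel)"
    by (rule nn_integral_liminf[OF m])
  also have "\<dots> \<le> liminf (\<lambda>i. G D a (b + 1 / Suc i))"
  proof (rule Liminf_mono, rule always_eventually, rule allI)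
    fix i show "(\<integral>\<^sup>+t. ?g i t * indicator {a<..b} t \<partial>lborel) \<le> G D a (b + 1 / Suc i)"
      using averaged_G(2)[OF D(1) DU pos[of i], of a b] by simp
  qed
  also have "\<dots> = G D a b" by (rule lim_imp_Liminf[OF trivial_limit_sequentially G_tendsto[OF D]])
  finally show ?thesis .
qed

lemma integral_\<beta>_ge:
  assumes D: "open D" "D \<subseteq> U" and "a < b"
  shows "G D a b \<le> (\<integral>\<^sup>+t\<in>{a<..b}. \<beta> t D \<partial>lborel)"
proof -
  let ?\<eta> = "\<lambda>z. indicator {a<..b} (f z) *\<^sub>R F z"
  have \<eta>: "?\<eta> \<in> borel_measurable M" by measurable
  have fin\<eta>: "(\<integral>\<^sup>+z\<in>K. norm (?\<eta> z) \<partial>M) < \<infinity>" if K: "compact K" "K \<subseteq> U" for K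
  proof -
    have "(\<integral>\<^sup>+z\<in>K. norm (?\<eta> z) \<partial>M) \<le> (\<integral>\<^sup>+z\<in>K \<inter> {z. \<bar>f z\<bar> \<le> \<bar>a\<bar> + \<bar>b\<bar>}. norm (F z) \<partial>M)"
      by (intro nn_integral_mono) (auto simp: indicator_def)
    also have "\<dots> < \<infinity>" by (rule fin[OF K])
    finally show ?thesis .
  qed
  \<comment> \<open>The mass over the slab is itself the variation of a functional, and the values
    of this functional are the integrals of \<open>S t\<close> over \<open>{a<..b}\<close>.\<close>
  have "open_variation U (\<lambda>\<theta>. \<integral>z. \<theta> z \<bullet> ?\<eta> z \<partial>M) D = (\<integral>\<^sup>+z\<in>D. norm (?\<eta> z) \<partial>M)"
    by (rule M.density_open_variation[OF \<eta> fin\<eta> refl D])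
  moreover have "(\<integral>\<^sup>+z\<in>D. norm (?\<eta> z) \<partial>M) = G D a b"
    unfolding G_def by (intro nn_integral_cong) (auto simp: indicator_def)
  ultimately have "G D a b = open_variation U (\<lambda>\<theta>. \<integral>z. \<theta> z \<bullet> ?\<eta> z \<partial>M) D" by simp
  also have "\<dots> \<le> (\<integral>\<^sup>+t\<in>{a<..b}. \<beta> t D \<partial>lborel)"
  proof (rule open_variation_least)
    fix \<theta> :: "'a \<Rightarrow> 'b" assume \<theta>: "test_fun U \<theta>" "spt \<theta> \<subseteq> D" "\<And>x. norm (\<theta> x) \<le> 1"
    have "(\<integral>z. \<theta> z \<bullet> ?\<eta> z \<partial>M) = (LINT t:{a<..b}|lborel. S t \<theta>)"
      unfolding S_integral[OF \<theta>(1) assms(3)] by simp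
    then have "ennreal (\<integral>z. \<theta> z \<bullet> ?\<eta> z \<partial>M) \<le> (\<integral>\<^sup>+t. ennreal (indicator {a<..b} t *\<^sub>R S t \<theta>) \<partial>lborel)"
      unfolding set_lebesgue_integral_def using ennreal_integral_le by metis
    also have "\<dots> \<le> (\<integral>\<^sup>+t\<in>{a<..b}. \<beta> t D \<partial>lborel)"
      using open_variation_upper[OF \<theta>] by (intro nn_integral_mono) (auto simp: indicator_def \<beta>_def)
    finally show "ennreal (\<integral>z. \<theta> z \<bullet> ?\<eta> z \<partial>M) \<le> (\<integral>\<^sup>+t\<in>{a<..b}. \<beta> t D \<partial>lborel)" .
  qed
  finally show ?thesis .
qed

lemma integral_\<beta>:
  assumes D: "open D" "D \<subseteq> C k" and "a < b"
  shows "(\<integral>\<^sup>+t\<in>{a<..b}. \<beta> t D \<partial>lborel) = emeasure \<mu> (D \<times> {a<..b})"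
proof -
  have DU: "D \<subseteq> U" using D C_subset by blast
  show ?thesis
    using integral_\<beta>_le[OF D, of a b] integral_\<beta>_ge[OF D(1) DU assms(3)] G_eq_\<mu>[OF D(1) DU] by (simp add: antisym)
qed

text \<open>Countably many conditions, so that they hold simultaneously for almost every t; they
  make the variation of \<open>S t\<close> a Radon measure (\<open>good_radon\<close>).\<close>

definition good :: "real \<Rightarrow> bool" where "good t \<longleftrightarrow> (\<forall>k. \<beta> t (C k) < \<infinity>)"

lemma good_sets: "{t. good t} \<in> sets borel"
proof -
  have "Measurable.pred borel good" unfolding good_def using \<beta>_measurable by measurable
  then show ?thesis by (simp add: pred_def)
qed

lemma AE_good: "AE t in lborel. good t"
proof -
  have "AE t in lborel. \<forall>i::nat. \<forall>k. t \<in> {- real i<..real i} \<longrightarrow> \<beta> t (C k) < \<infinity>"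
  proof (subst AE_all_countable, rule allI, subst AE_all_countable, rule allI)
    fix i k
    have "(\<integral>\<^sup>+t\<in>{- real i<..real i}. \<beta> t (C k) \<partial>lborel) \<le> G (C k) (- real i) (real i)"
      by (rule integral_\<beta>_le[OF open_C order_refl])
    also have "\<dots> < \<infinity>" by (rule G_finite)
    finally have "AE t in lborel. \<beta> t (C k) * indicator {- real i<..real i} t \<noteq> \<infinity>"
      using \<beta>_measurable by (intro nn_integral_PInf_AE) auto
    then show "AE t in lborel. t \<in> {- real i<..real i} \<longrightarrow> \<beta> t (C k) < \<infinity>"
      by eventually_elim (auto simp: indicator_def less_top)
  qed
  then show ?thesis
  proof eventually_elim
    case (elim t)
    obtain i :: nat where "\<bar>t\<bar> < real i" using reals_Archimedean2 by blast
    then have "t \<in> {- real i<..real i}" by auto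
    with elim show ?case by (auto simp: good_def)
  qed
qed

text \<open>The null measure at exceptional t turns the variations into a kernel that is finite on
  each \<open>C k\<close> for all t, without affecting integrals over t.\<close>

definition \<nu> :: "real \<Rightarrow> 'a measure" where
  "\<nu> t = (if good t then variation U (S t) else null_measure (borel_of (top_of_set U)))"

lemma sets_\<nu>: "sets (\<nu> t) = sets (borel_of (top_of_set U))"
  using variation_spec[OF open_U S_linear] by (simp add: \<nu>_def)

lemma \<nu>_open: "good t \<Longrightarrow> open D \<Longrightarrow> D \<subseteq> U \<Longrightarrow> emeasure (\<nu> t) D = \<beta> t D"
  using variation_spec[OF open_U S_linear] by (simp add: \<nu>_def \<beta>_def)

lemma \<nu>_bad: "\<not> good t \<Longrightarrow> emeasure (\<nu> t) D = 0" by (simp add: \<nu>_def)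

lemma \<nu>_finite: "emeasure (\<nu> t) (C k) < \<infinity>"
proof (cases "good t")
  case True
  then show ?thesis using \<nu>_open[OF True open_C C_subset] by (simp add: good_def)
qed (simp add: \<nu>_bad)

lemma locally_finite_\<nu>: "locally_finite U (\<nu> t)"
proof
  show "open U" by (rule open_U)
  show "sets (\<nu> t) = sets (borel_of (top_of_set U))" by (rule sets_\<nu>)
  fix K assume "compact K" "K \<subseteq> U"
  then obtain k where k: "K \<subseteq> C k" using absorb by blast
  have "emeasure (\<nu> t) K \<le> emeasure (\<nu> t) (C k)"
    using k open_C C_subset by (intro emeasure_mono) (auto simp: sets_\<nu> sets_U_iff)
  then show "emeasure (\<nu> t) K < \<infinity>" using \<nu>_finite[of t k] le_less_trans by blast
qed

lemma good_radon: "good t \<Longrightarrow> radon_measure (top_of_set U) (variation U (S t))"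
  using locally_finite.radon[OF locally_finite_\<nu>, of t] by (simp add: \<nu>_def)

lemma good_distribution: "good t \<Longrightarrow> distribution_with_variation U (\<nu> t) (S t)"
  using locally_finite_\<nu>[of t] S_linear[of t]
  by (simp add: distribution_with_variation_def distribution_with_variation_axioms_def \<nu>_def)

lemma \<nu>_open_measurable:
  assumes "open D" "D \<subseteq> U" shows "(\<lambda>t. emeasure (\<nu> t) D) \<in> borel_measurable borel"
proof -
  have "emeasure (\<nu> t) D = (if good t then \<beta> t D else 0)" for t
    using \<nu>_open[OF _ assms] \<nu>_bad by simp
  moreover have "(\<lambda>t. if good t then \<beta> t D else 0) \<in> borel_measurable borel"
    using good_sets \<beta>_measurable by (intro measurable_If) auto
  ultimately show ?thesis by simp
qed

lemma AE_\<nu>: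
  assumes "open D" "D \<subseteq> U" shows "AE t in lborel. emeasure (\<nu> t) D = \<beta> t D"
  using AE_good by eventually_elim (rule \<nu>_open[OF _ assms])

sublocale Dis: disintegration U C \<mu> \<nu>
proof
  show "sets (\<nu> t) = sets (borel_of (top_of_set U))" for t by (rule sets_\<nu>)
  show "emeasure (\<nu> t) (C k) < \<infinity>" for t k by (rule \<nu>_finite)
  fix D k assume D: "open D" "D \<subseteq> C k"
  then have DU: "D \<subseteq> U" using C_subset by blast
  show "(\<lambda>t. emeasure (\<nu> t) D) \<in> borel_measurable borel" by (rule \<nu>_open_measurable[OF D(1) DU])
  fix a b :: real assume ab: "a < b"
  have "(\<integral>\<^sup>+t\<in>{a<..b}. emeasure (\<nu> t) D \<partial>lborel) = (\<integral>\<^sup>+t\<in>{a<..b}. \<beta> t D \<partial>lborel)"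
    using AE_\<nu>[OF D(1) DU] by (intro nn_integral_cong_AE) auto
  then show "(\<integral>\<^sup>+t\<in>{a<..b}. emeasure (\<nu> t) D \<partial>lborel) = emeasure \<mu> (D \<times> {a<..b})"
    using integral_\<beta>[OF D ab] by simp
qed

end

section \<open>Completions, null sets and signed integrals along slices\<close>

lemma completion_measurable_AE:
  assumes g: "g \<in> measurable M N" and eq: "AE x in M. f x = g x" and f: "f \<in> space M \<rightarrow> space N"
  shows "f \<in> measurable (completion M) N"
proof (rule measurableI)
  show "f x \<in> space N" if "x \<in> space (completion M)" for x using f that by auto
  fix A assume A: "A \<in> sets N"
  obtain Z where Z: "Z \<in> null_sets M" "{x \<in> space M. f x \<noteq> g x} \<subseteq> Z"
    using eq by (auto simp: eventually_ae_filter)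
  have "f -` A \<inter> space M = (g -` A \<inter> space M - Z) \<union> (f -` A \<inter> space M \<inter> Z)" using Z(2) by auto
  moreover have "g -` A \<inter> space M - Z \<in> sets (completion M)"
    using measurable_sets[OF g A] Z(1) by auto
  moreover have "f -` A \<inter> space M \<inter> Z \<in> sets (completion M)"
    by (rule null_sets_completion[OF Z(1)]) auto
  ultimately have "f -` A \<inter> space M \<in> sets (completion M)" using sets.Un by metis
  then show "f -` A \<inter> space (completion M) \<in> sets (completion M)" by simp
qed

lemma completion_integrable_AE:
  fixes f g :: "'a \<Rightarrow> 'b::{banach, second_countable_topology}"
  assumes g: "integrable M g" and eq: "AE x in M. f x = g x"
  shows "integrable (completion M) f" "integral\<^sup>L (completion M) f = integral\<^sup>L M g"
proof -
  have m: "f \<in> borel_measurable (completion M)" by (rule completion_measurable_AE[OF _ eq]) (use g in auto)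
  have gm: "g \<in> borel_measurable M" using g by simp
  have "integrable (completion M) g" using g gm by (simp add: integrable_completion)
  then show "integrable (completion M) f"
    using integrable_cong_AE[OF m measurable_completion[OF gm] AE_completion[OF eq]] by simp
  show "integral\<^sup>L (completion M) f = integral\<^sup>L M g"
    using integral_cong_AE[OF m measurable_completion[OF gm] AE_completion[OF eq]] integral_completion[OF gm] by simp
qed

context disintegration
begin

lemma space_\<kappa>: "space (\<kappa> t) = U"
  using sets_eq_imp_space_eq[OF sets_\<kappa>] by (simp add: space_borel_of)

lemma slice_measurable: "h \<in> measurable \<mu> X \<Longrightarrow> (\<lambda>z. h (z, t)) \<in> measurable (\<kappa> t) X"
proof -
  assume h: "h \<in> measurable \<mu> X"
  have "(\<lambda>z. (z, t)) \<in> measurable (\<kappa> t) \<mu>"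
  proof (rule measurableI)
    show "(z, t) \<in> space \<mu>" if "z \<in> space (\<kappa> t)" for z using that space_\<kappa> Mu.space_M by simp
    fix A assume A: "A \<in> sets \<mu>"
    have "(\<lambda>z. (z, t)) -` A \<inter> space (\<kappa> t) = {z. (z, t) \<in> A}"
      using A space_\<kappa> Mu.sets_iff[of A] by auto
    then show "(\<lambda>z. (z, t)) -` A \<inter> space (\<kappa> t) \<in> sets (\<kappa> t)" using slice_sets[OF A] by simp
  qed
  then show ?thesis using h by (rule measurable_compose)
qed

lemma AE_slices:
  assumes "AE p in \<mu>. P p" shows "AE t in lborel. AE z in \<kappa> t. P (z, t)"
proof -
  obtain Z where Z: "Z \<in> null_sets \<mu>" "{p \<in> space \<mu>. \<not> P p} \<subseteq> Z"
    using assms by (auto simp: eventually_ae_filter)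
  have Zs: "Z \<in> sets \<mu>" using Z(1) by blast
  have "(\<integral>\<^sup>+t. emeasure (\<kappa> t) {z. (z, t) \<in> Z} \<partial>lborel) = 0"
    using emeasure_eq_nn_integral[OF Zs] Z(1) by auto
  then have "AE t in lborel. emeasure (\<kappa> t) {z. (z, t) \<in> Z} = 0"
    using emeasure_section_measurable[OF Zs] by (subst nn_integral_0_iff_AE[symmetric]) auto
  then show ?thesis
  proof eventually_elim
    case (elim t)
    then have "{z. (z, t) \<in> Z} \<in> null_sets (\<kappa> t)" using slice_sets[OF Zs] by (intro null_setsI)
    moreover have "{z \<in> space (\<kappa> t). \<not> P (z, t)} \<subseteq> {z. (z, t) \<in> Z}"
      using Z(2) by (auto simp: space_\<kappa> Mu.space_M)
    ultimately show ?case by (rule AE_I')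
  qed
qed

text \<open>Positive and negative parts are disintegrated separately. Both inner integrals are
  finite for almost every t because their integrals over t are finite.\<close>

lemma integral_disintegration:
  fixes g :: "'a \<times> real \<Rightarrow> real"
  assumes g: "integrable \<mu> g"
  shows "AE t in lborel. integrable (\<kappa> t) (\<lambda>z. g (z, t))"
    "integrable lborel (\<lambda>t. \<integral>z. g (z, t) \<partial>\<kappa> t)"
    "(\<integral>t. (\<integral>z. g (z, t) \<partial>\<kappa> t) \<partial>lborel) = (\<integral>p. g p \<partial>\<mu>)"
proof -
  define P Q where "P t = (\<integral>\<^sup>+z. ennreal (g (z, t)) \<partial>\<kappa> t)" and "Q t = (\<integral>\<^sup>+z. ennreal (- g (z, t)) \<partial>\<kappa> t)" for t
  have gm: "g \<in> borel_measurable \<mu>" using g by simp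
  have mp: "(\<lambda>p. ennreal (g p)) \<in> borel_measurable \<mu>" "(\<lambda>p. ennreal (- g p)) \<in> borel_measurable \<mu>"
    using gm by measurable
  have gs: "(\<lambda>z. g (z, t)) \<in> borel_measurable (\<kappa> t)" for t by (rule slice_measurable[OF gm])
  have P [measurable]: "P \<in> borel_measurable borel" and Q [measurable]: "Q \<in> borel_measurable borel"
    and IP: "(\<integral>\<^sup>+t. P t \<partial>lborel) = (\<integral>\<^sup>+p. ennreal (g p) \<partial>\<mu>)"
    and IQ: "(\<integral>\<^sup>+t. Q t \<partial>lborel) = (\<integral>\<^sup>+p. ennreal (- g p) \<partial>\<mu>)"
    using nn_integral_disintegration[OF mp(1)] nn_integral_disintegration[OF mp(2)]
    unfolding P_def Q_def by (auto simp: fun_eq_iff)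
  have fin: "(\<integral>\<^sup>+p. ennreal (g p) \<partial>\<mu>) < \<infinity>" "(\<integral>\<^sup>+p. ennreal (- g p) \<partial>\<mu>) < \<infinity>"
    using g by (auto simp: real_integrable_def less_top)
  have AEP: "AE t in lborel. P t \<noteq> \<infinity>" and AEQ: "AE t in lborel. Q t \<noteq> \<infinity>"
    using fin unfolding IP[symmetric] IQ[symmetric]
    by (intro nn_integral_PInf_AE; simp add: less_top)+
  have iff: "integrable (\<kappa> t) (\<lambda>z. g (z, t)) \<longleftrightarrow> P t \<noteq> \<infinity> \<and> Q t \<noteq> \<infinity>" for t
    using gs[of t] by (simp add: real_integrable_def P_def Q_def)
  show ae: "AE t in lborel. integrable (\<kappa> t) (\<lambda>z. g (z, t))"
    using AEP AEQ by eventually_elim (simp add: iff)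
  \<comment> \<open>A slice that is not integrable has Bochner integral 0 by convention. With this
    case included the formula holds for every t, which gives measurability in t without discarding a
    null set.\<close>
  have eq: "(\<integral>z. g (z, t) \<partial>\<kappa> t) = (if P t \<noteq> \<infinity> \<and> Q t \<noteq> \<infinity> then enn2real (P t) - enn2real (Q t) else 0)" for t
    using iff[of t] real_lebesgue_integral_def[of "\<kappa> t" "\<lambda>z. g (z, t)"]
    by (simp add: not_integrable_integral_eq P_def Q_def)
  have eqAE: "AE t in lborel. (\<integral>z. g (z, t) \<partial>\<kappa> t) = enn2real (P t) - enn2real (Q t)"
    using AEP AEQ by eventually_elim (simp add: eq)
  have meas: "(\<lambda>t. \<integral>z. g (z, t) \<partial>\<kappa> t) \<in> borel_measurable lborel"
    unfolding eq by measurable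
  have real: "integrable lborel (\<lambda>t. enn2real (X t)) \<and> (\<integral>t. enn2real (X t) \<partial>lborel) = enn2real (\<integral>\<^sup>+t. X t \<partial>lborel)"
    if X: "X \<in> borel_measurable borel" "AE t in lborel. X t \<noteq> \<infinity>" "(\<integral>\<^sup>+t. X t \<partial>lborel) < \<infinity>" for X
  proof -
    have "(\<integral>\<^sup>+t. ennreal (enn2real (X t)) \<partial>lborel) = (\<integral>\<^sup>+t. X t \<partial>lborel)"
      using X(2) by (intro nn_integral_cong_AE) (auto simp: less_top)
    moreover have "(\<lambda>t. enn2real (X t)) \<in> borel_measurable lborel" using X(1) by measurable
    ultimately show ?thesis
      using X(3) by (auto intro!: integrableI_nonneg simp: integral_eq_nn_integral)
  qed
  have iP: "integrable lborel (\<lambda>t. enn2real (P t))" "(\<integral>t. enn2real (P t) \<partial>lborel) = enn2real (\<integral>\<^sup>+p. ennreal (g p) \<partial>\<mu>)"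
    using real[OF P AEP] fin IP by auto
  have iQ: "integrable lborel (\<lambda>t. enn2real (Q t))" "(\<integral>t. enn2real (Q t) \<partial>lborel) = enn2real (\<integral>\<^sup>+p. ennreal (- g p) \<partial>\<mu>)"
    using real[OF Q AEQ] fin IQ by auto
  have d: "integrable lborel (\<lambda>t. enn2real (P t) - enn2real (Q t))" using iP iQ by simp
  show "integrable lborel (\<lambda>t. \<integral>z. g (z, t) \<partial>\<kappa> t)"
    using d integrable_cong_AE[OF meas _ eqAE] by simp
  have "(\<integral>t. (\<integral>z. g (z, t) \<partial>\<kappa> t) \<partial>lborel) = (\<integral>t. enn2real (P t) - enn2real (Q t) \<partial>lborel)"
    using d by (intro integral_cong_AE[OF meas _ eqAE]) simp
  also have "\<dots> = (\<integral>p. g p \<partial>\<mu>)" using iP iQ g by (simp add: real_lebesgue_integral_def)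
  finally show "(\<integral>t. (\<integral>z. g (z, t) \<partial>\<kappa> t) \<partial>lborel) = (\<integral>p. g p \<partial>\<mu>)" .
qed

end

section \<open>Polar densities of the slices\<close>

lemma bump_sequence:
  fixes D :: "'a::euclidean_space set"
  assumes "open D"
  obtains \<phi> :: "nat \<Rightarrow> 'a \<Rightarrow> real" where "\<And>k. test_fun D (\<phi> k)" "\<And>k x. 0 \<le> \<phi> k x" "\<And>k x. \<phi> k x \<le> 1"
    "\<And>x. (\<lambda>k. \<phi> k x) \<longlonglongrightarrow> indicator D x"
proof -
  obtain K where K: "\<And>n::nat. compact(K n)" "\<And>n. K n \<subseteq> D" "\<And>n. K n \<subseteq> interior(K(Suc n))" "\<Union>(range K) = D"
    using open_Union_compact_subsets[OF assms] by metis
  have "\<exists>\<phi> :: 'a \<Rightarrow> real. test_fun D \<phi> \<and> (\<forall>x. 0 \<le> \<phi> x) \<and> (\<forall>x. \<phi> x \<le> 1) \<and> (\<forall>x\<in>K k. \<phi> x = 1)" for k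
  proof -
    obtain \<phi> :: "'a \<Rightarrow> real" and G where "test_fun D \<phi>" "\<And>x. 0 \<le> \<phi> x" "\<And>x. \<phi> x \<le> 1"
      "open G" "K k \<subseteq> G" "\<And>x. x \<in> G \<Longrightarrow> \<phi> x = 1"
      using bump_function[OF K(1) assms K(2)] by metis
    then show ?thesis by blast
  qed
  then obtain \<phi> :: "nat \<Rightarrow> 'a \<Rightarrow> real" where \<phi>: "\<And>k. test_fun D (\<phi> k)" "\<And>k x. 0 \<le> \<phi> k x" "\<And>k x. \<phi> k x \<le> 1"
    "\<And>k x. x \<in> K k \<Longrightarrow> \<phi> k x = 1" by metis
  have mono: "K i \<subseteq> K j" if "i \<le> j" for i j
    using that by (induction rule: dec_induct) (use K(3) interior_subset in blast)+
  have "(\<lambda>k. \<phi> k x) \<longlonglongrightarrow> indicator D x" for x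
  proof (cases "x \<in> D")
    case True
    then obtain i where i: "x \<in> K i" using K(4) by blast
    have "\<forall>\<^sub>F k in sequentially. \<phi> k x = indicator D x"
      using eventually_ge_at_top[of i]
    proof eventually_elim
      case (elim k)
      then have "x \<in> K k" using mono i by blast
      then show ?case using \<phi>(4) True by simp
    qed
    then show ?thesis by (rule tendsto_eventually)
  next
    case False
    then have "\<phi> k x = 0" for k using \<phi>(1)[of k] spt_subset_outside[of "\<phi> k" D x] by (simp add: test_fun_def)
    then show ?thesis using False by simp
  qed
  then show ?thesis using that \<phi>(1-3) by blast
qed

context coarea_slices
begin

text \<open>An arbitrary choice for each t; joint measurability in z and t is neither asserted nor
  used. Measurability in t is proved only for the integrals in
  \<open>normal_component\<close>.\<close>

definition normal :: "real \<Rightarrow> 'a \<Rightarrow> 'b" where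
  "normal t = (if good t then SOME h. h \<in> borel_measurable (\<nu> t) \<and> (\<forall>x. norm (h x) \<le> 1) \<and>
     (\<forall>\<theta>. test_fun U \<theta> \<longrightarrow> S t \<theta> = (\<integral>x. \<theta> x \<bullet> h x \<partial>\<nu> t)) else (\<lambda>x. 0))"

lemma normal_good:
  assumes "good t"
  shows "normal t \<in> borel_measurable (\<nu> t) \<and> (\<forall>x. norm (normal t x) \<le> 1) \<and>
     (\<forall>\<theta>. test_fun U \<theta> \<longrightarrow> S t \<theta> = (\<integral>x. \<theta> x \<bullet> normal t x \<partial>\<nu> t))"
proof -
  interpret distribution_with_variation U "\<nu> t" "S t" by (rule good_distribution[OF assms])
  have "\<exists>h. h \<in> borel_measurable (\<nu> t) \<and> (\<forall>x. norm (h x) \<le> 1) \<and>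
     (\<forall>\<theta>. test_fun U \<theta> \<longrightarrow> S t \<theta> = (\<integral>x. \<theta> x \<bullet> h x \<partial>\<nu> t))"
    using polar_decomposition by metis
  then show ?thesis unfolding normal_def if_P[OF assms] by (rule someI_ex)
qed

lemma normal [measurable]: "normal t \<in> borel_measurable (\<nu> t)"
proof (cases "good t")
  case False
  then have "normal t = (\<lambda>x. 0)" by (simp add: normal_def)
  then show ?thesis by simp
qed (use normal_good in blast)

lemma norm_normal: "norm (normal t x) \<le> 1"
proof (cases "good t")
  case False
  then show ?thesis by (simp add: normal_def)
qed (use normal_good in blast)

lemma S_eq_normal: "good t \<Longrightarrow> test_fun U \<theta> \<Longrightarrow> S t \<theta> = (\<integral>x. \<theta> x \<bullet> normal t x \<partial>\<nu> t)"
  using normal_good by blast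

lemma inner_Basis_le: "norm v \<le> 1 \<Longrightarrow> e \<in> Basis \<Longrightarrow> \<bar>v \<bullet> e\<bar> \<le> (1::real)"
  using Basis_le_norm order_trans by blast

lemma D_sets: "open D \<Longrightarrow> D \<subseteq> U \<Longrightarrow> D \<in> sets (\<nu> t)" by (simp add: sets_\<nu> sets_U_iff)

lemma \<nu>_finite': "D \<subseteq> C k \<Longrightarrow> emeasure (\<nu> t) D < \<infinity>"
  using emeasure_mono[OF _ Dis.C_sets, of D k t] \<nu>_finite[of t k] le_less_trans by blast

lemma \<nu>_integral_zero: "\<not> good t \<Longrightarrow> (\<integral>z. h z \<partial>\<nu> t) = (0 :: real)"
  by (simp add: \<nu>_def)

text \<open>Bumps increasing the mass towards D are multiplied by e and inserted into the slice
  identity. On the slices the values tend to the integral of the component of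
  \<open>normal t\<close> over D, dominated by the mass of D; after integration in t the limit must
  be the integral of the component of \<open>n\<close> over the box.\<close>

lemma normal_component:
  assumes D: "open D" "D \<subseteq> C k" and e: "e \<in> Basis" and ab: "a < b"
  shows "(\<lambda>t. \<integral>z. indicator D z * (normal t z \<bullet> e) \<partial>\<nu> t) \<in> borel_measurable borel"
    "set_integrable lborel {a<..b} (\<lambda>t. \<integral>z. indicator D z * (normal t z \<bullet> e) \<partial>\<nu> t)"
    "(LINT t:{a<..b}|lborel. \<integral>z. indicator D z * (normal t z \<bullet> e) \<partial>\<nu> t) =
      (\<integral>p. indicator (D \<times> {a<..b}) p * (n p \<bullet> e) \<partial>\<mu>)"
    "set_integrable lborel {a<..b} (\<lambda>t. measure (\<nu> t) D)"
    "ennreal (LINT t:{a<..b}|lborel. measure (\<nu> t) D) = emeasure \<mu> (D \<times> {a<..b})"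
proof -
  have DU: "D \<subseteq> U" using D C_subset by blast
  let ?H = "\<lambda>t. \<integral>z. indicator D z * (normal t z \<bullet> e) \<partial>\<nu> t"
  let ?m = "\<lambda>t. measure (\<nu> t) D"
  obtain \<phi> :: "nat \<Rightarrow> 'a \<Rightarrow> real" where \<phi>: "\<And>k. test_fun D (\<phi> k)" "\<And>k x. 0 \<le> \<phi> k x" "\<And>k x. \<phi> k x \<le> 1"
    "\<And>x. (\<lambda>k. \<phi> k x) \<longlonglongrightarrow> indicator D x" using bump_sequence[OF D(1)] by metis
  have \<phi>U: "test_fun U (\<phi> k)" for k using \<phi>(1)[of k] DU by (auto simp: test_fun_def)
  have \<phi>out: "\<phi> k x = 0" if "x \<notin> D" for k x
    using \<phi>(1)[of k] spt_subset_outside[of "\<phi> k" D x] that by (simp add: test_fun_def)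
  have \<phi>ind: "\<phi> k x \<le> indicator D x" for k x using \<phi>(3) \<phi>out by (auto simp: indicator_def)
  let ?\<theta> = "\<lambda>k x. \<phi> k x *\<^sub>R e"
  have \<theta>: "test_fun U (?\<theta> k)" for k by (rule test_fun_scaleR_const(1)[OF \<phi>U])
  have mt: "ennreal (?m t) = emeasure (\<nu> t) D" for t
    using \<nu>_finite'[OF D(2), of t] by (simp add: emeasure_eq_ennreal_measure)
  have m_meas: "?m \<in> borel_measurable borel"
    unfolding measure_def using \<nu>_open_measurable[OF D(1) DU] by measurable
  have m_int: "(\<integral>\<^sup>+t. ennreal (indicator {a<..b} t *\<^sub>R ?m t) \<partial>lborel) = emeasure \<mu> (D \<times> {a<..b})"
  proof -
    have "(\<integral>\<^sup>+t. ennreal (indicator {a<..b} t *\<^sub>R ?m t) \<partial>lborel) = (\<integral>\<^sup>+t\<in>{a<..b}. emeasure (\<nu> t) D \<partial>lborel)"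
      by (intro nn_integral_cong) (auto simp: indicator_def mt[symmetric])
    also have "\<dots> = emeasure \<mu> (D \<times> {a<..b})" by (rule Dis.box_\<kappa>[OF D ab])
    finally show ?thesis .
  qed
  have box_fin: "emeasure \<mu> (D \<times> {a<..b}) < \<infinity>"
    using G_eq_\<mu>[OF D(1) DU, of a b] le_less_trans[OF G_mono[OF D(2), of a b] G_finite[of k a b]] by simp
  show m_set: "set_integrable lborel {a<..b} ?m"
    unfolding set_integrable_def using m_meas m_int box_fin by (intro integrableI_nonneg) auto
  show "ennreal (LINT t:{a<..b}|lborel. ?m t) = emeasure \<mu> (D \<times> {a<..b})"
    unfolding set_lebesgue_integral_def m_int[symmetric]
    using m_set by (intro nn_integral_eq_integral[symmetric]) (auto simp: set_integrable_def)
  \<comment> \<open>Put to 0 at exceptional t, where \<nu> is null, so that the integral formula and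
    the bound by the mass of D hold for every t.\<close>
  let ?s = "\<lambda>k t. if good t then S t (?\<theta> k) else 0"
  have s_eq: "?s k t = (\<integral>z. \<phi> k z * (normal t z \<bullet> e) \<partial>\<nu> t)" for k t
    using S_eq_normal[OF _ \<theta>, of t k] \<nu>_integral_zero[of t] by (auto simp: inner_commute)
  have bnd: "\<bar>\<phi> k z * (normal t z \<bullet> e)\<bar> \<le> indicator D z" for k z t
  proof -
    have "\<bar>\<phi> k z * (normal t z \<bullet> e)\<bar> = \<phi> k z * \<bar>normal t z \<bullet> e\<bar>" using \<phi>(2) by (simp add: abs_mult)
    also have "\<dots> \<le> \<phi> k z * 1" using \<phi>(2) inner_Basis_le[OF norm_normal e] by (intro mult_left_mono) auto
    also have "\<dots> \<le> indicator D z" using \<phi>ind by simp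
    finally show ?thesis .
  qed
  have indD: "integrable (\<nu> t) (indicator D :: 'a \<Rightarrow> real)" for t
    using D_sets[OF D(1) DU] \<nu>_finite'[OF D(2)] by (intro integrable_real_indicator)
  have \<phi>m: "\<phi> k \<in> borel_measurable (\<nu> t)" for k t
    by (rule locally_finite.test_fun_measurable[OF locally_finite_\<nu> \<phi>U])
  have Dm [measurable]: "D \<in> sets (\<nu> t)" for t by (rule D_sets[OF D(1) DU])
  have s_lim: "(\<lambda>k. ?s k t) \<longlonglongrightarrow> ?H t" for t
    unfolding s_eq
  proof (rule integral_dominated_convergence[where w="indicator D"])
    show "AE z in \<nu> t. (\<lambda>k. \<phi> k z * (normal t z \<bullet> e)) \<longlonglongrightarrow> indicator D z * (normal t z \<bullet> e)"
      by (intro AE_I2 tendsto_intros \<phi>)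
    show "AE z in \<nu> t. norm (\<phi> k z * (normal t z \<bullet> e)) \<le> indicator D z" for k
      using bnd by simp
    show "(\<lambda>z. \<phi> k z * (normal t z \<bullet> e)) \<in> borel_measurable (\<nu> t)" for k
      using \<phi>m by measurable
    show "(\<lambda>z. indicator D z * (normal t z \<bullet> e)) \<in> borel_measurable (\<nu> t)" by measurable
  qed (rule indD)
  have s_meas: "?s k \<in> borel_measurable borel" for k
    using good_sets S_measurable[OF \<theta>] by (intro measurable_If) auto
  show H_meas: "?H \<in> borel_measurable borel"
    by (rule borel_measurable_LIMSEQ_real[OF s_lim s_meas])
  have s_bnd: "\<bar>?s k t\<bar> \<le> ?m t" for k t
  proof -
    have "\<bar>?s k t\<bar> \<le> (\<integral>z. indicator D z \<partial>\<nu> t)"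
      unfolding s_eq
    proof (rule Bochner_Integration.integral_norm_bound_integral[OF _ indD, where f="\<lambda>z. \<phi> k z * (normal t z \<bullet> e)", unfolded real_norm_def])
      show "integrable (\<nu> t) (\<lambda>z. \<phi> k z * (normal t z \<bullet> e))" using \<phi>m bnd by (intro Bochner_Integration.integrable_bound[OF indD]) auto
      show "\<bar>\<phi> k z * (normal t z \<bullet> e)\<bar> \<le> indicator D z" for z by (rule bnd)
    qed
    then show ?thesis by simp
  qed
  have lim: "(\<lambda>k. LINT t:{a<..b}|lborel. ?s k t) \<longlonglongrightarrow> (LINT t:{a<..b}|lborel. ?H t)"
    and H_int: "integrable lborel (\<lambda>t. indicator {a<..b} t *\<^sub>R ?H t)"
    unfolding set_lebesgue_integral_def
  proof -
    have c1: "(\<lambda>t. indicator {a<..b} t *\<^sub>R ?H t) \<in> borel_measurable lborel" using H_meas by measurable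
    have c2: "(\<lambda>t. indicator {a<..b} t *\<^sub>R ?s k t) \<in> borel_measurable lborel" for k
      using s_meas[of k] by measurable
    have c3: "integrable lborel (\<lambda>t. indicator {a<..b} t *\<^sub>R ?m t)" using m_set by (simp add: set_integrable_def)
    have c4: "AE t in lborel. (\<lambda>k. indicator {a<..b} t *\<^sub>R ?s k t) \<longlonglongrightarrow> indicator {a<..b} t *\<^sub>R ?H t"
      by (intro AE_I2 tendsto_scaleR tendsto_const s_lim)
    have c5: "AE t in lborel. norm (indicator {a<..b} t *\<^sub>R ?s k t) \<le> indicator {a<..b} t *\<^sub>R ?m t" for k
    proof (rule AE_I2)
      fix t show "norm (indicator {a<..b} t *\<^sub>R ?s k t) \<le> indicator {a<..b} t *\<^sub>R ?m t"
        unfolding norm_scaleR real_norm_def using s_bnd[of t k]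
        by (cases "t \<in> {a<..b}") (simp_all only: indicator_simps, simp_all)
    qed
    show "(\<lambda>k. \<integral>t. indicator {a<..b} t *\<^sub>R ?s k t \<partial>lborel) \<longlonglongrightarrow> (\<integral>t. indicator {a<..b} t *\<^sub>R ?H t \<partial>lborel)"
      by (rule integral_dominated_convergence[OF c1 c2 c3 c4 c5])
    show "integrable lborel (\<lambda>t. indicator {a<..b} t *\<^sub>R ?H t)"
      by (rule integrable_dominated_convergence[OF c1 c2 c3 c4 c5])
  qed
  show "set_integrable lborel {a<..b} ?H" using H_int by (simp add: set_integrable_def)
  have s_int: "(LINT t:{a<..b}|lborel. ?s k t) = (\<integral>z. indicator {a<..b} (f z) * (\<phi> k z * (e \<bullet> F z)) \<partial>M)" for k
  proof -
    have "(LINT t:{a<..b}|lborel. ?s k t) = (LINT t:{a<..b}|lborel. S t (?\<theta> k))"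
      unfolding set_lebesgue_integral_def
    proof (rule integral_cong_AE)
      show "(\<lambda>t. indicator {a<..b} t *\<^sub>R ?s k t) \<in> borel_measurable lborel" using s_meas[of k] by measurable
      show "(\<lambda>t. indicator {a<..b} t *\<^sub>R S t (?\<theta> k)) \<in> borel_measurable lborel"
        using S_measurable[OF \<theta>[of k]] by measurable
      show "AE t in lborel. indicator {a<..b} t *\<^sub>R ?s k t = indicator {a<..b} t *\<^sub>R S t (?\<theta> k)"
        using AE_good by eventually_elim simp
    qed
    also have "\<dots> = (\<integral>z. indicator {a<..b} (f z) * (\<phi> k z * (e \<bullet> F z)) \<partial>M)"
      unfolding S_integral[OF \<theta> ab] by simp
    finally show ?thesis .
  qed
  have [measurable]: "D \<in> sets M" by (rule M.open_in_sets[OF D(1) DU])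
  have "(\<lambda>k. \<integral>z. indicator {a<..b} (f z) * (\<phi> k z * (e \<bullet> F z)) \<partial>M) \<longlonglongrightarrow>
      (\<integral>z. indicator {a<..b} (f z) * (indicator D z * (e \<bullet> F z)) \<partial>M)"
  proof (rule integral_dominated_convergence[where w="\<lambda>z. norm (F z) * (indicator D z * indicator {a<..b} (f z))"])
    show "integrable M (\<lambda>z. norm (F z) * (indicator D z * indicator {a<..b} (f z)))"
    proof (rule integrableI_nonneg)
      have "(\<integral>\<^sup>+z. ennreal (norm (F z) * (indicator D z * indicator {a<..b} (f z))) \<partial>M) = G D a b"
        unfolding G_def by (intro nn_integral_cong) (auto simp: indicator_def)
      also have "\<dots> < \<infinity>" using G_eq_\<mu>[OF D(1) DU] box_fin by simp
      finally show "(\<integral>\<^sup>+z. ennreal (norm (F z) * (indicator D z * indicator {a<..b} (f z))) \<partial>M) < \<infinity>" .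
    qed auto
    show "AE z in M. (\<lambda>k. indicator {a<..b} (f z) * (\<phi> k z * (e \<bullet> F z))) \<longlonglongrightarrow>
        indicator {a<..b} (f z) * (indicator D z * (e \<bullet> F z))"
      by (intro AE_I2 tendsto_intros \<phi>)
    show "AE z in M. norm (indicator {a<..b} (f z) * (\<phi> k z * (e \<bullet> F z))) \<le>
        norm (F z) * (indicator D z * indicator {a<..b} (f z))" for k
    proof (rule AE_I2)
      fix z
      have "\<bar>\<phi> k z * (e \<bullet> F z)\<bar> = \<phi> k z * \<bar>e \<bullet> F z\<bar>" using \<phi>(2) by (simp add: abs_mult)
      also have "\<dots> \<le> indicator D z * norm (F z)"
        using \<phi>ind[of k z] \<phi>(2)[of k z] Basis_le_norm[OF e, of "F z"] by (intro mult_mono) (auto simp: inner_commute)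
      finally show "norm (indicator {a<..b} (f z) * (\<phi> k z * (e \<bullet> F z))) \<le>
        norm (F z) * (indicator D z * indicator {a<..b} (f z))" by (auto simp: indicator_def split: if_splits)
    qed
    show "(\<lambda>z. indicator {a<..b} (f z) * (\<phi> k z * (e \<bullet> F z))) \<in> borel_measurable M" for k
      using M.test_fun_measurable[OF \<phi>U[of k]] by measurable
  qed measurable
  then have "(\<lambda>k. LINT t:{a<..b}|lborel. ?s k t) \<longlonglongrightarrow>
      (\<integral>z. indicator {a<..b} (f z) * (indicator D z * (e \<bullet> F z)) \<partial>M)" unfolding s_int .
  from LIMSEQ_unique[OF lim this] have "(LINT t:{a<..b}|lborel. ?H t) =
      (\<integral>z. indicator {a<..b} (f z) * (indicator D z * (e \<bullet> F z)) \<partial>M)" .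
  also have "\<dots> = (\<integral>z. (indicator (D \<times> {a<..b}) (z, f z) *\<^sub>R e) \<bullet> F z \<partial>M)"
    by (intro Bochner_Integration.integral_cong refl) (auto simp: indicator_def)
  also have "\<dots> = (\<integral>p. (indicator (D \<times> {a<..b}) p *\<^sub>R e) \<bullet> n p \<partial>\<mu>)"
  proof (rule integral_\<mu>[symmetric])
    have "D \<times> {a<..b} \<in> sets \<mu>" using DU box_borel[OF D(1)] by (auto simp: sets_\<mu> sets_prod_iff)
    then show "(\<lambda>p. indicator (D \<times> {a<..b}) p *\<^sub>R e) \<in> borel_measurable \<mu>" by measurable
  qed
  finally show "(LINT t:{a<..b}|lborel. ?H t) = (\<integral>p. indicator (D \<times> {a<..b}) p * (n p \<bullet> e) \<partial>\<mu>)"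
    by (simp add: inner_commute)
qed

text \<open>The weights lie between 0 and 2, since a component of a vector of norm at most 1 is at
  least -1 and at most 1. Thus these are positive locally finite measures, and subtracting the
  unweighted ones recovers the signed component.\<close>

abbreviation "\<kappa>' e t \<equiv> density (\<nu> t) (\<lambda>z. ennreal (1 + normal t z \<bullet> e))"
abbreviation "\<mu>' e \<equiv> density \<mu> (\<lambda>p. ennreal (1 + n p \<bullet> e))"

lemma integral_weight:
  fixes X :: "'c measure" and h :: "'c \<Rightarrow> 'b"
  assumes A: "A \<in> sets X" "emeasure X A < \<infinity>" and h: "h \<in> borel_measurable X" "\<And>x. norm (h x) \<le> 1"
    and e: "e \<in> Basis"
  shows "emeasure (density X (\<lambda>x. ennreal (1 + h x \<bullet> e))) A = ennreal (measure X A + (\<integral>x. indicator A x * (h x \<bullet> e) \<partial>X))"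
    "0 \<le> measure X A + (\<integral>x. indicator A x * (h x \<bullet> e) \<partial>X)"
proof -
  have iA: "integrable X (indicator A :: 'c \<Rightarrow> real)" using A by (rule integrable_real_indicator)
  have ih: "integrable X (\<lambda>x. indicator A x * (h x \<bullet> e))"
  proof (rule Bochner_Integration.integrable_bound[OF iA])
    show "(\<lambda>x. indicator A x * (h x \<bullet> e)) \<in> borel_measurable X" using A(1) h(1) by measurable
    show "AE x in X. norm (indicator A x * (h x \<bullet> e)) \<le> norm (indicator A x :: real)"
      using inner_Basis_le[OF h(2) e] by (auto simp: indicator_def)
  qed
  have pos: "0 \<le> indicator A x + indicator A x * (h x \<bullet> e)" for x
    using inner_Basis_le[OF h(2)[of x] e] by (auto simp: indicator_def abs_le_iff)
  have int: "(\<integral>x. indicator A x + indicator A x * (h x \<bullet> e) \<partial>X) = measure X A + (\<integral>x. indicator A x * (h x \<bullet> e) \<partial>X)"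
    using iA ih A(1) by simp
  show "0 \<le> measure X A + (\<integral>x. indicator A x * (h x \<bullet> e) \<partial>X)"
    unfolding int[symmetric] using pos by simp
  have "emeasure (density X (\<lambda>x. ennreal (1 + h x \<bullet> e))) A = (\<integral>\<^sup>+x. ennreal (1 + h x \<bullet> e) * indicator A x \<partial>X)"
    using A(1) h(1) by (intro emeasure_density) auto
  also have "\<dots> = (\<integral>\<^sup>+x. ennreal (indicator A x + indicator A x * (h x \<bullet> e)) \<partial>X)"
    by (intro nn_integral_cong) (auto simp: indicator_def)
  also have "\<dots> = ennreal (\<integral>x. indicator A x + indicator A x * (h x \<bullet> e) \<partial>X)"
    using iA ih pos by (intro nn_integral_eq_integral) auto
  finally show "emeasure (density X (\<lambda>x. ennreal (1 + h x \<bullet> e))) A = ennreal (measure X A + (\<integral>x. indicator A x * (h x \<bullet> e) \<partial>X))"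
    unfolding int .
qed

text \<open>The box identity for the weighted measures is the sum of the one for \<mu> and the
  component identity of \<open>normal_component\<close>.\<close>

lemma disintegration_component:
  assumes e: "e \<in> Basis" shows "disintegration U C (\<mu>' e) (\<kappa>' e)"
proof -
  interpret ME: locally_finite "U \<times> (UNIV :: real set)" "\<mu>' e"
  proof (rule Mu.locally_finite_density)
    show "(\<lambda>p. ennreal (1 + n p \<bullet> e)) \<in> borel_measurable \<mu>" using n_measurable by measurable
    fix K assume K: "compact K" "K \<subseteq> U \<times> (UNIV :: real set)"
    have "(\<integral>\<^sup>+p\<in>K. ennreal (1 + n p \<bullet> e) \<partial>\<mu>) \<le> (\<integral>\<^sup>+p. ennreal 2 * indicator K p \<partial>\<mu>)"
    proof (intro nn_integral_mono mult_right_mono ennreal_leI)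
      fix p show "1 + n p \<bullet> e \<le> 2" using inner_Basis_le[OF norm_n e, of p] by (simp add: abs_le_iff)
    qed simp
    also have "\<dots> = ennreal 2 * emeasure \<mu> K" using Mu.compact_in_sets[OF K] by (simp add: nn_integral_cmult_indicator)
    also have "\<dots> < \<infinity>" using Mu.finite_on_compact[OF K] by (simp add: ennreal_mult_less_top)
    finally show "(\<integral>\<^sup>+p\<in>K. ennreal (1 + n p \<bullet> e) \<partial>\<mu>) < \<infinity>" .
  qed
  have em: "emeasure (\<kappa>' e t) D = ennreal (measure (\<nu> t) D + (\<integral>z. indicator D z * (normal t z \<bullet> e) \<partial>\<nu> t))"
    "0 \<le> measure (\<nu> t) D + (\<integral>z. indicator D z * (normal t z \<bullet> e) \<partial>\<nu> t)"
    if D: "open D" "D \<subseteq> C k" for D k t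
    using integral_weight[OF D_sets[OF D(1) subset_trans[OF D(2) C_subset]] \<nu>_finite'[OF D(2)] normal norm_normal e] by auto
  show ?thesis
  proof
    show "sets (\<kappa>' e t) = sets (borel_of (top_of_set U))" for t by (simp add: sets_\<nu>)
    show "emeasure (\<kappa>' e t) (C k) < \<infinity>" for t k using em(1)[OF open_C order_refl] by simp
    fix D k assume D: "open D" "D \<subseteq> C k"
    have DU: "D \<subseteq> U" using D C_subset by blast
    note nc = normal_component[OF D e]
    show "(\<lambda>t. emeasure (\<kappa>' e t) D) \<in> borel_measurable borel"
    proof -
      have "(\<lambda>t. measure (\<nu> t) D) \<in> borel_measurable borel"
        unfolding measure_def using \<nu>_open_measurable[OF D(1) DU] by measurable
      then show ?thesis unfolding em(1)[OF D] using nc(1)[of 0 1] by measurable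
    qed
    fix a b :: real assume ab: "a < b"
    have box: "D \<times> {a<..b} \<in> sets \<mu>" using DU box_borel[OF D(1)] by (auto simp: sets_\<mu> sets_prod_iff)
    have fin: "emeasure \<mu> (D \<times> {a<..b}) < \<infinity>" using nc(5)[OF ab] by (metis ennreal_less_top infinity_ennreal_def)
    let ?g = "\<lambda>t. indicator {a<..b} t *\<^sub>R measure (\<nu> t) D + indicator {a<..b} t *\<^sub>R (\<integral>z. indicator D z * (normal t z \<bullet> e) \<partial>\<nu> t)"
    have "(\<integral>\<^sup>+t\<in>{a<..b}. emeasure (\<kappa>' e t) D \<partial>lborel) = (\<integral>\<^sup>+t. ennreal (?g t) \<partial>lborel)"
      unfolding em(1)[OF D] by (intro nn_integral_cong) (auto simp: indicator_def)
    also have "\<dots> = ennreal (\<integral>t. ?g t \<partial>lborel)"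
    proof (rule nn_integral_eq_integral)
      show "integrable lborel ?g" using nc(2,4)[OF ab] by (auto simp: set_integrable_def)
      show "AE t in lborel. 0 \<le> ?g t" using em(2)[OF D] by (auto simp: indicator_def)
    qed
    also have "(\<integral>t. ?g t \<partial>lborel) = (LINT t:{a<..b}|lborel. measure (\<nu> t) D) + (\<integral>p. indicator (D \<times> {a<..b}) p * (n p \<bullet> e) \<partial>\<mu>)"
      using nc(2,4)[OF ab] unfolding nc(3)[OF ab, symmetric]
      by (simp add: set_integrable_def set_lebesgue_integral_def)
    also have "(LINT t:{a<..b}|lborel. measure (\<nu> t) D) = measure \<mu> (D \<times> {a<..b})"
    proof -
      have "0 \<le> (LINT t:{a<..b}|lborel. measure (\<nu> t) D)"
        unfolding set_lebesgue_integral_def by (intro Bochner_Integration.integral_nonneg) simp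
      then show ?thesis using nc(5)[OF ab] by (metis enn2real_ennreal measure_def)
    qed
    also have "ennreal (measure \<mu> (D \<times> {a<..b}) + (\<integral>p. indicator (D \<times> {a<..b}) p * (n p \<bullet> e) \<partial>\<mu>)) = emeasure (\<mu>' e) (D \<times> {a<..b})"
      by (rule integral_weight(1)[OF box fin n_measurable norm_n e, symmetric])
    finally show "(\<integral>\<^sup>+t\<in>{a<..b}. emeasure (\<kappa>' e t) D \<partial>lborel) = emeasure (\<mu>' e) (D \<times> {a<..b})" .
  qed
qed

end

section \<open>Integration formulas for the slices\<close>

context coarea_slices
begin

lemma variation_S: "good t \<Longrightarrow> variation U (S t) = \<nu> t" by (simp add: \<nu>_def)

lemma dist_ext_S:
  assumes "good t" "h \<in> L1_space (\<nu> t)"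
  shows "dist_ext U (S t) h = (\<integral>z. h z \<bullet> normal t z \<partial>completion (\<nu> t))"
  by (rule locally_finite.dist_ext_eq[OF locally_finite_\<nu> variation_S[OF assms(1)] normal norm_normal
        S_eq_normal[OF assms(1)] assms(2)])

lemma integral_weight_component:
  fixes X :: "'c measure" and h :: "'c \<Rightarrow> 'b" and g :: "'c \<Rightarrow> real"
  assumes h: "h \<in> borel_measurable X" "\<And>x. norm (h x) \<le> 1" and e: "e \<in> Basis" and g: "integrable X g"
  shows "integrable (density X (\<lambda>x. ennreal (1 + h x \<bullet> e))) g"
    "(\<integral>x. g x * (h x \<bullet> e) \<partial>X) = (\<integral>x. g x \<partial>density X (\<lambda>x. ennreal (1 + h x \<bullet> e))) - (\<integral>x. g x \<partial>X)"
    "integrable X (\<lambda>x. g x * (h x \<bullet> e))"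
proof -
  have gm: "g \<in> borel_measurable X" using g by simp
  have wm: "(\<lambda>x. 1 + h x \<bullet> e) \<in> borel_measurable X" using h(1) by measurable
  have pos: "AE x in X. 0 \<le> 1 + h x \<bullet> e"
  proof (rule AE_I2)
    fix x show "0 \<le> 1 + h x \<bullet> e" using inner_Basis_le[OF h(2)[of x] e] by linarith
  qed
  show ge: "integrable X (\<lambda>x. g x * (h x \<bullet> e))"
  proof (rule Bochner_Integration.integrable_bound[OF g])
    show "(\<lambda>x. g x * (h x \<bullet> e)) \<in> borel_measurable X" using gm h(1) by measurable
    show "AE x in X. norm (g x * (h x \<bullet> e)) \<le> norm (g x)"
    proof (rule AE_I2)
      fix x show "norm (g x * (h x \<bullet> e)) \<le> norm (g x)"
        using mult_left_mono[OF inner_Basis_le[OF h(2)[of x] e] abs_ge_zero[of "g x"]] by (simp add: abs_mult)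
    qed
  qed
  have sum: "(1 + h x \<bullet> e) *\<^sub>R g x = g x + g x * (h x \<bullet> e)" for x by (simp add: algebra_simps)
  show "integrable (density X (\<lambda>x. ennreal (1 + h x \<bullet> e))) g"
    unfolding integrable_density[OF gm wm pos] sum by (rule Bochner_Integration.integrable_add[OF g ge])
  have "(\<integral>x. g x \<partial>density X (\<lambda>x. ennreal (1 + h x \<bullet> e))) = (\<integral>x. g x \<partial>X) + (\<integral>x. g x * (h x \<bullet> e) \<partial>X)"
    unfolding integral_density[OF gm wm pos] sum by (rule Bochner_Integration.integral_add[OF g ge])
  then show "(\<integral>x. g x * (h x \<bullet> e) \<partial>X) = (\<integral>x. g x \<partial>density X (\<lambda>x. ennreal (1 + h x \<bullet> e))) - (\<integral>x. g x \<partial>X)"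
    by simp
qed

text \<open>The inner product is expanded in coordinates, and each signed measure (h \<bullet> e) X
  is the difference of the positive measures (1 + h \<bullet> e) X and X, to which the
  disintegration applies.\<close>

lemma integral_inner_components:
  fixes X :: "'c measure" and h g :: "'c \<Rightarrow> 'b"
  assumes h: "h \<in> borel_measurable X" "\<And>x. norm (h x) \<le> 1" and g: "integrable X g"
  shows "(\<integral>x. g x \<bullet> h x \<partial>X) =
    (\<Sum>e\<in>Basis. (\<integral>x. g x \<bullet> e \<partial>density X (\<lambda>x. ennreal (1 + h x \<bullet> e))) - (\<integral>x. g x \<bullet> e \<partial>X))"
proof -
  have ge: "integrable X (\<lambda>x. g x \<bullet> e)" for e using g by simp
  have "(\<integral>x. g x \<bullet> h x \<partial>X) = (\<integral>x. (\<Sum>e\<in>Basis. (g x \<bullet> e) * (h x \<bullet> e)) \<partial>X)"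
    by (intro Bochner_Integration.integral_cong refl) (rule euclidean_inner)
  also have "\<dots> = (\<Sum>e\<in>Basis. \<integral>x. (g x \<bullet> e) * (h x \<bullet> e) \<partial>X)"
    by (intro Bochner_Integration.integral_sum integral_weight_component(3)[OF h _ ge])
  also have "\<dots> = (\<Sum>e\<in>Basis. (\<integral>x. g x \<bullet> e \<partial>density X (\<lambda>x. ennreal (1 + h x \<bullet> e))) - (\<integral>x. g x \<bullet> e \<partial>X))"
    by (intro sum.cong refl integral_weight_component(2)[OF h _ ge])
  finally show ?thesis .
qed

theorem slices_L1:
  assumes \<psi>: "\<psi> \<in> L1_space (variation (U \<times> UNIV) T)"
  shows "AE t in lebesgue. (\<lambda>z. \<psi> (z, t)) \<in> L1_space (variation U (S t))"
    "integrable lebesgue (\<lambda>t. dist_ext U (S t) (\<lambda>z. \<psi> (z, t)))"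
    "dist_ext (U \<times> UNIV) T \<psi> = (\<integral>t. dist_ext U (S t) (\<lambda>z. \<psi> (z, t)) \<partial>lebesgue)"
proof -
  have \<psi>\<mu>: "\<psi> \<in> L1_space \<mu>" using \<psi> by (simp add: variation_T)
  obtain \<psi>' where \<psi>': "integrable \<mu> \<psi>'" "AE p in \<mu>. \<psi> p = \<psi>' p" using L1_space_borel[OF \<psi>\<mu>] by blast
  have \<psi>'m: "\<psi>' \<in> borel_measurable \<mu>" using \<psi>'(1) by simp
  have comp: "integrable \<mu> (\<lambda>p. \<psi>' p \<bullet> e)" for e using \<psi>'(1) by simp
  have AEeq: "AE t in lborel. AE z in \<nu> t. \<psi> (z, t) = \<psi>' (z, t)" by (rule Dis.AE_slices[OF \<psi>'(2)])
  have AEint: "AE t in lborel. integrable (\<nu> t) (\<lambda>z. \<psi>' (z, t))"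
    using Dis.integral_disintegration(1)[OF integrable_norm[OF \<psi>'(1)]]
  proof eventually_elim
    case (elim t)
    have "(\<lambda>z. \<psi>' (z, t)) \<in> borel_measurable (\<nu> t)" by (rule Dis.slice_measurable[OF \<psi>'m])
    with elim show ?case by (rule integrable_norm_cancel)
  qed
  let ?h = "\<lambda>t. dist_ext U (S t) (\<lambda>z. \<psi> (z, t))"
  \<comment> \<open>The value on a slice in terms of positive kernels only; the two integrals in
    each summand are disintegrated separately and reassembled for \<open>n\<close> on the
    product.\<close>
  let ?k = "\<lambda>t. \<Sum>e\<in>Basis. (\<integral>z. \<psi>' (z, t) \<bullet> e \<partial>\<kappa>' e t) - (\<integral>z. \<psi>' (z, t) \<bullet> e \<partial>\<nu> t)"
  have L1: "(\<lambda>z. \<psi> (z, t)) \<in> L1_space (\<nu> t)"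
    and hk: "good t \<Longrightarrow> ?h t = ?k t"
    if "AE z in \<nu> t. \<psi> (z, t) = \<psi>' (z, t)" "integrable (\<nu> t) (\<lambda>z. \<psi>' (z, t))" for t
  proof -
    show L1: "(\<lambda>z. \<psi> (z, t)) \<in> L1_space (\<nu> t)"
      unfolding L1_space_def using completion_integrable_AE(1)[OF that(2,1)] by simp
    assume g: "good t"
    have "?h t = (\<integral>z. \<psi> (z, t) \<bullet> normal t z \<partial>completion (\<nu> t))" by (rule dist_ext_S[OF g L1])
    also have "\<dots> = (\<integral>z. \<psi>' (z, t) \<bullet> normal t z \<partial>\<nu> t)"
    proof (rule completion_integrable_AE(2))
      show "integrable (\<nu> t) (\<lambda>z. \<psi>' (z, t) \<bullet> normal t z)"
        by (rule locally_finite.bounded_mult_integrable[OF locally_finite_\<nu> that(2) normal norm_normal])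
      show "AE z in \<nu> t. \<psi> (z, t) \<bullet> normal t z = \<psi>' (z, t) \<bullet> normal t z"
        using that(1) by eventually_elim simp
    qed
    also have "\<dots> = ?k t" by (rule integral_inner_components[OF normal norm_normal that(2)])
    finally show "?h t = ?k t" .
  qed
  have "AE t in lborel. (\<lambda>z. \<psi> (z, t)) \<in> L1_space (variation U (S t))"
    using AEeq AEint AE_good by eventually_elim (use L1 variation_S in simp)
  then show "AE t in lebesgue. (\<lambda>z. \<psi> (z, t)) \<in> L1_space (variation U (S t))" by (rule AE_completion)
  have eq: "AE t in lborel. ?h t = ?k t"
    using AEeq AEint AE_good by eventually_elim (rule hk)
  have ie: "integrable lborel (\<lambda>t. \<integral>z. \<psi>' (z, t) \<bullet> e \<partial>\<kappa>' e t)"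
    "(\<integral>t. (\<integral>z. \<psi>' (z, t) \<bullet> e \<partial>\<kappa>' e t) \<partial>lborel) = (\<integral>p. \<psi>' p \<bullet> e \<partial>\<mu>' e)" if e: "e \<in> Basis" for e
    using disintegration.integral_disintegration(2,3)[OF disintegration_component[OF e]
        integral_weight_component(1)[OF n_measurable norm_n e comp]] by auto
  have i: "integrable lborel (\<lambda>t. \<integral>z. \<psi>' (z, t) \<bullet> e \<partial>\<nu> t)"
    "(\<integral>t. (\<integral>z. \<psi>' (z, t) \<bullet> e \<partial>\<nu> t) \<partial>lborel) = (\<integral>p. \<psi>' p \<bullet> e \<partial>\<mu>)" for e
    using Dis.integral_disintegration(2,3)[OF comp] by auto
  have ik: "integrable lborel ?k" using ie i by (intro Bochner_Integration.integrable_sum Bochner_Integration.integrable_diff)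
  show "integrable lebesgue ?h" by (rule completion_integrable_AE(1)[OF ik eq])
  have "(\<integral>t. ?h t \<partial>lebesgue) = (\<integral>t. ?k t \<partial>lborel)" by (rule completion_integrable_AE(2)[OF ik eq])
  also have "\<dots> = (\<Sum>e\<in>Basis. (\<integral>t. (\<integral>z. \<psi>' (z, t) \<bullet> e \<partial>\<kappa>' e t) - (\<integral>z. \<psi>' (z, t) \<bullet> e \<partial>\<nu> t) \<partial>lborel))"
    using ie i by (intro Bochner_Integration.integral_sum Bochner_Integration.integrable_diff)
  also have "\<dots> = (\<Sum>e\<in>Basis. (\<integral>p. \<psi>' p \<bullet> e \<partial>\<mu>' e) - (\<integral>p. \<psi>' p \<bullet> e \<partial>\<mu>))"
  proof (rule sum.cong[OF refl])
    fix e :: 'b assume e: "e \<in> Basis"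
    show "(\<integral>t. (\<integral>z. \<psi>' (z, t) \<bullet> e \<partial>\<kappa>' e t) - (\<integral>z. \<psi>' (z, t) \<bullet> e \<partial>\<nu> t) \<partial>lborel) = (\<integral>p. \<psi>' p \<bullet> e \<partial>\<mu>' e) - (\<integral>p. \<psi>' p \<bullet> e \<partial>\<mu>)"
      unfolding ie(2)[OF e, symmetric] i(2)[symmetric]
      by (rule Bochner_Integration.integral_diff[OF ie(1)[OF e] i(1)])
  qed
  also have "\<dots> = (\<integral>p. \<psi>' p \<bullet> n p \<partial>\<mu>)" by (rule integral_inner_components[OF n_measurable norm_n \<psi>'(1), symmetric])
  also have "\<dots> = (\<integral>p. \<psi> p \<bullet> n p \<partial>completion \<mu>)"
  proof (rule completion_integrable_AE(2)[symmetric])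
    show "integrable \<mu> (\<lambda>p. \<psi>' p \<bullet> n p)" by (rule Mu.bounded_mult_integrable[OF \<psi>'(1) n_measurable norm_n])
    show "AE p in \<mu>. \<psi> p \<bullet> n p = \<psi>' p \<bullet> n p" using \<psi>'(2) by eventually_elim simp
  qed
  also have "\<dots> = dist_ext (U \<times> UNIV) T \<psi>" by (rule dist_ext_T[OF \<psi>\<mu>, symmetric])
  finally show "dist_ext (U \<times> UNIV) T \<psi> = (\<integral>t. ?h t \<partial>lebesgue)" ..
qed

lemma e2ennreal_minus: "e2ennreal (enn2ereal x - enn2ereal y) = x - y"
proof -
  have "e2ennreal (max 0 r) = e2ennreal r" for r
    by (cases "0 \<le> r") (simp_all add: max_def e2ennreal_neg)
  then have "e2ennreal (enn2ereal x - enn2ereal y) = e2ennreal (enn2ereal (x - y))"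
    by (simp only: minus_ennreal.rep_eq)
  then show ?thesis by (simp only: e2ennreal_enn2ereal)
qed

text \<open>With truncated subtraction both sides are the maximum of a and b.\<close>

lemma ennreal_add_diff_swap: "(a::ennreal) + (b - a) = b + (a - b)"
proof (cases "a \<le> b")
  case True
  then show ?thesis
    by (cases "a = top") (auto simp: add_diff_inverse_ennreal diff_eq_0_iff_ennreal top_unique less_top)
next
  case False
  then have "b \<le> a" "b < top" by (auto simp: less_top[symmetric])
  then show ?thesis by (simp add: add_diff_inverse_ennreal diff_eq_0_iff_ennreal)
qed

text \<open>Transposing x + v = y + u; the second hypothesis makes the two terms on one side finite
  and thereby excludes a difference of infinities.\<close>

lemma enn2ereal_diff_eq:
  assumes eq: "x + v = y + u" and fin: "x < \<infinity> \<and> u \<le> x \<or> y < \<infinity> \<and> v \<le> y"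
  shows "enn2ereal x - enn2ereal y = enn2ereal u - enn2ereal v"
  using assms
  by (cases x rule: ennreal_cases; cases y rule: ennreal_cases; cases u rule: ennreal_cases; cases v rule: ennreal_cases)
    (auto simp: top_unique enn2ereal_ennreal simp flip: ennreal_plus)

text \<open>If P and Q are the slice integrals of the two parts of g, the inner integral P - Q may
  cancel: its own parts are the truncated differences of P and Q, not P and Q. The equality P + (Q -
  P) = Q + (P - Q) for truncated differences compensates after integration in t.\<close>

theorem slices_ereal:
  fixes g :: "'a \<times> real \<Rightarrow> ereal"
  assumes g: "ereal_integrable (completion (variation (U \<times> UNIV) T)) g"
  shows "AE t in lebesgue. ereal_integrable (completion (variation U (S t))) (\<lambda>z. g (z, t))"
    "ereal_integrable lebesgue (\<lambda>t. ereal_integral (completion (variation U (S t))) (\<lambda>z. g (z, t)))"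
    "ereal_integral (completion (variation (U \<times> UNIV) T)) g =
      ereal_integral lebesgue (\<lambda>t. ereal_integral (completion (variation U (S t))) (\<lambda>z. g (z, t)))"
proof -
  have gm: "g \<in> borel_measurable (completion \<mu>)"
    and gfin: "(\<integral>\<^sup>+p. e2ennreal (g p) \<partial>\<mu>) < \<infinity> \<or> (\<integral>\<^sup>+p. e2ennreal (- g p) \<partial>\<mu>) < \<infinity>"
    using g by (auto simp: ereal_integrable_def variation_T nn_integral_completion)
  have pm: "(\<lambda>p. e2ennreal (g p)) \<in> borel_measurable (completion \<mu>)" using gm by measurable
  have qm: "(\<lambda>p. e2ennreal (- g p)) \<in> borel_measurable (completion \<mu>)" using gm by measurable
  obtain p where p: "p \<in> borel_measurable \<mu>" "AE x in \<mu>. e2ennreal (g x) = p x"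
    using completion_ex_borel_measurable[OF pm] by blast
  obtain q where q: "q \<in> borel_measurable \<mu>" "AE x in \<mu>. e2ennreal (- g x) = q x"
    using completion_ex_borel_measurable[OF qm] by blast
  define P where "P t = (\<integral>\<^sup>+z. p (z, t) \<partial>\<nu> t)" for t
  define Q where "Q t = (\<integral>\<^sup>+z. q (z, t) \<partial>\<nu> t)" for t
  have [measurable]: "P \<in> borel_measurable borel" "Q \<in> borel_measurable borel"
    and IP': "(\<integral>\<^sup>+x. p x \<partial>\<mu>) = (\<integral>\<^sup>+t. P t \<partial>lborel)" and IQ': "(\<integral>\<^sup>+x. q x \<partial>\<mu>) = (\<integral>\<^sup>+t. Q t \<partial>lborel)"
    using Dis.nn_integral_disintegration[OF p(1)] Dis.nn_integral_disintegration[OF q(1)]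
    unfolding P_def[abs_def] Q_def[abs_def] by auto
  have IP: "(\<integral>\<^sup>+x. e2ennreal (g x) \<partial>\<mu>) = (\<integral>\<^sup>+t. P t \<partial>lborel)"
    unfolding IP'[symmetric] by (rule nn_integral_cong_AE[OF p(2)])
  have IQ: "(\<integral>\<^sup>+x. e2ennreal (- g x) \<partial>\<mu>) = (\<integral>\<^sup>+t. Q t \<partial>lborel)"
    unfolding IQ'[symmetric] by (rule nn_integral_cong_AE[OF q(2)])
  have fin: "(\<integral>\<^sup>+t. P t \<partial>lborel) < \<infinity> \<or> (\<integral>\<^sup>+t. Q t \<partial>lborel) < \<infinity>" using gfin IP IQ by simp
  have PQ: "AE t in lborel. P t < \<infinity> \<or> Q t < \<infinity>"
  proof -
    have "AE t in lborel. P t < \<infinity>" if "(\<integral>\<^sup>+t. P t \<partial>lborel) < \<infinity>"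
      using nn_integral_PInf_AE[of P lborel] that by (auto simp: less_top)
    moreover have "AE t in lborel. Q t < \<infinity>" if "(\<integral>\<^sup>+t. Q t \<partial>lborel) < \<infinity>"
      using nn_integral_PInf_AE[of Q lborel] that by (auto simp: less_top)
    ultimately show ?thesis using fin by (auto elim: eventually_mono)
  qed
  have split: "x = enn2ereal (e2ennreal x) - enn2ereal (e2ennreal (- x))" for x :: ereal
    by (cases "0 \<le> x") (auto simp: enn2ereal_e2ennreal e2ennreal_neg zero_ennreal.rep_eq)
  have slice: "(\<lambda>z. g (z, t)) \<in> borel_measurable (completion (\<nu> t)) \<and>
      (\<integral>\<^sup>+z. e2ennreal (g (z, t)) \<partial>completion (\<nu> t)) = P t \<and> (\<integral>\<^sup>+z. e2ennreal (- g (z, t)) \<partial>completion (\<nu> t)) = Q t"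
    if ae: "AE z in \<nu> t. e2ennreal (g (z, t)) = p (z, t)" "AE z in \<nu> t. e2ennreal (- g (z, t)) = q (z, t)" for t
  proof (intro conjI)
    have [measurable]: "(\<lambda>z. p (z, t)) \<in> borel_measurable (\<nu> t)" "(\<lambda>z. q (z, t)) \<in> borel_measurable (\<nu> t)"
      by (rule Dis.slice_measurable[OF p(1)], rule Dis.slice_measurable[OF q(1)])
    show "(\<lambda>z. g (z, t)) \<in> borel_measurable (completion (\<nu> t))"
    proof (rule completion_measurable_AE)
      show "(\<lambda>z. enn2ereal (p (z, t)) - enn2ereal (q (z, t))) \<in> borel_measurable (\<nu> t)" by measurable
      show "AE z in \<nu> t. g (z, t) = enn2ereal (p (z, t)) - enn2ereal (q (z, t))"
        using ae by eventually_elim (metis split)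
    qed simp
    show "(\<integral>\<^sup>+z. e2ennreal (g (z, t)) \<partial>completion (\<nu> t)) = P t"
      unfolding nn_integral_completion P_def by (rule nn_integral_cong_AE[OF ae(1)])
    show "(\<integral>\<^sup>+z. e2ennreal (- g (z, t)) \<partial>completion (\<nu> t)) = Q t"
      unfolding nn_integral_completion Q_def by (rule nn_integral_cong_AE[OF ae(2)])
  qed
  let ?h = "\<lambda>t. ereal_integral (completion (variation U (S t))) (\<lambda>z. g (z, t))"
  let ?R = "\<lambda>t. enn2ereal (P t) - enn2ereal (Q t)"
  note AEs = Dis.AE_slices[OF p(2)] Dis.AE_slices[OF q(2)]
  have "AE t in lborel. ereal_integrable (completion (variation U (S t))) (\<lambda>z. g (z, t)) \<and> ?h t = ?R t"
    using AEs AE_good PQ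
  proof eventually_elim
    case (elim t)
    from slice[OF elim(1,2)] elim(4) show ?case
      unfolding variation_S[OF elim(3)] ereal_integrable_def ereal_integral_def by simp
  qed
  then have int: "AE t in lborel. ereal_integrable (completion (variation U (S t))) (\<lambda>z. g (z, t))"
    and hR: "AE t in lborel. ?h t = ?R t" by (auto elim: eventually_mono)
  show "AE t in lebesgue. ereal_integrable (completion (variation U (S t))) (\<lambda>z. g (z, t))"
    by (rule AE_completion[OF int])
  have Rm: "?R \<in> borel_measurable lborel" by measurable
  have hm: "?h \<in> borel_measurable lebesgue" by (rule completion_measurable_AE[OF Rm hR]) simp
  have u: "(\<integral>\<^sup>+t. e2ennreal (?h t) \<partial>lebesgue) = (\<integral>\<^sup>+t. P t - Q t \<partial>lborel)"
    unfolding nn_integral_completion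
    by (rule nn_integral_cong_AE) (use hR PQ in eventually_elim, simp add: e2ennreal_minus)
  have v: "(\<integral>\<^sup>+t. e2ennreal (- ?h t) \<partial>lebesgue) = (\<integral>\<^sup>+t. Q t - P t \<partial>lborel)"
    unfolding nn_integral_completion
  proof (rule nn_integral_cong_AE)
    show "AE t in lborel. e2ennreal (- ?h t) = Q t - P t"
      using hR PQ
    proof eventually_elim
      case (elim t)
      have "- ?R t = enn2ereal (Q t) - enn2ereal (P t)"
        using elim(2) by (cases "P t" rule: ennreal_cases; cases "Q t" rule: ennreal_cases) (auto simp: enn2ereal_ennreal)
      with elim show ?case by (simp add: e2ennreal_minus disj_commute)
    qed
  qed
  have uP: "(\<integral>\<^sup>+t. P t - Q t \<partial>lborel) \<le> (\<integral>\<^sup>+t. P t \<partial>lborel)" and vQ: "(\<integral>\<^sup>+t. Q t - P t \<partial>lborel) \<le> (\<integral>\<^sup>+t. Q t \<partial>lborel)"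
    by (auto intro!: nn_integral_mono simp: diff_le_self_ennreal)
  show "ereal_integrable lebesgue ?h"
    unfolding ereal_integrable_def u v using hm fin uP vQ le_less_trans by blast
  have add: "(\<integral>\<^sup>+t. P t \<partial>lborel) + (\<integral>\<^sup>+t. Q t - P t \<partial>lborel) = (\<integral>\<^sup>+t. Q t \<partial>lborel) + (\<integral>\<^sup>+t. P t - Q t \<partial>lborel)"
    by (subst (1 2) nn_integral_add[symmetric]) (auto simp: ennreal_add_diff_swap)
  show "ereal_integral (completion (variation (U \<times> UNIV) T)) g = ereal_integral lebesgue ?h"
  proof -
    have "ereal_integral (completion (variation (U \<times> UNIV) T)) g =
        enn2ereal (\<integral>\<^sup>+t. P t \<partial>lborel) - enn2ereal (\<integral>\<^sup>+t. Q t \<partial>lborel)"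
      unfolding ereal_integral_def variation_T nn_integral_completion IP IQ ..
    also have "\<dots> = enn2ereal (\<integral>\<^sup>+t. P t - Q t \<partial>lborel) - enn2ereal (\<integral>\<^sup>+t. Q t - P t \<partial>lborel)"
      by (rule enn2ereal_diff_eq[OF add]) (use fin uP vQ in auto)
    also have "\<dots> = ereal_integral lebesgue ?h"
      unfolding ereal_integral_def[of lebesgue] u v ..
    finally show ?thesis .
  qed
qed

lemma T_representable: "representable_by_integration (U \<times> UNIV) T"
  unfolding representable_by_integration_def variation_T by (rule Mu.radon)

lemma AE_S_representable: "AE t in lebesgue. representable_by_integration U (S t)"
  unfolding representable_by_integration_def
  by (rule AE_completion) (use AE_good in eventually_elim, rule good_radon)

end

section \<open>A covering theorem and approximate continuity\<close>

text \<open>Finitely many balls of radius d/2 cover K, and each contains at most one point of a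
  d-separated set.\<close>

lemma separated_card_bound:
  fixes K :: "'a::metric_space set"
  assumes "compact K" "0 < d"
  shows "\<exists>N. \<forall>Q. finite Q \<longrightarrow> Q \<subseteq> K \<longrightarrow> (\<forall>x\<in>Q. \<forall>y\<in>Q. x \<noteq> y \<longrightarrow> d \<le> dist x y) \<longrightarrow> card Q \<le> N"
proof -
  have cov: "K \<subseteq> (\<Union>c\<in>K. ball c (d / 2))"
  proof
    fix x assume "x \<in> K"
    then show "x \<in> (\<Union>c\<in>K. ball c (d / 2))" using assms(2) by (intro UN_I[of x]) auto
  qed
  obtain F where F: "finite F" "K \<subseteq> (\<Union>c\<in>F. ball c (d / 2))"
    by (rule compactE_image[OF assms(1) _ cov]) (rule open_ball, rule that)
  have "card Q \<le> card F"
    if Q: "finite Q" "Q \<subseteq> K" "\<And>x y. x \<in> Q \<Longrightarrow> y \<in> Q \<Longrightarrow> x \<noteq> y \<Longrightarrow> d \<le> dist x y" for Q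
  proof -
    have "\<forall>x\<in>Q. \<exists>c. c \<in> F \<and> x \<in> ball c (d / 2)"
    proof
      fix x assume "x \<in> Q"
      then have "x \<in> (\<Union>c\<in>F. ball c (d / 2))" using F(2) Q(2) by (meson subsetD)
      then show "\<exists>c. c \<in> F \<and> x \<in> ball c (d / 2)" by (elim UN_E) (intro exI conjI)
    qed
    from bchoice[OF this] obtain c where c': "\<forall>x\<in>Q. c x \<in> F \<and> x \<in> ball (c x) (d / 2)" by (elim exE) (rule that)
    note c = c'[rule_format]
    have "inj_on c Q"
    proof (rule inj_onI, rule ccontr)
      fix x y assume xy: "x \<in> Q" "y \<in> Q" "c x = c y" "x \<noteq> y"
      have "dist (c x) x < d / 2" "dist (c x) y < d / 2" using c[OF xy(1)] c[OF xy(2)] xy(3) by auto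
      then have "dist x y < d" using dist_triangle_half_r[of "c x" x d y] by simp
      with Q(3)[OF xy(1,2,4)] show False by simp
    qed
    then show ?thesis using c F(1) by (intro card_inj_on_le[of c]) auto
  qed
  then show ?thesis by (intro exI[of _ "card F"] allI impI) simp
qed

text \<open>In the triangle 0, u, v the side opposite to 0 is the longest, so the angle at 0 is at
  least sixty degrees and the unit vectors are at least 1 apart.\<close>

lemma dist_sgn_ge_1:
  fixes u v :: "'a::euclidean_space"
  assumes "u \<noteq> 0" "v \<noteq> 0" "norm u < norm (u - v)" "norm v < norm (u - v)"
  shows "1 \<le> dist (sgn u) (sgn v)"
proof -
  define a b where "a = norm u" and "b = norm v"
  have ab: "0 < a" "0 < b" using assms by (auto simp: a_def b_def)
  have uv: "(norm (u - v))\<^sup>2 = a\<^sup>2 + b\<^sup>2 - 2 * (u \<bullet> v)"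
    by (simp add: a_def b_def power2_norm_eq_inner algebra_simps inner_commute)
  have "a\<^sup>2 < (norm (u - v))\<^sup>2" "b\<^sup>2 < (norm (u - v))\<^sup>2"
    using assms by (auto simp: a_def b_def intro!: power_strict_mono)
  then have "2 * (u \<bullet> v) \<le> b\<^sup>2" "2 * (u \<bullet> v) \<le> a\<^sup>2" using uv by auto
  moreover have "a\<^sup>2 \<le> a * b \<or> b\<^sup>2 \<le> a * b" using ab by (simp add: power2_eq_square) (metis linear)
  ultimately have "2 * (u \<bullet> v) \<le> a * b" by linarith
  then have "2 * (sgn u \<bullet> sgn v) \<le> 1"
    using ab by (simp add: sgn_div_norm a_def b_def field_simps)
  moreover have "(norm (sgn u - sgn v))\<^sup>2 = 2 - 2 * (sgn u \<bullet> sgn v)"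
  proof -
    have "sgn u \<bullet> sgn u = 1" "sgn v \<bullet> sgn v = 1"
      using assms by (simp_all add: dot_square_norm norm_sgn)
    then show ?thesis by (simp add: power2_norm_eq_inner algebra_simps inner_commute)
  qed
  ultimately have "1\<^sup>2 \<le> (norm (sgn u - sgn v))\<^sup>2" by simp
  then have "1 \<le> norm (sgn u - sgn v)" by (rule power2_le_imp_le) simp
  then show ?thesis by (simp add: dist_norm)
qed

text \<open>The families of Besicovitch's covering theorem, as pairs of centre and radius: no closed
  ball contains the centre of another one.\<close>

definition ball_separated :: "('a::metric_space \<times> real) set \<Rightarrow> bool" where
  "ball_separated P \<longleftrightarrow> (\<forall>p\<in>P. 0 < snd p) \<and> (\<forall>p\<in>P. \<forall>q\<in>P. p \<noteq> q \<longrightarrow> max (snd p) (snd q) < dist (fst p) (fst q))"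

text \<open>Two centres whose balls meet at \<open>y\<close> are seen from \<open>y\<close> under an angle of at least sixty degrees.\<close>

lemma ball_separated_overlap:
  "\<exists>N::nat. \<forall>(P :: ('a::euclidean_space \<times> real) set) y. finite P \<longrightarrow> ball_separated P \<longrightarrow>
    card {p \<in> P. y \<in> cball (fst p) (snd p)} \<le> N"
proof -
  obtain N where N: "\<forall>Q :: 'a set. finite Q \<longrightarrow> Q \<subseteq> sphere 0 1 \<longrightarrow>
      (\<forall>x\<in>Q. \<forall>y\<in>Q. x \<noteq> y \<longrightarrow> 1 \<le> dist x y) \<longrightarrow> card Q \<le> N"
    using separated_card_bound[OF compact_sphere[of "0::'a" 1] zero_less_one] by (elim exE) (rule that)
  have "card {p \<in> P. y \<in> cball (fst p) (snd p)} \<le> N + 1"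
    if P: "finite P" "ball_separated P" for P :: "('a \<times> real) set" and y
  proof -
    let ?A = "{p \<in> P. y \<in> cball (fst p) (snd p) \<and> fst p \<noteq> y}" and ?B = "{p \<in> P. fst p = y}"
    have sep: "dist (sgn (fst p - y)) (sgn (fst q - y)) \<ge> 1" if "p \<in> ?A" "q \<in> ?A" "p \<noteq> q" for p q
    proof (rule dist_sgn_ge_1)
      have "max (snd p) (snd q) < dist (fst p) (fst q)" using P(2) that by (auto simp: ball_separated_def)
      then show "norm (fst p - y) < norm (fst p - y - (fst q - y))" "norm (fst q - y) < norm (fst p - y - (fst q - y))"
        using that by (auto simp: dist_norm)
    qed (use that in auto)
    have inj: "inj_on (\<lambda>p. sgn (fst p - y)) ?A"
    proof (rule inj_onI, rule ccontr)
      fix p q assume "p \<in> ?A" "q \<in> ?A" "sgn (fst p - y) = sgn (fst q - y)" "p \<noteq> q"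
      then show False using sep[of p q] by simp
    qed
    have "card ((\<lambda>p. sgn (fst p - y)) ` ?A) \<le> N"
    proof (rule N[rule_format])
      show "finite ((\<lambda>p. sgn (fst p - y)) ` ?A)" using P(1) by simp
      show "(\<lambda>p. sgn (fst p - y)) ` ?A \<subseteq> sphere 0 1" by (auto simp: norm_sgn)
      fix u v assume "u \<in> (\<lambda>p. sgn (fst p - y)) ` ?A" "v \<in> (\<lambda>p. sgn (fst p - y)) ` ?A" "u \<noteq> v"
      then obtain p q where "p \<in> ?A" "q \<in> ?A" "u = sgn (fst p - y)" "v = sgn (fst q - y)" by blast
      then show "1 \<le> dist u v" using sep[of p q] \<open>u \<noteq> v\<close> by metis
    qed
    then have A: "card ?A \<le> N" unfolding card_image[OF inj] .
    have B: "card ?B \<le> 1"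
    proof (rule card_le_Suc0_iff_eq[THEN iffD2, unfolded One_nat_def[symmetric]])
      show "finite ?B" using P(1) by simp
      show "\<forall>p\<in>?B. \<forall>q\<in>?B. p = q"
      proof (intro ballI, rule ccontr)
        fix p q assume pq: "p \<in> ?B" "q \<in> ?B" "p \<noteq> q"
        then have "max (snd p) (snd q) < dist (fst p) (fst q)" "0 < snd p"
          using P(2)[unfolded ball_separated_def] by blast+
        then show False using pq by simp
      qed
    qed
    have "card {p \<in> P. y \<in> cball (fst p) (snd p)} \<le> card (?A \<union> ?B)"
      using P(1) by (intro card_mono) auto
    also have "\<dots> \<le> card ?A + card ?B" by (rule card_Un_le)
    finally show ?thesis using A B by linarith
  qed
  then show ?thesis by blast
qed

text \<open>Greedy selection with the largest radii first: the induction adds a radius b smaller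
  than all earlier ones. Among the points of \<open>K b\<close> not yet covered a b-separated set of
  maximal size is taken. Maximality makes its b-balls cover the rest, and its points lie outside the
  earlier, larger balls.\<close>

lemma ball_separated_cover:
  fixes K :: "real \<Rightarrow> 'a::euclidean_space set"
  assumes "finite R" "\<And>r. r \<in> R \<Longrightarrow> 0 < r" "\<And>r. r \<in> R \<Longrightarrow> bounded (K r)"
  shows "\<exists>P. finite P \<and> ball_separated P \<and> (\<forall>p\<in>P. snd p \<in> R \<and> fst p \<in> K (snd p)) \<and>
    (\<Union>r\<in>R. K r) \<subseteq> (\<Union>p\<in>P. cball (fst p) (snd p))"
  using assms
proof (induction R rule: finite_linorder_min_induct)
  case empty
  then show ?case by (intro exI[of _ "{}"]) (auto simp: ball_separated_def)
next
  case (insert b R)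
  have "\<exists>P. finite P \<and> ball_separated P \<and> (\<forall>p\<in>P. snd p \<in> R \<and> fst p \<in> K (snd p)) \<and>
      (\<Union>r\<in>R. K r) \<subseteq> (\<Union>p\<in>P. cball (fst p) (snd p))"
    by (rule insert.IH) (use insert.prems in auto)
  then obtain P where P: "finite P" "ball_separated P" "\<forall>p\<in>P. snd p \<in> R \<and> fst p \<in> K (snd p)"
    "(\<Union>r\<in>R. K r) \<subseteq> (\<Union>p\<in>P. cball (fst p) (snd p))" by (elim exE conjE) (rule that)
  have b: "0 < b" "bounded (K b)" using insert.prems by auto
  define D where "D = K b - (\<Union>p\<in>P. cball (fst p) (snd p))"
  have "compact (closure (K b))" using b by (simp add: compact_closure)
  from separated_card_bound[OF this b(1)]
  obtain N where N: "\<forall>Q. finite Q \<longrightarrow> Q \<subseteq> closure (K b) \<longrightarrow>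
      (\<forall>x\<in>Q. \<forall>y\<in>Q. x \<noteq> y \<longrightarrow> b \<le> dist x y) \<longrightarrow> card Q \<le> N"
    by (elim exE) (rule that)
  define \<Q> where "\<Q> Q \<longleftrightarrow> finite Q \<and> Q \<subseteq> D \<and> (\<forall>x\<in>Q. \<forall>y\<in>Q. x \<noteq> y \<longrightarrow> b < dist x y)" for Q
  have "card Q < N + 1" if "\<Q> Q" for Q
  proof -
    have "card Q \<le> N"
      using that closure_subset[of "K b"]
      by (intro N[rule_format]) (auto simp: \<Q>_def D_def intro: less_imp_le)
    then show ?thesis by simp
  qed
  then obtain Q where Q: "\<Q> Q" "\<And>Q'. \<Q> Q' \<Longrightarrow> card Q' \<le> card Q"
    using ex_has_greatest_nat[of \<Q> "{}" card "N + 1"] by (auto simp: \<Q>_def)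
  have Qc: "D \<subseteq> (\<Union>x\<in>Q. cball x b)"
  proof
    fix z assume z: "z \<in> D"
    show "z \<in> (\<Union>x\<in>Q. cball x b)"
    proof (rule ccontr)
      assume "z \<notin> (\<Union>x\<in>Q. cball x b)"
      then have far: "b < dist x z" if "x \<in> Q" for x using that by auto
      then have "z \<notin> Q" using b(1) by force
      have "\<Q> (insert z Q)" using Q(1) z far by (auto simp: \<Q>_def dist_commute)
      then have "card (insert z Q) \<le> card Q" by (rule Q(2))
      then show False using \<open>z \<notin> Q\<close> Q(1) by (simp add: \<Q>_def)
    qed
  qed
  let ?P = "P \<union> (\<lambda>x. (x, b)) ` Q"
  have "ball_separated ?P"
    unfolding ball_separated_def
  proof (intro conjI ballI impI)
    fix p assume "p \<in> ?P" then show "0 < snd p" using P(2) b(1) by (auto simp: ball_separated_def)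
  next
    have mixed: "max (snd p) b < dist (fst p) x" if "p \<in> P" "x \<in> Q" for p x
    proof -
      have "b < snd p" using P(3) that(1) insert.hyps by auto
      moreover have "x \<notin> cball (fst p) (snd p)" using that Q(1) by (auto simp: \<Q>_def D_def)
      ultimately show ?thesis by simp
    qed
    fix p q assume pq: "p \<in> ?P" "q \<in> ?P" "p \<noteq> q"
    then consider "p \<in> P" "q \<in> P" | x where "p \<in> P" "x \<in> Q" "q = (x, b)" | x where "q \<in> P" "x \<in> Q" "p = (x, b)"
      | x y where "x \<in> Q" "y \<in> Q" "p = (x, b)" "q = (y, b)" by blast
    then show "max (snd p) (snd q) < dist (fst p) (fst q)"
    proof cases
      case 1 then show ?thesis using P(2) pq(3) by (auto simp: ball_separated_def)
    next
      case 2 then show ?thesis using mixed by simp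
    next
      case 3 then show ?thesis using mixed[of q x] by (simp add: max.commute dist_commute)
    next
      case 4 then show ?thesis using Q(1) pq(3) by (auto simp: \<Q>_def)
    qed
  qed
  moreover have "finite ?P" using P(1) Q(1) by (simp add: \<Q>_def)
  moreover have "\<forall>p\<in>?P. snd p \<in> insert b R \<and> fst p \<in> K (snd p)" using P(3) Q(1) by (auto simp: \<Q>_def D_def)
  moreover have "(\<Union>r\<in>insert b R. K r) \<subseteq> (\<Union>p\<in>?P. cball (fst p) (snd p))"
  proof -
    have "K b \<subseteq> (\<Union>p\<in>P. cball (fst p) (snd p)) \<union> D" by (auto simp: D_def)
    then show ?thesis using P(4) Qc by auto
  qed
  ultimately show ?case by blast
qed

section \<open>The maximal function and points of density\<close>

lemma cball_measure_tendsto: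
  fixes \<mu> :: "'a::euclidean_space measure"
  assumes sets: "sets \<mu> = sets borel" and fin: "finite_measure \<mu>"
  shows "(\<lambda>i. emeasure \<mu> (cball x (r + 1 / real (Suc i)))) \<longlonglongrightarrow> emeasure \<mu> (cball x r)"
proof -
  interpret finite_measure \<mu> by (rule fin)
  have "(\<lambda>i. emeasure \<mu> (cball x (r + 1 / real (Suc i)))) \<longlonglongrightarrow> emeasure \<mu> (\<Inter>i. cball x (r + 1 / real (Suc i)))"
  proof (rule Lim_emeasure_decseq)
    show "range (\<lambda>i. cball x (r + 1 / real (Suc i))) \<subseteq> sets \<mu>" by (auto simp: sets)
    show "decseq (\<lambda>i. cball x (r + 1 / real (Suc i)))"
    proof (rule decseq_SucI)
      fix i show "cball x (r + 1 / real (Suc (Suc i))) \<subseteq> cball x (r + 1 / real (Suc i))"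
        by (rule subset_cball) (simp add: field_simps)
    qed
  qed simp
  moreover have "(\<Inter>i. cball x (r + 1 / real (Suc i))) = cball x r"
  proof
    show "(\<Inter>i. cball x (r + 1 / real (Suc i))) \<subseteq> cball x r"
    proof
      fix y assume y: "y \<in> (\<Inter>i. cball x (r + 1 / real (Suc i)))"
      then have le: "dist x y \<le> r + 1 / real (Suc i)" for i by auto
      have "dist x y \<le> r + 0"
      proof (rule LIMSEQ_le_const)
        show "(\<lambda>i. r + 1 / real (Suc i)) \<longlonglongrightarrow> r + 0"
          using LIMSEQ_inverse_real_of_nat by (intro tendsto_intros) (simp add: inverse_eq_divide)
      qed (use le in blast)
      then show "y \<in> cball x r" by simp
    qed
    show "cball x r \<subseteq> (\<Inter>i. cball x (r + 1 / real (Suc i)))"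
      by (rule INT_greatest) (rule subset_cball, simp)
  qed
  ultimately show ?thesis by simp
qed

text \<open>The condition on the radius is open, so on a compact set finitely many radii
  suffice and the greedy selection applies.\<close>

lemma maximal_inequality:
  fixes \<mu> \<nu> :: "'a::euclidean_space measure" and l :: real
  assumes N: "\<And>(P :: ('a \<times> real) set) y. finite P \<Longrightarrow> ball_separated P \<Longrightarrow>
      card {p \<in> P. y \<in> cball (fst p) (snd p)} \<le> N"
    and \<mu>: "sets \<mu> = sets borel" "finite_measure \<mu>" and \<nu>: "sets \<nu> = sets borel" "finite_measure \<nu>"
  shows "open {x. \<exists>r>0. ennreal l * emeasure \<mu> (cball x r) < emeasure \<nu> (cball x r)} \<and>
    ennreal l * emeasure \<mu> {x. \<exists>r>0. ennreal l * emeasure \<mu> (cball x r) < emeasure \<nu> (cball x r)} \<le>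
      of_nat N * emeasure \<nu> UNIV"
proof -
  let ?B = "\<lambda>x r. ennreal l * emeasure \<mu> (cball x r) < emeasure \<nu> (cball x r)"
  let ?A = "{x. \<exists>r>0. ?B x r}"
  interpret finite_measure \<mu> by (rule \<mu>(2))
  have "\<forall>x\<in>?A. \<exists>p. 0 < fst p \<and> 0 < snd p \<and> (\<forall>y\<in>ball x (snd p). ?B y (fst p))"
  proof
    fix x assume x: "x \<in> ?A"
    obtain r where r: "0 < r" "?B x r" using x by blast
    have "(\<lambda>i. ennreal l * emeasure \<mu> (cball x (r + 1 / real (Suc i)))) \<longlonglongrightarrow> ennreal l * emeasure \<mu> (cball x r)"
      by (intro ennreal_tendsto_cmult cball_measure_tendsto \<mu>) simp
    then have "\<forall>\<^sub>F i in sequentially. ennreal l * emeasure \<mu> (cball x (r + 1 / real (Suc i))) < emeasure \<nu> (cball x r)"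
      by (rule order_tendstoD(2)[OF _ r(2)])
    then obtain i where i: "ennreal l * emeasure \<mu> (cball x (r + 1 / real (Suc i))) < emeasure \<nu> (cball x r)"
      by (auto simp: eventually_sequentially)
    \<comment> \<open>For y within e/2 of x, the ball about y of radius r + e/2 lies in the ball
      about x of radius r + e and contains the one of radius r. So the strict inequality between
      these two balls about x passes to y with a single radius.\<close>
    define e where "e = 1 / real (Suc i)"
    have e: "0 < e" by (simp add: e_def)
    have "?B y (r + e / 2)" if y: "y \<in> ball x (e / 2)" for y
    proof -
      have d: "dist x y < e / 2" using y by simp
      have s1: "cball y (r + e / 2) \<subseteq> cball x (r + e)" using d by (simp add: cball_subset_cball_iff dist_commute)
      have s2: "cball x r \<subseteq> cball y (r + e / 2)" using d by (simp add: cball_subset_cball_iff)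
      have "ennreal l * emeasure \<mu> (cball y (r + e / 2)) \<le> ennreal l * emeasure \<mu> (cball x (r + e))"
        by (intro mult_left_mono emeasure_mono s1) (auto simp: \<mu>)
      also have "\<dots> < emeasure \<nu> (cball x r)" using i by (simp add: e_def)
      also have "\<dots> \<le> emeasure \<nu> (cball y (r + e / 2))" by (intro emeasure_mono s2) (auto simp: \<nu>)
      finally show ?thesis .
    qed
    then show "\<exists>p. 0 < fst p \<and> 0 < snd p \<and> (\<forall>y\<in>ball x (snd p). ?B y (fst p))"
      using r(1) e by (intro exI[of _ "(r + e / 2, e / 2)"]) auto
  qed
  from bchoice[OF this] obtain p where
    p: "\<forall>x\<in>?A. 0 < fst (p x) \<and> 0 < snd (p x) \<and> (\<forall>y\<in>ball x (snd (p x)). ?B y (fst (p x)))"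
    by (elim exE) (rule that)
  define \<rho> \<delta> where "\<rho> x = fst (p x)" and "\<delta> x = snd (p x)" for x
  have \<rho>\<delta>: "0 < \<rho> x \<and> 0 < \<delta> x \<and> (\<forall>y\<in>ball x (\<delta> x). ?B y (\<rho> x))" if "x \<in> ?A" for x
    unfolding \<rho>_def \<delta>_def by (rule p[rule_format, OF that])
  have "ball x (\<delta> x) \<subseteq> ?A" if "x \<in> ?A" for x using \<rho>\<delta>[OF that] by blast
  then have op: "open ?A" unfolding open_contains_ball using \<rho>\<delta> by meson
  have compact: "ennreal l * emeasure \<mu> K \<le> of_nat N * emeasure \<nu> UNIV" if K: "compact K" "K \<subseteq> ?A" for K
  proof -
    have cov: "K \<subseteq> (\<Union>x\<in>K. ball x (\<delta> x))"
    proof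
      fix x assume x: "x \<in> K"
      then have "x \<in> ?A" using K(2) by blast
      then show "x \<in> (\<Union>x\<in>K. ball x (\<delta> x))" using \<rho>\<delta> x by (intro UN_I[of x]) auto
    qed
    obtain F where F: "F \<subseteq> K" "finite F" "K \<subseteq> (\<Union>x\<in>F. ball x (\<delta> x))"
      by (rule compactE_image[OF K(1) _ cov]) (rule open_ball, rule that)
    \<comment> \<open>Only the radii attached to the finite subcover occur; \<open>L r\<close> is
      the union of the small balls for which the radius r serves at every point.\<close>
    define R where "R = \<rho> ` F"
    define L where "L r = (\<Union>x\<in>{x\<in>F. \<rho> x = r}. ball x (\<delta> x))" for r
    have FA: "x \<in> ?A" if "x \<in> F" for x using that F(1) K(2) by blast
    have "finite R" using F(2) by (simp add: R_def)
    moreover have "0 < r" if "r \<in> R" for r using that \<rho>\<delta>[OF FA] by (auto simp: R_def)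
    moreover have "bounded (L r)" for r using F(2) by (auto simp: L_def intro!: bounded_UN)
    ultimately have "\<exists>P. finite P \<and> ball_separated P \<and> (\<forall>p\<in>P. snd p \<in> R \<and> fst p \<in> L (snd p)) \<and>
        (\<Union>r\<in>R. L r) \<subseteq> (\<Union>p\<in>P. cball (fst p) (snd p))"
      by (rule ball_separated_cover)
    then obtain P where P: "finite P" "ball_separated P" "\<forall>p\<in>P. snd p \<in> R \<and> fst p \<in> L (snd p)"
      "(\<Union>r\<in>R. L r) \<subseteq> (\<Union>p\<in>P. cball (fst p) (snd p))"
      by (elim exE conjE) (rule that)
    have BP: "?B (fst p) (snd p)" if p: "p \<in> P" for p
    proof -
      have "fst p \<in> L (snd p)" using P(3) p by blast
      then obtain x where x: "x \<in> F" "\<rho> x = snd p" "fst p \<in> ball x (\<delta> x)" by (auto simp: L_def)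
      then show ?thesis using \<rho>\<delta>[OF FA[OF x(1)]] by metis
    qed
    have "K \<subseteq> (\<Union>r\<in>R. L r)"
    proof
      fix x assume "x \<in> K"
      then obtain y where y: "y \<in> F" "x \<in> ball y (\<delta> y)" using F(3) by blast
      then have "x \<in> L (\<rho> y)" unfolding L_def by blast
      then show "x \<in> (\<Union>r\<in>R. L r)" using y(1) by (auto simp: R_def)
    qed
    then have KP: "K \<subseteq> (\<Union>p\<in>P. cball (fst p) (snd p))" using P(4) by blast
    have "emeasure \<mu> K \<le> emeasure \<mu> (\<Union>p\<in>P. cball (fst p) (snd p))"
      using P(1) by (intro emeasure_mono KP) (auto simp: \<mu>)
    also have "\<dots> \<le> (\<Sum>p\<in>P. emeasure \<mu> (cball (fst p) (snd p)))"
      using P(1) by (intro emeasure_subadditive_finite) (auto simp: \<mu>)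
    finally have "ennreal l * emeasure \<mu> K \<le> ennreal l * (\<Sum>p\<in>P. emeasure \<mu> (cball (fst p) (snd p)))"
      by (rule mult_left_mono) simp
    also have "\<dots> = (\<Sum>p\<in>P. ennreal l * emeasure \<mu> (cball (fst p) (snd p)))" by (rule sum_distrib_left)
    also have "\<dots> \<le> (\<Sum>p\<in>P. emeasure \<nu> (cball (fst p) (snd p)))"
      by (intro sum_mono less_imp_le BP)
    also have "\<dots> = (\<Sum>p\<in>P. \<integral>\<^sup>+y. indicator (cball (fst p) (snd p)) y \<partial>\<nu>)"
      by (intro sum.cong refl nn_integral_indicator[symmetric]) (simp add: \<nu>)
    also have "\<dots> = (\<integral>\<^sup>+y. (\<Sum>p\<in>P. indicator (cball (fst p) (snd p)) y) \<partial>\<nu>)"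
      by (intro nn_integral_sum[symmetric] borel_measurable_indicator) (simp add: \<nu>)
    also have "\<dots> \<le> (\<integral>\<^sup>+y. of_nat N \<partial>\<nu>)"
    proof (rule nn_integral_mono)
      fix y
      have "(\<Sum>p\<in>P. indicator (cball (fst p) (snd p)) y) = (of_nat (card {p \<in> P. y \<in> cball (fst p) (snd p)}) :: ennreal)"
        using P(1) by (simp add: indicator_def sum.If_cases Int_def)
      also have "\<dots> \<le> of_nat N" using N[OF P(1,2), of y] by (simp only: of_nat_le_iff)
      finally show "(\<Sum>p\<in>P. indicator (cball (fst p) (snd p)) y) \<le> (of_nat N :: ennreal)" .
    qed
    also have "\<dots> = of_nat N * emeasure \<nu> UNIV"
      using sets_eq_imp_space_eq[OF \<nu>(1)] by simp
    finally show ?thesis .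
  qed
  have "emeasure \<mu> ?A = (SUP K\<in>{K. K \<subseteq> ?A \<and> compact K}. emeasure \<mu> K)"
    using op emeasure_finite by (intro inner_regular[OF \<mu>(1)]) auto
  then have "ennreal l * emeasure \<mu> ?A = (SUP K\<in>{K. K \<subseteq> ?A \<and> compact K}. ennreal l * emeasure \<mu> K)"
    by (simp add: SUP_mult_left_ennreal)
  also have "\<dots> \<le> of_nat N * emeasure \<nu> UNIV" by (rule SUP_least) (use compact in auto)
  finally show ?thesis using op by blast
qed

text \<open>A compact K inside A may exhaust A up to measure e. Near a point outside A, and hence
  outside K, only A - K counts, so density above l means that the maximal function of the measure
  restricted to A - K exceeds l. By the weak type bound such points lie in a set of measure at most
  N e / l, and e is arbitrary.\<close>

lemma AE_density_zero:
  fixes \<mu> :: "'a::euclidean_space measure"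
  assumes \<mu>: "sets \<mu> = sets borel" "finite_measure \<mu>" and A: "A \<in> sets borel"
  shows "AE x in \<mu>. x \<notin> A \<longrightarrow> ((\<lambda>r. emeasure \<mu> (A \<inter> cball x r) / emeasure \<mu> (cball x r)) \<longlongrightarrow> 0) (at_right 0)"
proof -
  interpret finite_measure \<mu> by (rule \<mu>(2))
  obtain N where N: "\<forall>(P :: ('a \<times> real) set) y. finite P \<longrightarrow> ball_separated P \<longrightarrow>
    card {p \<in> P. y \<in> cball (fst p) (snd p)} \<le> N" using ball_separated_overlap by (elim exE) (rule that)
  let ?q = "\<lambda>x r. emeasure \<mu> (A \<inter> cball x r) / emeasure \<mu> (cball x r)"
  have *: "AE x in \<mu>. x \<notin> A \<longrightarrow> (\<forall>\<^sub>F r in at_right 0. ?q x r \<le> ennreal l)" if l: "0 < l" for l :: real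
  proof -
    let ?D = "{x. x \<notin> A \<and> \<not> (\<forall>\<^sub>F r in at_right 0. ?q x r \<le> ennreal l)}"
    have "\<exists>B. B \<in> sets \<mu> \<and> ?D \<subseteq> B \<and> ennreal l * emeasure \<mu> B \<le> of_nat N * ennreal e" if e: "0 < e" for e :: real
    proof -
      have Am: "A \<in> sets \<mu>" using A \<mu> by simp
      interpret L: locally_finite UNIV \<mu>
      proof
        show "sets \<mu> = sets (borel_of (top_of_set UNIV))"
          by (subst sets_borel_of_top_of_set) (simp_all add: \<mu>)
      qed (simp_all add: less_top[symmetric])
      obtain K where K: "K \<subseteq> A" "compact K" "emeasure \<mu> (A - K) \<le> ennreal e"
        by (rule L.inner_approx[OF Am _ e]) (simp add: less_top[symmetric], rule that)
      have ABm: "A - K \<in> sets \<mu>" using A borel_compact[OF K(2)] \<mu>(1) by auto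
      let ?\<nu> = "density \<mu> (indicator (A - K))"
      have \<nu>: "emeasure ?\<nu> X = emeasure \<mu> ((A - K) \<inter> X)" if "X \<in> sets borel" for X
        using that ABm \<mu> by (simp add: emeasure_density indicator_inter_arith[symmetric])
      have fin: "finite_measure ?\<nu>"
        by (rule finite_measureI) (use \<nu>[of UNIV] sets_eq_imp_space_eq[OF \<mu>(1)] in simp)
      let ?B = "{x. \<exists>r>0. ennreal l * emeasure \<mu> (cball x r) < emeasure ?\<nu> (cball x r)}"
      have B: "open ?B" "ennreal l * emeasure \<mu> ?B \<le> of_nat N * emeasure ?\<nu> UNIV"
      proof -
        have "open ?B \<and> ennreal l * emeasure \<mu> ?B \<le> of_nat N * emeasure ?\<nu> UNIV"
        proof (rule maximal_inequality[OF _ \<mu> _ fin])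
          show "sets ?\<nu> = sets borel" using \<mu>(1) by simp
        qed (rule N[rule_format])
        then show "open ?B" "ennreal l * emeasure \<mu> ?B \<le> of_nat N * emeasure ?\<nu> UNIV" by (rule conjunct1, rule conjunct2)
      qed
      have "emeasure ?\<nu> UNIV \<le> ennreal e" using K(3) \<nu>[of UNIV] by simp
      then have le: "ennreal l * emeasure \<mu> ?B \<le> of_nat N * ennreal e"
        using B(2) by (meson mult_left_mono order_trans zero_le)
      have "?D \<subseteq> ?B"
      proof
        fix x assume x: "x \<in> ?D"
        then have "x \<notin> K" using K(1) by blast
        moreover have "open (- K)" using K(2) compact_imp_closed by blast
        ultimately obtain d where d: "0 < d" "cball x d \<subseteq> - K" using open_contains_cball[of "- K"] by auto
        have "\<exists>r. 0 < r \<and> r < d \<and> ennreal l < ?q x r"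
        proof (rule ccontr)
          assume "\<nexists>r. 0 < r \<and> r < d \<and> ennreal l < ?q x r"
          then have "?q x r \<le> ennreal l" if "0 < r" "r < d" for r using that not_less by blast
          then have "\<forall>\<^sub>F r in at_right 0. ?q x r \<le> ennreal l"
            unfolding eventually_at_right_field using d(1) by (intro exI[of _ d]) blast
          with x show False by blast
        qed
        then obtain r where r: "0 < r" "r < d" "ennreal l < ?q x r" by blast
        have "A \<inter> cball x r = (A - K) \<inter> cball x r" using d(2) r(2) subset_cball[of r d x] by auto
        then have q: "ennreal l < emeasure ?\<nu> (cball x r) / emeasure \<mu> (cball x r)"
          using r(3) \<nu>[of "cball x r"] by simp
        have "emeasure \<mu> (cball x r) \<noteq> 0"
        proof
          assume z: "emeasure \<mu> (cball x r) = 0"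
          have "emeasure ?\<nu> (cball x r) \<le> emeasure \<mu> (cball x r)"
            using \<nu>[of "cball x r"] by (simp add: emeasure_mono \<mu>)
          then show False using q z by simp
        qed
        then have "ennreal l * emeasure \<mu> (cball x r) < emeasure ?\<nu> (cball x r)"
        proof -
          obtain b where b: "emeasure \<mu> (cball x r) = ennreal b" "0 < b"
            using \<open>emeasure \<mu> (cball x r) \<noteq> 0\<close> emeasure_finite[of "cball x r"]
            by (cases "emeasure \<mu> (cball x r)" rule: ennreal_cases) (auto simp: less_le)
          obtain a where a: "emeasure ?\<nu> (cball x r) = ennreal a" "0 \<le> a"
            using finite_measure.emeasure_finite[OF fin, of "cball x r"]
            by (cases "emeasure ?\<nu> (cball x r)" rule: ennreal_cases) auto
          have "l < a / b" using q a b l by (simp add: divide_ennreal ennreal_less_iff)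
          then show ?thesis using a b l by (simp add: field_simps ennreal_less_iff flip: ennreal_mult)
        qed
        then show "x \<in> ?B" using r(1) by blast
      qed
      then show ?thesis using B(1) le \<mu>(1) by (intro exI[of _ ?B]) auto
    qed
    then have "\<exists>B. B \<in> sets \<mu> \<and> ?D \<subseteq> B \<and> ennreal l * emeasure \<mu> B \<le> of_nat N * ennreal (1 / real (Suc j))" for j
      by simp
    then have "\<forall>j. \<exists>B. B \<in> sets \<mu> \<and> ?D \<subseteq> B \<and> ennreal l * emeasure \<mu> B \<le> of_nat N * ennreal (1 / real (Suc j))"
      by (rule allI)
    from choice[OF this] obtain B where B': "\<forall>j. B j \<in> sets \<mu> \<and> ?D \<subseteq> B j \<and>
        ennreal l * emeasure \<mu> (B j) \<le> of_nat N * ennreal (1 / real (Suc j))" by (elim exE) (rule that)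
    note B = conjunct1[OF spec[OF B']] conjunct1[OF conjunct2[OF spec[OF B']]] conjunct2[OF conjunct2[OF spec[OF B']]]
    have "ennreal l * emeasure \<mu> (\<Inter>j. B j) \<le> 0"
    proof (rule LIMSEQ_le_const)
      have "(\<lambda>j. ennreal (1 / real (Suc j))) \<longlonglongrightarrow> ennreal 0"
        using LIMSEQ_inverse_real_of_nat by (intro tendsto_ennrealI) (simp add: inverse_eq_divide)
      then have "(\<lambda>j. of_nat N * ennreal (1 / real (Suc j))) \<longlonglongrightarrow> of_nat N * ennreal 0"
        by (intro ennreal_tendsto_cmult) (auto simp: of_nat_less_top)
      then show "(\<lambda>j. of_nat N * ennreal (1 / real (Suc j))) \<longlonglongrightarrow> 0" by simp
      have "ennreal l * emeasure \<mu> (\<Inter>j. B j) \<le> of_nat N * ennreal (1 / real (Suc j))" for j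
        using B(1) by (intro order_trans[OF _ B(3)] mult_left_mono emeasure_mono) auto
      then show "\<exists>M. \<forall>j\<ge>M. ennreal l * emeasure \<mu> (\<Inter>j. B j) \<le> of_nat N * ennreal (1 / real (Suc j))" by blast
    qed
    then have "emeasure \<mu> (\<Inter>j. B j) = 0" using l by simp
    then have null: "(\<Inter>j. B j) \<in> null_sets \<mu>" using B(1) by (intro null_setsI) auto
    show ?thesis by (rule AE_I'[OF null]) (use B(2) in blast)
  qed
  have "AE x in \<mu>. \<forall>k::nat. x \<notin> A \<longrightarrow> (\<forall>\<^sub>F r in at_right 0. ?q x r \<le> ennreal (1 / real (Suc k)))"
    by (subst AE_all_countable, intro allI *) simp
  then show ?thesis
  proof eventually_elim
    case (elim x)
    show ?case
    proof
      assume x: "x \<notin> A"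
      show "(?q x \<longlongrightarrow> 0) (at_right 0)"
      proof (rule order_tendstoI)
        fix a :: ennreal assume a: "0 < a"
        have "\<exists>e>0. ennreal e \<le> a"
        proof (cases a rule: ennreal_cases)
          case (real r) then show ?thesis using a by (intro exI[of _ r]) auto
        next
          case top then show ?thesis by (intro exI[of _ 1]) simp
        qed
        then obtain e where e: "0 < e" "ennreal e \<le> a" by (elim exE conjE) (rule that)
        obtain k where k: "inverse (real (Suc k)) < e" using reals_Archimedean[OF e(1)] by blast
        have "\<forall>\<^sub>F r in at_right 0. ?q x r \<le> ennreal (1 / real (Suc k))" using elim x by blast
        then show "\<forall>\<^sub>F r in at_right 0. ?q x r < a"
        proof eventually_elim
          case (elim r)
          also have "ennreal (1 / real (Suc k)) < ennreal e" using k e(1) by (simp add: ennreal_less_iff inverse_eq_divide)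
          finally show ?case using e(2) by simp
        qed
      qed simp
    qed
  qed
qed

section \<open>Approximate limits for locally finite measures\<close>

context locally_finite
begin

text \<open>Exceptional points lie in open null sets, and by Lindelof's theorem countably many of
  these have the same union.\<close>

lemma AE_positive_balls: "AE x in M. \<forall>r>0. 0 < emeasure M (cball x r \<inter> W)"
proof -
  define \<F> where "\<F> = {D. open D \<and> D \<subseteq> W \<and> emeasure M D = 0}"
  obtain \<F>' where \<F>': "\<F>' \<subseteq> \<F>" "countable \<F>'" "\<Union>\<F>' = \<Union>\<F>"
    by (rule Lindelof[of \<F>]) (use \<F>_def in blast)+
  have "D \<in> null_sets M" if "D \<in> \<F>'" for D
    using that \<F>'(1) open_in_sets[of D] by (intro null_setsI) (auto simp: \<F>_def)
  then have "(\<Union>D\<in>\<F>'. D) \<in> null_sets M" by (intro null_sets_UN' \<F>'(2))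
  then have null: "\<Union>\<F> \<in> null_sets M" using \<F>'(3) by simp
  show ?thesis
  proof (rule AE_I'[OF null], rule subsetI)
    fix x assume "x \<in> {x \<in> space M. \<not> (\<forall>r>0. 0 < emeasure M (cball x r \<inter> W))}"
    then obtain r where r: "x \<in> W" "0 < r" "emeasure M (cball x r \<inter> W) = 0" by (auto simp: space_M)
    have "emeasure M (ball x r \<inter> W) \<le> emeasure M (cball x r \<inter> W)"
      using open_W by (intro emeasure_mono) (auto simp: sets_iff)
    then have "ball x r \<inter> W \<in> \<F>" using r open_W by (auto simp: \<F>_def)
    moreover have "x \<in> ball x r \<inter> W" using r by simp
    ultimately show "x \<in> \<Union>\<F>" by blast
  qed
qed

text \<open>The density quotients at x depend only on the measure near x, so the finite case is
  applied to the restrictions to the compact sets of the exhaustion.\<close>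

lemma AE_density_zero:
  assumes A: "A \<in> sets M"
  shows "AE x in M. x \<notin> A \<longrightarrow> ((\<lambda>r. emeasure M (A \<inter> cball x r) / emeasure M (cball x r \<inter> W)) \<longlongrightarrow> 0) (at_right 0)"
proof -
  obtain C where C: "\<And>n::nat. compact (C n)" "\<And>n. C n \<subseteq> W" "incseq C" "(\<Union>n. interior (C n)) = W"
    using exhaustion by metis
  define \<mu> where "\<mu> n = distr (density M (indicator (C n))) borel id" for n
  have Cm: "C n \<in> sets M" for n using compact_in_sets[OF C(1,2)] .
  have idm: "id \<in> measurable (density M (indicator (C n))) borel" for n
    unfolding measurable_density_eq1
  proof (rule measurableI)
    fix B :: "'a set" assume "B \<in> sets borel"
    then show "id -` B \<inter> space M \<in> sets M" using open_W by (auto simp: space_M sets_iff)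
  qed simp
  have sets_\<mu>: "sets (\<mu> n) = sets borel" for n by (simp add: \<mu>_def)
  have em: "emeasure (\<mu> n) B = emeasure M (B \<inter> C n)" if B: "B \<in> sets borel" for n B
  proof -
    have BW: "B \<inter> W \<in> sets M" using B open_W by (auto simp: sets_iff)
    have "emeasure (\<mu> n) B = emeasure (density M (indicator (C n))) (B \<inter> W)"
      using B by (simp add: \<mu>_def emeasure_distr[OF idm] space_M)
    also have "\<dots> = emeasure M (C n \<inter> (B \<inter> W))"
      using BW Cm by (simp add: emeasure_density indicator_inter_arith[symmetric])
    also have "C n \<inter> (B \<inter> W) = B \<inter> C n" using C(2)[of n] by blast
    finally show ?thesis .
  qed
  have fin: "finite_measure (\<mu> n)" for n
    by (rule finite_measureI)
      (use em[of UNIV n] finite_on_compact[OF C(1,2), of n] sets_eq_imp_space_eq[OF sets_\<mu>[of n]] in auto)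
  let ?q = "\<lambda>x r. emeasure M (A \<inter> cball x r) / emeasure M (cball x r \<inter> W)"
  let ?Q = "\<lambda>n x r. emeasure (\<mu> n) (A \<inter> cball x r) / emeasure (\<mu> n) (cball x r)"
  have Ab: "A \<in> sets borel" using A by (simp add: sets_iff)
  have "\<forall>n. \<exists>B. B \<in> null_sets (\<mu> n) \<and> {x. \<not> (x \<notin> A \<longrightarrow> (?Q n x \<longlongrightarrow> 0) (at_right 0))} \<subseteq> B"
  proof
    fix n
    have "space (\<mu> n) = UNIV" using sets_eq_imp_space_eq[OF sets_\<mu>[of n]] by simp
    then show "\<exists>B. B \<in> null_sets (\<mu> n) \<and> {x. \<not> (x \<notin> A \<longrightarrow> (?Q n x \<longlongrightarrow> 0) (at_right 0))} \<subseteq> B"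
      using AE_density_zero[OF sets_\<mu> fin Ab, of n] unfolding eventually_ae_filter by (simp only: Bex_def simp_thms UNIV_I)
  qed
  from choice[OF this] obtain B where B': "\<forall>n. B n \<in> null_sets (\<mu> n) \<and>
    {x. \<not> (x \<notin> A \<longrightarrow> (?Q n x \<longlongrightarrow> 0) (at_right 0))} \<subseteq> B n" by (elim exE) (rule that)
  have B: "B n \<in> null_sets (\<mu> n)" "{x. \<not> (x \<notin> A \<longrightarrow> (?Q n x \<longlongrightarrow> 0) (at_right 0))} \<subseteq> B n" for n
    using spec[OF B', of n] by (rule conjunct1, rule conjunct2)
  have "B n \<inter> C n \<in> null_sets M" for n
  proof (rule null_setsI)
    have Bb: "B n \<in> sets borel" using null_setsD2[OF B(1)[of n]] sets_\<mu> by simp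
    show "emeasure M (B n \<inter> C n) = 0" using null_setsD1[OF B(1)[of n]] em[OF Bb] by simp
    show "B n \<inter> C n \<in> sets M" using Bb Cm[of n] by (auto simp: sets_iff)
  qed
  then have null: "(\<Union>n. B n \<inter> C n) \<in> null_sets M" by (intro null_sets_UN)
  show ?thesis
  proof (rule AE_I'[OF null], rule subsetI, rule ccontr)
    fix x assume x: "x \<in> {x \<in> space M. \<not> (x \<notin> A \<longrightarrow> (?q x \<longlongrightarrow> 0) (at_right 0))}" "x \<notin> (\<Union>n. B n \<inter> C n)"
    then have "x \<in> W" by (simp add: space_M)
    then obtain n where n: "x \<in> interior (C n)" using C(4) by blast
    then have "x \<in> C n" using interior_subset by blast
    then have "x \<notin> B n" using x(2) by blast
    then have lim: "(?Q n x \<longlongrightarrow> 0) (at_right 0)" using B(2)[of n] x(1) by blast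
    obtain d where d: "0 < d" "cball x d \<subseteq> interior (C n)" using n open_contains_cball[of "interior (C n)"] by auto
    have "\<forall>\<^sub>F r in at_right 0. ?Q n x r = ?q x r"
      unfolding eventually_at_right_field
    proof (intro exI[of _ d] conjI allI impI)
      fix r :: real assume r: "0 < r" "r < d"
      have "cball x r \<subseteq> C n" using d(2) interior_subset[of "C n"] subset_cball[of r d x] r by auto
      then have "(A \<inter> cball x r) \<inter> C n = A \<inter> cball x r" "cball x r \<inter> C n = cball x r \<inter> W" using C(2)[of n] by auto
      then show "?Q n x r = ?q x r" using em[of "A \<inter> cball x r" n] em[of "cball x r" n] Ab by simp
    qed (rule d)
    then have "(?q x \<longlongrightarrow> 0) (at_right 0)" using lim by (rule Lim_transform_eventually[rotated])
    then show False using x(1) by blast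
  qed
qed

text \<open>The preimages of the complements of countably many basic open sets have density 0 at
  almost every point outside them. If G x lies in a basic set D inside the e-ball about G x, the
  points where G deviates by at least e lie in the preimage of the complement of D.\<close>

lemma AE_approx_continuous:
  fixes G :: "'a \<Rightarrow> 'c::{second_countable_topology, metric_space}"
  assumes G: "G \<in> borel_measurable M"
  shows "AE a in M. approx_limit M G a (G a)"
proof -
  obtain \<B> :: "'c set set" where \<B>: "countable \<B>" "topological_basis \<B>" using ex_countable_basis by blast
  define A where "A D = G -` (- D) \<inter> space M" for D
  have Am: "A D \<in> sets M" if "D \<in> \<B>" for D
    unfolding A_def using topological_basis_open[OF \<B>(2) that] by (intro measurable_sets[OF G]) auto
  have "AE x in M. \<forall>D\<in>\<B>. x \<notin> A D \<longrightarrow>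
      ((\<lambda>r. emeasure M (A D \<inter> cball x r) / emeasure M (cball x r \<inter> W)) \<longlongrightarrow> 0) (at_right 0)"
    unfolding AE_ball_countable[OF \<B>(1)] by (intro ballI AE_density_zero Am)
  with AE_positive_balls AE_space show ?thesis
  proof eventually_elim
    case (elim x)
    have "((\<lambda>r. emeasure M {z \<in> cball x r \<inter> W. e \<le> dist (G z) (G x)} / emeasure M (cball x r \<inter> W)) \<longlongrightarrow> 0) (at_right 0)"
      if e: "0 < e" for e
    proof -
      obtain D where D: "D \<in> \<B>" "G x \<in> D" "D \<subseteq> ball (G x) e"
        by (rule topological_basisE[OF \<B>(2) open_ball, of "G x" "G x" e]) (use e in auto)
      have lim: "((\<lambda>r. emeasure M (A D \<inter> cball x r) / emeasure M (cball x r \<inter> W)) \<longlongrightarrow> 0) (at_right 0)"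
        using elim(3) D(1,2) by (auto simp: A_def)
      show ?thesis
      proof (rule tendsto_sandwich[OF _ _ tendsto_const lim])
        show "\<forall>\<^sub>F r in at_right 0. emeasure M {z \<in> cball x r \<inter> W. e \<le> dist (G z) (G x)} / emeasure M (cball x r \<inter> W)
          \<le> emeasure M (A D \<inter> cball x r) / emeasure M (cball x r \<inter> W)"
        proof (intro always_eventually allI divide_right_mono_ennreal emeasure_mono)
          fix r
          show "{z \<in> cball x r \<inter> W. e \<le> dist (G z) (G x)} \<subseteq> A D \<inter> cball x r"
            using D(3) by (auto simp: A_def space_M dist_commute)
          show "A D \<inter> cball x r \<in> sets M" using Am[OF D(1)] by (auto simp: sets_iff)
        qed
      qed simp
    qed
    with elim show ?case by (simp add: approx_limit_def space_M)
  qed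
qed

lemma approx_limit_AE_cong:
  assumes m: "F \<in> borel_measurable (completion M)" "G \<in> borel_measurable (completion M)"
    and eq: "AE z in M. F z = G z" and F: "approx_limit (completion M) F a y"
  shows "approx_limit (completion M) G a y"
proof -
  have "emeasure (completion M) {z \<in> cball a r \<inter> W. e \<le> dist (F z) y} =
      emeasure (completion M) {z \<in> cball a r \<inter> W. e \<le> dist (G z) y}" for e r
  proof (rule emeasure_eq_AE)
    have cl: "closed {w. e \<le> dist w y}" by (intro closed_Collect_le continuous_intros)
    have "cball a r \<inter> W \<in> sets (completion M)" using open_W by (auto simp: sets_iff)
    moreover have "{z \<in> cball a r \<inter> W. e \<le> dist (H z) y} = (cball a r \<inter> W) \<inter> (H -` {w. e \<le> dist w y} \<inter> space (completion M))" for H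
      by (auto simp: space_M)
    ultimately have *: "{z \<in> cball a r \<inter> W. e \<le> dist (H z) y} \<in> sets (completion M)"
      if "H \<in> borel_measurable (completion M)" for H
      using measurable_sets[OF that borel_closed[OF cl]] by (metis sets.Int)
    show "{z \<in> cball a r \<inter> W. e \<le> dist (F z) y} \<in> sets (completion M)"
      "{z \<in> cball a r \<inter> W. e \<le> dist (G z) y} \<in> sets (completion M)" by (intro * m)+
    show "AE x in completion M. (x \<in> {z \<in> cball a r \<inter> W. e \<le> dist (F z) y}) = (x \<in> {z \<in> cball a r \<inter> W. e \<le> dist (G z) y})"
      using AE_completion[OF eq] by eventually_elim simp
  qed
  then show ?thesis using F by (simp add: approx_limit_def space_M)
qed

text \<open>With e half the distance of the two limits, every value of F is at least e away from one
  of them, so the two quotients add up to at least 1 while both tend to 0. Small balls about a have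
  positive finite measure.\<close>

lemma approx_limit_unique:
  assumes F: "F \<in> borel_measurable (completion M)" and a: "a \<in> W"
    and y: "approx_limit (completion M) F a y" and z: "approx_limit (completion M) F a z"
  shows "y = z"
proof (rule ccontr)
  assume "y \<noteq> z"
  define e where "e = dist y z / 2"
  have e: "0 < e" using \<open>y \<noteq> z\<close> by (simp add: e_def)
  let ?A = "\<lambda>w r. {x \<in> cball a r \<inter> W. e \<le> dist (F x) w}"
  let ?q = "\<lambda>w r. emeasure (completion M) (?A w r) / emeasure (completion M) (cball a r \<inter> W)"
  have Am: "?A w r \<in> sets (completion M)" for w r
  proof -
    have cl: "closed {v. e \<le> dist v w}" by (intro closed_Collect_le continuous_intros)
    have "cball a r \<inter> W \<in> sets (completion M)" using open_W by (auto simp: sets_iff)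
    moreover have "?A w r = (cball a r \<inter> W) \<inter> (F -` {v. e \<le> dist v w} \<inter> space (completion M))"
      by (auto simp: space_M)
    ultimately show ?thesis using measurable_sets[OF F borel_closed[OF cl]] by (metis sets.Int)
  qed
  obtain d where d: "0 < d" "cball a d \<subseteq> W" using a open_W open_contains_cball by blast
  have "((\<lambda>r. ?q y r + ?q z r) \<longlongrightarrow> 0 + 0) (at_right 0)"
    using y z e by (intro tendsto_add) (auto simp: approx_limit_def space_M)
  moreover have "\<forall>\<^sub>F r in at_right 0. 1 \<le> ?q y r + ?q z r"
    unfolding eventually_at_right_field
  proof (intro exI[of _ d] conjI allI impI)
    fix r :: real assume r: "0 < r" "r < d"
    let ?m = "emeasure (completion M) (cball a r \<inter> W)"
    have W: "cball a r \<subseteq> W" using d(2) r subset_cball[of r d a] by auto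
    have "?m \<noteq> \<infinity>" using finite_on_compact[OF compact_cball W] W by (simp add: Int_absorb2 sets_iff)
    moreover have "?m \<noteq> 0" using y r(1) by (auto simp: approx_limit_def space_M)
    ultimately have one: "?m / ?m = 1" by (simp add: less_top)
    have "?m \<le> emeasure (completion M) (?A y r \<union> ?A z r)"
    proof (rule emeasure_mono)
      show "cball a r \<inter> W \<subseteq> ?A y r \<union> ?A z r"
      proof
        fix x assume x: "x \<in> cball a r \<inter> W"
        have "dist y z \<le> dist (F x) y + dist (F x) z" by (rule dist_triangle3)
        then have "e \<le> dist (F x) y \<or> e \<le> dist (F x) z" unfolding e_def by linarith
        with x show "x \<in> ?A y r \<union> ?A z r" by blast
      qed
    qed (intro sets.Un Am)
    also have "\<dots> \<le> emeasure (completion M) (?A y r) + emeasure (completion M) (?A z r)"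
      by (intro emeasure_subadditive Am)
    finally have "?m / ?m \<le> (emeasure (completion M) (?A y r) + emeasure (completion M) (?A z r)) / ?m"
      by (rule divide_right_mono_ennreal)
    then show "1 \<le> ?q y r + ?q z r" unfolding one add_divide_distrib_ennreal .
  qed (rule d)
  ultimately have "(1::ennreal) \<le> 0 + 0" by (intro tendsto_lowerbound) auto
  then show False by simp
qed

end

section \<open>Varifolds\<close>

lemma orth_proj:
  fixes S :: "'a::euclidean_space set"
  assumes S: "subspace S"
  shows "orth_proj S x \<in> S" "\<And>w. w \<in> S \<Longrightarrow> (x - orth_proj S x) \<bullet> w = 0"
    "\<And>y. y \<in> S \<Longrightarrow> (\<And>w. w \<in> S \<Longrightarrow> (x - y) \<bullet> w = 0) \<Longrightarrow> orth_proj S x = y"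
proof -
  define P where "P x = (THE y. y \<in> S \<and> (\<forall>w\<in>S. orthogonal (x - y) w))" for x
  have uniq: "y = y'" if "y \<in> S" "y' \<in> S" "\<And>w. w \<in> S \<Longrightarrow> (x - y) \<bullet> w = 0" "\<And>w. w \<in> S \<Longrightarrow> (x - y') \<bullet> w = 0" for x y y'
  proof -
    have "y' - y \<in> S" using that S by (simp add: subspace_diff)
    then have "(x - y) \<bullet> (y' - y) - (x - y') \<bullet> (y' - y) = 0" using that(3,4) by simp
    then have "(y' - y) \<bullet> (y' - y) = 0" by (simp add: inner_diff_left)
    then show ?thesis by simp
  qed
  have "\<exists>!y. y \<in> S \<and> (\<forall>w\<in>S. orthogonal (x - y) w)" for x
  proof -
    obtain y z where yz: "y \<in> span S" "\<And>w. w \<in> span S \<Longrightarrow> orthogonal z w" "x = y + z"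
      using orthogonal_subspace_decomp_exists[of S x] by metis
    then have "y \<in> S \<and> (\<forall>w\<in>S. orthogonal (x - y) w)" using span_eq_iff[THEN iffD2, OF S] by auto
    then show ?thesis by (intro ex1I[of _ y]) (auto simp: orthogonal_def intro: uniq)
  qed
  then have P: "P x \<in> S \<and> (\<forall>w\<in>S. orthogonal (x - P x) w)" for x unfolding P_def by (rule theI')
  have PI: "P x = y" if "y \<in> S" "\<And>w. w \<in> S \<Longrightarrow> (x - y) \<bullet> w = 0" for x y
    by (rule uniq[of _ _ x]) (use P[of x] that in \<open>auto simp: orthogonal_def\<close>)
  have "linear P"
  proof (rule linearI)
    fix x y show "P (x + y) = P x + P y"
    proof (rule PI)
      show "P x + P y \<in> S" using P S by (simp add: subspace_add)
      show "(x + y - (P x + P y)) \<bullet> w = 0" if "w \<in> S" for w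
      proof -
        have "(x - P x) \<bullet> w = 0" "(y - P y) \<bullet> w = 0" using P that by (auto simp: orthogonal_def)
        then show ?thesis by (simp add: algebra_simps)
      qed
    qed
  next
    fix c x show "P (c *\<^sub>R x) = c *\<^sub>R P x"
    proof (rule PI)
      show "c *\<^sub>R P x \<in> S" using P S by (simp add: subspace_mul)
      show "(c *\<^sub>R x - c *\<^sub>R P x) \<bullet> w = 0" if "w \<in> S" for w
        using P[of x] that by (auto simp: orthogonal_def scaleR_diff_right[symmetric])
    qed
  qed
  then have bl: "bounded_linear P" by (simp add: linear_conv_bounded_linear)
  \<comment> \<open>\<open>Blinfun\<close> inverts \<open>blinfun_apply\<close> only on bounded
    linear maps, so linearity of the pointwise description has to come first.\<close>
  have eq: "blinfun_apply (orth_proj S) = P"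
    unfolding orth_proj_def P_def[symmetric] by (rule bounded_linear_Blinfun_apply[OF bl])
  show "orth_proj S x \<in> S" "\<And>w. w \<in> S \<Longrightarrow> (x - orth_proj S x) \<bullet> w = 0"
    "\<And>y. y \<in> S \<Longrightarrow> (\<And>w. w \<in> S \<Longrightarrow> (x - y) \<bullet> w = 0) \<Longrightarrow> orth_proj S x = y"
    unfolding eq using P PI by (auto simp: orthogonal_def)
qed

lemma norm_orth_proj_apply:
  assumes S: "subspace S" shows "norm (orth_proj S x) \<le> norm x"
proof -
  have "(x - orth_proj S x) \<bullet> orth_proj S x = 0" by (intro orth_proj[OF S])
  then have "norm (orth_proj S x) * norm (orth_proj S x) = x \<bullet> orth_proj S x"
    by (simp add: inner_diff_left flip: power2_eq_square power2_norm_eq_inner)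
  also have "\<dots> \<le> norm x * norm (orth_proj S x)" by (rule norm_cauchy_schwarz)
  finally show ?thesis by (cases "norm (orth_proj S x) = 0") auto
qed

lemma orth_proj_range:
  assumes S: "subspace S" shows "range (orth_proj S) = S" "x \<in> S \<Longrightarrow> orth_proj S x = x"
proof -
  show *: "orth_proj S x = x" if "x \<in> S" for x by (rule orth_proj(3)[OF S that]) simp
  show "range (orth_proj S) = S" using orth_proj(1)[OF S] * by (auto simp: image_iff) metis
qed

lemma orth_proj_self_adjoint:
  assumes S: "subspace S" shows "orth_proj S x \<bullet> y = x \<bullet> orth_proj S y"
proof -
  have "(x - orth_proj S x) \<bullet> orth_proj S y = 0" "(y - orth_proj S y) \<bullet> orth_proj S x = 0"
    by (intro orth_proj[OF S])+
  then have "x \<bullet> orth_proj S y = orth_proj S x \<bullet> orth_proj S y" "y \<bullet> orth_proj S x = orth_proj S y \<bullet> orth_proj S x"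
    by (simp_all add: inner_diff_left)
  then show ?thesis by (metis inner_commute)
qed

lemma orth_proj_eqI:
  fixes P :: "'a::euclidean_space \<Rightarrow>\<^sub>L 'a"
  assumes idem: "\<And>x. P (P x) = P x" and sym: "\<And>x y. P x \<bullet> y = x \<bullet> P y"
  shows "subspace (range P)" "orth_proj (range P) = P"
proof -
  show S: "subspace (range P)"
    by (rule linear_subspace_image[OF _ subspace_UNIV])
      (rule bounded_linear.linear[OF blinfun.bounded_linear_right])
  show "orth_proj (range P) = P"
  proof (rule blinfun_eqI)
    fix x show "orth_proj (range P) x = P x"
    proof (rule orth_proj(3)[OF S])
      fix w assume "w \<in> range P"
      then obtain y where y: "w = P y" by blast
      have "(x - P x) \<bullet> P y = P (x - P x) \<bullet> y" by (rule sym[symmetric])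
      then show "(x - P x) \<bullet> w = 0" by (simp add: y blinfun.diff_right idem)
    qed simp
  qed
qed

text \<open>If \<open>\<parallel>P - Q\<parallel> < 1\<close> then \<open>P\<close> is injective on the range of \<open>Q\<close>.\<close>

lemma dim_le_of_dist_orth_proj:
  fixes S T :: "'a::euclidean_space set"
  assumes S: "subspace S" and T: "subspace T" and d: "dist (orth_proj S) (orth_proj T) < 1"
  shows "dim T \<le> dim S"
proof -
  have lin: "linear (orth_proj S)" by (rule bounded_linear.linear[OF blinfun.bounded_linear_right])
  have "inj_on (orth_proj S) (span T)"
  proof (rule linear_inj_on_iff_eq_0[OF lin subspace_span, THEN iffD2], intro ballI impI, rule ccontr)
    fix x assume x: "x \<in> span T" "orth_proj S x = 0" "x \<noteq> 0"
    have "x \<in> T" using x(1) span_eq_iff[THEN iffD2, OF T] by simp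
    then have "norm x = norm ((orth_proj S - orth_proj T) x)"
      using x(2) orth_proj_range(2)[OF T] by (simp add: blinfun.diff_left)
    also have "\<dots> \<le> norm (orth_proj S - orth_proj T) * norm x" by (rule norm_blinfun)
    also have "\<dots> < 1 * norm x" using d x(3) by (intro mult_strict_right_mono) (auto simp: dist_norm)
    finally show False by simp
  qed
  then have "dim (orth_proj S ` T) = dim T" by (rule dim_image_eq[OF lin])
  moreover have "dim (orth_proj S ` T) \<le> dim S" by (rule dim_subset) (use orth_proj(1)[OF S] in auto)
  ultimately show ?thesis by simp
qed

text \<open>Projections have operator norm at most 1. A limit of symmetric idempotent maps is
  symmetric and idempotent, hence a projection, and projections at distance less than 1 have ranges
  of equal dimension.\<close>

lemma compact_orth_proj_image:
  "compact (orth_proj ` {S :: 'a::euclidean_space set. subspace S \<and> dim S = m})"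
  unfolding compact_eq_bounded_closed
proof
  show "bounded (orth_proj ` {S :: 'a set. subspace S \<and> dim S = m})"
    unfolding bounded_iff
    by (rule exI[of _ 1]) (auto intro!: norm_blinfun_bound norm_orth_proj_apply)
  show "closed (orth_proj ` {S :: 'a set. subspace S \<and> dim S = m})"
    unfolding closed_sequential_limits
  proof (intro allI impI)
    fix X :: "nat \<Rightarrow> 'a \<Rightarrow>\<^sub>L 'a" and P
    assume "(\<forall>n. X n \<in> orth_proj ` {S. subspace S \<and> dim S = m}) \<and> X \<longlonglongrightarrow> P"
    then have X: "\<And>n. \<exists>S. subspace S \<and> dim S = m \<and> X n = orth_proj S" and lim: "X \<longlonglongrightarrow> P" by auto
    then obtain S where S: "\<And>n. subspace (S n)" "\<And>n. dim (S n) = m" "\<And>n. X n = orth_proj (S n)" by metis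
    have app: "(\<lambda>n. X n (Y n)) \<longlonglongrightarrow> P y" if "Y \<longlonglongrightarrow> y" for Y y
      by (rule tendsto_intros lim that)+
    have idem: "P (P x) = P x" for x
    proof (rule LIMSEQ_unique)
      show "(\<lambda>n. X n (X n x)) \<longlonglongrightarrow> P (P x)" by (intro app tendsto_const)
      have "X n (X n x) = X n x" for n unfolding S(3) by (intro orth_proj_range orth_proj S)
      then show "(\<lambda>n. X n (X n x)) \<longlonglongrightarrow> P x" using app[OF tendsto_const] by simp
    qed
    have sym: "P x \<bullet> y = x \<bullet> P y" for x y
    proof (rule LIMSEQ_unique)
      show "(\<lambda>n. X n x \<bullet> y) \<longlonglongrightarrow> P x \<bullet> y" by (intro tendsto_intros app)
      have "X n x \<bullet> y = x \<bullet> X n y" for n unfolding S(3) by (rule orth_proj_self_adjoint[OF S(1)])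
      then show "(\<lambda>n. X n x \<bullet> y) \<longlonglongrightarrow> x \<bullet> P y" by (simp add: app tendsto_inner)
    qed
    note P = orth_proj_eqI[OF idem sym]
    obtain n where n: "dist (X n) P < 1"
      using metric_LIMSEQ_D[OF lim zero_less_one] by blast
    have "dim (range P) \<le> dim (S n)" "dim (S n) \<le> dim (range P)"
      by (rule dim_le_of_dist_orth_proj; use P S n in \<open>simp add: dist_commute\<close>)+
    then show "P \<in> orth_proj ` {S. subspace S \<and> dim S = m}"
      using P S(2)[of n] by (intro image_eqI[of _ _ "range P"]) auto
  qed
qed

text \<open>This is what makes the weight of a varifold finite on compact sets: over a compact K the
  whole cylinder is compact.\<close>

lemma compact_space_grassmannian: "compact_space (grassmannian m :: 'a::euclidean_space set topology)"
proof -
  let ?A = "{S :: 'a set. subspace S \<and> dim S = m}"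
  show ?thesis
    unfolding compact_space_alt
  proof (intro allI impI)
    fix \<U> assume "(\<forall>C\<in>\<U>. openin (grassmannian m :: 'a set topology) C) \<and> topspace (grassmannian m) \<subseteq> \<Union>\<U>"
    then have \<U>: "\<forall>C\<in>\<U>. openin (grassmannian m) C" "topspace (grassmannian m) \<subseteq> \<Union>\<U>" by blast+
    have top: "topspace (grassmannian m) = ?A" by (simp add: grassmannian_def topspace_pullback_topology)
    define \<W> where "\<W> = {C. open C \<and> orth_proj -` C \<inter> ?A \<in> \<U>}"
    have "orth_proj ` ?A \<subseteq> \<Union>\<W>"
    proof
      fix P assume "P \<in> orth_proj ` ?A"
      then obtain S where S: "S \<in> ?A" "P = orth_proj S" by blast
      then obtain D where D: "D \<in> \<U>" "S \<in> D" using \<U>(2) top by blast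
      then obtain C where "open C" "D = orth_proj -` C \<inter> ?A"
        using \<U>(1) unfolding grassmannian_def openin_pullback_topology by auto
      then show "P \<in> \<Union>\<W>" using D S unfolding \<W>_def by (intro UnionI[of C]) auto
    qed
    then obtain \<W>' where \<W>': "\<W>' \<subseteq> \<W>" "finite \<W>'" "orth_proj ` ?A \<subseteq> \<Union>\<W>'"
      by (rule compactE[OF compact_orth_proj_image]) (unfold \<W>_def, blast)
    show "\<exists>\<F>. finite \<F> \<and> \<F> \<subseteq> \<U> \<and> topspace (grassmannian m) \<subseteq> \<Union>\<F>"
    proof (intro exI conjI)
      show "finite ((\<lambda>C. orth_proj -` C \<inter> ?A) ` \<W>')" using \<W>'(2) by (rule finite_imageI)
      show "(\<lambda>C. orth_proj -` C \<inter> ?A) ` \<W>' \<subseteq> \<U>" using \<W>'(1) unfolding \<W>_def by blast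
      show "topspace (grassmannian m) \<subseteq> \<Union>((\<lambda>C. orth_proj -` C \<inter> ?A) ` \<W>')" using \<W>'(3) unfolding top by blast
    qed
  qed
qed

section \<open>Varifolds, their weights and the first variation\<close>

lemma measurable_continuous_map:
  assumes "continuous_map X Y f" shows "f \<in> measurable (borel_of X) (borel_of Y)"
proof (rule measurableI[OF _ ] , goal_cases)
  case (1 x) then show ?case using assms by (auto simp: space_borel_of continuous_map_def)
next
  case (2 A)
  have "f \<in> measurable (borel_of X) (sigma (topspace Y) {C. openin Y C})"
  proof (rule measurable_measure_of)
    show "{C. openin Y C} \<subseteq> Pow (topspace Y)" by (auto dest: openin_subset)
    show "f \<in> space (borel_of X) \<rightarrow> topspace Y" using assms by (auto simp: space_borel_of continuous_map_def)
    fix C assume "C \<in> {C. openin Y C}"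
    then have "openin X {x \<in> topspace X. f x \<in> C}" using assms by (simp add: openin_continuous_map_preimage)
    moreover have "f -` C \<inter> space (borel_of X) = {x \<in> topspace X. f x \<in> C}" by (auto simp: space_borel_of)
    ultimately show "f -` C \<inter> space (borel_of X) \<in> sets (borel_of X)" by (auto simp: sets_borel_of)
  qed
  then show ?case using 2 measurable_sets by (simp add: borel_of_def)
qed

lemma borel_of_euclidean: "borel_of (euclidean :: 'a::topological_space topology) = borel"
  by (simp add: borel_of_def borel_def)

lemma hom_inner_eq:
  assumes "linear \<sigma>" shows "hom_inner \<sigma> \<tau> = (\<Sum>b\<in>Basis. \<tau> b \<bullet> \<sigma> b)"
  by (simp add: hom_inner_def adjoint_works[OF assms] inner_commute[of "adjoint \<sigma> _"] inner_commute[of "\<tau> _"])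

lemma hom_inner_commute: "linear \<sigma> \<Longrightarrow> linear \<tau> \<Longrightarrow> hom_inner \<sigma> \<tau> = hom_inner \<tau> \<sigma>"
  by (simp add: hom_inner_eq inner_commute)

locale varifold_locally_finite =
  fixes U :: "'a::euclidean_space set" and m :: nat and V :: "('a \<times> 'a set) measure"
  assumes open_U: "open U" and V: "varifold U m V"
begin

abbreviation "W \<equiv> weight U V"

lemma sets_V: "sets V = sets (borel_of (varifold_space U m))"
  using V by (simp add: varifold_def radon_measure_def)

lemma space_V: "space V = U \<times> topspace (grassmannian m)"
  using sets_eq_imp_space_eq[OF sets_V] by (simp add: space_borel_of varifold_space_def)

lemma measurable_V: "continuous_map (varifold_space U m) X g \<Longrightarrow> g \<in> measurable V (borel_of X)"
  using measurable_continuous_map measurable_cong_sets[OF sets_V refl] by blast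

lemma fst_measurable: "fst \<in> measurable V (borel_of (top_of_set U))"
  by (rule measurable_V) (simp add: varifold_space_def continuous_map_fst)

lemma orth_proj_measurable: "(\<lambda>p. orth_proj (snd p) b) \<in> borel_measurable V"
proof -
  have "continuous_map (grassmannian m) euclidean (\<lambda>S. orth_proj S b)"
    unfolding grassmannian_def
    by (rule continuous_map_pullback[of euclidean euclidean "\<lambda>P. blinfun_apply P b", unfolded o_def])
      (auto intro!: continuous_intros)
  then have "continuous_map (varifold_space U m) euclidean (\<lambda>p. orth_proj (snd p) b)"
    unfolding varifold_space_def by (rule continuous_map_compose[OF continuous_map_snd, unfolded o_def])
  then show ?thesis using measurable_V by (simp add: borel_of_euclidean[symmetric])
qed

lemma sets_W: "sets W = sets (borel_of (top_of_set U))" by (simp add: weight_def)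

lemma emeasure_W: "A \<in> sets W \<Longrightarrow> emeasure W A = emeasure V (A \<times> topspace (grassmannian m))"
proof -
  assume A: "A \<in> sets W"
  then have "A \<subseteq> U" using sets.sets_into_space sets_eq_imp_space_eq[OF sets_W] by (force simp: space_borel_of)
  then have "fst -` A \<inter> space V = A \<times> topspace (grassmannian m)" by (auto simp: space_V)
  then show "emeasure W A = emeasure V (A \<times> topspace (grassmannian m))"
    using A unfolding weight_def by (subst emeasure_distr[OF fst_measurable]) auto
qed

sublocale W: locally_finite U W
proof
  show "open U" by (rule open_U)
  show "sets W = sets (borel_of (top_of_set U))" by (rule sets_W)
  fix K assume K: "compact K" "K \<subseteq> U"
  then have "K \<in> sets W" using open_U borel_compact[OF K(1)] by (auto simp: sets_W sets_borel_of_top_of_set sets_restrict_space_iff)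
  then have "emeasure W K = emeasure V (K \<times> topspace (grassmannian m))" by (rule emeasure_W)
  also have "compactin (varifold_space U m) (K \<times> topspace (grassmannian m))"
    unfolding varifold_space_def compactin_Times
    using K compact_space_grassmannian by (auto simp: compactin_subtopology compact_space_def)
  then have "emeasure V (K \<times> topspace (grassmannian m)) < \<infinity>"
    using V by (auto simp: varifold_def radon_measure_def)
  finally show "emeasure W K < \<infinity>" .
qed

lemma distr_fst_measurable: "f \<in> measurable W N \<Longrightarrow> (\<lambda>p. f (fst p)) \<in> measurable V N"
  using measurable_compose[OF fst_measurable] measurable_cong_sets[OF sets_W refl] by blast

lemma AE_fst: "AE z in W. P z \<Longrightarrow> AE p in V. P (fst p)"
  unfolding weight_def by (rule AE_distrD[OF fst_measurable])

lemma cylinder_in_sets: "A \<in> sets W \<Longrightarrow> A \<times> topspace (grassmannian m) \<in> sets V"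
proof -
  assume A: "A \<in> sets W"
  then have "fst -` A \<inter> space V = A \<times> topspace (grassmannian m)"
    by (auto simp: space_V W.sets_iff)
  then show ?thesis using A measurable_sets[OF fst_measurable, of A] unfolding sets_W by simp
qed

definition divergence :: "('a \<Rightarrow> 'a) \<Rightarrow> 'a \<times> 'a set \<Rightarrow> real" where
  "divergence \<theta> p = hom_inner (frechet_derivative \<theta> (at (fst p))) (orth_proj (snd p))"

lemma divergence_eq:
  "smooth \<theta> \<Longrightarrow> divergence \<theta> p = (\<Sum>b\<in>Basis. orth_proj (snd p) b \<bullet> frechet_derivative \<theta> (at (fst p)) b)"
  unfolding divergence_def
  by (rule hom_inner_eq, rule has_derivative_linear, rule smooth_has_derivative)

lemma divergence_add:
  assumes "smooth \<theta>" "smooth \<zeta>"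
  shows "divergence (\<lambda>x. \<theta> x + \<zeta> x) p = divergence \<theta> p + divergence \<zeta> p"
proof -
  have "frechet_derivative (\<lambda>x. \<theta> x + \<zeta> x) (at z) v = frechet_derivative \<theta> (at z) v + frechet_derivative \<zeta> (at z) v" for z v
    by (rule frechet_derivative_eqI) (intro has_derivative_add smooth_has_derivative assms)
  then show ?thesis using assms by (simp add: divergence_eq smooth_add inner_add_right sum.distrib)
qed

lemma divergence_scaleR:
  assumes "smooth \<theta>"
  shows "divergence (\<lambda>x. c *\<^sub>R \<theta> x) p = c * divergence \<theta> p"
proof -
  have "frechet_derivative (\<lambda>x. c *\<^sub>R \<theta> x) (at z) v = c *\<^sub>R frechet_derivative \<theta> (at z) v" for z v
    by (rule frechet_derivative_eqI) (intro has_derivative_scaleR_right smooth_has_derivative assms)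
  then show ?thesis using assms by (simp add: divergence_eq smooth_scaleR sum_distrib_left)
qed

lemma divergence_measurable:
  assumes "smooth \<theta>" shows "divergence \<theta> \<in> borel_measurable V"
proof -
  have "(\<lambda>p. frechet_derivative \<theta> (at (fst p)) b) \<in> borel_measurable V" for b
    by (intro distr_fst_measurable W.measurable_M borel_measurable_continuous_onI smooth_continuous_on
        smooth_frechet_derivative assms)
  then have "(\<lambda>p. \<Sum>b\<in>Basis. orth_proj (snd p) b \<bullet> frechet_derivative \<theta> (at (fst p)) b) \<in> borel_measurable V"
    by (intro borel_measurable_sum borel_measurable_inner orth_proj_measurable)
  then show ?thesis using divergence_eq[OF assms] by (simp cong: measurable_cong)
qed

lemma frechet_derivative_outside_spt:
  assumes "x \<notin> spt \<theta>" shows "frechet_derivative \<theta> (at x) v = 0"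
proof (rule frechet_derivative_eqI)
  have "((\<lambda>x. 0) has_derivative (\<lambda>v. 0)) (at x)" by simp
  then show "(\<theta> has_derivative (\<lambda>v. 0)) (at x)"
  proof (rule has_derivative_transform_within_open)
    show "open (- spt \<theta>)" by (simp add: open_Compl)
    show "0 = \<theta> y" if "y \<in> - spt \<theta>" for y using spt_outside[of y \<theta>] that by simp
  qed (use assms in simp)
qed

lemma divergence_integrable:
  assumes \<theta>: "test_fun U \<theta>"
  shows "integrable V (divergence \<theta>)" "\<exists>B. \<forall>p\<in>space V. \<bar>divergence \<theta> p\<bar> \<le> B"
proof -
  have s: "smooth \<theta>" and K: "compact (spt \<theta>)" "spt \<theta> \<subseteq> U" using \<theta> by (auto simp: test_fun_def)
  have "test_fun U (\<lambda>x. frechet_derivative \<theta> (at x) b)" for b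
    using frechet_derivative_outside_spt by (intro test_funI[OF _ K] smooth_frechet_derivative s)
  then have "\<exists>B. \<forall>x. norm (frechet_derivative \<theta> (at x) b) \<le> B" for b
    by (rule W.test_fun_bounded) blast
  then obtain B where B: "\<And>b x. norm (frechet_derivative \<theta> (at x) b) \<le> B b" by metis
  have bd: "\<bar>divergence \<theta> p\<bar> \<le> (\<Sum>b\<in>Basis. B b)" if p: "p \<in> space V" for p
  proof -
    have S: "subspace (snd p)" using p by (auto simp: space_V grassmannian_def topspace_pullback_topology)
    have "\<bar>orth_proj (snd p) b \<bullet> frechet_derivative \<theta> (at (fst p)) b\<bar> \<le> B b" if b: "b \<in> Basis" for b :: 'a
    proof -
      have "\<bar>orth_proj (snd p) b \<bullet> frechet_derivative \<theta> (at (fst p)) b\<bar>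
        \<le> norm (orth_proj (snd p) b) * norm (frechet_derivative \<theta> (at (fst p)) b)" by (rule Cauchy_Schwarz_ineq2)
      also have "\<dots> \<le> 1 * B b" using norm_orth_proj_apply[OF S, of b] b B by (intro mult_mono) auto
      finally show ?thesis by simp
    qed
    then show ?thesis unfolding divergence_eq[OF s] by (intro order_trans[OF sum_abs] sum_mono)
  qed
  then show "\<exists>B. \<forall>p\<in>space V. \<bar>divergence \<theta> p\<bar> \<le> B" by blast
  have KW: "spt \<theta> \<in> sets W" using W.compact_in_sets K by blast
  show "integrable V (divergence \<theta>)"
  proof (rule integrableI_bounded_set[of "spt \<theta> \<times> topspace (grassmannian m)"])
    show "spt \<theta> \<times> topspace (grassmannian m) \<in> sets V" by (rule cylinder_in_sets[OF KW])
    show "emeasure V (spt \<theta> \<times> topspace (grassmannian m)) < \<infinity>"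
      using emeasure_W[OF KW] W.finite_on_compact[OF K] by simp
    show "divergence \<theta> \<in> borel_measurable V" by (rule divergence_measurable[OF s])
    show "AE p in V. p \<in> spt \<theta> \<times> topspace (grassmannian m) \<longrightarrow> norm (divergence \<theta> p) \<le> (\<Sum>b\<in>Basis. B b)"
      using bd by (intro AE_I2) simp
    show "AE p in V. p \<notin> spt \<theta> \<times> topspace (grassmannian m) \<longrightarrow> divergence \<theta> p = 0"
    proof (intro AE_I2 impI)
      fix p assume that: "p \<in> space V" "p \<notin> spt \<theta> \<times> topspace (grassmannian m)"
      have "fst p \<notin> spt \<theta>" using that by (auto simp: space_V)
      then show "divergence \<theta> p = 0" by (simp add: divergence_eq[OF s] frechet_derivative_outside_spt)
    qed
  qed
qed

lemma first_variation_eq: "first_variation V' \<theta> = (\<integral>p. divergence \<theta> p \<partial>V')"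
  by (simp add: first_variation_def divergence_def split_beta')

lemma first_variation_linear: "dist_linear U (first_variation V)"
proof -
  have "divergence (\<lambda>x. \<theta> x + \<zeta> x) = (\<lambda>p. divergence \<theta> p + divergence \<zeta> p)"
    "divergence (\<lambda>x. c *\<^sub>R \<theta> x) = (\<lambda>p. c * divergence \<theta> p)"
    if "test_fun U \<theta>" "test_fun U \<zeta>" for \<theta> \<zeta> c
    using that by (auto simp: divergence_add divergence_scaleR test_fun_smooth)
  then show ?thesis unfolding dist_linear_def first_variation_eq
    using divergence_integrable(1) by simp
qed

text \<open>A superlevel set of f need only be measurable for a completion. Replacing it by an
  almost equal Borel set E0 turns the restriction into a density, with which integrals can be
  computed.\<close>

lemma restr_measure_eq:
  assumes E0: "E0 \<in> sets W" and E: "E \<subseteq> U" "AE z in W. z \<in> E \<longleftrightarrow> z \<in> E0"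
  shows "restr_measure V (E \<times> topspace (grassmannian m)) = density V (\<lambda>p. indicator E0 (fst p))"
proof -
  let ?E = "E \<times> topspace (grassmannian m)" and ?F = "E0 \<times> topspace (grassmannian m)"
  have E0V: "?F \<in> sets V" by (rule cylinder_in_sets[OF E0])
  have im: "(\<lambda>p. indicator E0 (fst p) :: ennreal) \<in> borel_measurable V"
    using E0 by (intro distr_fst_measurable borel_measurable_indicator)
  have AE: "AE p in V. p \<in> ?E \<longleftrightarrow> p \<in> ?F"
    using AE_fst[OF E(2)] AE_space by eventually_elim (auto simp: space_V)
  have "emeasure (completion V) (?E \<inter> B) = emeasure (density V (\<lambda>p. indicator E0 (fst p))) B" if B: "B \<in> sets V" for B
  proof -
    have sp: "?E \<inter> B \<subseteq> space V" using sets.sets_into_space[OF B] by blast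
    have "(\<lambda>p. p \<in> ?E \<inter> B) \<in> measurable (completion V) (count_space UNIV)"
    proof (rule completion_measurable_AE[of "\<lambda>p. p \<in> ?F \<inter> B"])
      show "(\<lambda>p. p \<in> ?F \<inter> B) \<in> measurable V (count_space UNIV)"
        using E0V B by (intro pred_intros_logic measurable_If_set) (auto simp: pred_def Int_def[symmetric] intro!: sets.Int)
      show "AE p in V. (p \<in> ?E \<inter> B) = (p \<in> ?F \<inter> B)" using AE by eventually_elim blast
    qed simp
    then have "?E \<inter> B \<in> sets (completion V)"
      using sp by (auto simp: pred_def Int_absorb1 elim!: back_subst[of "\<lambda>x. x \<in> sets (completion V)"])
    then have "emeasure (completion V) (?E \<inter> B) = emeasure (completion V) (?F \<inter> B)"
      using E0V B AE_completion[OF AE] by (intro emeasure_eq_AE) auto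
    also have "\<dots> = emeasure V (?F \<inter> B)" using E0V B by simp
    also have "\<dots> = (\<integral>\<^sup>+p. indicator (?F \<inter> B) p \<partial>V)" using E0V B by simp
    also have "\<dots> = (\<integral>\<^sup>+p. indicator E0 (fst p) * indicator B p \<partial>V)"
      by (intro nn_integral_cong) (auto simp: indicator_def space_V)
    also have "\<dots> = emeasure (density V (\<lambda>p. indicator E0 (fst p))) B"
      by (rule emeasure_density[symmetric, OF im B])
    finally show ?thesis .
  qed
  then have "restr_measure V ?E = measure_of (space V) (sets V) (emeasure (density V (\<lambda>p. indicator E0 (fst p))))"
    unfolding restr_measure_def
    by (intro measure_of_eq sets.space_closed) (auto simp: sets.sigma_sets_eq)
  also have "\<dots> = density V (\<lambda>p. indicator E0 (fst p))"
    using measure_of_of_measure[of "density V (\<lambda>p. indicator E0 (fst p))"] by simp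
  finally show ?thesis .
qed

lemma first_variation_restr:
  assumes E0: "E0 \<in> sets W" and E: "E \<subseteq> U" "AE z in W. z \<in> E \<longleftrightarrow> z \<in> E0" and \<theta>: "test_fun U \<theta>"
  shows "first_variation (restr_measure V (E \<times> topspace (grassmannian m))) \<theta> =
    (\<integral>p. indicator E0 (fst p) * divergence \<theta> p \<partial>V)"
proof -
  have im: "(\<lambda>p. indicator E0 (fst p) :: real) \<in> borel_measurable V"
    using E0 by (intro distr_fst_measurable borel_measurable_indicator)
  have "(\<integral>p. divergence \<theta> p \<partial>density V (\<lambda>p. ennreal (indicator E0 (fst p)))) = (\<integral>p. indicator E0 (fst p) *\<^sub>R divergence \<theta> p \<partial>V)"
    by (rule integral_density) (use im divergence_measurable[OF test_fun_smooth[OF \<theta>]] in auto)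
  then show ?thesis unfolding restr_measure_eq[OF E0 E] first_variation_eq by (simp add: ennreal_indicator)
qed

end

section \<open>Superlevel sets and smooth truncations\<close>

text \<open>\<open>clamp_length a b y\<close> is the length of \<open>{a<..b} \<inter> {..<y}\<close>.\<close>

definition clamp_length :: "real \<Rightarrow> real \<Rightarrow> real \<Rightarrow> real" where
  "clamp_length a b y = max 0 (y - a) - max 0 (y - b)"

lemma clamp_length_bounds: "a \<le> b \<Longrightarrow> 0 \<le> clamp_length a b y" "a \<le> b \<Longrightarrow> clamp_length a b y \<le> b - a"
  by (auto simp: clamp_length_def)

lemma integral_superlevel_indicator:
  assumes "a < b"
  shows "integrable lborel (\<lambda>t. indicator {a<..b} t * indicator {t<..} y :: real)"
    "(\<integral>t. indicator {a<..b} t * indicator {t<..} y \<partial>lborel) = clamp_length a b y"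
proof -
  have eq: "(\<lambda>t. indicator {a<..b} t * indicator {t<..} y :: real) = indicator ({a<..b} \<inter> {..<y})"
    by (auto simp: indicator_def)
  have fin: "emeasure lborel ({a<..b} \<inter> {..<y}) < \<infinity>"
    by (rule le_less_trans[OF emeasure_mono[of _ "{a<..b}"]]) (use assms in auto)
  then show "integrable lborel (\<lambda>t. indicator {a<..b} t * indicator {t<..} y :: real)"
    unfolding eq by (subst integrable_indicator_iff) auto
  have "measure lborel ({a<..b} \<inter> {..<y}) = clamp_length a b y"
  proof -
    consider "y \<le> a" | "a < y" "y \<le> b" | "b < y" by linarith
    then show ?thesis
    proof cases
      case 1
      then have "{a<..b} \<inter> {..<y} = {}" by auto
      then show ?thesis using 1 assms by (simp add: clamp_length_def)
    next
      case 2
      then have "{a<..b} \<inter> {..<y} = {a<..<y}" by auto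
      then show ?thesis using 2 by (simp add: clamp_length_def)
    next
      case 3
      then have "{a<..b} \<inter> {..<y} = {a<..b}" by auto
      then show ?thesis using 3 assms by (simp add: clamp_length_def)
    qed
  qed
  then show "(\<integral>t. indicator {a<..b} t * indicator {t<..} y \<partial>lborel) = clamp_length a b y"
    unfolding eq by simp
qed

lemma integrable_bounded_scaleR:
  fixes h :: "'c \<Rightarrow> 'b::{banach, second_countable_topology}"
  assumes g: "g \<in> borel_measurable X" "\<And>x. \<bar>g x\<bar> \<le> B" and h: "integrable X h"
  shows "integrable X (\<lambda>x. g x *\<^sub>R h x)"
proof (rule Bochner_Integration.integrable_bound)
  show "integrable X (\<lambda>x. B *\<^sub>R h x)" by (intro integrable_scaleR_right h)
  show "(\<lambda>x. g x *\<^sub>R h x) \<in> borel_measurable X" using g(1) h by (intro borel_measurable_scaleR) auto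
  have "\<bar>g x\<bar> \<le> \<bar>B\<bar>" for x using g(2)[of x] by linarith
  then show "AE x in X. norm (g x *\<^sub>R h x) \<le> norm (B *\<^sub>R h x)" by (intro AE_I2) (simp add: mult_right_mono)
qed

lemma integral_bounded_compose_tendsto:
  fixes q :: "nat \<Rightarrow> real \<Rightarrow> real"
  assumes q: "\<And>k. q k \<in> borel_measurable borel" "r \<in> borel_measurable borel" "\<And>y. (\<lambda>k. q k y) \<longlonglongrightarrow> r y"
    and B: "\<And>k y. \<bar>q k y\<bar> \<le> B" and h: "h \<in> borel_measurable X" and g: "integrable X g"
  shows "(\<lambda>k. \<integral>x. q k (h x) * g x \<partial>X) \<longlonglongrightarrow> (\<integral>x. r (h x) * g x \<partial>X)"
proof (rule integral_dominated_convergence[where w="\<lambda>x. B * \<bar>g x\<bar>"])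
  have gm: "g \<in> borel_measurable X" using g by simp
  show "(\<lambda>x. r (h x) * g x) \<in> borel_measurable X" by (intro borel_measurable_times gm measurable_compose[OF h q(2)])
  show "(\<lambda>x. q k (h x) * g x) \<in> borel_measurable X" for k
    by (intro borel_measurable_times gm measurable_compose[OF h q(1)])
  show "integrable X (\<lambda>x. B * \<bar>g x\<bar>)" using g by simp
  show "AE x in X. (\<lambda>k. q k (h x) * g x) \<longlonglongrightarrow> r (h x) * g x" by (intro AE_I2 tendsto_mult_right q)
  show "AE x in X. norm (q k (h x) * g x) \<le> B * \<bar>g x\<bar>" for k
    by (intro AE_I2) (simp add: abs_mult mult_right_mono B)
qed

text \<open>Right continuity rests on the strict inequality in the superlevel sets: if S n decreases
  to t from above, h x > t implies h x > S n for large n. The integral over t is Fubini's theorem,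
  \<open>clamp_length\<close> being the length of the admissible t.\<close>

lemma superlevel_integral:
  fixes h g :: "'c \<Rightarrow> real"
  assumes X: "sigma_finite_measure X" and h: "h \<in> borel_measurable X" and g: "integrable X g"
  shows "continuous (at_right t) (\<lambda>t. \<integral>x. indicator {t<..} (h x) * g x \<partial>X)"
    "a < b \<Longrightarrow> set_integrable lborel {a<..b} (\<lambda>t. \<integral>x. indicator {t<..} (h x) * g x \<partial>X)"
    "a < b \<Longrightarrow> (LINT t:{a<..b}|lborel. \<integral>x. indicator {t<..} (h x) * g x \<partial>X) = (\<integral>x. clamp_length a b (h x) * g x \<partial>X)"
proof -
  have gm: "g \<in> borel_measurable X" using g by simp
  have ind: "(\<lambda>x. indicator {t<..} (h x) :: real) \<in> borel_measurable X" for t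
    by (rule measurable_compose[OF h]) simp
  have "((\<lambda>t. \<integral>x. indicator {t<..} (h x) * g x \<partial>X) \<longlongrightarrow> (\<integral>x. indicator {t<..} (h x) * g x \<partial>X)) (at_right t)"
  proof (rule tendsto_at_right_sequentially[of t "t + 1"])
    fix S :: "nat \<Rightarrow> real" assume S: "\<And>n. t < S n" "S \<longlonglongrightarrow> t"
    show "(\<lambda>n. \<integral>x. indicator {S n<..} (h x) * g x \<partial>X) \<longlonglongrightarrow> (\<integral>x. indicator {t<..} (h x) * g x \<partial>X)"
    proof (rule integral_dominated_convergence[where w="\<lambda>x. \<bar>g x\<bar>"])
      show "AE x in X. (\<lambda>n. indicator {S n<..} (h x) * g x) \<longlonglongrightarrow> indicator {t<..} (h x) * g x"
      proof (rule AE_I2)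
        fix x
        have "\<forall>\<^sub>F n in sequentially. indicator {S n<..} (h x) = (indicator {t<..} (h x) :: real)"
        proof (cases "t < h x")
          case True
          with order_tendstoD(2)[OF S(2) this] show ?thesis by (auto elim!: eventually_mono)
        next
          case False
          then have "\<not> S n < h x" for n using S(1)[of n] by linarith
          with False show ?thesis by simp
        qed
        then show "(\<lambda>n. indicator {S n<..} (h x) * g x) \<longlonglongrightarrow> indicator {t<..} (h x) * g x"
          by (intro tendsto_mult_right tendsto_eventually)
      qed
    qed (use g gm ind in \<open>auto simp: indicator_def intro!: borel_measurable_times\<close>)
  qed simp
  then show "continuous (at_right t) (\<lambda>t. \<integral>x. indicator {t<..} (h x) * g x \<partial>X)"
    by (simp add: continuous_within)
  assume ab: "a < b"
  interpret X: sigma_finite_measure X by (rule X)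
  interpret P: pair_sigma_finite X lborel ..
  define q where "q x t = (indicator {a<..b} t * indicator {t<..} (h x)) * g x" for x t
  have m: "(\<lambda>(x, t). q x t) \<in> borel_measurable (X \<Otimes>\<^sub>M lborel)"
  proof -
    have hm: "(\<lambda>p. h (fst p)) \<in> borel_measurable (X \<Otimes>\<^sub>M lborel)"
      by (rule measurable_compose[OF measurable_fst h])
    have gm': "(\<lambda>p. g (fst p)) \<in> borel_measurable (X \<Otimes>\<^sub>M lborel)"
      by (rule measurable_compose[OF measurable_fst gm])
    have sm: "(\<lambda>p. snd p) \<in> borel_measurable (X \<Otimes>\<^sub>M lborel)" by measurable
    have "(\<lambda>p. (indicator {a<..b} (snd p) * indicator {0<..} (h (fst p) - snd p)) * g (fst p)) \<in> borel_measurable (X \<Otimes>\<^sub>M lborel)"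
      by (intro borel_measurable_times gm' measurable_compose[OF sm] measurable_compose[OF borel_measurable_diff[OF hm sm]]) simp_all
    moreover have "(\<lambda>p. (indicator {a<..b} (snd p) * indicator {0<..} (h (fst p) - snd p)) * g (fst p)) = (\<lambda>(x, t). q x t)"
      by (auto simp: q_def indicator_def fun_eq_iff)
    ultimately show ?thesis by simp
  qed
  have qi: "integrable lborel (q x)" for x
    unfolding q_def by (intro integrable_mult_left integral_superlevel_indicator ab)
  have qI: "(\<integral>t. q x t \<partial>lborel) = clamp_length a b (h x) * g x" for x
    using integral_superlevel_indicator(2)[OF ab, of "h x"] by (simp add: q_def)
  have "(\<integral>t. norm (q x t) \<partial>lborel) = clamp_length a b (h x) * \<bar>g x\<bar>" for x
    using integral_superlevel_indicator(2)[OF ab, of "h x"] by (simp add: q_def abs_mult)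
  moreover have "integrable X (\<lambda>x. clamp_length a b (h x) * \<bar>g x\<bar>)"
  proof (rule Bochner_Integration.integrable_bound)
    show "integrable X (\<lambda>x. (b - a) * \<bar>g x\<bar>)" using g by simp
    show "(\<lambda>x. clamp_length a b (h x) * \<bar>g x\<bar>) \<in> borel_measurable X"
      unfolding clamp_length_def using h gm by simp
    show "AE x in X. norm (clamp_length a b (h x) * \<bar>g x\<bar>) \<le> norm ((b - a) * \<bar>g x\<bar>)"
      using clamp_length_bounds[of a b] ab by (intro AE_I2) (auto simp: abs_mult intro!: mult_right_mono)
  qed
  ultimately have int: "integrable (X \<Otimes>\<^sub>M lborel) (\<lambda>(x, t). q x t)"
    using m qi by (intro P.Fubini_integrable) auto
  have q_snd: "(\<integral>x. q x t \<partial>X) = indicator {a<..b} t *\<^sub>R (\<integral>x. indicator {t<..} (h x) * g x \<partial>X)" for t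
    by (simp add: q_def mult.assoc)
  show "set_integrable lborel {a<..b} (\<lambda>t. \<integral>x. indicator {t<..} (h x) * g x \<partial>X)"
    unfolding set_integrable_def q_snd[symmetric] by (rule P.integrable_snd[OF int])
  show "(LINT t:{a<..b}|lborel. \<integral>x. indicator {t<..} (h x) * g x \<partial>X) = (\<integral>x. clamp_length a b (h x) * g x \<partial>X)"
    unfolding set_lebesgue_integral_def q_snd[symmetric] qI[symmetric] by (rule P.Fubini_integral[OF int])
qed

text \<open>The primitive of the step increases no faster than y and runs parallel to y from 1 on,
  so it stays within 1 of the positive part. Rescaling will make this error small.\<close>

lemma ramp_exists:
  "\<exists>\<rho>. (\<forall>y. (\<rho> has_real_derivative smooth_step y) (at y)) \<and> (\<forall>y. \<bar>\<rho> y - max 0 y\<bar> \<le> 1)"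
proof -
  obtain \<rho> where deriv: "\<And>y. (\<rho> has_real_derivative smooth_step y) (at y)" and 0: "\<And>y. y \<le> 0 \<Longrightarrow> \<rho> y = 0"
    using antiderivative_exists[OF smooth_continuous_on[OF smooth_step(1)] smooth_step(4)] by blast
  have "\<bar>\<rho> y - max 0 y\<bar> \<le> 1" for y
  proof -
    have up: "\<rho> x \<le> \<rho> y" if "x \<le> y" for x y
      by (rule DERIV_nonneg_imp_nondecreasing[OF that]) (use deriv smooth_step(2) in blast)
    have down: "x - \<rho> x \<le> y - \<rho> y" if "x \<le> y" for x y
    proof (rule DERIV_nonneg_imp_nondecreasing[OF that])
      fix z
      have "((\<lambda>y. y - \<rho> y) has_real_derivative 1 - smooth_step z) (at z)" by (intro DERIV_diff DERIV_ident deriv)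
      then show "\<exists>d. ((\<lambda>y. y - \<rho> y) has_real_derivative d) (at z) \<and> 0 \<le> d" using smooth_step(3)[of z] by auto
    qed
    have one: "\<rho> y - y \<ge> \<rho> 1 - 1" if "1 \<le> y" for y
    proof (rule DERIV_nonneg_imp_nondecreasing[OF that])
      fix z :: real assume "1 \<le> z"
      have "((\<lambda>y. \<rho> y - y) has_real_derivative smooth_step z - 1) (at z)" by (intro DERIV_diff DERIV_ident deriv)
      then show "\<exists>d. ((\<lambda>y. \<rho> y - y) has_real_derivative d) (at z) \<and> 0 \<le> d"
        using smooth_step(5)[OF \<open>1 \<le> z\<close>] by auto
    qed
    consider "y \<le> 0" | "0 < y" "y \<le> 1" | "1 < y" by linarith
    then show ?thesis
    proof cases
      case 1 then show ?thesis by (simp add: 0)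
    next
      case 2 then show ?thesis using up[of 0 y] down[of 0 y] 0[of 0] by auto
    next
      case 3 then show ?thesis using up[of 0 1] down[of 0 y] one[of y] 0[of 0] by auto
    qed
  qed
  then show ?thesis using deriv by blast
qed

text \<open>With c = k + 1, two rescaled ramps \<rho>(c (y - r)) / c, at r = a and r = b, are
  subtracted. Their errors total 2/c \<le> 2, which explains the bound; the steps are complete at
  distance 1/c \<le> 1, so all derivatives vanish off \<open>{a..b + 1}\<close>. As the step is 0 at
  0, the limit of the derivatives excludes a and includes b.\<close>

lemma smooth_clamp_sequence:
  assumes ab: "a < b"
  obtains \<eta> \<eta>' :: "nat \<Rightarrow> real \<Rightarrow> real" where "\<And>k. smooth (\<eta> k)" "\<And>k y v. frechet_derivative (\<eta> k) (at y) v = v * \<eta>' k y"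
    "\<And>k y. \<bar>\<eta> k y\<bar> \<le> b - a + 2" "\<And>k y. \<bar>\<eta>' k y\<bar> \<le> 1" "\<And>k y. y \<notin> {a..b + 1} \<Longrightarrow> \<eta>' k y = 0"
    "\<And>y. (\<lambda>k. \<eta> k y) \<longlonglongrightarrow> clamp_length a b y" "\<And>y. (\<lambda>k. \<eta>' k y) \<longlonglongrightarrow> indicator {a<..b} y"
    "\<And>k. \<eta>' k \<in> borel_measurable borel"
proof -
  obtain \<rho> where \<rho>: "\<And>y. (\<rho> has_real_derivative smooth_step y) (at y)" "\<And>y. \<bar>\<rho> y - max 0 y\<bar> \<le> 1"
    using ramp_exists by blast
  define c where "c k = real (Suc k)" for k
  have c: "1 \<le> c k" "0 < c k" for k by (auto simp: c_def)
  define \<eta> where "\<eta> k y = \<rho> (c k * (y - a)) / c k - \<rho> (c k * (y - b)) / c k" for k y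
  define \<eta>' where "\<eta>' k y = smooth_step (c k * (y - a)) - smooth_step (c k * (y - b))" for k y
  have deriv: "(\<eta> k has_real_derivative \<eta>' k y) (at y)" for k y
  proof -
    have "((\<lambda>y. \<rho> (c k * (y - r)) / c k) has_real_derivative smooth_step (c k * (y - r))) (at y)" for r
      using c(2)[of k] by (auto intro!: derivative_eq_intros DERIV_chain2[OF \<rho>(1)])
    then show ?thesis unfolding \<eta>_def[abs_def] \<eta>'_def by (intro DERIV_diff)
  qed
  have sm: "smooth (\<eta>' k)" for k
  proof -
    have "smooth (\<lambda>y. smooth_step (c k * y + - (c k * r)))" for r
      by (rule smooth_compose[OF smooth_linear_comp smooth_step(1)])
    then have "smooth (\<lambda>y. smooth_step (c k * (y - r)))" for r by (simp add: right_diff_distrib)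
    then show ?thesis unfolding \<eta>'_def[abs_def] by (intro smooth_diff)
  qed
  have close: "\<bar>\<eta> k y - clamp_length a b y\<bar> \<le> 2 / c k" for k y
  proof -
    have "\<bar>\<rho> (c k * (y - r)) / c k - max 0 (y - r)\<bar> \<le> 1 / c k" for r
    proof -
      have "max 0 (c k * (y - r)) = c k * max 0 (y - r)" using c(2)[of k] by (simp add: max_mult_distrib_left)
      then have "\<rho> (c k * (y - r)) / c k - max 0 (y - r) = (\<rho> (c k * (y - r)) - max 0 (c k * (y - r))) / c k"
        using c(2)[of k] by (simp add: field_simps)
      then show ?thesis using \<rho>(2) c(2)[of k] by (simp add: abs_divide divide_right_mono)
    qed
    from this[of a] this[of b] show ?thesis unfolding \<eta>_def clamp_length_def by (simp add: abs_le_iff)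
  qed
  have 0: "(\<lambda>k. 2 / c k) \<longlonglongrightarrow> 0" unfolding c_def by real_asymp
  show ?thesis
  proof (rule that[of \<eta> \<eta>'])
    show "smooth (\<eta> k)" for k by (rule smooth_antiderivative[OF deriv sm])
    show "frechet_derivative (\<eta> k) (at y) v = v * \<eta>' k y" for k y v
      by (rule frechet_derivative_eqI) (use deriv[of k y] in \<open>simp add: has_field_derivative_def mult_commute_abs\<close>)
    show "\<bar>\<eta> k y\<bar> \<le> b - a + 2" for k y
    proof -
      have "2 / c k \<le> 2" using c(1)[of k] by (simp add: field_simps)
      then show ?thesis using close[of k y] clamp_length_bounds[of a b y] ab by linarith
    qed
    show "\<bar>\<eta>' k y\<bar> \<le> 1" for k y
      using smooth_step(2,3)[of "c k * (y - a)"] smooth_step(2,3)[of "c k * (y - b)"] by (simp add: \<eta>'_def abs_le_iff)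
    show "\<eta>' k y = 0" if "y \<notin> {a..b + 1}" for k y
    proof (cases "y < a")
      case True
      then show ?thesis using ab c(2)[of k] by (simp add: \<eta>'_def smooth_step(4) mult_le_0_iff)
    next
      case False
      with that have "1 \<le> y - b" "1 \<le> y - a" using ab by auto
      then have "1 * 1 \<le> c k * (y - b)" "1 * 1 \<le> c k * (y - a)" using c(1)[of k] by (intro mult_mono; simp)+
      then show ?thesis by (simp add: \<eta>'_def smooth_step(5))
    qed
    show "(\<lambda>k. \<eta> k y) \<longlonglongrightarrow> clamp_length a b y" for y
    proof -
      have "(\<lambda>k. \<eta> k y - clamp_length a b y) \<longlonglongrightarrow> 0"
        by (rule Lim_null_comparison[OF _ 0]) (use close in simp)
      then show ?thesis by (simp add: LIM_zero_iff)
    qed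
    show "(\<lambda>k. \<eta>' k y) \<longlonglongrightarrow> indicator {a<..b} y" for y
    proof -
      have step: "(\<lambda>k. smooth_step (c k * z)) \<longlonglongrightarrow> indicator {0<..} z" for z
      proof (cases "0 < z")
        case True
        have "filterlim (\<lambda>k. c k * z) at_top sequentially" using True unfolding c_def by real_asymp
        then have "\<forall>\<^sub>F k in sequentially. 1 \<le> c k * z" by (simp add: filterlim_at_top)
        then show ?thesis using True by (intro tendsto_eventually) (auto elim!: eventually_mono simp: smooth_step(5))
      next
        case False
        then show ?thesis using c(2) by (simp add: smooth_step(4) mult_le_0_iff less_imp_le)
      qed
      have "(\<lambda>k. \<eta>' k y) \<longlonglongrightarrow> indicator {0<..} (y - a) - indicator {0<..} (y - b)"
        unfolding \<eta>'_def by (intro tendsto_diff step)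
      moreover have "indicator {0<..} (y - a) - indicator {0<..} (y - b) = (indicator {a<..b} y :: real)"
        using ab by (auto simp: indicator_def)
      ultimately show ?thesis by simp
    qed
    show "\<eta>' k \<in> borel_measurable borel" for k
      by (intro borel_measurable_continuous_onI smooth_continuous_on sm)
  qed
qed

section \<open>The coarea identity for weakly differentiable functions\<close>

lemma emeasure_add_measure:
  assumes "sets N = sets M" "A \<in> sets M"
  shows "emeasure (add_measure M N) A = emeasure M A + emeasure N A"
proof (rule emeasure_measure_of[OF add_measure_def sets.space_closed])
  show "positive (sets (add_measure M N)) (\<lambda>A. emeasure M A + emeasure N A)" by (simp add: positive_def)
  have s: "sets (add_measure M N) = sets M" by (simp add: add_measure_def)
  show "A \<in> sets (add_measure M N)" using assms(2) s by simp
  show "countably_additive (sets (add_measure M N)) (\<lambda>A. emeasure M A + emeasure N A)"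
    unfolding countably_additive_def s
  proof (intro allI impI)
    fix A :: "nat \<Rightarrow> _" assume A: "range A \<subseteq> sets M" "disjoint_family A" "(\<Union>i. A i) \<in> sets M"
    have "(\<Sum>i. emeasure M (A i) + emeasure N (A i)) = (\<Sum>i. emeasure M (A i)) + (\<Sum>i. emeasure N (A i))"
      by (rule suminf_add[symmetric]) auto
    also have "\<dots> = emeasure M (\<Union>i. A i) + emeasure N (\<Union>i. A i)"
      using suminf_emeasure[OF A(1,2)] suminf_emeasure[of A N] A assms(1) by simp
    finally show "(\<Sum>i. emeasure M (A i) + emeasure N (A i)) = emeasure M (\<Union>i. A i) + emeasure N (\<Union>i. A i)" .
  qed
qed

lemma completion_add_measure_ex_borel:
  fixes f :: "'a \<Rightarrow> real"
  assumes s: "sets N = sets M" and f: "f \<in> borel_measurable (completion (add_measure M N))"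
  shows "\<exists>f'\<in>borel_measurable M. (AE x in M. f x = f' x) \<and> (AE x in N. f x = f' x)"
proof -
  have sets: "sets (add_measure M N) = sets M" by (simp add: add_measure_def)
  obtain f' where f': "f' \<in> borel_measurable (add_measure M N)" "AE x in add_measure M N. f x = f' x"
    using completion_ex_borel_measurable_real[OF f] by blast
  obtain Z where Z: "Z \<in> null_sets (add_measure M N)" "{x \<in> space (add_measure M N). f x \<noteq> f' x} \<subseteq> Z"
    using f'(2) by (auto simp: eventually_ae_filter)
  have ZM: "Z \<in> sets M" using null_setsD2[OF Z(1)] sets by simp
  have sp: "space (add_measure M N) = space M" "space N = space M"
    using sets_eq_imp_space_eq[OF sets] sets_eq_imp_space_eq[OF s] by auto
  have "emeasure M Z + emeasure N Z = 0"
    using null_setsD1[OF Z(1)] emeasure_add_measure[OF s ZM] by simp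
  then have "Z \<in> null_sets M" "Z \<in> null_sets N" using ZM s by (auto intro!: null_setsI)
  then have "AE x in M. f x = f' x" "AE x in N. f x = f' x"
    using Z(2) by (auto intro!: AE_I'[where N=Z] simp: sp)
  moreover have "f' \<in> borel_measurable M" using f'(1) measurable_cong_sets[OF sets refl] by blast
  ultimately show ?thesis by blast
qed

lemma (in varifold_locally_finite) sigma_finite_V: "sigma_finite_measure V"
proof
  obtain C where C: "\<And>n::nat. compact (C n)" "\<And>n. C n \<subseteq> U" "incseq C" "(\<Union>n. interior (C n)) = U"
    using W.exhaustion by metis
  have CW: "C n \<in> sets W" for n by (rule W.compact_in_sets[OF C(1,2)])
  let ?A = "range (\<lambda>n. C n \<times> topspace (grassmannian m))"
  have "(\<Union>n. C n) = U" using C(2,4) interior_subset by blast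
  then have "\<Union>?A = space V" by (auto simp: space_V)
  moreover have "?A \<subseteq> sets V" using cylinder_in_sets[OF CW] by blast
  moreover have "emeasure V (C n \<times> topspace (grassmannian m)) \<noteq> \<infinity>" for n
    using emeasure_W[OF CW] W.finite_on_compact[OF C(1,2)] by (metis less_irrefl)
  ultimately show "\<exists>A. countable A \<and> A \<subseteq> sets V \<and> \<Union>A = space V \<and> (\<forall>a\<in>A. emeasure V a \<noteq> \<infinity>)"
    by (intro exI[of _ ?A]) auto
qed

text \<open>\<open>f0\<close> is a Borel representative of \<open>f\<close> and \<open>n\<close> is the polar density of the first variation.\<close>

locale varifold_function = varifold_locally_finite U m V
  for U :: "'a::euclidean_space set" and m V +
  fixes n :: "'a \<Rightarrow> 'a" and f f0 :: "'a \<Rightarrow> real"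
  assumes radon: "radon_measure (top_of_set U) (variation U (first_variation V))"
    and n: "n \<in> borel_measurable (variation U (first_variation V))" "\<And>z. norm (n z) \<le> 1"
    and first_variation_polar: "\<And>\<theta>. test_fun U \<theta> \<Longrightarrow>
      first_variation V \<theta> = (\<integral>z. \<theta> z \<bullet> n z \<partial>variation U (first_variation V))"
    and f0: "f0 \<in> borel_measurable (weight U V)"
    and f_W: "AE z in weight U V. f z = f0 z"
    and f_\<delta>: "AE z in variation U (first_variation V). f z = f0 z"
begin

abbreviation "\<delta> \<equiv> variation U (first_variation V)"

sublocale D: locally_finite U \<delta>
  by (rule locally_finite_variation[OF open_U first_variation_linear radon])

lemma sets_\<delta>_W: "sets \<delta> = sets W" by (simp add: D.sets_M W.sets_M)

lemma measurable_\<delta>_W: "measurable \<delta> N = measurable W N"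
  by (rule measurable_cong_sets[OF sets_\<delta>_W refl])

lemma theta_n_integrable: "test_fun U \<theta> \<Longrightarrow> integrable \<delta> (\<lambda>z. \<theta> z \<bullet> n z)"
  by (rule D.bounded_mult_integrable[OF D.test_fun_integrable n])

text \<open>The factor h, built from f, is known only up to null sets of the variation; on a bounded
  Borel representative g the extension is integration against the polar density.\<close>

lemma dist_ext_first_variation:
  assumes \<theta>: "test_fun U \<theta>" and g: "g \<in> borel_measurable \<delta>" "\<And>z. \<bar>g z\<bar> \<le> B" and eq: "AE z in \<delta>. h z = g z"
  shows "dist_ext U (first_variation V) (\<lambda>z. h z *\<^sub>R \<theta> z) = (\<integral>z. g z * (\<theta> z \<bullet> n z) \<partial>\<delta>)"
proof -
  have ig: "integrable \<delta> (\<lambda>z. g z *\<^sub>R \<theta> z)"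
    by (rule integrable_bounded_scaleR[OF g D.test_fun_integrable[OF \<theta>]])
  have ae: "AE z in \<delta>. h z *\<^sub>R \<theta> z = g z *\<^sub>R \<theta> z" using eq by eventually_elim simp
  have L1: "(\<lambda>z. h z *\<^sub>R \<theta> z) \<in> L1_space \<delta>"
    unfolding L1_space_def by (intro CollectI completion_integrable_AE(1)[OF ig ae])
  have "dist_ext U (first_variation V) (\<lambda>z. h z *\<^sub>R \<theta> z) = (\<integral>z. (h z *\<^sub>R \<theta> z) \<bullet> n z \<partial>completion \<delta>)"
    by (rule D.dist_ext_eq[OF refl n first_variation_polar L1])
  also have "\<dots> = (\<integral>z. (g z *\<^sub>R \<theta> z) \<bullet> n z \<partial>\<delta>)"
  proof (rule completion_integrable_AE(2))
    show "integrable \<delta> (\<lambda>z. (g z *\<^sub>R \<theta> z) \<bullet> n z)" by (rule D.bounded_mult_integrable[OF ig n])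
    show "AE z in \<delta>. (h z *\<^sub>R \<theta> z) \<bullet> n z = (g z *\<^sub>R \<theta> z) \<bullet> n z" using eq by eventually_elim simp
  qed
  finally show ?thesis by simp
qed

definition slice_boundary :: "real \<Rightarrow> ('a \<Rightarrow> 'a) \<Rightarrow> real" where
  "slice_boundary t = varifold_boundary U m V {z \<in> U. f z > t}"

text \<open>Both terms of the boundary become integrals of the same indicator of the Borel
  representative \<open>f0\<close>; it represents f almost everywhere for the weight and for the
  variation alike.\<close>

lemma slice_boundary_eq:
  assumes \<theta>: "test_fun U \<theta>"
  shows "slice_boundary t \<theta> = (\<integral>z. indicator {t<..} (f0 z) * (\<theta> z \<bullet> n z) \<partial>\<delta>) -
    (\<integral>p. indicator {t<..} (f0 (fst p)) * divergence \<theta> p \<partial>V)"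
proof -
  let ?E = "{z \<in> U. f z > t}" and ?E' = "f0 -` {t<..} \<inter> space W"
  have E': "?E' \<in> sets W" by (rule measurable_sets[OF f0]) simp
  have "dist_restrict U (first_variation V) ?E \<theta> = (\<integral>z. indicator {t<..} (f0 z) * (\<theta> z \<bullet> n z) \<partial>\<delta>)"
    unfolding dist_restrict_def
  proof (rule dist_ext_first_variation[OF \<theta>, where B=1])
    show "(\<lambda>z. indicator {t<..} (f0 z)) \<in> borel_measurable \<delta>"
      unfolding measurable_\<delta>_W by (rule measurable_compose[OF f0]) simp
    show "AE z in \<delta>. indicator ?E z = indicator {t<..} (f0 z)"
      using f_\<delta> AE_space by eventually_elim (auto simp: D.space_M indicator_def)
  qed (simp add: indicator_def)
  moreover have "first_variation (restr_measure V (?E \<times> topspace (grassmannian m))) \<theta> =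
      (\<integral>p. indicator ?E' (fst p) * divergence \<theta> p \<partial>V)"
  proof (rule first_variation_restr[OF E' _ _ \<theta>])
    show "AE z in W. z \<in> ?E \<longleftrightarrow> z \<in> ?E'"
      using f_W AE_space by eventually_elim (auto simp: W.space_M)
  qed simp
  moreover have "(\<integral>p. indicator ?E' (fst p) * divergence \<theta> p \<partial>V) =
      (\<integral>p. indicator {t<..} (f0 (fst p)) * divergence \<theta> p \<partial>V)"
    by (rule Bochner_Integration.integral_cong) (auto simp: indicator_def space_V W.space_M)
  ultimately show ?thesis by (simp add: slice_boundary_def varifold_boundary_def)
qed

lemma f0_fst: "(\<lambda>p. f0 (fst p)) \<in> borel_measurable V"
  by (rule distr_fst_measurable[OF f0])

lemmas bounded_mult_divergence_integrable =
  integrable_bounded_scaleR[OF _ _ divergence_integrable(1), unfolded real_scaleR_def]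

lemmas bounded_mult_theta_n_integrable =
  integrable_bounded_scaleR[OF _ _ theta_n_integrable, unfolded real_scaleR_def]

lemma indicator_f0_measurable:
  "A \<in> sets borel \<Longrightarrow> (\<lambda>z. indicator A (f0 z) :: real) \<in> borel_measurable \<delta>"
  "A \<in> sets borel \<Longrightarrow> (\<lambda>p. indicator A (f0 (fst p)) :: real) \<in> borel_measurable V"
  unfolding measurable_\<delta>_W by (rule measurable_compose[OF f0] measurable_compose[OF f0_fst], simp)+

lemma slice_boundary_linear: "dist_linear U (slice_boundary t)"
proof -
  have i: "integrable \<delta> (\<lambda>z. indicator {t<..} (f0 z) * (\<theta> z \<bullet> n z))"
    "integrable V (\<lambda>p. indicator {t<..} (f0 (fst p)) * divergence \<theta> p)" if "test_fun U \<theta>" for \<theta>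
    by (rule bounded_mult_theta_n_integrable[where B=1, OF _ _ that] bounded_mult_divergence_integrable[where B=1, OF _ _ that],
        rule indicator_f0_measurable, simp, simp add: indicator_def)+
  show ?thesis
    unfolding dist_linear_def
  proof (intro conjI allI impI)
    fix \<theta> \<zeta> :: "'a \<Rightarrow> 'a" assume t: "test_fun U \<theta>" "test_fun U \<zeta>"
    show "slice_boundary t (\<lambda>x. \<theta> x + \<zeta> x) = slice_boundary t \<theta> + slice_boundary t \<zeta>"
      using t i[OF t(1)] i[OF t(2)]
      by (simp add: slice_boundary_eq test_fun_add divergence_add test_fun_smooth inner_add_left distrib_left)
  next
    fix c and \<theta> :: "'a \<Rightarrow> 'a" assume t: "test_fun U \<theta>"
    have "test_fun U (\<lambda>x. c *\<^sub>R \<theta> x)" by (rule test_fun_scaleR(1)[OF smooth_const t])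
    then show "slice_boundary t (\<lambda>x. c *\<^sub>R \<theta> x) = c * slice_boundary t \<theta>"
      using t by (simp add: slice_boundary_eq divergence_scaleR test_fun_smooth mult.left_commute[of _ c] right_diff_distrib)
  qed
qed

lemma slice_boundary_integral:
  assumes \<theta>: "test_fun U \<theta>"
  shows "continuous (at_right t) (\<lambda>t. slice_boundary t \<theta>)"
    "a < b \<Longrightarrow> set_integrable lborel {a<..b} (\<lambda>t. slice_boundary t \<theta>)"
    "a < b \<Longrightarrow> (LINT t:{a<..b}|lborel. slice_boundary t \<theta>) =
      (\<integral>z. clamp_length a b (f0 z) * (\<theta> z \<bullet> n z) \<partial>\<delta>) - (\<integral>p. clamp_length a b (f0 (fst p)) * divergence \<theta> p \<partial>V)"
proof -
  have f0\<delta>: "f0 \<in> borel_measurable \<delta>" unfolding measurable_\<delta>_W by (rule f0)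
  note s\<delta> = superlevel_integral[OF D.sigma_finite f0\<delta> theta_n_integrable[OF \<theta>]]
  note sV = superlevel_integral[OF sigma_finite_V f0_fst divergence_integrable(1)[OF \<theta>]]
  show "continuous (at_right t) (\<lambda>t. slice_boundary t \<theta>)"
    unfolding slice_boundary_eq[OF \<theta>] by (intro continuous_diff s\<delta>(1) sV(1))
  assume ab: "a < b"
  show "set_integrable lborel {a<..b} (\<lambda>t. slice_boundary t \<theta>)"
    unfolding slice_boundary_eq[OF \<theta>] by (intro set_integral_diff s\<delta>(2) sV(2) ab)
  show "(LINT t:{a<..b}|lborel. slice_boundary t \<theta>) =
      (\<integral>z. clamp_length a b (f0 z) * (\<theta> z \<bullet> n z) \<partial>\<delta>) - (\<integral>p. clamp_length a b (f0 (fst p)) * divergence \<theta> p \<partial>V)"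
    unfolding slice_boundary_eq[OF \<theta>] by (simp only: set_integral_diff(2)[OF s\<delta>(2) sV(2)] s\<delta>(3) sV(3) ab)
qed

end

section \<open>Gradient fields, their uniqueness and approximate limits\<close>

lemma norm_le_norm_blinfun_inner_right: "norm u \<le> norm (blinfun_inner_right u)"
proof (cases "u = 0")
  case False
  have "norm u * norm u \<le> norm (blinfun_inner_right u) * norm u"
    using norm_blinfun[of "blinfun_inner_right u" u] by (simp add: dot_square_norm power2_eq_square)
  with False show ?thesis by simp
qed simp

text \<open>Representing covectors by vectors is isometric, so approximate limits of the gradient
  field and of the weak derivative correspond.\<close>

lemma dist_blinfun_inner_right: "dist (blinfun_inner_right u) (blinfun_inner_right v) = dist u v"
proof -
  have eq: "blinfun_inner_right u - blinfun_inner_right v = blinfun_inner_right (u - v)"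
    by (rule blinfun_eqI) (simp add: blinfun.diff_left inner_diff_left)
  have "norm (blinfun_inner_right (u - v)) \<le> norm (u - v)"
    by (rule norm_blinfun_bound) (auto simp: Cauchy_Schwarz_ineq2)
  then show ?thesis using norm_le_norm_blinfun_inner_right[of "u - v"] by (simp add: dist_norm eq)
qed

text \<open>Riesz representation turns covector valued functions into vector fields, for which a
  Borel representative is found coordinatewise.\<close>

lemma completion_ex_borel_gradient:
  fixes F :: "'a \<Rightarrow> 'b::euclidean_space \<Rightarrow>\<^sub>L real"
  assumes F: "F \<in> borel_measurable (completion M)"
  shows "\<exists>F'\<in>borel_measurable M. AE z in M. F z = blinfun_inner_right (F' z)"
proof -
  let ?G = "\<lambda>z. \<Sum>b\<in>Basis. F z b *\<^sub>R b"
  have eq: "F z = blinfun_inner_right (?G z)" for z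
  proof (rule blinfun_eqI)
    fix v
    have "F z v = F z (\<Sum>b\<in>Basis. (v \<bullet> b) *\<^sub>R b)" by (simp add: euclidean_representation)
    also have "\<dots> = blinfun_inner_right (?G z) v"
      by (simp add: blinfun.sum_right blinfun.scaleR_right inner_sum_left inner_commute[of v] mult.commute)
    finally show "F z v = blinfun_inner_right (?G z) v" .
  qed
  have "(\<lambda>P::'b \<Rightarrow>\<^sub>L real. P b) \<in> borel_measurable borel" for b
    by (intro borel_measurable_continuous_onI continuous_intros)
  then have "?G \<in> borel_measurable (completion M)"
    by (intro borel_measurable_sum borel_measurable_scaleR borel_measurable_const measurable_compose[OF F])
  from completion_ex_borel_measurable_euclidean[OF this]
  obtain F' where F': "F' \<in> borel_measurable M" "AE z in M. ?G z = F' z" by (elim bexE) (rule that)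
  have "AE z in M. F z = blinfun_inner_right (F' z)" using F'(2)
  proof eventually_elim
    case (elim z)
    show ?case by (subst eq, subst elim) (rule refl)
  qed
  from this F'(1) show ?thesis by (rule bexI)
qed

locale varifold_gradient = varifold_function U m V n f f0
  for U :: "'a::euclidean_space set" and m V n f f0 +
  fixes F :: "'a \<Rightarrow> 'a \<Rightarrow>\<^sub>L real" and F0 :: "'a \<Rightarrow> 'a"
  assumes F: "is_weak_deriv U V f F"
    and F0: "F0 \<in> borel_measurable (weight U V)"
    and F_W: "AE z in weight U V. F z = blinfun_inner_right (F0 z)"
begin

lemma slab_finite:
  assumes K: "compact K" "K \<subseteq> U"
  shows "(\<integral>\<^sup>+z\<in>K \<inter> {z. \<bar>f0 z\<bar> \<le> s}. norm (F0 z) \<partial>W) < \<infinity>"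
proof -
  \<comment> \<open>The local integrability in \<open>is_weak_deriv\<close> is stated for
    nonnegative bounds only; hence the maximum with 0.\<close>
  have "(\<integral>\<^sup>+z\<in>K \<inter> {z. \<bar>f0 z\<bar> \<le> s}. norm (F0 z) \<partial>W) \<le> (\<integral>\<^sup>+z\<in>K \<inter> {z. norm (f z) \<le> max 0 s}. norm (F z) \<partial>W)"
  proof (rule nn_integral_mono_AE)
    show "AE z in W. ennreal (norm (F0 z)) * indicator (K \<inter> {z. \<bar>f0 z\<bar> \<le> s}) z
      \<le> ennreal (norm (F z)) * indicator (K \<inter> {z. norm (f z) \<le> max 0 s}) z"
      using F_W f_W
    proof eventually_elim
      case (elim z)
      then show ?case using norm_le_norm_blinfun_inner_right[of "F0 z"] by (auto simp: indicator_def)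
    qed
  qed
  also have "\<dots> = (\<integral>\<^sup>+z\<in>K \<inter> {z. norm (f z) \<le> max 0 s}. norm (F z) \<partial>completion W)"
    by (rule nn_integral_completion[symmetric])
  also have "\<dots> < \<infinity>" using F K unfolding is_weak_deriv_def by (simp del: infinity_ennreal_def)
  finally show ?thesis .
qed

lemma slab_integrable:
  fixes g :: "'a \<Rightarrow> 'a"
  assumes g: "g \<in> borel_measurable W" "\<And>z. norm (g z) \<le> B" and K: "compact K" "K \<subseteq> U"
    and 0: "\<And>z. z \<in> U \<Longrightarrow> z \<notin> K \<or> \<not> \<bar>f0 z\<bar> \<le> s \<Longrightarrow> g z = 0"
  shows "integrable W (\<lambda>z. g z \<bullet> F0 z)"
proof (rule integrableI_bounded)
  show "(\<lambda>z. g z \<bullet> F0 z) \<in> borel_measurable W" by (intro borel_measurable_inner g F0)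
  let ?A = "K \<inter> {z. \<bar>f0 z\<bar> \<le> s}"
  have "(\<integral>\<^sup>+z. ennreal (norm (g z \<bullet> F0 z)) \<partial>W) \<le> (\<integral>\<^sup>+z. ennreal B * (ennreal (norm (F0 z)) * indicator ?A z) \<partial>W)"
  proof (rule nn_integral_mono)
    fix z assume "z \<in> space W"
    then have z: "z \<in> U" by (simp add: W.space_M)
    show "ennreal (norm (g z \<bullet> F0 z)) \<le> ennreal B * (ennreal (norm (F0 z)) * indicator ?A z)"
    proof (cases "z \<in> ?A")
      case True
      have "norm (g z \<bullet> F0 z) \<le> norm (g z) * norm (F0 z)" by (simp add: Cauchy_Schwarz_ineq2)
      also have "\<dots> \<le> B * norm (F0 z)" by (intro mult_right_mono g) simp
      finally have "ennreal (norm (g z \<bullet> F0 z)) \<le> ennreal (B * norm (F0 z))" by (rule ennreal_leI)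
      also have "\<dots> = ennreal B * ennreal (norm (F0 z))"
        using order_trans[OF norm_ge_zero g(2)] by (intro ennreal_mult) auto
      finally show ?thesis using True by simp
    next
      case False
      then show ?thesis using 0[OF z] by auto
    qed
  qed
  also have "\<dots> = ennreal B * (\<integral>\<^sup>+z\<in>?A. norm (F0 z) \<partial>W)"
  proof (rule nn_integral_cmult)
    have "?A \<inter> space W = K \<inter> (f0 -` {-s..s} \<inter> space W)" by auto
    then have "?A \<inter> space W \<in> sets W"
      using measurable_sets[OF f0, of "{-s..s}"] W.compact_in_sets[OF K] by simp
    moreover have "?A \<inter> space W = ?A" using K(2) by (auto simp: W.space_M)
    ultimately show "(\<lambda>z. ennreal (norm (F0 z)) * indicator ?A z) \<in> borel_measurable W"
      using F0 by (intro borel_measurable_times_ennreal borel_measurable_indicator) simp_all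
  qed
  also have "\<dots> < \<infinity>" using slab_finite[OF K, of s] by (simp add: ennreal_mult_less_top)
  finally show "(\<integral>\<^sup>+z. ennreal (norm (g z \<bullet> F0 z)) \<partial>W) < \<infinity>" .
qed

lemma theta_F0_integrable:
  assumes \<theta>: "test_fun U \<theta>" and q: "q \<in> borel_measurable borel" "\<And>y. \<bar>q y\<bar> \<le> 1" "\<And>y. y \<notin> {c..d} \<Longrightarrow> q y = 0"
  shows "integrable W (\<lambda>z. q (f0 z) * (\<theta> z \<bullet> F0 z))"
proof -
  obtain B where B: "\<And>z. norm (\<theta> z) \<le> B" using W.test_fun_bounded[OF \<theta>] by metis
  have "integrable W (\<lambda>z. (q (f0 z) *\<^sub>R \<theta> z) \<bullet> F0 z)"
  proof (rule slab_integrable[of _ B "spt \<theta>" "max \<bar>c\<bar> \<bar>d\<bar>"])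
    show "(\<lambda>z. q (f0 z) *\<^sub>R \<theta> z) \<in> borel_measurable W"
      by (intro borel_measurable_scaleR measurable_compose[OF f0 q(1)] W.test_fun_measurable \<theta>)
    show "norm (q (f0 z) *\<^sub>R \<theta> z) \<le> B" for z
      using mult_mono[OF q(2)[of "f0 z"] B[of z]] by simp
    show "compact (spt \<theta>)" "spt \<theta> \<subseteq> U" using \<theta> by (auto simp: test_fun_def)
    show "q (f0 z) *\<^sub>R \<theta> z = 0" if "z \<notin> spt \<theta> \<or> \<not> \<bar>f0 z\<bar> \<le> max \<bar>c\<bar> \<bar>d\<bar>" for z
      using that
    proof
      assume "\<not> \<bar>f0 z\<bar> \<le> max \<bar>c\<bar> \<bar>d\<bar>"
      then have "f0 z \<notin> {c..d}" by auto
      then show ?thesis using q(3) by simp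
    qed (simp add: spt_outside)
  qed
  then show ?thesis by simp
qed

text \<open>The defining identity of a weak derivative with all three terms rewritten for the Borel
  representatives and uncompleted measures, where limits in \<eta> can be taken.\<close>

lemma weak_derivative_identity:
  assumes \<theta>: "test_fun U \<theta>" and \<eta>: "smooth \<eta>" "\<And>y v. frechet_derivative \<eta> (at y) v = v * \<eta>' y"
    and bd: "\<And>y. \<bar>\<eta> y\<bar> \<le> B" "\<And>y. \<bar>\<eta>' y\<bar> \<le> 1" and 0: "\<And>y. y \<notin> {c..d} \<Longrightarrow> \<eta>' y = 0"
    and m: "\<eta>' \<in> borel_measurable borel"
  shows "(\<integral>z. \<eta> (f0 z) * (\<theta> z \<bullet> n z) \<partial>\<delta>) =
    (\<integral>p. \<eta> (f0 (fst p)) * divergence \<theta> p \<partial>V) + (\<integral>z. \<eta>' (f0 z) * (\<theta> z \<bullet> F0 z) \<partial>W)"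
proof -
  have \<eta>m: "\<eta> \<in> borel_measurable borel" by (intro borel_measurable_continuous_onI smooth_continuous_on \<eta>)
  have "closure {y. frechet_derivative \<eta> (at y) \<noteq> (\<lambda>_. 0)} \<subseteq> {c..d}"
  proof (rule closure_minimal)
    show "{y. frechet_derivative \<eta> (at y) \<noteq> (\<lambda>_. 0)} \<subseteq> {c..d}"
    proof (rule subsetI, rule ccontr)
      fix y assume "y \<in> {y. frechet_derivative \<eta> (at y) \<noteq> (\<lambda>_. 0)}" "y \<notin> {c..d}"
      then show False using 0[of y] by (auto simp: \<eta>(2) fun_eq_iff)
    qed
  qed simp
  then have "bounded {y. frechet_derivative \<eta> (at y) \<noteq> (\<lambda>_. 0)}"
    by (intro bounded_subset[OF compact_imp_bounded[OF compact_Icc] order_trans[OF closure_subset]])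
  then have "compact (closure {y. frechet_derivative \<eta> (at y) \<noteq> (\<lambda>_. 0)})" by (simp only: compact_closure)
  then have id: "dist_ext U (first_variation V) (\<lambda>z. \<eta> (f z) *\<^sub>R \<theta> z) =
      (\<integral>(z, S). \<eta> (f z) * hom_inner (orth_proj S) (frechet_derivative \<theta> (at z)) \<partial>completion V) +
      (\<integral>z. (frechet_derivative \<eta> (at (f z)) \<circ> F z) (\<theta> z) \<partial>completion W)"
    using F \<theta> \<eta>(1) unfolding is_weak_deriv_def by blast
  have 1: "dist_ext U (first_variation V) (\<lambda>z. \<eta> (f z) *\<^sub>R \<theta> z) = (\<integral>z. \<eta> (f0 z) * (\<theta> z \<bullet> n z) \<partial>\<delta>)"
  proof (rule dist_ext_first_variation[OF \<theta> _ bd(1)])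
    show "(\<lambda>z. \<eta> (f0 z)) \<in> borel_measurable \<delta>"
      unfolding measurable_\<delta>_W by (rule measurable_compose[OF f0 \<eta>m])
    show "AE z in \<delta>. \<eta> (f z) = \<eta> (f0 z)" using f_\<delta> by eventually_elim simp
  qed
  have 2: "(\<integral>(z, S). \<eta> (f z) * hom_inner (orth_proj S) (frechet_derivative \<theta> (at z)) \<partial>completion V) =
      (\<integral>p. \<eta> (f0 (fst p)) * divergence \<theta> p \<partial>V)"
  proof (rule completion_integrable_AE(2))
    show "integrable V (\<lambda>p. \<eta> (f0 (fst p)) * divergence \<theta> p)"
      by (rule bounded_mult_divergence_integrable[OF measurable_compose[OF f0_fst \<eta>m] bd(1) \<theta>])
    have "hom_inner (orth_proj S) (frechet_derivative \<theta> (at z)) = divergence \<theta> (z, S)" for z S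
      unfolding divergence_def fst_conv snd_conv
      by (rule hom_inner_commute)
        (rule bounded_linear.linear[OF blinfun.bounded_linear_right]
          has_derivative_linear[OF smooth_has_derivative[OF test_fun_smooth[OF \<theta>]]])+
    then show "AE p in V. (case p of (z, S) \<Rightarrow> \<eta> (f z) * hom_inner (orth_proj S) (frechet_derivative \<theta> (at z))) =
        \<eta> (f0 (fst p)) * divergence \<theta> p"
      using AE_fst[OF f_W] by (auto elim!: eventually_mono simp: split_beta')
  qed
  have 3: "(\<integral>z. (frechet_derivative \<eta> (at (f z)) \<circ> F z) (\<theta> z) \<partial>completion W) =
      (\<integral>z. \<eta>' (f0 z) * (\<theta> z \<bullet> F0 z) \<partial>W)"
  proof (rule completion_integrable_AE(2))
    show "integrable W (\<lambda>z. \<eta>' (f0 z) * (\<theta> z \<bullet> F0 z))" by (rule theta_F0_integrable[OF \<theta> m bd(2) 0])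
    show "AE z in W. (frechet_derivative \<eta> (at (f z)) \<circ> F z) (\<theta> z) = \<eta>' (f0 z) * (\<theta> z \<bullet> F0 z)"
      using F_W f_W by eventually_elim (simp add: \<eta>(2) inner_commute)
  qed
  show ?thesis using id unfolding 1 2 3 .
qed

lemma slice_boundary_F0:
  assumes \<theta>: "test_fun U \<theta>" and ab: "a < b"
  shows "(LINT t:{a<..b}|lborel. slice_boundary t \<theta>) = (\<integral>z. indicator {a<..b} (f0 z) * (\<theta> z \<bullet> F0 z) \<partial>W)"
proof -
  obtain \<eta> \<eta>' :: "nat \<Rightarrow> real \<Rightarrow> real" where \<eta>: "\<And>k. smooth (\<eta> k)" "\<And>k y v. frechet_derivative (\<eta> k) (at y) v = v * \<eta>' k y"
    "\<And>k y. \<bar>\<eta> k y\<bar> \<le> b - a + 2" "\<And>k y. \<bar>\<eta>' k y\<bar> \<le> 1" "\<And>k y. y \<notin> {a..b + 1} \<Longrightarrow> \<eta>' k y = 0"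
    "\<And>y. (\<lambda>k. \<eta> k y) \<longlonglongrightarrow> clamp_length a b y" "\<And>y. (\<lambda>k. \<eta>' k y) \<longlonglongrightarrow> indicator {a<..b} y"
    "\<And>k. \<eta>' k \<in> borel_measurable borel"
    by (rule smooth_clamp_sequence[OF ab]) (rule that)
  have \<eta>m: "\<eta> k \<in> borel_measurable borel" for k by (intro borel_measurable_continuous_onI smooth_continuous_on \<eta>)
  have cm: "clamp_length a b \<in> borel_measurable borel" unfolding clamp_length_def[abs_def] by simp
  have f0\<delta>: "f0 \<in> borel_measurable \<delta>" unfolding measurable_\<delta>_W by (rule f0)
  have id: "(\<integral>z. \<eta> k (f0 z) * (\<theta> z \<bullet> n z) \<partial>\<delta>) - (\<integral>p. \<eta> k (f0 (fst p)) * divergence \<theta> p \<partial>V) =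
      (\<integral>z. \<eta>' k (f0 z) * (\<theta> z \<bullet> F0 z) \<partial>W)" for k
    unfolding diff_eq_eq add.commute[of "integral\<^sup>L W _"]
    by (rule weak_derivative_identity[OF \<theta> \<eta>(1,2,3,4,5,8)])
  note lim = integral_bounded_compose_tendsto[OF \<eta>m cm \<eta>(6,3)]
  note 1 = lim[OF f0\<delta> theta_n_integrable[OF \<theta>]]
  note 2 = lim[OF f0_fst divergence_integrable(1)[OF \<theta>]]
  have 3: "(\<lambda>k. \<integral>z. \<eta>' k (f0 z) * (\<theta> z \<bullet> F0 z) \<partial>W) \<longlonglongrightarrow> (\<integral>z. indicator {a<..b} (f0 z) * (\<theta> z \<bullet> F0 z) \<partial>W)"
  \<comment> \<open>All the derivatives are supported in \<open>{a..b + 1}\<close>, a fixed slab on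
    which the gradient is integrable against \<theta>.\<close>
  proof (rule integral_dominated_convergence[where w="\<lambda>z. norm (indicator {a..b + 1} (f0 z) * (\<theta> z \<bullet> F0 z))"])
    have tm: "(\<lambda>z. \<theta> z \<bullet> F0 z) \<in> borel_measurable W" by (intro borel_measurable_inner W.test_fun_measurable \<theta> F0)
    have im: "(\<lambda>z. indicator A (f0 z) :: real) \<in> borel_measurable W" if "A \<in> sets borel" for A
      using that by (intro measurable_compose[OF f0]) simp
    show "(\<lambda>z. indicator {a<..b} (f0 z) * (\<theta> z \<bullet> F0 z)) \<in> borel_measurable W"
      by (intro borel_measurable_times tm im) simp
    show "(\<lambda>z. \<eta>' k (f0 z) * (\<theta> z \<bullet> F0 z)) \<in> borel_measurable W" for k
      by (intro borel_measurable_times tm measurable_compose[OF f0 \<eta>(8)])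
    have "integrable W (\<lambda>z. indicator {a..b + 1} (f0 z) * (\<theta> z \<bullet> F0 z))"
      by (rule theta_F0_integrable[OF \<theta>, where c=a and d="b + 1"]) (auto simp: indicator_def)
    then show "integrable W (\<lambda>z. norm (indicator {a..b + 1} (f0 z) * (\<theta> z \<bullet> F0 z)))" by (rule integrable_norm)
    show "AE z in W. (\<lambda>k. \<eta>' k (f0 z) * (\<theta> z \<bullet> F0 z)) \<longlonglongrightarrow> indicator {a<..b} (f0 z) * (\<theta> z \<bullet> F0 z)"
      by (intro AE_I2 tendsto_mult_right \<eta>)
    have "\<bar>\<eta>' k y\<bar> \<le> indicator {a..b + 1} y" for k y using \<eta>(4)[of k y] \<eta>(5)[of y k] by (cases "y \<in> {a..b+1}") auto
    then show "AE z in W. norm (\<eta>' k (f0 z) * (\<theta> z \<bullet> F0 z)) \<le> norm (indicator {a..b + 1} (f0 z) * (\<theta> z \<bullet> F0 z))" for k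
      by (intro AE_I2) (auto simp: abs_mult intro!: mult_right_mono)
  qed
  show ?thesis
    unfolding slice_boundary_integral(3)[OF \<theta> ab]
    by (rule LIMSEQ_unique[OF tendsto_diff[OF 1 2]]) (simp only: id 3)
qed

text \<open>The left side of \<open>slice_boundary_F0\<close> does not involve the gradient. Hence,
  on each slab of bounded values of \<open>f0\<close>, the functional with density F0 - F0'
  vanishes, and so does its variation, the integral of |F0 - F0'| over the slab.\<close>

lemma gradient_unique:
  assumes "varifold_gradient U m V n f f0 F' F0'"
  shows "AE z in W. F0 z = F0' z"
proof -
  interpret G: varifold_gradient U m V n f f0 F' F0' by (rule assms)
  have *: "AE z in W. indicator {- real k<..real k} (f0 z) *\<^sub>R (F0 z - F0' z) = 0" for k :: nat
  \<comment> \<open>For k = 0 the interval is empty; the slice identity requires proper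
    endpoints.\<close>
  proof (cases "k = 0")
    case False
    let ?I = "\<lambda>z. indicator {- real k<..real k} (f0 z) :: real"
    let ?\<eta> = "\<lambda>z. ?I z *\<^sub>R (F0 z - F0' z)"
    have \<eta>m: "?\<eta> \<in> borel_measurable W"
      by (intro borel_measurable_scaleR borel_measurable_diff F0 G.F0 measurable_compose[OF f0]) simp
    have "open_variation U (\<lambda>\<theta> :: 'a \<Rightarrow> 'a. 0) U = (\<integral>\<^sup>+z\<in>U. norm (?\<eta> z) \<partial>W)"
    proof (rule W.density_open_variation[OF \<eta>m _ _ open_U order_refl])
      fix K assume K: "compact K" "K \<subseteq> U"
      let ?A = "K \<inter> {z. \<bar>f0 z\<bar> \<le> real k}"
      have Am: "?A \<in> sets W"
      proof -
        have "K \<inter> (f0 -` {- real k..real k} \<inter> space W) \<in> sets W"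
          by (intro sets.Int W.compact_in_sets K measurable_sets[OF f0]) simp
        moreover have "K \<inter> (f0 -` {- real k..real k} \<inter> space W) = ?A" using K(2) by (auto simp: W.space_M)
        ultimately show ?thesis by simp
      qed
      have "(\<integral>\<^sup>+z\<in>K. norm (?\<eta> z) \<partial>W) \<le>
          (\<integral>\<^sup>+z. ennreal (norm (F0 z)) * indicator ?A z + ennreal (norm (F0' z)) * indicator ?A z \<partial>W)"
      proof (rule nn_integral_mono)
        fix z
        show "ennreal (norm (?\<eta> z)) * indicator K z \<le> ennreal (norm (F0 z)) * indicator ?A z + ennreal (norm (F0' z)) * indicator ?A z"
        proof (cases "z \<in> K \<and> f0 z \<in> {- real k<..real k}")
          case True
          then have "ennreal (norm (F0 z - F0' z)) \<le> ennreal (norm (F0 z)) + ennreal (norm (F0' z))"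
            by (simp add: ennreal_leI norm_triangle_ineq4 flip: ennreal_plus)
          then show ?thesis using True by (simp add: abs_le_iff)
        qed (auto simp: indicator_def)
      qed
      also have "\<dots> = (\<integral>\<^sup>+z\<in>?A. norm (F0 z) \<partial>W) + (\<integral>\<^sup>+z\<in>?A. norm (F0' z) \<partial>W)"
        using Am F0 G.F0 by (intro nn_integral_add) auto
      also have "\<dots> < \<infinity>" using slab_finite[OF K, of "real k"] G.slab_finite[OF K, of "real k"] by simp
      finally show "(\<integral>\<^sup>+z\<in>K. norm (?\<eta> z) \<partial>W) < \<infinity>" .
    next
      fix \<theta> :: "'a \<Rightarrow> 'a" assume \<theta>: "test_fun U \<theta>"
      have k: "- real k < real k" using False by simp
      have "(\<integral>z. \<theta> z \<bullet> ?\<eta> z \<partial>W) = (\<integral>z. ?I z * (\<theta> z \<bullet> F0 z) - ?I z * (\<theta> z \<bullet> F0' z) \<partial>W)"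
        by (simp add: algebra_simps)
      also have "\<dots> = (\<integral>z. ?I z * (\<theta> z \<bullet> F0 z) \<partial>W) - (\<integral>z. ?I z * (\<theta> z \<bullet> F0' z) \<partial>W)"
        by (rule Bochner_Integration.integral_diff; rule theta_F0_integrable[OF \<theta>, where c="- real k" and d="real k"]
            G.theta_F0_integrable[OF \<theta>, where c="- real k" and d="real k"]; simp add: indicator_def)
      also have "\<dots> = 0" using slice_boundary_F0[OF \<theta> k] G.slice_boundary_F0[OF \<theta> k] by simp
      finally show "0 = (\<integral>z. \<theta> z \<bullet> ?\<eta> z \<partial>W)" by simp
    qed
    moreover have "open_variation U (\<lambda>\<theta> :: 'a \<Rightarrow> 'a. 0) U \<le> 0" by (rule open_variation_least) simp
    ultimately have "(\<integral>\<^sup>+z\<in>U. norm (?\<eta> z) \<partial>W) = 0" by simp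
    moreover have "(\<integral>\<^sup>+z\<in>U. norm (?\<eta> z) \<partial>W) = (\<integral>\<^sup>+z. norm (?\<eta> z) \<partial>W)"
      by (intro nn_integral_cong) (simp add: W.space_M)
    ultimately have "(\<integral>\<^sup>+z. norm (?\<eta> z) \<partial>W) = 0" by simp
    then have "AE z in W. ennreal (norm (?\<eta> z)) = 0"
      using nn_integral_0_iff_AE[OF measurable_compose[OF measurable_compose[OF \<eta>m borel_measurable_norm] measurable_ennreal]] by blast
    then show ?thesis by eventually_elim simp
  qed simp
  have "AE z in W. \<forall>k::nat. indicator {- real k<..real k} (f0 z) *\<^sub>R (F0 z - F0' z) = 0"
    by (subst AE_all_countable) (intro allI *)
  then show ?thesis
  proof eventually_elim
    case (elim z)
    obtain k :: nat where "\<bar>f0 z\<bar> < real k" using reals_Archimedean2 by blast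
    then have "f0 z \<in> {- real k<..real k}" by auto
    with elim[rule_format, of k] show ?case by simp
  qed
qed

text \<open>At almost every point the gradient field is approximately continuous. The description in
  \<open>weak_deriv\<close> admits every weak derivative, but all of them agree almost everywhere,
  hence have the same approximate limits, and these are unique.\<close>

lemma AE_weak_deriv: "AE z in W. weak_deriv U V f z = blinfun_inner_right (F0 z)"
  using W.AE_approx_continuous[OF F0] AE_space
proof eventually_elim
  case (elim a)
  have a: "a \<in> U" using elim(2) by (simp add: W.space_M)
  let ?F = "\<lambda>z. blinfun_inner_right (F0 z)"
  have Fm: "F \<in> borel_measurable (completion W)" using F by (simp add: is_weak_deriv_def)
  have "?F \<in> borel_measurable W"
    by (intro measurable_compose[OF F0] borel_measurable_continuous_onI bounded_linear.continuous_on[OF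
          bounded_linear_blinfun_inner_right] continuous_on_id)
  then have F'm: "?F \<in> borel_measurable (completion W)" by (rule measurable_completion)
  have "approx_limit (completion W) ?F a (?F a)"
  proof -
    have "{z \<in> cball a r \<inter> U. e \<le> dist (F0 z) (F0 a)} \<in> sets W" for e r
    proof -
      have "cball a r \<inter> U \<in> sets W" using open_U by (auto simp: W.sets_iff)
      moreover have "F0 -` {w. e \<le> dist w (F0 a)} \<inter> space W \<in> sets W"
        by (intro measurable_sets[OF F0] borel_closed closed_Collect_le continuous_intros)
      moreover have "{z \<in> cball a r \<inter> U. e \<le> dist (F0 z) (F0 a)} =
          (cball a r \<inter> U) \<inter> (F0 -` {w. e \<le> dist w (F0 a)} \<inter> space W)" by (auto simp: W.space_M)
      ultimately show ?thesis by (metis sets.Int)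
    qed
    moreover have "cball a r \<inter> U \<in> sets W" for r using open_U by (auto simp: W.sets_iff)
    ultimately show ?thesis using elim(1) by (simp add: approx_limit_def W.space_M dist_blinfun_inner_right)
  qed
  then have lim: "approx_limit (completion W) F a (?F a)"
    by (rule W.approx_limit_AE_cong[OF F'm Fm, rotated]) (use F_W in eventually_elim, simp)
  show ?case
    unfolding weak_deriv_def
  proof (rule the_equality)
    show "\<exists>F. is_weak_deriv U V f F \<and> approx_limit (completion W) F a (?F a)" using F lim by blast
    fix y assume "\<exists>F. is_weak_deriv U V f F \<and> approx_limit (completion W) F a y"
    then obtain F' where F': "is_weak_deriv U V f F'" "approx_limit (completion W) F' a y" by blast
    have F'm: "F' \<in> borel_measurable (completion W)" using F'(1) by (simp add: is_weak_deriv_def)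
    obtain F0' where F0': "F0' \<in> borel_measurable W" "AE z in W. F' z = blinfun_inner_right (F0' z)"
      using completion_ex_borel_gradient[OF F'm] by (elim bexE) (rule that)
    have "varifold_gradient U m V n f f0 F' F0'" by unfold_locales (rule F' F0')+
    then have "AE z in W. F0 z = F0' z" by (rule gradient_unique)
    then have "AE z in W. F' z = F z" using F_W F0'(2) by eventually_elim simp
    then have "approx_limit (completion W) F a y" by (rule W.approx_limit_AE_cong[OF F'm Fm _ F'(2)])
    then show "y = ?F a" by (rule W.approx_limit_unique[OF Fm a _ lim])
  qed
qed

lemma graph_integral:
  fixes \<psi> :: "'a \<times> real \<Rightarrow> 'a"
  assumes \<psi>: "test_fun (U \<times> UNIV) \<psi>"
  shows "(\<integral>z. weak_deriv U V f z (\<psi> (z, f z)) \<partial>completion W) = (\<integral>z. \<psi> (z, f0 z) \<bullet> F0 z \<partial>W)"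
proof (rule completion_integrable_AE(2))
  have K: "compact (spt \<psi>)" "spt \<psi> \<subseteq> U \<times> UNIV" and s: "smooth \<psi>" using \<psi> by (auto simp: test_fun_def)
  have "compact (\<psi> ` spt \<psi>)" by (intro compact_continuous_image smooth_continuous_on K s)
  then have "bounded (\<psi> ` spt \<psi>)" by (rule compact_imp_bounded)
  then obtain B where B': "0 < B" "\<And>p. p \<in> spt \<psi> \<Longrightarrow> norm (\<psi> p) \<le> B"
    unfolding bounded_pos by blast
  have B: "norm (\<psi> p) \<le> B" for p using B' by (cases "p \<in> spt \<psi>") (auto simp: spt_outside)
  have "compact (snd ` spt \<psi>)" by (intro compact_continuous_image K continuous_intros)
  then have "bounded (snd ` spt \<psi>)" by (rule compact_imp_bounded)
  then obtain s where s: "\<And>y. y \<in> snd ` spt \<psi> \<Longrightarrow> \<bar>y\<bar> \<le> s"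
    unfolding bounded_iff real_norm_def by blast
  show "integrable W (\<lambda>z. \<psi> (z, f0 z) \<bullet> F0 z)"
  proof (rule slab_integrable[of _ B "fst ` spt \<psi>" s])
    have "(\<lambda>z. (z, f0 z)) \<in> measurable W (borel \<Otimes>\<^sub>M borel)"
      by (intro measurable_Pair f0 W.measurable_M measurable_ident_sets refl)
    then have "(\<lambda>z. (z, f0 z)) \<in> measurable W borel" by (simp add: borel_prod)
    then show "(\<lambda>z. \<psi> (z, f0 z)) \<in> borel_measurable W"
      by (rule measurable_compose) (intro borel_measurable_continuous_onI smooth_continuous_on test_fun_smooth[OF \<psi>])
    show "compact (fst ` spt \<psi>)" by (intro compact_continuous_image K continuous_intros)
    show "fst ` spt \<psi> \<subseteq> U" using K(2) by auto
    show "\<psi> (z, f0 z) = 0" if "z \<notin> fst ` spt \<psi> \<or> \<not> \<bar>f0 z\<bar> \<le> s" for z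
    proof (rule spt_outside[of "(z, f0 z)" \<psi>], rule notI)
      assume "(z, f0 z) \<in> spt \<psi>"
      then have "z \<in> fst ` spt \<psi>" "f0 z \<in> snd ` spt \<psi>" by (auto intro: rev_image_eqI)
      then show False using that s by blast
    qed
  qed (rule B)
  show "AE z in W. weak_deriv U V f z (\<psi> (z, f z)) = \<psi> (z, f0 z) \<bullet> F0 z"
    using AE_weak_deriv f_W by eventually_elim (simp add: inner_commute)
qed

end

lemma varifold_gradient_exists:
  fixes U :: "'a::euclidean_space set"
  assumes "open U" "varifold U m V" and radon: "radon_measure (top_of_set U) (variation U (first_variation V))"
    and f: "f \<in> weakly_diff U V"
  shows "\<exists>n f0 F F0. varifold_gradient U m V n f f0 F F0"
proof -
  interpret varifold_locally_finite U m V by unfold_locales (rule assms)+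
  let ?\<delta> = "variation U (first_variation V)"
  interpret D: distribution_with_variation U ?\<delta> "first_variation V"
    by (rule distribution_with_variation.intro[OF locally_finite_variation[OF open_U first_variation_linear radon]])
      (unfold_locales, rule first_variation_linear, rule refl)
  obtain n where n: "n \<in> borel_measurable ?\<delta>" "\<And>x. norm (n x) \<le> 1" "AE x in ?\<delta>. norm (n x) = 1"
    "\<And>\<theta>. test_fun U \<theta> \<Longrightarrow> first_variation V \<theta> = (\<integral>x. \<theta> x \<bullet> n x \<partial>?\<delta>)"
    by (rule D.polar_decomposition) (rule that)
  have "f \<in> borel_measurable (completion (add_measure W ?\<delta>))" using f by (simp add: weakly_diff_def)
  from completion_add_measure_ex_borel[OF _ this] obtain f0 where
    f0: "f0 \<in> borel_measurable W" "AE z in W. f z = f0 z" "AE z in ?\<delta>. f z = f0 z"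
    by (auto simp: D.sets_M W.sets_M)
  obtain F where F: "is_weak_deriv U V f F" using f by (auto simp: weakly_diff_def)
  then have "F \<in> borel_measurable (completion W)" by (simp add: is_weak_deriv_def)
  from completion_ex_borel_gradient[OF this] obtain F0 where
    F0: "F0 \<in> borel_measurable W" "AE z in W. F z = blinfun_inner_right (F0 z)" by (elim bexE) (rule that)
  have "varifold_gradient U m V n f f0 F F0"
    by unfold_locales (rule radon n f0 F F0 | assumption)+
  then show ?thesis by blast
qed

theorem theorem6p29:
  fixes m :: nat
    and U :: "(real ^ 'n) set"
    and V :: "((real ^ 'n) \<times> (real ^ 'n) set) measure"
    and f :: "real ^ 'n \<Rightarrow> real"
    and T :: "((real ^ 'n) \<times> real \<Rightarrow> real ^ 'n) \<Rightarrow> real"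
    and E :: "real \<Rightarrow> (real ^ 'n) set"
  assumes "0 < m" and "m \<le> CARD('n)"
    and "open U"
    and "rectifiable_varifold U m V"
    and "radon_measure (top_of_set U) (variation U (first_variation V))"
    and "f \<in> weakly_diff U V"
    and "is_distribution (U \<times> UNIV) T"
    and "\<And>\<psi>. test_fun (U \<times> UNIV) \<psi> \<Longrightarrow>
           T \<psi> = (\<integral>z. weak_deriv U V f z (\<psi> (z, f z)) \<partial>completion (weight U V))"
    and "\<And>t. E t = {z \<in> U. f z > t}"
  shows "representable_by_integration (U \<times> UNIV) T \<and>
    (AE t in lebesgue. representable_by_integration U (varifold_boundary U m V (E t))) \<and>
    (\<forall>\<psi> \<in> L1_space (variation (U \<times> UNIV) T).
       (AE t in lebesgue.
          (\<lambda>z. \<psi> (z, t)) \<in> L1_space (variation U (varifold_boundary U m V (E t)))) \<and>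
       integrable lebesgue
         (\<lambda>t. dist_ext U (varifold_boundary U m V (E t)) (\<lambda>z. \<psi> (z, t))) \<and>
       dist_ext (U \<times> UNIV) T \<psi> =
         (\<integral>t. dist_ext U (varifold_boundary U m V (E t)) (\<lambda>z. \<psi> (z, t)) \<partial>lebesgue)) \<and>
    (\<forall>g :: (real ^ 'n) \<times> real \<Rightarrow> ereal.
       ereal_integrable (completion (variation (U \<times> UNIV) T)) g \<longrightarrow>
       (AE t in lebesgue.
          ereal_integrable (completion (variation U (varifold_boundary U m V (E t))))
            (\<lambda>z. g (z, t))) \<and>
       ereal_integrable lebesgue
         (\<lambda>t. ereal_integral (completion (variation U (varifold_boundary U m V (E t))))
                (\<lambda>z. g (z, t))) \<and>
       ereal_integral (completion (variation (U \<times> UNIV) T)) g =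
         ereal_integral lebesgue
           (\<lambda>t. ereal_integral (completion (variation U (varifold_boundary U m V (E t))))
                  (\<lambda>z. g (z, t))))"
proof -
  have "varifold U m V" using assms(4) by (simp add: rectifiable_varifold_def)
  from varifold_gradient_exists[OF assms(3) this assms(5,6)]
  obtain n f0 F F0 where "varifold_gradient U m V n f f0 F F0" by (elim exE) (rule that)
  then interpret varifold_gradient U m V n f f0 F F0 .
  obtain C where C: "open_exhaustion U C" using ex_open_exhaustion[OF assms(3)] by (elim exE) (rule that)
  have S: "varifold_boundary U m V (E t) = slice_boundary t" for t by (simp add: slice_boundary_def assms(9))
  \<comment> \<open>The base measure is the weight. Slabs are cut with the representative
    \<open>f0\<close>, whereas \<open>slice_boundary\<close> still refers to the superlevel sets of
    f itself, which are the given sets E(t).\<close>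
  have "coarea_slices U C W f0 F0 slice_boundary T"
  proof (intro coarea_slices.intro coarea_slices_axioms.intro C W.locally_finite_axioms f0 F0 slab_finite
      slice_boundary_linear slice_boundary_integral(1,2) slice_boundary_F0)
    show "T \<psi> = (\<integral>z. \<psi> (z, f0 z) \<bullet> F0 z \<partial>W)" if "test_fun (U \<times> UNIV) \<psi>" for \<psi>
      using assms(8)[OF that] graph_integral[OF that] by simp
  qed
  then interpret coarea_slices U C W f0 F0 slice_boundary T .
  show ?thesis
    unfolding S using T_representable AE_S_representable slices_L1 slices_ereal by blast
qed

end
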